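(* Consider the one-dimensional ARX system $$y_{k+1}=a_1y_k+\cdots+a_py_{k+1-p}+b_1u_k+\cdots+b_qu_{k+1-q}+w_{k+1}$$ with unknown parameters $a_i,b_j$, operated in closed loop under the self-tuning regulation control with diminishing excitation described in the context, with excitation parameter $\overline\varepsilon$ and $t=\max\{p,q\}+p-1$. Assume: (C1) $\{w_k,\mathcal{F}_k\}_{k\ge1}$ is a martingale difference sequence, i.e. $\mathbb{E}[w_{k+1}\mid\mathcal{F}_k]=0$ for $k\ge1$; there exists some $\gamma>2$ such that $\sup_k\mathbb{E}[|w_{k+1}|^\gamma\mid\mathcal{F}_k]<\infty$ almost surely; and $\lim_{k\to\infty}\frac1k\sum_{i=1}^kw_i^2=R>0$ almost surely. (C2) $B(z)=b_1+b_2z+\cdots+b_qz^{q-1}\ne0$ for all $z$ with $|z|\le1$. (C3) $|a_p|+|b_q|\ne0$. (C4) The control is well defined, for each $k\ge0$, from the certainty-equivalence equation given in the context (in whose solved form the estimate $b_{1,k}$ appears as a denominator). Let the parameter $\overline\varepsilon$ of the diminishing excitation satisfy $\overline\varepsilon(t+1)\in(0,\tfrac14)$ and set $\lambda_N=N^{1-\frac32\overline\varepsilon(t+1)}$. Let $\theta_L=[a_1,\dots,a_p,b_1,\dots,b_q]^T$, let $C^*=\{i\in\{1,\dots,p+q\}:\theta_L(i)=0\}$, and let $C^*_{N+1}=\{i\in\{1,\dots,p+q\}:\beta_{N+1,L}(i)=0\}$, where $\beta_{N+1,L}$ is the sparse estimate defined in the context. Then there exists an $\omega$-set $\Omega_0$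 with $\mathbb{P}\{\Omega_0\}=1$ such that for any $\omega\in\Omega_0$ there exists an integer $N_0(\omega)$ with $$C^*_{N+1}=C^*\quad\text{for all } N\ge N_0(\omega),$$ i.e. the zero and nonzero elements of $\theta_L$ are correctly identified.
   Context: Notation. $\varphi_{k,L}=[y_k,\dots,y_{k+1-p},u_k,\dots,u_{k+1-q}]^T\in\mathbb{R}^{p+q}$, so the system reads $y_{k+1}=\theta_L^T\varphi_{k,L}+w_{k+1}$; here $u_k,y_k,w_k$ are the system input, output and noise. The filtration is $\mathcal{F}_k=\sigma\{y_k,\dots,y_0,\,u_{k-1},\dots,u_0,\,w_k,\dots,w_0,\,w'_k,\dots,w'_0\}$, $k\ge1$, where $\{w'_k\}$ is the sequence of exogenous input signals. Closed loop. $\{y_k^*\}$ is a sequence of deterministic bounded reference signals. $\{w'_k\}$ is an i.i.d. and bounded random sequence with $\mathbb{E}w'_k=0$, $\mathbb{E}(w'_k)^2=1$. The least squares estimate of $\theta_L$ is $$\theta_{N+1,L}=\Big(\sum_{k=1}^N\varphi_{k,L}\varphi_{k,L}^T\Big)^{-1}\sum_{k=1}^N\varphi_{k,L}y_{k+1},$$ and $b_{1,k}$ denotes the component of $\theta_{k,L}$ that estimates $b_1$. The adaptive control $u_k^0$ is defined, by the certainty equivalence principle, from the equation $\theta_{k,L}^T\varphi_{k,L}=y_{k+1}^*$ (solved for the current-input entry of $\varphi_{k,L}$), or equivalently $$u_k^0=\frac{1}{b_{1,k}}\Big\{y_{k+1}^*+\big(b_{1,k}u_k-\theta_{k,L}^T\varphi_{k,L}\big)\Big\},$$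 where the right-hand side does not depend on $u_k$, since the terms in $u_k$ cancel. The input actually applied to the system at time $k$ is $$u_k=u_k^0+\frac{w'_k}{r_{k-1}^{\overline\varepsilon/2}},\quad k\ge1,\qquad r_{k-1}=1+\sum_{i=1}^{k-1}\|\varphi_{i,L}\|^2,$$ where in general $\overline\varepsilon\in\big(0,\tfrac{1}{2(t+1)}\big)$ (the claim restricts this further). Sparse estimate. Let $\lambda_{\max}(N),\lambda_{\min}(N)$ be the maximal and minimal eigenvalues of $\sum_{k=1}^N\varphi_{k,L}\varphi_{k,L}^T$, and let $\mathrm{sgn}(x)=1$ if $x\ge0$, $\mathrm{sgn}(x)=-1$ if $x<0$. For $j=1,\dots,p+q$, $$\widehat\theta_{N+1,L}(j)=\theta_{N+1,L}(j)+\mathrm{sgn}(\theta_{N+1,L}(j))\sqrt{\frac{\log\lambda_{\max}(N)}{\lambda_{\min}(N)}},$$ and $$\beta_{N+1,L}=\mathrm{argmin}_{\beta\in\mathbb{R}^{p+q}}\Big\{\sum_{k=1}^N(y_{k+1}-\beta^T\varphi_{k,L})^2+\lambda_N\sum_{l=1}^{p+q}\frac{|\beta(l)|}{|\widehat\theta_{N+1,L}(l)|}\Big\},$$ computed from the data of the closed-loop system. *)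

theory Defs
  imports "HOL-Probability.Probability" "Jordan_Normal_Form.Spectral_Radius"
begin

unbundle no vec_syntax
no_notation inner (infix "\<bullet>" 70)

text \<open>
  Vectors and matrices are those of Jordan_Normal_Form, whose indices start at 0: for
  \<open>i < p\<close> the entry \<open>i\<close> of a vector of dimension \<open>p + q\<close> belongs to \<open>a\<^sub>i\<^sub>+\<^sub>1\<close>, and for
  \<open>j < q\<close> the entry \<open>p + j\<close> belongs to \<open>b\<^sub>j\<^sub>+\<^sub>1\<close>.  In particular the entry \<open>p\<close> belongs to
  \<open>b\<^sub>1\<close> and to the current input.  A sample path of the output or of the input is a function
  on the integers, because the first regressors refer to negative times.
\<close>

section \<open>Sample paths\<close>

definition parameter_vec ::
  "nat \<Rightarrow> nat \<Rightarrow> (nat \<Rightarrow> real) \<Rightarrow> (nat \<Rightarrow> real) \<Rightarrow> real Matrix.vec" where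
  "parameter_vec p q a b =
     Matrix.vec (p + q) (\<lambda>i. if i < p then a (i + 1) else b (i - p + 1))"

definition regressor ::
  "nat \<Rightarrow> nat \<Rightarrow> (int \<Rightarrow> real) \<Rightarrow> (int \<Rightarrow> real) \<Rightarrow> nat \<Rightarrow> real Matrix.vec" where
  "regressor p q y u k =
     Matrix.vec (p + q) (\<lambda>i. if i < p then y (int k - int i) else u (int k - int (i - p)))"

definition gram ::
  "nat \<Rightarrow> nat \<Rightarrow> (int \<Rightarrow> real) \<Rightarrow> (int \<Rightarrow> real) \<Rightarrow> nat \<Rightarrow> real Matrix.mat" where
  "gram p q y u N = Matrix.mat (p + q) (p + q)
     (\<lambda>(i, j). \<Sum>k = 1..N. regressor p q y u k $ i * regressor p q y u k $ j)"

definition cross_moment ::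
  "nat \<Rightarrow> nat \<Rightarrow> (int \<Rightarrow> real) \<Rightarrow> (int \<Rightarrow> real) \<Rightarrow> nat \<Rightarrow> real Matrix.vec" where
  "cross_moment p q y u N = Matrix.vec (p + q)
     (\<lambda>i. \<Sum>k = 1..N. regressor p q y u k $ i * y (int k + 1))"

text \<open>
  The Gram matrix is a sum of rank one matrices, so it is singular for the first few times and
  the least squares formula has no meaning there.  At those times the estimate is a start-up
  value \<open>\<theta>0 k\<close>.  A convention like \<open>inverse = 0\<close> would not do: it would
  make the estimate of \<open>b\<^sub>1\<close>, by which the control law divides, vanish.
\<close>

definition ls_estimate ::
  "nat \<Rightarrow> nat \<Rightarrow> (int \<Rightarrow> real) \<Rightarrow> (int \<Rightarrow> real) \<Rightarrow> (nat \<Rightarrow> real Matrix.vec) \<Rightarrow> nat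
     \<Rightarrow> real Matrix.vec" where
  "ls_estimate p q y u \<theta>0 k =
     (case mat_inverse (gram p q y u (k - 1)) of
        Some P \<Rightarrow> P *\<^sub>v cross_moment p q y u (k - 1)
      | None \<Rightarrow> \<theta>0 k)"

definition b1_estimate ::
  "nat \<Rightarrow> nat \<Rightarrow> (int \<Rightarrow> real) \<Rightarrow> (int \<Rightarrow> real) \<Rightarrow> (nat \<Rightarrow> real Matrix.vec) \<Rightarrow> nat \<Rightarrow> real" where
  "b1_estimate p q y u \<theta>0 k = ls_estimate p q y u \<theta>0 k $ p"

definition certainty_equivalence_control ::
  "nat \<Rightarrow> nat \<Rightarrow> (int \<Rightarrow> real) \<Rightarrow> (int \<Rightarrow> real) \<Rightarrow> (nat \<Rightarrow> real Matrix.vec) \<Rightarrow> (nat \<Rightarrow> real)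
     \<Rightarrow> nat \<Rightarrow> real" where
  "certainty_equivalence_control p q y u \<theta>0 yref k =
     1 / b1_estimate p q y u \<theta>0 k *
       (yref (k + 1) +
         (b1_estimate p q y u \<theta>0 k * u (int k)
           - ls_estimate p q y u \<theta>0 k \<bullet> regressor p q y u k))"

definition regressor_energy ::
  "nat \<Rightarrow> nat \<Rightarrow> (int \<Rightarrow> real) \<Rightarrow> (int \<Rightarrow> real) \<Rightarrow> nat \<Rightarrow> real" where
  "regressor_energy p q y u k =
     1 + (\<Sum>i = 1..k. regressor p q y u i \<bullet> regressor p q y u i)"

definition sgn1 :: "real \<Rightarrow> real" where
  "sgn1 x = (if x \<ge> 0 then 1 else - 1)"

definition lambda_max ::
  "nat \<Rightarrow> nat \<Rightarrow> (int \<Rightarrow> real) \<Rightarrow> (int \<Rightarrow> real) \<Rightarrow> nat \<Rightarrow> real" where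
  "lambda_max p q y u N = Max (spectrum (gram p q y u N))"

definition lambda_min ::
  "nat \<Rightarrow> nat \<Rightarrow> (int \<Rightarrow> real) \<Rightarrow> (int \<Rightarrow> real) \<Rightarrow> nat \<Rightarrow> real" where
  "lambda_min p q y u N = Min (spectrum (gram p q y u N))"

text \<open>
  \<open>modified_estimate \<dots> N\<close> and \<open>sparse_estimate \<dots> N\<close> are the estimates with time
  index \<open>N + 1\<close>, computed from the data up to \<open>y\<^sub>N\<^sub>+\<^sub>1\<close>.
\<close>

definition modified_estimate ::
  "nat \<Rightarrow> nat \<Rightarrow> (int \<Rightarrow> real) \<Rightarrow> (int \<Rightarrow> real) \<Rightarrow> (nat \<Rightarrow> real Matrix.vec) \<Rightarrow> nat
     \<Rightarrow> real Matrix.vec" where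
  "modified_estimate p q y u \<theta>0 N = Matrix.vec (p + q)
     (\<lambda>j. ls_estimate p q y u \<theta>0 (N + 1) $ j
        + sgn1 (ls_estimate p q y u \<theta>0 (N + 1) $ j)
            * sqrt (ln (lambda_max p q y u N) / lambda_min p q y u N))"

definition sparse_criterion ::
  "nat \<Rightarrow> nat \<Rightarrow> (int \<Rightarrow> real) \<Rightarrow> (int \<Rightarrow> real) \<Rightarrow> (nat \<Rightarrow> real Matrix.vec) \<Rightarrow> (nat \<Rightarrow> real)
     \<Rightarrow> nat \<Rightarrow> real Matrix.vec \<Rightarrow> real" where
  "sparse_criterion p q y u \<theta>0 lam N \<beta> =
     (\<Sum>k = 1..N. (y (int k + 1) - \<beta> \<bullet> regressor p q y u k)\<^sup>2)
     + lam N * (\<Sum>l < p + q. \<bar>\<beta> $ l\<bar> / \<bar>modified_estimate p q y u \<theta>0 N $ l\<bar>)"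

definition sparse_estimate ::
  "nat \<Rightarrow> nat \<Rightarrow> (int \<Rightarrow> real) \<Rightarrow> (int \<Rightarrow> real) \<Rightarrow> (nat \<Rightarrow> real Matrix.vec) \<Rightarrow> (nat \<Rightarrow> real)
     \<Rightarrow> nat \<Rightarrow> real Matrix.vec" where
  "sparse_estimate p q y u \<theta>0 lam N =
     arg_min_on (sparse_criterion p q y u \<theta>0 lam N) (carrier_vec (p + q))"

definition arx_equation ::
  "nat \<Rightarrow> nat \<Rightarrow> (nat \<Rightarrow> real) \<Rightarrow> (nat \<Rightarrow> real) \<Rightarrow> (int \<Rightarrow> real) \<Rightarrow> (int \<Rightarrow> real)
     \<Rightarrow> (nat \<Rightarrow> real) \<Rightarrow> nat \<Rightarrow> bool" where
  "arx_equation p q a b y u w k \<longleftrightarrow>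
     y (int k + 1) = (\<Sum>i = 1..p. a i * y (int k + 1 - int i))
                   + (\<Sum>j = 1..q. b j * u (int k + 1 - int j)) + w (k + 1)"

section \<open>Processes\<close>

definition generated_by :: "'a measure \<Rightarrow> ('a \<Rightarrow> real) set \<Rightarrow> 'a measure" where
  "generated_by M X =
     sigma (space M) {f -` A \<inter> space M | f A. f \<in> X \<and> A \<in> sets borel}"

definition observations ::
  "('a \<Rightarrow> int \<Rightarrow> real) \<Rightarrow> ('a \<Rightarrow> int \<Rightarrow> real) \<Rightarrow> nat \<Rightarrow> ('a \<Rightarrow> real) set" where
  "observations y u k =
     {\<lambda>\<omega>. y \<omega> (int i) | i. i \<le> k} \<union> {\<lambda>\<omega>. u \<omega> (int i) | i. i < k}"

definition filtration_at ::
  "'a measure \<Rightarrow> ('a \<Rightarrow> int \<Rightarrow> real) \<Rightarrow> ('a \<Rightarrow> int \<Rightarrow> real) \<Rightarrow> ('a \<Rightarrow> nat \<Rightarrow> real)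
     \<Rightarrow> ('a \<Rightarrow> nat \<Rightarrow> real) \<Rightarrow> nat \<Rightarrow> 'a measure" where
  "filtration_at M y u w w' k = generated_by M
     (observations y u k \<union> {\<lambda>\<omega>. w \<omega> i | i. i \<le> k} \<union> {\<lambda>\<omega>. w' \<omega> i | i. i \<le> k})"

text \<open>
  Values at negative times do not occur in the filtration, so they are constants.
\<close>

definition arx_processes ::
  "'a measure \<Rightarrow> ('a \<Rightarrow> int \<Rightarrow> real) \<Rightarrow> ('a \<Rightarrow> int \<Rightarrow> real) \<Rightarrow> ('a \<Rightarrow> nat \<Rightarrow> real)
     \<Rightarrow> ('a \<Rightarrow> nat \<Rightarrow> real) \<Rightarrow> bool" where
  "arx_processes M y u w w' \<longleftrightarrow>
     (\<forall>k. (\<lambda>\<omega>. y \<omega> k) \<in> borel_measurable M \<and> (\<lambda>\<omega>. u \<omega> k) \<in> borel_measurable M) \<and>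
     (\<forall>k. (\<lambda>\<omega>. w \<omega> k) \<in> borel_measurable M \<and> (\<lambda>\<omega>. w' \<omega> k) \<in> borel_measurable M) \<and>
     (\<forall>k<0. \<exists>c d. \<forall>\<omega>\<in>space M. y \<omega> k = c \<and> u \<omega> k = d)"

definition startup_values ::
  "'a measure \<Rightarrow> nat \<Rightarrow> nat \<Rightarrow> ('a \<Rightarrow> int \<Rightarrow> real) \<Rightarrow> ('a \<Rightarrow> int \<Rightarrow> real)
     \<Rightarrow> ('a \<Rightarrow> nat \<Rightarrow> real Matrix.vec) \<Rightarrow> bool" where
  "startup_values M p q y u \<theta>0 \<longleftrightarrow>
     (\<forall>k. (\<forall>\<omega>\<in>space M. \<theta>0 \<omega> k \<in> carrier_vec (p + q)) \<and>
          (\<forall>i<p + q. (\<lambda>\<omega>. \<theta>0 \<omega> k $ i)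
             \<in> borel_measurable (generated_by M (observations y u k))))"

definition iid_bounded_normalized :: "'a measure \<Rightarrow> ('a \<Rightarrow> nat \<Rightarrow> real) \<Rightarrow> bool" where
  "iid_bounded_normalized M v \<longleftrightarrow>
     prob_space.indep_vars M (\<lambda>_. borel) (\<lambda>k \<omega>. v \<omega> k) UNIV \<and>
     (\<forall>k. distr M borel (\<lambda>\<omega>. v \<omega> k) = distr M borel (\<lambda>\<omega>. v \<omega> 0)) \<and>
     (\<exists>c. \<forall>k. AE \<omega> in M. \<bar>v \<omega> k\<bar> \<le> c) \<and>
     (\<forall>k. prob_space.expectation M (\<lambda>\<omega>. v \<omega> k) = 0) \<and>
     (\<forall>k. prob_space.expectation M (\<lambda>\<omega>. (v \<omega> k)\<^sup>2) = 1)"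

text \<open>
  \<open>w'\<close> is exogenous: it is generated outside the loop, so what is injected at time \<open>k\<close>
  is independent of everything that has entered the loop before.
\<close>

definition exogenous ::
  "'a measure \<Rightarrow> ('a \<Rightarrow> int \<Rightarrow> real) \<Rightarrow> ('a \<Rightarrow> int \<Rightarrow> real) \<Rightarrow> ('a \<Rightarrow> nat \<Rightarrow> real)
     \<Rightarrow> ('a \<Rightarrow> nat \<Rightarrow> real) \<Rightarrow> bool" where
  "exogenous M y u w w' \<longleftrightarrow>
     (\<forall>k\<ge>1. prob_space.indep_set M
        (sets (generated_by M {\<lambda>\<omega>. w' \<omega> k}))
        (sets (generated_by M
          (observations y u k \<union> {\<lambda>\<omega>. w \<omega> i | i. i \<le> k} \<union> {\<lambda>\<omega>. w' \<omega> i | i. i < k}))))"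

definition martingale_difference ::
  "'a measure \<Rightarrow> (nat \<Rightarrow> 'a measure) \<Rightarrow> ('a \<Rightarrow> nat \<Rightarrow> real) \<Rightarrow> bool" where
  "martingale_difference M F w \<longleftrightarrow>
     (\<forall>k\<ge>1. integrable M (\<lambda>\<omega>. w \<omega> k) \<and> (\<lambda>\<omega>. w \<omega> k) \<in> borel_measurable (F k)) \<and>
     (\<forall>k\<ge>1. AE \<omega> in M. real_cond_exp M (F k) (\<lambda>\<omega>. w \<omega> (k + 1)) \<omega> = 0)"

text \<open>
  The conditional moment is the one of a nonnegative function, since \<open>\<bar>w\<bar> powr \<gamma>\<close> need not be
  integrable.
\<close>

definition bounded_conditional_moments ::
  "'a measure \<Rightarrow> (nat \<Rightarrow> 'a measure) \<Rightarrow> ('a \<Rightarrow> nat \<Rightarrow> real) \<Rightarrow> real \<Rightarrow> bool" where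
  "bounded_conditional_moments M F w \<gamma> \<longleftrightarrow>
     (AE \<omega> in M.
        (SUP k\<in>{1..}. nn_cond_exp M (F k) (\<lambda>\<omega>. ennreal (\<bar>w \<omega> (k + 1)\<bar> powr \<gamma>)) \<omega>) < \<infinity>)"

end

theory Submission
  imports Defs "HOL-Real_Asymp.Real_Asymp" "HOL-Complex_Analysis.Cauchy_Integral_Formula"
begin

text \<open>
  Both the noise and the injected excitation are martingale differences, so the cross terms of the
  analysis are transforms, of order \<open>\<Sigma>\<^sup>3\<^sup>/\<^sup>4\<close> in the energy \<open>\<Sigma>\<close> of the integrand. Since the determinant of the
  Gram matrix grows polynomially in the regressor energy \<open>r\<close>, the least squares recursion then bounds the
  weighted estimation error and the sum of the normalized squared prediction errors by powers of
  \<open>ln r\<close>. With the stable inverse of \<open>B\<close> this makes the output energy linear in time outside a sparse set of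
  bad times, at which the input can be very large only if \<open>b\<^sub>1\<close> is badly estimated. A very large
  input makes the estimate of \<open>b\<^sub>1\<close> accurate for a long time, and meanwhile the excitation has made the Gram matrix
  large; hence such inputs occur only finitely often and \<open>r\<^sub>N\<close> is at most \<open>N\<close> to a power close to one.

  For the smallest eigenvalue, the components of the regressor are peeled off from the newest to the
  oldest: each input contains fresh excitation of energy about \<open>N\<^sup>1\<^sup>-\<^sup>\<epsilon>\<close> and each output contains
  fresh noise, nearly orthogonal to everything older. So \<open>\<lambda>\<^sub>m\<^sub>i\<^sub>n\<close> grows at least like
  \<open>N\<close> to the power \<open>1 - \<epsilon> (t + 1)\<close>. Comparing the sparse minimizer with the true parameter gives
  its consistency, and comparing it with its truncations forces the vanishing coordinates to be exactly zero.

  That the Gram matrix becomes regular is itself a matter of excitation: as long as it is singular the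
  regressors satisfy an exact linear relation, which a recursive projection would learn and then use to predict the
  excitation or the noise without error.
\<close>

section \<open>Martingale transforms\<close>

text \<open>The obstacle is a circle. The lower bound for the smallest eigenvalue presupposes that
  \<open>r N\<close> is almost linear in \<open>N\<close>; almost linear growth presupposes a good
  estimate of \<open>b\<^sub>1\<close>, hence a large smallest eigenvalue. It is broken by a growth
  bound that is conditional on the size of the inputs at bad times: just before a very large input
  this condition follows from the monotonicity of the inverse Gram matrix. The exponent 3/4, instead
  of one close to 1/2, needs no more than a maximal inequality. Its price is an error of order about
  N^(1/2 + \<epsilon>) in the excitation bound, which has to stay below N^(1 - \<eta>), where \<eta>
  = \<epsilon> (t + 1) < 1/4. The penalty N^(1 - 3/2 \<eta>) lies between two orders. It is
  negligible against N^(1 - \<eta>), so nonzero coordinates survive; divided by a modified estimate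
  of order N^(-(1 - \<eta>)/2) at a vanishing coordinate, it exceeds the order N^(1 - \<eta>/4) of
  what the fit can gain there, up to small exponents. All estimates on the loop are made on one
  sample path that satisfies finitely many transform bounds; probability only supplies such
  paths.\<close>

lemma abs_summation_by_parts_le:
  fixes X c :: "nat \<Rightarrow> real"
  assumes X: "\<And>k. \<bar>X k\<bar> \<le> B" and c: "\<And>k. c k \<le> c (Suc k)" "\<And>k. 0 \<le> c k"
  shows "\<bar>\<Sum>k<Suc n. c k * (X (Suc k) - X k)\<bar> \<le> 2 * B * c n"
proof -
  \<comment> \<open>Apart from the boundary term \<open>c n * X (Suc n)\<close> only values of
    \<open>X\<close> weighted by the increments of \<open>c\<close>, and by \<open>c 0\<close>,
    remain; these weights add up to \<open>c n\<close>.\<close>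
  have "\<bar>(\<Sum>k<Suc n. c k * (X (Suc k) - X k)) - c n * X (Suc n)\<bar> \<le> B * c n"
  proof (induction n)
    case 0
    have "\<bar>X 0\<bar> * c 0 \<le> B * c 0" using X[of 0] c(2)[of 0] by (rule mult_right_mono)
    then have "\<bar>c 0 * X 0\<bar> \<le> B * c 0" using c(2)[of 0] by (simp add: abs_mult mult.commute[of "c 0"])
    then show ?case by (simp add: algebra_simps)
  next
    case (Suc n)
    have "\<bar>(c n - c (Suc n)) * X (Suc n)\<bar> \<le> (c (Suc n) - c n) * B"
      using X[of "Suc n"] c(1)[of n] by (simp add: abs_mult mult_left_mono)
    moreover have "(\<Sum>k<Suc (Suc n). c k * (X (Suc k) - X k)) - c (Suc n) * X (Suc (Suc n))
       = ((\<Sum>k<Suc n. c k * (X (Suc k) - X k)) - c n * X (Suc n)) + (c n - c (Suc n)) * X (Suc n)"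
      by (simp add: algebra_simps)
    ultimately show ?case using Suc.IH by (simp add: algebra_simps)
  qed
  moreover have "\<bar>c n * X (Suc n)\<bar> \<le> B * c n"
    using mult_right_mono[OF X[of "Suc n"] c(2)[of n]] c(2)[of n] by (simp add: abs_mult mult.commute[of "c n"])
  ultimately show ?thesis by linarith
qed

lemma powr_three_halves: "0 \<le> (s::real) \<Longrightarrow> s powr (3/2) = s * sqrt s"
proof -
  assume "0 \<le> s"
  have "s powr (3/2) = s powr (1 + 1/2)" by simp
  also have "\<dots> = s * sqrt s" using \<open>0 \<le> s\<close> by (simp only: powr_add powr_half_sqrt) auto
  finally show ?thesis .
qed

text \<open>Integral comparison for the power -3/2: each term is at most the decrease of
  \<open>2 / sqrt s\<close>. The denominator already contains the current term, so a single huge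
  \<open>a k\<close> does no harm. This is the origin of the exponents 3/4 and 3/2 below.\<close>

lemma sum_normalized_le:
  fixes a :: "nat \<Rightarrow> real"
  assumes a: "\<And>k. 0 \<le> a k"
  shows "(\<Sum>k<n. a k / (1 + (\<Sum>i<Suc k. a i)) powr (3/2)) \<le> 2"
proof -
  define s where "s n = 1 + (\<Sum>i<n. a i)" for n
  have s1: "1 \<le> s n" for n using a by (simp add: s_def sum_nonneg)
  have step: "a k / s (Suc k) powr (3/2) \<le> 2 / sqrt (s k) - 2 / sqrt (s (Suc k))" for k
  proof -
    define A B where "A = sqrt (s k)" and "B = sqrt (s (Suc k))"
    have A: "A > 0" "A \<le> B" using s1[of k] a[of k] by (auto simp: A_def B_def s_def intro!: real_sqrt_gt_zero)
    then have B: "B > 0" by simp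
    have ak: "a k = B^2 - A^2" using s1[of k] s1[of "Suc k"] by (simp add: A_def B_def) (simp add: s_def)
    have den: "s (Suc k) powr (3/2) = B^3" using s1[of "Suc k"]
      by (simp add: powr_three_halves B_def power3_eq_cube)
    have "(B^2 - A^2) * (A * B) \<le> 2 * (B - A) * B^3"
    proof -
      have "A * (A + B) \<le> B * (B + B)" using A B by (intro mult_mono) auto
      then have "(B - A) * B * (A * (A + B)) \<le> (B - A) * B * (B * (B + B))"
        using A B by (intro mult_left_mono) auto
      then show ?thesis by (simp add: power2_eq_square power3_eq_cube algebra_simps)
    qed
    then have "(B^2 - A^2) / B^3 \<le> 2 * (B - A) / (A * B)"
      using A B by (simp add: field_simps)
    also have "\<dots> = 2 / A - 2 / B" using A B by (simp add: field_simps)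
    finally show ?thesis unfolding ak den A_def[symmetric] B_def[symmetric] .
  qed
  have "(\<Sum>k<n. a k / s (Suc k) powr (3/2)) \<le> 2 / sqrt (s 0) - 2 / sqrt (s n)"
    by (induction n) (use step in \<open>auto intro: order_trans[OF add_mono]\<close>, smt (verit) step)
  also have "\<dots> \<le> 2" using s1[of n] by (simp add: s_def)
  finally show ?thesis unfolding s_def .
qed

text \<open>\<open>v k\<close> becomes known at time \<open>Suc k\<close>, so an integrand adapted
  to \<open>F\<close> is predictable for it. The bound of the conditional variances is random, and
  \<open>v k\<close> itself is only required to be integrable; the truncations below deal with
  both.\<close>

locale mds = prob_space M for M :: "'a measure" +
  fixes F :: "nat \<Rightarrow> 'a measure" and v :: "nat \<Rightarrow> 'a \<Rightarrow> real"
  assumes subalg: "\<And>k. subalgebra M (F k)"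
    and F_mono: "\<And>j k. j \<le> k \<Longrightarrow> sets (F j) \<subseteq> sets (F k)"
    and v_int: "\<And>k. integrable M (v k)"
    and v_meas: "\<And>k. v k \<in> borel_measurable (F (Suc k))"
    and v_zero: "\<And>k. AE \<omega> in M. real_cond_exp M (F k) (v k) \<omega> = 0"
    and v_var: "AE \<omega> in M. (SUP k. nn_cond_exp M (F k) (\<lambda>\<omega>. ennreal ((v k \<omega>)\<^sup>2)) \<omega>) < \<infinity>"
begin

definition cvar :: "nat \<Rightarrow> 'a \<Rightarrow> ennreal" where
  "cvar k = nn_cond_exp M (F k) (\<lambda>\<omega>. ennreal ((v k \<omega>)\<^sup>2))"

lemma sfs: "sigma_finite_subalgebra M (F k)"
proof -
  interpret finite_measure_subalgebra M "F k"
    by standard (rule subalg)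
  show ?thesis by (rule sigma_finite_subalgebra_axioms)
qed

lemma space_F: "space (F k) = space M"
  using subalg[of k] by (simp add: subalgebra_def)

lemma F_to_M: "f \<in> borel_measurable (F k) \<Longrightarrow> f \<in> borel_measurable M"
  by (rule measurable_from_subalg[OF subalg])

lemma F_to_F: "f \<in> borel_measurable (F j) \<Longrightarrow> j \<le> k \<Longrightarrow> f \<in> borel_measurable (F k)"
  by (rule measurable_from_subalg[of "F k" "F j"]) (auto simp: subalgebra_def space_F F_mono)

lemma v_M[measurable]: "v k \<in> borel_measurable M"
  by (rule F_to_M[OF v_meas])

lemma cvar_meas: "cvar k \<in> borel_measurable (F k)"
  unfolding cvar_def by simp

text \<open>Orthogonality of the increments. Since \<open>h k\<close> vanishes where the conditional
  variance exceeds \<open>K\<close>, the product of \<open>h k\<close> and \<open>v k\<close> has a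
  second moment of at most \<open>K\<close> times that of \<open>h k\<close>, although
  \<open>v k\<close> need not be square integrable.\<close>

lemma transform_second_moment:
  fixes K :: real
  assumes h: "\<And>k. h k \<in> borel_measurable (F k)"
    and K: "\<And>k \<omega>. h k \<omega> \<noteq> 0 \<Longrightarrow> cvar k \<omega> \<le> ennreal K" and K0: "0 \<le> K"
    and h1: "\<And>n \<omega>. \<omega> \<in> space M \<Longrightarrow> (\<Sum>k<n. (h k \<omega>)\<^sup>2) \<le> 2"
  shows "integrable M (\<lambda>\<omega>. (\<Sum>k<n. h k \<omega> * v k \<omega>)\<^sup>2) \<and>
         (\<integral>\<omega>. (\<Sum>k<n. h k \<omega> * v k \<omega>)\<^sup>2 \<partial>M) \<le> 2 * K"
proof -
  define D where "D k \<omega> = h k \<omega> * v k \<omega>" for k \<omega>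
  define X where "X n \<omega> = (\<Sum>k<n. D k \<omega>)" for n \<omega>
  have hM[measurable]: "h k \<in> borel_measurable M" for k by (rule F_to_M[OF h])
  have DM[measurable]: "D k \<in> borel_measurable M" for k unfolding D_def by measurable
  have XM[measurable]: "X n \<in> borel_measurable M" for n unfolding X_def by measurable
  have DF: "D k \<in> borel_measurable (F (Suc k))" for k
    unfolding D_def using F_to_F[OF h, of k "Suc k"] v_meas[of k] by simp
  have XF: "X n \<in> borel_measurable (F n)" for n
    unfolding X_def by (intro borel_measurable_sum) (metis DF F_to_F Suc_leI lessThan_iff)
  have h_sq2: "(h k \<omega>)\<^sup>2 \<le> 2" if "\<omega> \<in> space M" for k \<omega>
  proof -
    have "(h k \<omega>)\<^sup>2 \<le> (\<Sum>i<Suc k. (h i \<omega>)\<^sup>2)" by (simp add: sum_nonneg)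
    then show ?thesis using h1[OF that, of "Suc k"] by linarith
  qed
  have h_int: "integrable M (\<lambda>\<omega>. (h k \<omega>)\<^sup>2)" for k
    by (rule integrable_const_bound[of _ 2]) (use h_sq2 in auto)
  have nnD: "(\<integral>\<^sup>+\<omega>. ennreal ((D k \<omega>)\<^sup>2) \<partial>M) \<le> ennreal (K * (\<integral>\<omega>. (h k \<omega>)\<^sup>2 \<partial>M))" for k
  proof -
    have "(\<integral>\<^sup>+\<omega>. ennreal ((D k \<omega>)\<^sup>2) \<partial>M) = (\<integral>\<^sup>+\<omega>. ennreal ((h k \<omega>)\<^sup>2) * ennreal ((v k \<omega>)\<^sup>2) \<partial>M)"
      by (simp add: D_def power_mult_distrib ennreal_mult)
    also have "\<dots> = (\<integral>\<^sup>+\<omega>. ennreal ((h k \<omega>)\<^sup>2) * cvar k \<omega> \<partial>M)"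
      unfolding cvar_def
      by (rule sigma_finite_subalgebra.nn_cond_exp_intg[OF sfs, symmetric]) (use h in measurable)
    also have "\<dots> \<le> (\<integral>\<^sup>+\<omega>. ennreal (K * (h k \<omega>)\<^sup>2) \<partial>M)"
    proof (rule nn_integral_mono)
      fix \<omega>
      show "ennreal ((h k \<omega>)\<^sup>2) * cvar k \<omega> \<le> ennreal (K * (h k \<omega>)\<^sup>2)"
        using K[of k \<omega>] K0 by (cases "h k \<omega> = 0") (auto simp: ennreal_mult mult.commute[of _ "ennreal ((h k \<omega>)\<^sup>2)"] intro: mult_left_mono)
    qed
    also have "\<dots> = ennreal (\<integral>\<omega>. K * (h k \<omega>)\<^sup>2 \<partial>M)"
      by (rule nn_integral_eq_integral) (use h_int K0 in auto)
    finally show ?thesis by simp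
  qed
  have D2int: "integrable M (\<lambda>\<omega>. (D k \<omega>)\<^sup>2)" for k
    by (rule integrableI_nonneg) (use nnD[of k] in \<open>auto simp: less_top[symmetric] top_unique\<close>)
  have D2le: "(\<integral>\<omega>. (D k \<omega>)\<^sup>2 \<partial>M) \<le> K * (\<integral>\<omega>. (h k \<omega>)\<^sup>2 \<partial>M)" for k
  proof -
    have "ennreal (\<integral>\<omega>. (D k \<omega>)\<^sup>2 \<partial>M) \<le> ennreal (K * (\<integral>\<omega>. (h k \<omega>)\<^sup>2 \<partial>M))"
      using nnD[of k] by (subst (asm) nn_integral_eq_integral[OF D2int]) auto
    then show ?thesis using K0 by (subst (asm) ennreal_le_iff) auto
  qed
  have main: "integrable M (\<lambda>\<omega>. (X n \<omega>)\<^sup>2) \<and>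
       (\<integral>\<omega>. (X n \<omega>)\<^sup>2 \<partial>M) \<le> K * (\<integral>\<omega>. (\<Sum>k<n. (h k \<omega>)\<^sup>2) \<partial>M)" for n
  proof (induction n)
    case 0 then show ?case by (simp add: X_def)
  next
    case (Suc n)
    have XD: "integrable M (\<lambda>\<omega>. X n \<omega> * D n \<omega>)"
    proof (rule Bochner_Integration.integrable_bound[OF Bochner_Integration.integrable_add[OF conjunct1[OF Suc] D2int[of n]]])
      show "AE x in M. norm (X n x * D n x) \<le> norm ((X n x)\<^sup>2 + (D n x)\<^sup>2)"
      proof (rule AE_I2)
        fix x
        have "\<bar>X n x * D n x\<bar> \<le> (X n x)\<^sup>2 + (D n x)\<^sup>2"
          using sum_squares_bound[of "\<bar>X n x\<bar>" "\<bar>D n x\<bar>"] mult_nonneg_nonneg[of "\<bar>X n x\<bar>" "\<bar>D n x\<bar>"]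
          unfolding abs_mult power2_abs by linarith
        then show "norm (X n x * D n x) \<le> norm ((X n x)\<^sup>2 + (D n x)\<^sup>2)" by simp
      qed
    qed measurable
    \<comment> \<open>Grouped in this way, the cross term has a factor known at time
      \<open>n\<close> and is an integral against the conditional mean of \<open>v n\<close>, which
      is zero.\<close>
    have eq: "(\<lambda>\<omega>. X n \<omega> * D n \<omega>) = (\<lambda>\<omega>. (X n \<omega> * h n \<omega>) * v n \<omega>)" by (simp add: D_def mult_ac)
    have "(\<integral>\<omega>. (X n \<omega> * h n \<omega>) * v n \<omega> \<partial>M) = (\<integral>\<omega>. (X n \<omega> * h n \<omega>) * real_cond_exp M (F n) (v n) \<omega> \<partial>M)"
      by (rule sigma_finite_subalgebra.real_cond_exp_intg(2)[OF sfs, symmetric])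
         (use XD XF h in \<open>auto simp: eq\<close>)
    also have "\<dots> = (\<integral>\<omega>. 0 \<partial>M)"
      by (rule integral_cong_AE) (use v_zero[of n] F_to_M[OF borel_measurable_cond_exp] in auto)
    finally have XD0: "(\<integral>\<omega>. X n \<omega> * D n \<omega> \<partial>M) = 0" unfolding eq by simp
    have sq: "(X (Suc n) \<omega>)\<^sup>2 = (X n \<omega>)\<^sup>2 + 2 * (X n \<omega> * D n \<omega>) + (D n \<omega>)\<^sup>2" for \<omega>
      by (simp add: X_def power2_sum algebra_simps)
    have "(\<integral>\<omega>. (X (Suc n) \<omega>)\<^sup>2 \<partial>M) = (\<integral>\<omega>. (X n \<omega>)\<^sup>2 \<partial>M) + (\<integral>\<omega>. (D n \<omega>)\<^sup>2 \<partial>M)"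
      unfolding sq using XD0 XD conjunct1[OF Suc] D2int[of n] by simp
    also have "\<dots> \<le> K * (\<integral>\<omega>. (\<Sum>k<n. (h k \<omega>)\<^sup>2) \<partial>M) + K * (\<integral>\<omega>. (h n \<omega>)\<^sup>2 \<partial>M)"
      using Suc D2le[of n] by simp
    also have "\<dots> = K * (\<integral>\<omega>. (\<Sum>k<Suc n. (h k \<omega>)\<^sup>2) \<partial>M)"
      using h_int by (simp add: algebra_simps)
    finally show ?case unfolding sq using XD conjunct1[OF Suc] D2int[of n] by simp
  qed
  have "(\<integral>\<omega>. (\<Sum>k<n. (h k \<omega>)\<^sup>2) \<partial>M) \<le> (\<integral>\<omega>. 2 \<partial>M)"
    by (rule integral_mono) (use h_int h1 in auto)
  also have "\<dots> = 2" by (simp add: prob_space)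
  finally have "K * (\<integral>\<omega>. (\<Sum>k<n. (h k \<omega>)\<^sup>2) \<partial>M) \<le> K * 2" using K0 by (rule mult_left_mono)
  then show ?thesis using main[of n] unfolding X_def D_def by auto
qed

text \<open>Stopping the transform when it leaves \<open>[-c, c]\<close> reduces the maximal inequality to
  Chebyshev's.\<close>

lemma transform_maximal:
  fixes K c :: real
  assumes h: "\<And>k. h k \<in> borel_measurable (F k)"
    and K: "\<And>k \<omega>. h k \<omega> \<noteq> 0 \<Longrightarrow> cvar k \<omega> \<le> ennreal K" and K0: "0 \<le> K"
    and h1: "\<And>n \<omega>. \<omega> \<in> space M \<Longrightarrow> (\<Sum>k<n. (h k \<omega>)\<^sup>2) \<le> 2"
    and c: "0 < c"
  shows "prob {\<omega>\<in>space M. \<exists>j\<le>n. c < \<bar>\<Sum>k<j. h k \<omega> * v k \<omega>\<bar>} \<le> 2 * K / c\<^sup>2"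
proof -
  define X where "X n \<omega> = (\<Sum>k<n. h k \<omega> * v k \<omega>)" for n \<omega>
  define h' where "h' k \<omega> = (if \<forall>j\<in>{..k}. \<bar>X j \<omega>\<bar> \<le> c then h k \<omega> else 0)" for k \<omega>
  define X' where "X' n \<omega> = (\<Sum>k<n. h' k \<omega> * v k \<omega>)" for n \<omega>
  have hM[measurable]: "h k \<in> borel_measurable M" for k by (rule F_to_M[OF h])
  have [measurable]: "X n \<in> borel_measurable M" for n unfolding X_def by measurable
  have XF: "X n \<in> borel_measurable (F n)" for n
    unfolding X_def
  proof (intro borel_measurable_sum borel_measurable_times)
    fix i assume "i \<in> {..<n}"
    then show "h i \<in> borel_measurable (F n)" "v i \<in> borel_measurable (F n)"
      using F_to_F[OF h, of i n] F_to_F[OF v_meas, of i n] by auto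
  qed
  have h'F: "h' k \<in> borel_measurable (F k)" for k
  proof -
    have [measurable]: "X j \<in> borel_measurable (F k)" if "j \<in> {..k}" for j using F_to_F[OF XF] that by auto
    have [measurable]: "h k \<in> borel_measurable (F k)" by (rule h)
    show ?thesis unfolding h'_def by measurable
  qed
  have [measurable]: "h' k \<in> borel_measurable M" for k by (rule F_to_M[OF h'F])
  have [measurable]: "X' n \<in> borel_measurable M" for n unfolding X'_def by measurable
  have *: "integrable M (\<lambda>\<omega>. (X' n \<omega>)\<^sup>2) \<and> (\<integral>\<omega>. (X' n \<omega>)\<^sup>2 \<partial>M) \<le> 2 * K"
    unfolding X'_def
  proof (rule transform_second_moment[OF h'F _ K0])
    show "cvar k \<omega> \<le> ennreal K" if "h' k \<omega> \<noteq> 0" for k \<omega>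
      using K that by (auto simp: h'_def split: if_splits)
    show "(\<Sum>k<n. (h' k \<omega>)\<^sup>2) \<le> 2" if "\<omega> \<in> space M" for n \<omega>
      by (rule order_trans[OF sum_mono h1[OF that, of n]]) (auto simp: h'_def)
  qed
  have X'_eq: "((\<forall>j<n. \<bar>X j \<omega>\<bar> \<le> c) \<longrightarrow> X' n \<omega> = X n \<omega>) \<and> ((\<exists>j\<le>n. c < \<bar>X j \<omega>\<bar>) \<longrightarrow> c < \<bar>X' n \<omega>\<bar>)" for n \<omega>
  proof (induction n)
    case 0 then show ?case by (simp add: X_def X'_def)
  next
    case (Suc n)
    show ?case
    proof (cases "\<forall>j\<le>n. \<bar>X j \<omega>\<bar> \<le> c")
      case True
      then have "X' n \<omega> = X n \<omega>" "h' n \<omega> = h n \<omega>" using Suc by (auto simp: h'_def)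
      then have "X' (Suc n) \<omega> = X (Suc n) \<omega>" by (simp add: X_def X'_def)
      then show ?thesis using True by (metis le_Suc_eq not_less)
    next
      case False
      then have "h' n \<omega> = 0" by (auto simp: h'_def)
      then have "X' (Suc n) \<omega> = X' n \<omega>" by (simp add: X'_def)
      moreover have "c < \<bar>X' n \<omega>\<bar>" using False Suc by (auto simp: not_le)
      ultimately show ?thesis using False by (auto simp: less_Suc_eq_le)
    qed
  qed
  have "prob {\<omega>\<in>space M. \<exists>j\<le>n. c < \<bar>X j \<omega>\<bar>} \<le> prob {\<omega>\<in>space M. c\<^sup>2 \<le> (X' n \<omega>)\<^sup>2}"
  proof (rule finite_measure_mono)
    show "{\<omega>\<in>space M. \<exists>j\<le>n. c < \<bar>X j \<omega>\<bar>} \<subseteq> {\<omega>\<in>space M. c\<^sup>2 \<le> (X' n \<omega>)\<^sup>2}"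
    proof safe
      fix \<omega> j assume "j \<le> n" "c < \<bar>X j \<omega>\<bar>"
      then have "c < \<bar>X' n \<omega>\<bar>" using X'_eq by blast
      then show "c\<^sup>2 \<le> (X' n \<omega>)\<^sup>2" using c by (simp add: abs_le_square_iff[symmetric])
    qed
  qed measurable
  also have "\<dots> \<le> (\<integral>\<omega>. (X' n \<omega>)\<^sup>2 \<partial>M) / c\<^sup>2"
    by (rule integral_Markov_inequality_measure[where A = "space M" and u = "\<lambda>\<omega>. (X' n \<omega>)\<^sup>2", simplified])
       (use * c in auto)
  also have "\<dots> \<le> 2 * K / c\<^sup>2" using * by (intro divide_right_mono) auto
  finally show ?thesis unfolding X_def .
qed

text \<open>The maximal inequality is uniform in the horizon \<open>n\<close>, so the event that
  every level is exceeded has arbitrarily small probability. Boundedness is all that the later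
  summation by parts requires; no limit of the transform is constructed.\<close>

lemma transform_bounded_AE:
  fixes K :: real
  assumes h: "\<And>k. h k \<in> borel_measurable (F k)"
    and K: "\<And>k \<omega>. h k \<omega> \<noteq> 0 \<Longrightarrow> cvar k \<omega> \<le> ennreal K" and K0: "0 \<le> K"
    and h1: "\<And>n \<omega>. \<omega> \<in> space M \<Longrightarrow> (\<Sum>k<n. (h k \<omega>)\<^sup>2) \<le> 2"
  shows "AE \<omega> in M. \<exists>B. \<forall>n. \<bar>\<Sum>k<n. h k \<omega> * v k \<omega>\<bar> \<le> B"
proof -
  define X where "X n \<omega> = (\<Sum>k<n. h k \<omega> * v k \<omega>)" for n \<omega>
  have hM[measurable]: "h k \<in> borel_measurable M" for k by (rule F_to_M[OF h])
  have [measurable]: "X n \<in> borel_measurable M" for n unfolding X_def by measurable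
  define E where "E c n = {\<omega>\<in>space M. \<exists>j\<le>n. c < \<bar>X j \<omega>\<bar>}" for c :: real and n :: nat
  have Em: "E c n \<in> sets M" for c n unfolding E_def by measurable
  have EU: "(\<Union>n. E c n) \<in> sets M" for c using Em by auto
  have le: "prob (\<Union>n. E c n) \<le> 2 * K / c\<^sup>2" if "0 < c" for c
  proof (rule LIMSEQ_le_const2)
    show "(\<lambda>n. prob (E c n)) \<longlonglongrightarrow> prob (\<Union>n. E c n)"
      by (rule finite_Lim_measure_incseq) (auto simp: Em incseq_def E_def intro: order_trans)
    show "\<exists>N. \<forall>n\<ge>N. prob (E c n) \<le> 2 * K / c\<^sup>2"
      using transform_maximal[OF h K K0 h1 that] unfolding E_def X_def by auto
  qed
  define Z where "Z = (\<Inter>m::nat. \<Union>n. E (Suc m) n)"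
  have Zm: "Z \<in> sets M" unfolding Z_def using EU by auto
  have Zle: "prob Z \<le> 2 * K / (real (Suc m))\<^sup>2" for m
    by (rule order_trans[OF finite_measure_mono le]) (auto simp: Z_def EU Em)
  have "(\<lambda>m. 2 * K / (real (Suc m))\<^sup>2) \<longlonglongrightarrow> 0"
    by real_asymp
  then have "prob Z \<le> 0" by (rule LIMSEQ_le_const) (use Zle in auto)
  then have "prob Z = 0" by (simp add: measure_le_0_iff)
  then have "AE \<omega> in M. \<omega> \<notin> Z" using Zm by (simp add: prob_eq_0)
  then show ?thesis using AE_space
  proof (eventually_elim)
    case (elim \<omega>)
    then obtain m where "\<And>n. \<omega> \<notin> E (Suc m) n" by (auto simp: Z_def)
    then show ?case using elim unfolding E_def X_def by (intro exI[of _ "real (Suc m)"]) (auto simp: not_less)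
  qed
qed

lemma cvar_bounded: "AE \<omega> in M. \<exists>K::nat. \<forall>k. cvar k \<omega> \<le> ennreal (real K)"
  using v_var
proof eventually_elim
  case (elim \<omega>)
  define r where "r = enn2real (SUP k. cvar k \<omega>)"
  have r: "(SUP k. cvar k \<omega>) = ennreal r"
    unfolding r_def by (rule ennreal_enn2real[symmetric]) (use elim in \<open>simp only: cvar_def infinity_ennreal_def\<close>)
  obtain K :: nat where "r \<le> real K" using real_arch_simple by blast
  then have "cvar k \<omega> \<le> ennreal (real K)" for k
    using SUP_upper[of k UNIV "\<lambda>k. cvar k \<omega>"] r by (auto intro: order_trans ennreal_leI)
  then show ?case by blast
qed

text \<open>Divided by the power 3/4 of its running energy, the integrand has squares with sum at
  most 2, so the normalized transform is almost surely bounded; summation by parts restores the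
  weights.\<close>

lemma transform_bound:
  assumes g: "\<And>k. g k \<in> borel_measurable (F k)"
  shows "AE \<omega> in M. \<exists>C\<ge>0. \<forall>n. \<bar>\<Sum>k<n. g k \<omega> * v k \<omega>\<bar> \<le> C * (1 + (\<Sum>k<n. (g k \<omega>)\<^sup>2)) powr (3/4)"
proof -
  define s where "s k \<omega> = 1 + (\<Sum>i<k. (g i \<omega>)\<^sup>2)" for k \<omega>
  have s1: "1 \<le> s k \<omega>" for k \<omega> by (simp add: s_def sum_nonneg)
  have gF: "g j \<in> borel_measurable (F k)" if "j \<le> k" for j k using F_to_F[OF g that] .
  have sF: "s (Suc k) \<in> borel_measurable (F k)" for k
    unfolding s_def by (intro borel_measurable_add borel_measurable_sum borel_measurable_power gF) auto
  \<comment> \<open>The truncation keeps \<open>h K k\<close> known at time \<open>k\<close>. All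
    levels \<open>K\<close> are treated at once; on a given path a level above all its conditional
    variances leaves the integrand unchanged.\<close>
  define h where "h K k \<omega> = (if cvar k \<omega> \<le> ennreal (real K) then g k \<omega> / s (Suc k) \<omega> powr (3/4) else 0)"
    for K :: nat and k \<omega>
  have hF: "h K k \<in> borel_measurable (F k)" for K k
  proof -
    have [measurable]: "cvar k \<in> borel_measurable (F k)" "g k \<in> borel_measurable (F k)"
      "s (Suc k) \<in> borel_measurable (F k)" by (rule cvar_meas g sF)+
    show ?thesis unfolding h_def by measurable
  qed
  have "AE \<omega> in M. \<forall>K. \<exists>B. \<forall>n. \<bar>\<Sum>k<n. h K k \<omega> * v k \<omega>\<bar> \<le> B"
  proof (subst AE_all_countable, intro allI)
    fix K
    show "AE \<omega> in M. \<exists>B. \<forall>n. \<bar>\<Sum>k<n. h K k \<omega> * v k \<omega>\<bar> \<le> B"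
    proof (rule transform_bounded_AE[where h = "h K" and K = "real K"])
      show "h K k \<in> borel_measurable (F k)" for k by (rule hF)
      show "cvar k \<omega> \<le> ennreal (real K)" if "h K k \<omega> \<noteq> 0" for k \<omega>
        using that by (auto simp: h_def split: if_splits)
      show "(\<Sum>k<n. (h K k \<omega>)\<^sup>2) \<le> 2" for n \<omega>
      proof (rule order_trans[OF sum_mono sum_normalized_le[of "\<lambda>k. (g k \<omega>)\<^sup>2" n]])
        fix k
        have "(s (Suc k) \<omega> powr (3/4))\<^sup>2 = s (Suc k) \<omega> powr (3/2)"
          by (simp add: power2_eq_square powr_add[symmetric])
        then show "(h K k \<omega>)\<^sup>2 \<le> (g k \<omega>)\<^sup>2 / (1 + (\<Sum>i<Suc k. (g i \<omega>)\<^sup>2)) powr (3/2)"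
          by (auto simp: h_def power_divide s_def)
      qed simp
    qed simp
  qed
  then show ?thesis using cvar_bounded
  proof eventually_elim
    case (elim \<omega>)
    then obtain K :: nat where K: "\<And>k. cvar k \<omega> \<le> ennreal (real K)" by blast
    obtain B where B: "\<And>n. \<bar>\<Sum>k<n. h K k \<omega> * v k \<omega>\<bar> \<le> B" using elim by blast
    have B0: "0 \<le> B" using B[of 0] by simp
    define X where "X n = (\<Sum>k<n. h K k \<omega> * v k \<omega>)" for n
    have eq: "g k \<omega> * v k \<omega> = s (Suc k) \<omega> powr (3/4) * (X (Suc k) - X k)" for k
      using K[of k] s1[of "Suc k" \<omega>] by (simp add: X_def h_def)
    show ?case
    proof (intro exI[of _ "2 * B"] conjI allI)
      fix n
      show "\<bar>\<Sum>k<n. g k \<omega> * v k \<omega>\<bar> \<le> 2 * B * (1 + (\<Sum>k<n. (g k \<omega>)\<^sup>2)) powr (3/4)"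
      proof (cases n)
        case (Suc m)
        have "\<bar>\<Sum>k<Suc m. s (Suc k) \<omega> powr (3/4) * (X (Suc k) - X k)\<bar> \<le> 2 * B * s (Suc m) \<omega> powr (3/4)"
        proof (rule abs_summation_by_parts_le)
          show "\<bar>X k\<bar> \<le> B" for k using B by (simp add: X_def)
          show "s (Suc k) \<omega> powr (3/4) \<le> s (Suc (Suc k)) \<omega> powr (3/4)" for k
            using s1[of "Suc k" \<omega>] by (intro powr_mono2) (auto simp: s_def)
        qed auto
        then show ?thesis unfolding eq Suc by (simp add: s_def)
      qed (use B0 in auto)
    qed (use B0 in auto)
  qed
qed

text \<open>The terms are nonnegative, so the truncated and normalized series is almost surely
  finite because its expectation is at most \<open>2 * K\<close>. Replacing all weights by the
  largest one then removes the normalization.\<close>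

lemma square_bound:
  assumes a: "\<And>k. a k \<in> borel_measurable (F k)" and a0: "\<And>k \<omega>. 0 \<le> a k \<omega>"
  shows "AE \<omega> in M. \<exists>C\<ge>0. \<forall>n. (\<Sum>k<n. a k \<omega> * (v k \<omega>)\<^sup>2) \<le> C * (1 + (\<Sum>k<n. a k \<omega>)) powr (3/2)"
proof -
  define s where "s k \<omega> = 1 + (\<Sum>i<k. a i \<omega>)" for k \<omega>
  have s1: "1 \<le> s k \<omega>" for k \<omega> by (simp add: s_def sum_nonneg a0)
  have aF: "a j \<in> borel_measurable (F k)" if "j \<le> k" for j k using F_to_F[OF a that] .
  have sF: "s (Suc k) \<in> borel_measurable (F k)" for k
    unfolding s_def by (intro borel_measurable_add borel_measurable_sum aF) auto
  define h where "h K k \<omega> = (if cvar k \<omega> \<le> ennreal (real K) then a k \<omega> / s (Suc k) \<omega> powr (3/2) else 0)"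
    for K :: nat and k \<omega>
  have h0: "0 \<le> h K k \<omega>" for K k \<omega> by (simp add: h_def a0)
  have hF: "h K k \<in> borel_measurable (F k)" for K k
  proof -
    have [measurable]: "cvar k \<in> borel_measurable (F k)" "a k \<in> borel_measurable (F k)"
      "s (Suc k) \<in> borel_measurable (F k)" by (rule cvar_meas a sF)+
    show ?thesis unfolding h_def by measurable
  qed
  have [measurable]: "h K k \<in> borel_measurable M" for K k by (rule F_to_M[OF hF])
  have [measurable]: "cvar k \<in> borel_measurable M" for k by (rule F_to_M[OF cvar_meas])
  define Y where "Y K \<omega> = (\<Sum>k. ennreal (h K k \<omega>) * ennreal ((v k \<omega>)\<^sup>2))" for K \<omega>
  have "AE \<omega> in M. \<forall>K. Y K \<omega> \<noteq> \<infinity>"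
  proof (subst AE_all_countable, intro allI)
    fix K
    have "(\<integral>\<^sup>+\<omega>. Y K \<omega> \<partial>M) = (\<Sum>k. \<integral>\<^sup>+\<omega>. ennreal (h K k \<omega>) * ennreal ((v k \<omega>)\<^sup>2) \<partial>M)"
      unfolding Y_def by (rule nn_integral_suminf) measurable
    also have "\<dots> = (\<Sum>k. \<integral>\<^sup>+\<omega>. ennreal (h K k \<omega>) * cvar k \<omega> \<partial>M)"
      unfolding cvar_def
      by (intro arg_cong[of _ _ suminf] ext sigma_finite_subalgebra.nn_cond_exp_intg[OF sfs, symmetric])
         (use hF in auto)
    also have "\<dots> = (\<integral>\<^sup>+\<omega>. (\<Sum>k. ennreal (h K k \<omega>) * cvar k \<omega>) \<partial>M)"
      by (rule nn_integral_suminf[symmetric]) measurable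
    also have "\<dots> \<le> (\<integral>\<^sup>+\<omega>. ennreal (2 * real K) \<partial>M)"
    proof (rule nn_integral_mono, rule suminf_le_const)
      fix \<omega> n
      have "(\<Sum>k<n. ennreal (h K k \<omega>) * cvar k \<omega>) \<le> (\<Sum>k<n. ennreal (h K k \<omega> * real K))"
      proof (rule sum_mono)
        fix k
        show "ennreal (h K k \<omega>) * cvar k \<omega> \<le> ennreal (h K k \<omega> * real K)"
        proof (cases "cvar k \<omega> \<le> ennreal (real K)")
          case True
          then show ?thesis using h0[of K k \<omega>] by (simp add: ennreal_mult mult_left_mono)
        qed (simp add: h_def)
      qed
      also have "\<dots> = ennreal ((\<Sum>k<n. h K k \<omega>) * real K)"
        using h0 by (subst sum_ennreal) (auto simp: sum_distrib_right)
      also have "\<dots> \<le> ennreal (2 * real K)"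
      proof (intro ennreal_leI mult_right_mono)
        show "(\<Sum>k<n. h K k \<omega>) \<le> 2"
          by (rule order_trans[OF sum_mono sum_normalized_le[of "\<lambda>k. a k \<omega>" n]])
             (use a0 s1[of _ \<omega>] in \<open>auto simp: h_def s_def\<close>)
      qed simp
      finally show "(\<Sum>k<n. ennreal (h K k \<omega>) * cvar k \<omega>) \<le> ennreal (2 * real K)" .
    qed simp
    also have "\<dots> < \<infinity>" by (simp add: emeasure_space_1 ennreal_mult_less_top)
    finally have "(\<integral>\<^sup>+\<omega>. Y K \<omega> \<partial>M) \<noteq> \<infinity>" by simp
    then show "AE \<omega> in M. Y K \<omega> \<noteq> \<infinity>"
      by (rule nn_integral_PInf_AE[rotated]) (unfold Y_def, measurable)
  qed
  then show ?thesis using cvar_bounded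
  proof eventually_elim
    case (elim \<omega>)
    then obtain K :: nat where K: "\<And>k. cvar k \<omega> \<le> ennreal (real K)" by blast
    obtain C where C: "Y K \<omega> = ennreal C" "0 \<le> C" using elim by (cases "Y K \<omega>") auto
    show ?case
    proof (intro exI[of _ C] conjI allI)
      fix n
      have "ennreal (\<Sum>k<n. h K k \<omega> * (v k \<omega>)\<^sup>2) = (\<Sum>k<n. ennreal (h K k \<omega>) * ennreal ((v k \<omega>)\<^sup>2))"
        using h0 by (subst sum_ennreal[symmetric]) (auto simp: ennreal_mult)
      also have "\<dots> \<le> Y K \<omega>" unfolding Y_def by (rule sum_le_suminf) auto
      finally have *: "(\<Sum>k<n. h K k \<omega> * (v k \<omega>)\<^sup>2) \<le> C" using C by simp
      have "(\<Sum>k<n. a k \<omega> * (v k \<omega>)\<^sup>2) \<le> (\<Sum>k<n. s n \<omega> powr (3/2) * (h K k \<omega> * (v k \<omega>)\<^sup>2))"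
      proof (rule sum_mono)
        fix k assume "k \<in> {..<n}"
        then have "s (Suc k) \<omega> \<le> s n \<omega>" unfolding s_def by (intro add_left_mono sum_mono2) (auto simp: a0)
        then have "s (Suc k) \<omega> powr (3/2) \<le> s n \<omega> powr (3/2)" using s1[of "Suc k" \<omega>] by (intro powr_mono2) auto
        then have "s (Suc k) \<omega> powr (3/2) * h K k \<omega> \<le> s n \<omega> powr (3/2) * h K k \<omega>" using h0 by (rule mult_right_mono)
        moreover have "s (Suc k) \<omega> powr (3/2) * h K k \<omega> = a k \<omega>" using K[of k] s1[of "Suc k" \<omega>] by (simp add: h_def)
        ultimately have "a k \<omega> * (v k \<omega>)\<^sup>2 \<le> s n \<omega> powr (3/2) * h K k \<omega> * (v k \<omega>)\<^sup>2" by (intro mult_right_mono) auto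
        then show "a k \<omega> * (v k \<omega>)\<^sup>2 \<le> s n \<omega> powr (3/2) * (h K k \<omega> * (v k \<omega>)\<^sup>2)" by (simp add: mult_ac)
      qed
      also have "\<dots> \<le> s n \<omega> powr (3/2) * C"
        unfolding sum_distrib_left[symmetric] by (intro mult_left_mono *) auto
      finally show "(\<Sum>k<n. a k \<omega> * (v k \<omega>)\<^sup>2) \<le> C * (1 + (\<Sum>k<n. a k \<omega>)) powr (3/2)"
        by (simp add: s_def mult.commute)
    qed (rule C(2))
  qed
qed

text \<open>If \<open>v k = g k\<close> from some time on, the transform of \<open>g\<close> equals
  the energy of \<open>g\<close> up to a constant. This contradicts its bound by the power 3/4 of
  that energy when the energy is unbounded.\<close>

lemma not_predictable:
  assumes g: "\<And>k. g k \<in> borel_measurable (F k)"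
  shows "AE \<omega> in M. (\<forall>B. \<exists>n. B < (\<Sum>k<n. (v k \<omega>)\<^sup>2)) \<longrightarrow> \<not> (\<exists>K. \<forall>k\<ge>K. v k \<omega> = g k \<omega>)"
  using transform_bound[OF g]
proof eventually_elim
  case (elim \<omega>)
  show ?case
  proof (intro impI notI, elim exE)
    fix K assume unb: "\<forall>B. \<exists>n. B < (\<Sum>k<n. (v k \<omega>)\<^sup>2)" and K: "\<forall>k\<ge>K. v k \<omega> = g k \<omega>"
    obtain C where C: "0 \<le> C" "\<And>n. \<bar>\<Sum>k<n. g k \<omega> * v k \<omega>\<bar> \<le> C * (1 + (\<Sum>k<n. (g k \<omega>)\<^sup>2)) powr (3/4)"
      using elim by blast
    define D where "D = \<bar>\<Sum>k<K. g k \<omega> * v k \<omega> - (g k \<omega>)\<^sup>2\<bar>"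
    define D' where "D' = \<bar>\<Sum>k<K. (v k \<omega>)\<^sup>2 - (g k \<omega>)\<^sup>2\<bar>"
    have split: "(\<Sum>k<n. f k) = (\<Sum>k<K. f k)" if "n \<ge> K" "\<And>k. k \<ge> K \<Longrightarrow> f k = 0" for n and f :: "nat \<Rightarrow> real"
      using that by (intro sum.mono_neutral_right) auto
    have e1: "(\<Sum>k<n. g k \<omega> * v k \<omega>) \<ge> (\<Sum>k<n. (g k \<omega>)\<^sup>2) - D" if "n \<ge> K" for n
      using split[OF that, of "\<lambda>k. g k \<omega> * v k \<omega> - (g k \<omega>)\<^sup>2"] K
      by (simp add: D_def sum_subtractf power2_eq_square)
    have e2: "(\<Sum>k<n. (v k \<omega>)\<^sup>2) \<le> (\<Sum>k<n. (g k \<omega>)\<^sup>2) + D'" if "n \<ge> K" for n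
      using split[OF that, of "\<lambda>k. (v k \<omega>)\<^sup>2 - (g k \<omega>)\<^sup>2"] K
      by (simp add: D'_def sum_subtractf power2_eq_square)
    have "filterlim (\<lambda>x::real. x - C * (1 + x) powr (3/4)) at_top at_top" by real_asymp
    then have "eventually (\<lambda>x::real. D < x - C * (1 + x) powr (3/4)) at_top"
      by (rule filterlim_at_top_dense[THEN iffD1, rule_format])
    then obtain x0 where x0: "\<And>x. x \<ge> x0 \<Longrightarrow> D < x - C * (1 + x) powr (3/4)"
      by (auto simp: eventually_at_top_linorder)
    obtain n where n: "(\<Sum>k<K. (v k \<omega>)\<^sup>2) + \<bar>x0\<bar> + D' < (\<Sum>k<n. (v k \<omega>)\<^sup>2)" using unb by blast
    have nK: "n \<ge> K"
    proof (rule ccontr)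
      assume "\<not> n \<ge> K"
      then have "(\<Sum>k<n. (v k \<omega>)\<^sup>2) \<le> (\<Sum>k<K. (v k \<omega>)\<^sup>2)" by (intro sum_mono2) auto
      then show False using n by (simp add: D'_def)
    qed
    have "x0 \<le> (\<Sum>k<n. (g k \<omega>)\<^sup>2)" using e2[OF nK] n sum_nonneg[of "{..<K}" "\<lambda>k. (v k \<omega>)\<^sup>2"] by auto
    from x0[OF this] show False using e1[OF nK] C(2)[of n] by linarith
  qed
qed

end

section \<open>The least squares recursion\<close>

text \<open>Vectors are functions of which only the first \<open>d\<close> entries count, and
  matrices likewise. This avoids the dimension side conditions of \<open>Matrix.vec\<close> and
  suits measurability entry by entry.\<close>

definition dot :: "nat \<Rightarrow> (nat \<Rightarrow> real) \<Rightarrow> (nat \<Rightarrow> real) \<Rightarrow> real" where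
  "dot d x y = (\<Sum>i<d. x i * y i)"

definition app :: "nat \<Rightarrow> (nat \<Rightarrow> nat \<Rightarrow> real) \<Rightarrow> (nat \<Rightarrow> real) \<Rightarrow> nat \<Rightarrow> real" where
  "app d A x i = (\<Sum>j<d. A i j * x j)"

definition unitv :: "nat \<Rightarrow> nat \<Rightarrow> real" where
  "unitv i j = (if j = i then 1 else 0)"

lemma dot_cong: "(\<And>i. i < d \<Longrightarrow> x i = x' i) \<Longrightarrow> (\<And>i. i < d \<Longrightarrow> y i = y' i) \<Longrightarrow> dot d x y = dot d x' y'"
  by (simp add: dot_def)

lemma dot_commute: "dot d x y = dot d y x"
  by (simp add: dot_def mult.commute)

lemma dot_add_left: "dot d (\<lambda>i. x i + x' i) y = dot d x y + dot d x' y"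
  by (simp add: dot_def algebra_simps sum.distrib)

lemma dot_diff_left: "dot d (\<lambda>i. x i - x' i) y = dot d x y - dot d x' y"
  by (simp add: dot_def algebra_simps sum_subtractf)

lemma dot_scale_left: "dot d (\<lambda>i. x i * c) y = c * dot d x y"
  by (simp add: dot_def algebra_simps sum_distrib_left)

lemma dot_add_right: "dot d y (\<lambda>i. x i + x' i) = dot d y x + dot d y x'"
  by (simp add: dot_def algebra_simps sum.distrib)

lemma dot_diff_right: "dot d y (\<lambda>i. x i - x' i) = dot d y x - dot d y x'"
  by (simp add: dot_def algebra_simps sum_subtractf)

lemma dot_scale_right: "dot d y (\<lambda>i. x i * c) = c * dot d y x"
  by (simp add: dot_def algebra_simps sum_distrib_left)

lemma dot_nonneg: "0 \<le> dot d x x"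
  by (simp add: dot_def sum_nonneg)

lemma dot_unitv_left: "i < d \<Longrightarrow> dot d (unitv i) y = y i"
  by (simp add: dot_def unitv_def of_bool_def[symmetric] if_distrib[of "\<lambda>x. x * _"] cong: if_cong)

lemma dot_Cauchy_Schwarz: "(dot d x y)\<^sup>2 \<le> dot d x x * dot d y y"
  unfolding dot_def using Cauchy_Schwarz_ineq_sum[of x y "{..<d}"] by (simp add: power2_eq_square)

lemma component_sq_le_dot: "i < d \<Longrightarrow> (x i)\<^sup>2 \<le> dot d x x"
  unfolding dot_def power2_eq_square by (rule member_le_sum) auto

text \<open>Two factorizations of one block matrix of size \<open>d + 1\<close>, with blocks 1, z,
  -f, 1: clearing the lower left block leaves the Schur complement \<open>s\<close>, clearing the
  upper right block leaves \<open>A\<close>.\<close>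

lemma det_rank_one_update:
  fixes z f :: "nat \<Rightarrow> real"
  shows "det (Matrix.mat d d (\<lambda>(i,j). (if i = j then 1 else 0) + z i * f j)) = 1 + dot d z f"
proof -
  define U where "U = Matrix.mat d 1 (\<lambda>(i,j). z i)"
  define R where "R = Matrix.mat 1 d (\<lambda>(i,j). - f j)"
  define A where "A = Matrix.mat d d (\<lambda>(i,j). (if i = j then 1 else 0) + z i * f j)"
  define s where "s = 1 + dot d z f"
  define X where "X = four_block_mat (1\<^sub>m d) (0\<^sub>m d 1) R (1\<^sub>m 1)"
  define Y where "Y = four_block_mat (1\<^sub>m d) U (0\<^sub>m 1 d) (Matrix.mat 1 1 (\<lambda>_. s))"
  define X' where "X' = four_block_mat A U (0\<^sub>m 1 d) (1\<^sub>m 1)"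
  have c: "U \<in> carrier_mat d 1" "R \<in> carrier_mat 1 d" "A \<in> carrier_mat d d"
    "Matrix.mat 1 1 (\<lambda>_. s) \<in> carrier_mat 1 1"
    by (auto simp: U_def R_def A_def)
  have r1: "R * U + 1\<^sub>m 1 * Matrix.mat 1 1 (\<lambda>_. s) = 1\<^sub>m 1"
    by (rule eq_matI) (auto simp: R_def U_def s_def dot_def scalar_prod_def sum_negf lessThan_atLeast0 mult.commute)
  have r2: "A * 1\<^sub>m d + U * R = 1\<^sub>m d"
    by (rule eq_matI) (auto simp: R_def U_def A_def scalar_prod_def)
  have "X * Y = four_block_mat (1\<^sub>m d) U R (1\<^sub>m 1)"
    unfolding X_def Y_def
    by (subst mult_four_block_mat[of _ d d _ 1 _ 1 _ _ d _ 1]) (use c r1 in auto)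
  moreover have "X' * X = four_block_mat (1\<^sub>m d) U R (1\<^sub>m 1)"
    unfolding X_def X'_def
    by (subst mult_four_block_mat[of _ d d _ 1 _ 1 _ _ d _ 1]) (use c r2 in auto)
  ultimately have eq: "X * Y = X' * X" by simp
  have cc: "X \<in> carrier_mat (d + 1) (d + 1)" "Y \<in> carrier_mat (d + 1) (d + 1)" "X' \<in> carrier_mat (d + 1) (d + 1)"
    unfolding X_def Y_def X'_def using c by auto
  have dX: "det X = 1" unfolding X_def
    by (subst det_four_block_mat_upper_right_zero[of _ d _ 1]) (use c in auto)
  have dY: "det Y = s" unfolding Y_def
    by (subst det_four_block_mat_lower_left_zero[of _ d _ 1]) (use c in \<open>auto simp: det_single\<close>)
  have dX': "det X' = det A" unfolding X'_def
    by (subst det_four_block_mat_lower_left_zero[of _ d _ 1]) (use c in auto)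
  have "det X * det Y = det X' * det X"
    using eq det_mult[OF cc(1,2)] det_mult[OF cc(3,1)] by metis
  then show ?thesis using dX dY dX' by (simp add: A_def s_def)
qed

lemma abs_det_le:
  fixes A :: "real Matrix.mat"
  assumes A: "A \<in> carrier_mat d d" and B: "\<And>i j. i < d \<Longrightarrow> j < d \<Longrightarrow> \<bar>A $$ (i, j)\<bar> \<le> B"
  shows "\<bar>det A\<bar> \<le> fact d * B ^ d"
proof -
  have "\<bar>det A\<bar> \<le> (\<Sum>p \<in> {p. p permutes {0..<d}}. \<bar>signof p * (\<Prod>i = 0..<d. A $$ (i, p i))\<bar>)"
    unfolding det_def'[OF A] by (rule sum_abs)
  also have "\<dots> \<le> (\<Sum>p \<in> {p. p permutes {0..<d}}. B ^ d)"
  proof (rule sum_mono)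
    fix p assume "p \<in> {p. p permutes {0..<d}}"
    then have p: "p i < d" if "i < d" for i using permutes_in_image[of p "{0..<d}" i] that by auto
    have "\<bar>signof p * (\<Prod>i = 0..<d. A $$ (i, p i))\<bar> = (\<Prod>i = 0..<d. \<bar>A $$ (i, p i)\<bar>)"
      by (simp add: abs_mult sign_def abs_prod)
    also have "\<dots> \<le> (\<Prod>i = 0..<d. B)" using p B by (intro prod_mono) auto
    finally show "\<bar>signof p * (\<Prod>i = 0..<d. A $$ (i, p i))\<bar> \<le> B ^ d" by simp
  qed
  also have "\<dots> = fact d * B ^ d" by (simp add: card_permutations[OF refl])
  finally show ?thesis .
qed

section \<open>Quadratic forms and rank one updates of the inverse Gram matrix\<close>

locale lsq =
  fixes d :: nat and \<phi> :: "nat \<Rightarrow> nat \<Rightarrow> real" and W :: "nat \<Rightarrow> real"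
begin

definition G :: "nat \<Rightarrow> nat \<Rightarrow> nat \<Rightarrow> real" where "G n i j = (\<Sum>k = 1..n. \<phi> k i * \<phi> k j)"
definition Gm :: "nat \<Rightarrow> real Matrix.mat" where "Gm n = Matrix.mat d d (\<lambda>(i, j). G n i j)"
text \<open>The adjugate over the determinant is the inverse of a regular Gram matrix, in a form
  that is rational in the entries and hence evidently measurable.\<close>

definition Q :: "nat \<Rightarrow> nat \<Rightarrow> nat \<Rightarrow> real" where "Q n i j = adj_mat (Gm n) $$ (i, j) / det (Gm n)"
definition Qa :: "nat \<Rightarrow> (nat \<Rightarrow> real) \<Rightarrow> nat \<Rightarrow> real" where "Qa n = app d (Q n)"
definition S :: "nat \<Rightarrow> nat \<Rightarrow> real" where "S n i = (\<Sum>k = 1..n. \<phi> k i * W k)"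
definition z :: "nat \<Rightarrow> nat \<Rightarrow> real" where "z n = Qa n (\<phi> (Suc n))"
text \<open>\<open>s\<close> is the leverage of the next regressor, \<open>e\<close> the effect of
  the estimation error on the next prediction, and \<open>V\<close> the squared estimation error
  measured in the Gram matrix.\<close>

definition s :: "nat \<Rightarrow> real" where "s n = dot d (\<phi> (Suc n)) (z n)"
definition e :: "nat \<Rightarrow> real" where "e n = dot d (S n) (z n)"
definition V :: "nat \<Rightarrow> real" where "V n = dot d (S n) (Qa n (S n))"
definition tr :: "nat \<Rightarrow> real" where "tr n = (\<Sum>i<d. Q n i i)"

lemma Gm_carrier[simp]: "Gm n \<in> carrier_mat d d"
  by (simp add: Gm_def)

lemma dot_G: "dot d x (app d (G n) y) = (\<Sum>k = 1..n. dot d x (\<phi> k) * dot d y (\<phi> k))"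
proof -
  have "dot d x (app d (G n) y) = (\<Sum>i<d. \<Sum>j<d. \<Sum>k = 1..n. (x i * \<phi> k i) * (y j * \<phi> k j))"
    by (simp add: dot_def app_def G_def sum_distrib_left sum_distrib_right mult_ac)
  also have "\<dots> = (\<Sum>k = 1..n. \<Sum>i<d. \<Sum>j<d. (x i * \<phi> k i) * (y j * \<phi> k j))"
    by (simp only: sum.swap[of _ "{1..n}" "{..<d}"])
  also have "\<dots> = (\<Sum>k = 1..n. dot d x (\<phi> k) * dot d y (\<phi> k))"
    by (simp add: dot_def sum_product)
  finally show ?thesis .
qed

lemma app_G: "app d (G n) y i = (\<Sum>k = 1..n. \<phi> k i * dot d y (\<phi> k))"
proof -
  have "app d (G n) y i = (\<Sum>j<d. \<Sum>k = 1..n. \<phi> k i * (y j * \<phi> k j))"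
    by (simp add: app_def G_def sum_distrib_right sum_distrib_left mult_ac)
  also have "\<dots> = (\<Sum>k = 1..n. \<phi> k i * dot d y (\<phi> k))"
    by (subst sum.swap) (simp add: dot_def sum_distrib_left)
  finally show ?thesis .
qed

context
  fixes n assumes reg: "det (Gm n) \<noteq> 0"
begin

lemma G_mult_Q: "i < d \<Longrightarrow> k < d \<Longrightarrow> (\<Sum>j<d. G n i j * Q n j k) = (if i = k then 1 else 0)"
proof -
  assume ik: "i < d" "k < d"
  have c: "adj_mat (Gm n) \<in> carrier_mat d d" by (rule adj_mat) simp
  have "(Gm n * adj_mat (Gm n)) $$ (i, k) = (\<Sum>j<d. G n i j * adj_mat (Gm n) $$ (j, k))"
    using ik c by (simp add: scalar_prod_def Gm_def lessThan_atLeast0)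
  then have "(\<Sum>j<d. G n i j * adj_mat (Gm n) $$ (j, k)) = (det (Gm n) \<cdot>\<^sub>m 1\<^sub>m d) $$ (i, k)"
    by (simp add: adj_mat(2)[OF Gm_carrier])
  then show ?thesis using ik reg by (simp add: Q_def sum_divide_distrib[symmetric])
qed

lemma Q_mult_G: "i < d \<Longrightarrow> k < d \<Longrightarrow> (\<Sum>j<d. Q n i j * G n j k) = (if i = k then 1 else 0)"
proof -
  assume ik: "i < d" "k < d"
  have c: "adj_mat (Gm n) \<in> carrier_mat d d" by (rule adj_mat) simp
  have "(adj_mat (Gm n) * Gm n) $$ (i, k) = (\<Sum>j<d. adj_mat (Gm n) $$ (i, j) * G n j k)"
    using ik c by (simp add: scalar_prod_def Gm_def lessThan_atLeast0)
  then have "(\<Sum>j<d. adj_mat (Gm n) $$ (i, j) * G n j k) = (det (Gm n) \<cdot>\<^sub>m 1\<^sub>m d) $$ (i, k)"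
    by (simp add: adj_mat(3)[OF Gm_carrier])
  then show ?thesis using ik reg by (simp add: Q_def sum_divide_distrib[symmetric])
qed

lemma app_app_id:
  assumes "i < d" "\<And>k. k < d \<Longrightarrow> (\<Sum>j<d. A i j * B j k) = (if i = k then 1 else 0)"
  shows "app d A (app d B x) i = x i"
proof -
  have "app d A (app d B x) i = (\<Sum>j<d. \<Sum>k<d. A i j * B j k * x k)"
    by (simp add: app_def sum_distrib_left mult_ac)
  also have "\<dots> = (\<Sum>k<d. (\<Sum>j<d. A i j * B j k) * x k)"
    by (subst sum.swap) (simp add: sum_distrib_right)
  also have "\<dots> = (\<Sum>k<d. (if i = k then 1 else 0) * x k)"
    using assms(2) by (intro sum.cong) auto
  also have "\<dots> = x i" using assms(1) by (simp add: if_distrib[of "\<lambda>x. x * _"] cong: if_cong)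
  finally show ?thesis .
qed

lemma G_Qa: "i < d \<Longrightarrow> app d (G n) (Qa n x) i = x i"
  unfolding Qa_def by (rule app_app_id) (auto simp: G_mult_Q)

lemma Qa_G: "i < d \<Longrightarrow> Qa n (app d (G n) x) i = x i"
  unfolding Qa_def by (rule app_app_id) (auto simp: Q_mult_G)

text \<open>Writing \<open>x\<close> as the Gram matrix applied to \<open>Qa n x\<close> turns the
  form into a sum of products over the data. Symmetry, positivity and the Cauchy-Schwarz inequality
  for \<open>Q\<close> are read off from it.\<close>

lemma dot_Qa: "dot d x (Qa n y) = (\<Sum>k = 1..n. dot d (Qa n x) (\<phi> k) * dot d (Qa n y) (\<phi> k))"
proof -
  have "dot d x (Qa n y) = dot d (app d (G n) (Qa n x)) (Qa n y)"
    by (rule dot_cong) (simp_all add: G_Qa)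
  then show ?thesis by (simp add: dot_commute[of _ "app d _ _"] dot_G mult.commute)
qed

lemma Qa_sym: "dot d (Qa n x) y = dot d x (Qa n y)"
  by (subst dot_commute) (simp add: dot_Qa mult.commute)

lemma Qa_nonneg: "0 \<le> dot d x (Qa n x)"
  by (simp add: dot_Qa sum_nonneg)

lemma Qa_Cauchy_Schwarz: "(dot d x (Qa n y))\<^sup>2 \<le> dot d x (Qa n x) * dot d y (Qa n y)"
  unfolding dot_Qa using Cauchy_Schwarz_ineq_sum[of "\<lambda>k. dot d (Qa n x) (\<phi> k)" "\<lambda>k. dot d (Qa n y) (\<phi> k)" "{1..n}"]
  by (simp add: power2_eq_square)

lemma Q_diag: "i < d \<Longrightarrow> Q n i i = dot d (unitv i) (Qa n (unitv i))"
  by (simp add: dot_unitv_left Qa_def app_def unitv_def if_distrib[of "\<lambda>x. _ * x"] cong: if_cong)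

lemma tr_nonneg: "0 \<le> tr n"
  unfolding tr_def by (intro sum_nonneg) (simp add: Q_diag Qa_nonneg)

lemma Q_diag_le_tr: "i < d \<Longrightarrow> Q n i i \<le> tr n"
  unfolding tr_def by (rule member_le_sum) (auto simp: Q_diag Qa_nonneg)

lemma s_nonneg: "0 \<le> s n"
  by (simp add: s_def z_def Qa_nonneg)

lemma V_nonneg: "0 \<le> V n"
  by (simp add: V_def Qa_nonneg)

lemma V_eq: "V n = dot d (Qa n (S n)) (app d (G n) (Qa n (S n)))"
  by (simp add: V_def dot_Qa dot_G)

lemma component_sq_le: "i < d \<Longrightarrow> (Qa n (S n) i)\<^sup>2 \<le> Q n i i * V n"
  using Qa_Cauchy_Schwarz[of "unitv i" "S n"] by (simp add: Q_diag V_def dot_unitv_left)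

lemma e_eq: "e n = dot d (\<phi> (Suc n)) (Qa n (S n))"
  by (simp add: e_def z_def dot_commute[of d "\<phi> (Suc n)"] Qa_sym)

text \<open>The new Gram matrix is the old one times a rank one perturbation of the identity,
  because \<open>G n\<close> maps \<open>z n\<close> to the new regressor.\<close>

lemma det_step: "det (Gm (Suc n)) = det (Gm n) * (1 + s n)"
proof -
  define A where "A = Matrix.mat d d (\<lambda>(i,j). (if i = j then 1 else 0) + z n i * \<phi> (Suc n) j)"
  have A: "A \<in> carrier_mat d d" by (simp add: A_def)
  have Gz: "(\<Sum>k<d. G n i k * z n k) = \<phi> (Suc n) i" if "i < d" for i
    using G_Qa[OF that, of "\<phi> (Suc n)"] by (simp add: z_def app_def)
  have "Gm (Suc n) = Gm n * A"
  proof (rule eq_matI)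
    fix i j assume "i < dim_row (Gm n * A)" "j < dim_col (Gm n * A)"
    then have ij: "i < d" "j < d" by (auto simp: Gm_def A_def)
    have "(Gm n * A) $$ (i, j) = (\<Sum>k<d. G n i k * ((if k = j then 1 else 0) + z n k * \<phi> (Suc n) j))"
      using ij by (simp add: Gm_def A_def scalar_prod_def lessThan_atLeast0)
    also have "\<dots> = G n i j + (\<Sum>k<d. G n i k * z n k) * \<phi> (Suc n) j"
      using ij by (simp add: algebra_simps sum.distrib sum_distrib_right sum_distrib_left if_distrib[of "\<lambda>x. _ * x"] cong: if_cong)
    finally show "Gm (Suc n) $$ (i, j) = (Gm n * A) $$ (i, j)"
      using ij Gz by (simp add: Gm_def G_def)
  qed (auto simp: Gm_def A_def)
  then have "det (Gm (Suc n)) = det (Gm n) * det A" by (simp add: det_mult[OF Gm_carrier A])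
  also have "det A = 1 + s n" unfolding A_def by (simp add: det_rank_one_update s_def dot_commute)
  finally show ?thesis .
qed

lemma reg_Suc: "det (Gm (Suc n)) \<noteq> 0"
  using det_step reg s_nonneg by simp

end

lemma reg_mono: "det (Gm n) \<noteq> 0 \<Longrightarrow> n \<le> m \<Longrightarrow> det (Gm m) \<noteq> 0"
  by (rotate_tac 1, induction rule: dec_induct) (auto simp: reg_Suc)

context
  fixes n assumes reg: "det (Gm n) \<noteq> 0"
begin

lemma s1: "0 < 1 + s n" using s_nonneg[OF reg] by simp

text \<open>The Sherman-Morrison formula: the candidate \<open>u\<close> is shown to be mapped to
  \<open>y\<close> by the new Gram matrix, and regularity of that matrix makes it the only such
  vector.\<close>

lemma Q_step: "dot d x (Qa (Suc n) y) = dot d x (Qa n y) - dot d x (z n) * dot d y (z n) / (1 + s n)"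
proof -
  define u where "u i = Qa n y i - z n i * (dot d y (z n) / (1 + s n))" for i
  have yz: "dot d (Qa n y) (\<phi> (Suc n)) = dot d y (z n)" by (simp add: z_def Qa_sym[OF reg])
  have zz: "dot d (z n) (\<phi> (Suc n)) = s n" by (simp add: s_def dot_commute)
  have "app d (G (Suc n)) u i = y i" if i: "i < d" for i
  proof -
    have "app d (G (Suc n)) u i = app d (G n) u i + \<phi> (Suc n) i * dot d u (\<phi> (Suc n))"
      by (simp add: app_G)
    also have "app d (G n) u i = y i - \<phi> (Suc n) i * (dot d y (z n) / (1 + s n))"
    proof -
      have "app d (G n) u i = app d (G n) (Qa n y) i - app d (G n) (z n) i * (dot d y (z n) / (1 + s n))"
        by (simp add: app_def u_def algebra_simps sum_subtractf sum_distrib_left sum_divide_distrib)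
      then show ?thesis using G_Qa[OF reg i] by (simp add: z_def)
    qed
    also have "dot d u (\<phi> (Suc n)) = dot d y (z n) - (dot d y (z n) / (1 + s n)) * s n"
      unfolding u_def dot_diff_left dot_scale_left yz zz ..
    also have "y i - \<phi> (Suc n) i * (dot d y (z n) / (1 + s n)) + \<phi> (Suc n) i * (dot d y (z n) - dot d y (z n) / (1 + s n) * s n) = y i"
    proof -
      have *: "a - b * (c / D) + b * (c - c / D * t) = a" if "D \<noteq> 0" "t = D - 1" for a b c t D :: real
        unfolding that(2) using that(1) by (simp add: field_simps)
      show ?thesis by (rule *) (use s1 in auto)
    qed
    finally show ?thesis .
  qed
  then have "Qa (Suc n) y i = Qa (Suc n) (app d (G (Suc n)) u) i" for i
    unfolding Qa_def app_def[of d "Q (Suc n)"] by (intro sum.cong) auto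
  then have "Qa (Suc n) y i = u i" if "i < d" for i using Qa_G[OF reg_Suc[OF reg] that] by simp
  then have "dot d x (Qa (Suc n) y) = dot d x u" by (intro dot_cong) auto
  also have "\<dots> = dot d x (Qa n y) - dot d x (z n) * dot d y (z n) / (1 + s n)"
    unfolding u_def dot_diff_right dot_scale_right by simp
  finally show ?thesis .
qed

text \<open>The Lyapunov recursion of least squares. It consists of a dissipation, of a term linear
  in the new noise, whose coefficient depends on the past only, and of the noise energy weighted by
  a gain that will be summed against the logarithm of the determinant.\<close>

lemma V_step: "V (Suc n) = V n - (e n)\<^sup>2 / (1 + s n) + 2 * (e n / (1 + s n) * W (Suc n)) + s n / (1 + s n) * (W (Suc n))\<^sup>2"
proof -
  have SS: "S (Suc n) = (\<lambda>i. S n i + \<phi> (Suc n) i * W (Suc n))" by (simp add: S_def fun_eq_iff)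
  have Qlin: "Qa n (\<lambda>i. S n i + \<phi> (Suc n) i * W (Suc n)) = (\<lambda>i. Qa n (S n) i + z n i * W (Suc n))"
    by (simp add: Qa_def app_def z_def fun_eq_iff algebra_simps sum.distrib sum_distrib_left)
  have fS: "dot d (\<phi> (Suc n)) (Qa n (S n)) = e n" using e_eq[OF reg] by simp
  have 1: "dot d (S (Suc n)) (z n) = e n + W (Suc n) * s n"
    by (simp add: SS dot_add_left dot_scale_left e_def s_def)
  have 2: "dot d (S (Suc n)) (Qa n (S (Suc n))) = V n + 2 * W (Suc n) * e n + (W (Suc n))\<^sup>2 * s n"
    unfolding SS Qlin dot_add_left dot_add_right dot_scale_left dot_scale_right fS
    by (simp add: V_def e_def[symmetric] s_def[symmetric] power2_eq_square algebra_simps)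
  have "V (Suc n) = V n + 2 * W (Suc n) * e n + (W (Suc n))\<^sup>2 * s n - (e n + W (Suc n) * s n)\<^sup>2 / (1 + s n)"
    unfolding V_def[of "Suc n"] Q_step 1 2 by (simp add: power2_eq_square)
  also have "\<dots> = V n - (e n)\<^sup>2 / (1 + s n) + 2 * (e n / (1 + s n) * W (Suc n)) + s n / (1 + s n) * (W (Suc n))\<^sup>2"
  proof -
    have *: "c + 2 * x * a + x\<^sup>2 * t - (a + x * t)\<^sup>2 / D = c - a\<^sup>2 / D + 2 * (a / D * x) + t / D * x\<^sup>2"
      if "D \<noteq> 0" "t = D - 1" for c x a t D :: real
      unfolding that(2) using that(1) by (simp add: field_simps power2_eq_square)
    show ?thesis by (rule *) (use s1 in auto)
  qed
  finally show ?thesis .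
qed

lemma Q_diag_step: "i < d \<Longrightarrow> Q (Suc n) i i = Q n i i - (z n i)\<^sup>2 / (1 + s n)"
  by (simp add: Q_diag[OF reg] Q_diag[OF reg_Suc[OF reg]] Q_step dot_unitv_left power2_eq_square)

lemma tr_step: "tr n - tr (Suc n) = dot d (z n) (z n) / (1 + s n)"
  by (simp add: tr_def Q_diag_step sum_subtractf dot_def sum_divide_distrib power2_eq_square)

lemma tr_decreasing: "tr (Suc n) \<le> tr n"
  using tr_step dot_nonneg[of d "z n"] s1 by (smt (verit) divide_nonneg_pos)

lemma Q_diag_decreasing: "i < d \<Longrightarrow> Q (Suc n) i i \<le> Q n i i"
  using Q_diag_step s1 by simp

text \<open>One part of \<open>s\<close> is below 1; by Cauchy-Schwarz the other is at most the
  regressor energy times the decrease of the trace. These decreases have a finite sum, so the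
  leverage is small relative to the regressor energy except at few times.\<close>

lemma s_le: "s n \<le> 1 + dot d (\<phi> (Suc n)) (\<phi> (Suc n)) * (tr n - tr (Suc n))"
proof -
  have "(s n)\<^sup>2 \<le> dot d (\<phi> (Suc n)) (\<phi> (Suc n)) * dot d (z n) (z n)"
    unfolding s_def by (rule dot_Cauchy_Schwarz)
  then have "(s n)\<^sup>2 / (1 + s n) \<le> dot d (\<phi> (Suc n)) (\<phi> (Suc n)) * (tr n - tr (Suc n))"
    unfolding tr_step using s1 by (simp add: divide_right_mono)
  moreover have "s n = s n / (1 + s n) + (s n)\<^sup>2 / (1 + s n)"
    using s1 by (simp add: add_divide_distrib[symmetric] power2_eq_square nonzero_eq_divide_eq algebra_simps)
  moreover have "s n / (1 + s n) \<le> 1" using s1 by simp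
  ultimately show ?thesis by linarith
qed

text \<open>Once a regressor has entered the Gram matrix its leverage is s / (1 + s), whatever its
  size.\<close>

lemma updated_form: "dot d (\<phi> (Suc n)) (Qa (Suc n) (\<phi> (Suc n))) \<le> 1"
proof -
  have "dot d (\<phi> (Suc n)) (Qa (Suc n) (\<phi> (Suc n))) = s n - (s n)\<^sup>2 / (1 + s n)"
    unfolding Q_step by (simp add: s_def power2_eq_square z_def)
  also have "\<dots> = s n / (1 + s n)" using s1 by (simp add: field_simps power2_eq_square)
  also have "\<dots> \<le> 1" using s1 by simp
  finally show ?thesis .
qed

text \<open>Cauchy-Schwarz for \<open>Q\<close> in each coordinate bounds the length of
  \<open>Qa n x\<close> by the trace and the form; Cauchy-Schwarz in Euclidean space then bounds the
  form by itself times the claimed quantity.\<close>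

lemma Q_form_le: "dot d x (Qa n x) \<le> tr n * dot d x x"
proof -
  have "dot d x (Qa n x) = dot d (Qa n x) x" by (rule dot_commute)
  have ineq: "(Qa n x i)\<^sup>2 \<le> Q n i i * dot d x (Qa n x)" if "i < d" for i
    using Qa_Cauchy_Schwarz[OF reg, of "unitv i" x] that by (simp add: Q_diag[OF reg] dot_unitv_left)
  have "dot d (Qa n x) (Qa n x) \<le> (\<Sum>i<d. Q n i i * dot d x (Qa n x))"
    unfolding dot_def[of d "Qa n x" "Qa n x"] power2_eq_square[symmetric] using ineq by (intro sum_mono) auto
  then have "dot d (Qa n x) (Qa n x) \<le> tr n * dot d x (Qa n x)"
    by (simp add: tr_def sum_distrib_right)
  moreover have "(dot d x (Qa n x))\<^sup>2 \<le> dot d x x * dot d (Qa n x) (Qa n x)"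
    by (rule dot_Cauchy_Schwarz)
  ultimately have "(dot d x (Qa n x))\<^sup>2 \<le> dot d x x * (tr n * dot d x (Qa n x))"
    using dot_nonneg[of d x] by (meson mult_left_mono order_trans)
  then have "dot d x (Qa n x) * dot d x (Qa n x) \<le> (tr n * dot d x x) * dot d x (Qa n x)"
    by (simp add: power2_eq_square mult_ac)
  then show ?thesis
    using Qa_nonneg[OF reg, of x] tr_nonneg[OF reg] dot_nonneg[of d x]
    by (cases "dot d x (Qa n x) = 0") (auto simp: mult_le_cancel_right)
qed

end

lemma tr_mono: "det (Gm n) \<noteq> 0 \<Longrightarrow> n \<le> m \<Longrightarrow> tr m \<le> tr n"
  by (rotate_tac 1, induction rule: dec_induct)
     (auto intro: order_trans[OF tr_decreasing] simp: reg_mono)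

lemma Q_diag_mono: "det (Gm n) \<noteq> 0 \<Longrightarrow> i < d \<Longrightarrow> n \<le> m \<Longrightarrow> Q m i i \<le> Q n i i"
  by (rotate_tac 2, induction rule: dec_induct)
     (auto intro: order_trans[OF Q_diag_decreasing] simp: reg_mono)

lemma V_sum: "det (Gm n0) \<noteq> 0 \<Longrightarrow> n0 \<le> n \<Longrightarrow>
   V n + (\<Sum>m = n0..<n. (e m)\<^sup>2 / (1 + s m)) = V n0 + 2 * (\<Sum>m = n0..<n. e m / (1 + s m) * W (Suc m))
     + (\<Sum>m = n0..<n. s m / (1 + s m) * (W (Suc m))\<^sup>2)"
  by (rotate_tac 1, induction rule: dec_induct)
     (auto simp: V_step reg_mono algebra_simps)

text \<open>s / (1 + s) is at most ln (1 + s), and 1 + s is the growth factor of the determinant, so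
  the sum telescopes.\<close>

lemma gain_sum_le_ln_det:
  assumes "det (Gm n0) \<noteq> 0" "n0 \<le> n"
  shows "(\<Sum>m = n0..<n. s m / (1 + s m)) \<le> ln \<bar>det (Gm n)\<bar> - ln \<bar>det (Gm n0)\<bar>"
  using assms(2)
proof (induction n rule: nat_induct_at_least)
  case (Suc n)
  have r: "det (Gm n) \<noteq> 0" using reg_mono[OF assms(1)] Suc by simp
  have "s n / (1 + s n) \<le> ln (1 + s n)"
  proof -
    have "ln (1 / (1 + s n)) \<le> 1 / (1 + s n) - 1" using s1[OF r] by (intro ln_le_minus_one) auto
    then show ?thesis using s1[OF r] by (simp add: ln_div field_simps)
  qed
  moreover have "ln \<bar>det (Gm (Suc n))\<bar> = ln \<bar>det (Gm n)\<bar> + ln (1 + s n)"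
    using r s1[OF r] by (simp add: det_step[OF r] abs_mult ln_mult)
  ultimately show ?case using Suc by simp
qed simp

lemma abs_G_le: "\<bar>G n i j\<bar> \<le> (\<Sum>k = 1..n. dot d (\<phi> k) (\<phi> k))" if "i < d" "j < d"
proof -
  have "\<bar>G n i j\<bar> \<le> (\<Sum>k = 1..n. \<bar>\<phi> k i * \<phi> k j\<bar>)" unfolding G_def by (rule sum_abs)
  also have "\<dots> \<le> (\<Sum>k = 1..n. dot d (\<phi> k) (\<phi> k))"
  proof (rule sum_mono)
    fix k
    have "\<bar>\<phi> k i * \<phi> k j\<bar> \<le> ((\<phi> k i)\<^sup>2 + (\<phi> k j)\<^sup>2) / 2"
      using sum_squares_bound[of "\<bar>\<phi> k i\<bar>" "\<bar>\<phi> k j\<bar>"] by (simp add: abs_mult)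
    also have "\<dots> \<le> (dot d (\<phi> k) (\<phi> k) + dot d (\<phi> k) (\<phi> k)) / 2"
      by (intro divide_right_mono add_mono component_sq_le_dot that) simp
    finally show "\<bar>\<phi> k i * \<phi> k j\<bar> \<le> dot d (\<phi> k) (\<phi> k)" by simp
  qed
  finally show ?thesis .
qed

lemma ln_det_le:
  assumes "det (Gm n) \<noteq> 0"
  shows "ln \<bar>det (Gm n)\<bar> \<le> ln (fact d) + real d * ln (1 + (\<Sum>k = 1..n. dot d (\<phi> k) (\<phi> k)))"
proof -
  define r where "r = 1 + (\<Sum>k = 1..n. dot d (\<phi> k) (\<phi> k))"
  have r: "1 \<le> r" by (simp add: r_def sum_nonneg dot_nonneg)
  have "\<bar>det (Gm n)\<bar> \<le> fact d * r ^ d"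
  proof (rule abs_det_le[OF Gm_carrier])
    fix i j assume ij: "i < d" "j < d"
    then show "\<bar>Gm n $$ (i, j)\<bar> \<le> r" using abs_G_le[OF ij, of n] by (simp add: Gm_def r_def)
  qed
  then have "ln \<bar>det (Gm n)\<bar> \<le> ln (fact d * r ^ d)" using assms r by (intro ln_mono) auto
  also have "\<dots> = ln (fact d) + real d * ln r" using r by (simp add: ln_mult ln_realpow)
  finally show ?thesis by (simp add: r_def)
qed

end

section \<open>Inversion of minimum phase systems\<close>

text \<open>The constant is the value of the left side at the point \<open>X\<close> where
  \<open>C * x powr r\<close> and \<open>\<delta> * x\<close> cross. The lemma serves to absorb
  sublinear error terms.\<close>

lemma powr_sublinear:
  fixes C r \<delta> :: real
  assumes "0 < r" "r < 1" "0 < \<delta>" "0 \<le> C"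
  shows "\<exists>D\<ge>0. \<forall>x\<ge>0. C * x powr r \<le> \<delta> * x + D"
proof (intro exI[of _ "C * ((C / \<delta>) powr (1 / (1 - r))) powr r"] conjI allI impI)
  define X where "X = (C / \<delta>) powr (1 / (1 - r))"
  fix x :: real assume x: "0 \<le> x"
  show "C * x powr r \<le> \<delta> * x + C * X powr r"
  proof (cases "x \<le> X")
    case True
    then have "C * x powr r \<le> C * X powr r" using x assms by (intro mult_left_mono powr_mono2) auto
    then show ?thesis using x assms(3) by (smt (verit) mult_nonneg_nonneg)
  next
    case False
    moreover have "0 \<le> X" by (simp add: X_def)
    ultimately have x0: "0 < x" and Xx: "X \<le> x" by linarith+
    have "C / \<delta> \<le> x powr (1 - r)"
    proof (cases "C = 0")
      case False
      then have "C / \<delta> = X powr (1 - r)" using assms by (simp add: X_def powr_powr)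
      also have "\<dots> \<le> x powr (1 - r)" using Xx assms by (intro powr_mono2) (auto simp: X_def)
      finally show ?thesis .
    qed simp
    then have "C * x powr r \<le> (\<delta> * x powr (1 - r)) * x powr r"
      using assms by (intro mult_right_mono) (auto simp: field_simps)
    also have "\<dots> = \<delta> * x" using x0 by (simp add: powr_add[symmetric] mult.assoc)
    finally show ?thesis using assms by (smt (verit) mult_nonneg_nonneg powr_ge_zero)
  qed
qed (use assms in auto)

lemma ln_sublinear: "0 < r \<Longrightarrow> 0 < x \<Longrightarrow> ln x \<le> x powr r / (r::real)"
  using ln_le_minus_one[of "x powr r"] by (simp add: ln_powr field_simps)

text \<open>Inverting the polynomial \<open>B\<close> as a power series: its coefficients decay geometrically because
  \<open>B\<close> has no zeros in a disc of radius larger than one.\<close>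

lemma minimum_phase_inverse:
  fixes b :: "nat \<Rightarrow> real"
  assumes q: "q \<ge> 1"
    and B: "\<forall>z::complex. norm z \<le> 1 \<longrightarrow> (\<Sum>j = 1..q. of_real (b j) * z ^ (j - 1)) \<noteq> 0"
  obtains \<mu> C where "0 < \<mu>" "\<mu> < 1" "0 \<le> C"
    "\<And>u :: int \<Rightarrow> real. \<exists>D\<ge>0. \<forall>k::nat. \<bar>u (int k)\<bar> \<le>
        C * (\<Sum>i\<le>k. \<mu> ^ (k - i) * \<bar>\<Sum>j = 1..q. b j * u (int i + 1 - int j)\<bar>) + D"
proof -
  define P :: "complex poly" where "P = (\<Sum>j = 1..q. Polynomial.monom (of_real (b j)) (j - 1))"
  have polyP: "poly P z = (\<Sum>j = 1..q. of_real (b j) * z ^ (j - 1))" for z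
    by (simp add: P_def poly_sum poly_monom)
  have coeffP: "coeff P n = (if n < q then of_real (b (n + 1)) else 0)" for n
  proof -
    have "coeff P n = (\<Sum>j = 1..q. if j = n + 1 then of_real (b j) else 0)"
      unfolding P_def coeff_sum by (intro sum.cong) auto
    then show ?thesis by simp
  qed
  have nz: "poly P z \<noteq> 0" if "norm z \<le> 1" for z using B that polyP by auto
  have P0: "P \<noteq> 0" using nz[of 0] by auto
  define F where "F = fps_of_poly P"
  have F0: "fps_nth F 0 \<noteq> 0" using nz[of 0] by (simp add: F_def poly_0_coeff_0)
  \<comment> \<open>The smallest modulus of a root. Without roots any radius above 1 serves, here
    2.\<close>
  define r where "r = (if {z. poly P z = 0} = {} then 2 else Min (norm ` {z. poly P z = 0}))"
  have fin: "finite {z. poly P z = 0}" using P0 by (rule poly_roots_finite)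
  have r1: "1 < r"
    using nz fin by (auto simp: r_def not_le intro: ccontr)
  have nzr: "poly P z \<noteq> 0" if "norm z < r" for z
    using that fin by (auto simp: r_def split: if_splits)
  have "fps_conv_radius (inverse F) \<ge> min (ereal r) (fps_conv_radius F)"
    by (rule fps_conv_radius_inverse) (use F0 nzr r1 in \<open>auto simp: F_def zero_ereal_def\<close>)
  then have rad: "ereal r \<le> fps_conv_radius (inverse F)" by (simp add: F_def)
  define \<rho> where "\<rho> = (1 + r) / 2"
  have \<rho>: "1 < \<rho>" "\<rho> < r" using r1 by (auto simp: \<rho>_def)
  have "summable (\<lambda>n. norm (fps_nth (inverse F) n * of_real \<rho> ^ n))"
    by (rule norm_summable_fps) (use \<rho> rad in \<open>auto intro: less_le_trans[of _ "ereal r"]\<close>)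
  then have "Bseq (\<lambda>n. norm (fps_nth (inverse F) n * of_real \<rho> ^ n))"
    using summable_LIMSEQ_zero convergentI convergent_imp_Bseq by blast
  then obtain C where C: "0 < C" "\<And>n. norm (fps_nth (inverse F) n * of_real \<rho> ^ n) \<le> C"
    by (auto elim!: BseqE)
  define \<mu> where "\<mu> = 1 / \<rho>"
  have \<mu>: "0 < \<mu>" "\<mu> < 1" using \<rho> by (auto simp: \<mu>_def)
  have c: "norm (fps_nth (inverse F) n) \<le> C * \<mu> ^ n" for n
    using C(2)[of n] \<rho> by (simp add: \<mu>_def norm_mult norm_power power_one_over field_simps)
  show ?thesis
  proof (rule that[OF \<mu> less_imp_le[OF C(1)]])
    fix u :: "int \<Rightarrow> real"
    define \<zeta> where "\<zeta> i = (\<Sum>j = 1..q. b j * u (int i + 1 - int j))" for i :: nat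
    \<comment> \<open>The terms of the convolution that reach into negative times, which the power
      series does not see. They vanish for \<open>i \<ge> q\<close>, so they are bounded by some
      \<open>R\<close>; this depends on \<open>u\<close> and enters only the additive
      constant.\<close>
    define rest where "rest i = (\<Sum>j | j < q \<and> i < j. b (j + 1) * u (int i - int j))" for i :: nat
    define U where "U = Abs_fps (\<lambda>n. complex_of_real (u (int n)))"
    define Z where "Z = Abs_fps (\<lambda>n. complex_of_real (\<zeta> n - rest n))"
    have "F * U = Z"
    proof (rule fps_ext)
      fix k
      have "fps_nth (F * U) k = (\<Sum>j\<le>k. coeff P j * complex_of_real (u (int (k - j))))"
        by (simp add: fps_mult_nth F_def U_def atLeast0AtMost)
      also have "\<dots> = of_real (\<Sum>j\<le>k. (if j < q then b (j + 1) else 0) * u (int (k - j)))"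
        by (simp add: coeffP) (intro sum.cong refl, auto)
      also have "(\<Sum>j\<le>k. (if j < q then b (j + 1) else 0) * u (int (k - j)))
          = (\<Sum>j | j < q \<and> j \<le> k. b (j + 1) * u (int k - int j))"
        by (rule sum.mono_neutral_cong_right) (auto simp: of_nat_diff)
      also have "\<dots> = (\<Sum>j<q. b (j + 1) * u (int k - int j)) - rest k"
      proof -
        have "(\<Sum>j<q. b (j + 1) * u (int k - int j)) =
            (\<Sum>j | j < q \<and> j \<le> k. b (j + 1) * u (int k - int j)) + rest k"
          unfolding rest_def by (subst sum.union_disjoint[symmetric]) (auto intro!: sum.cong)
        then show ?thesis by simp
      qed
      also have "(\<Sum>j<q. b (j + 1) * u (int k - int j)) = \<zeta> k"
        unfolding \<zeta>_def by (rule sum.reindex_bij_witness[of _ "\<lambda>j. j - 1" "\<lambda>j. j + 1"])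
           (auto simp: of_nat_diff algebra_simps)
      finally show "fps_nth (F * U) k = fps_nth Z k" by (simp add: Z_def)
    qed
    then have "U = inverse F * Z" using F0 by (metis inverse_mult_eq_1 mult.assoc mult_1)
    then have uk: "complex_of_real (u (int k)) = (\<Sum>i\<le>k. fps_nth (inverse F) (k - i) * of_real (\<zeta> i - rest i))" for k
    proof -
      have "complex_of_real (u (int k)) = fps_nth (inverse F * Z) k"
        using \<open>U = inverse F * Z\<close> by (metis U_def fps_nth_Abs_fps)
      also have "\<dots> = (\<Sum>i\<le>k. fps_nth (inverse F) i * of_real (\<zeta> (k - i) - rest (k - i)))"
        by (simp add: fps_mult_nth Z_def atLeast0AtMost)
      also have "\<dots> = (\<Sum>i\<le>k. fps_nth (inverse F) (k - i) * of_real (\<zeta> i - rest i))"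
        by (rule sum.reindex_bij_witness[of _ "\<lambda>i. k - i" "\<lambda>i. k - i"]) auto
      finally show ?thesis .
    qed
    define R where "R = (\<Sum>i<q. \<bar>rest i\<bar>)"
    have R0: "0 \<le> R" by (simp add: R_def sum_nonneg)
    have restR: "\<bar>rest i\<bar> \<le> R" for i
    proof (cases "i < q")
      case True then show ?thesis unfolding R_def by (intro member_le_sum) auto
    next
      case False
      then have "rest i = 0" unfolding rest_def by (intro sum.neutral) auto
      then show ?thesis using R0 by simp
    qed
    have geo: "(\<Sum>i\<le>k. \<mu> ^ (k - i)) \<le> 1 / (1 - \<mu>)" for k
    proof -
      have "(\<Sum>i\<le>k. \<mu> ^ (k - i)) = (\<Sum>i\<le>k. \<mu> ^ i)"
        by (rule sum.reindex_bij_witness[of _ "\<lambda>i. k - i" "\<lambda>i. k - i"]) auto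
      also have "\<dots> = (1 - \<mu> ^ Suc k) / (1 - \<mu>)" using \<mu> by (simp only: lessThan_Suc_atMost[symmetric] geometric_sum) (simp add: field_simps)
      also have "\<dots> \<le> 1 / (1 - \<mu>)" using \<mu> by (intro divide_right_mono) auto
      finally show ?thesis .
    qed
    show "\<exists>D\<ge>0. \<forall>k::nat. \<bar>u (int k)\<bar> \<le> C * (\<Sum>i\<le>k. \<mu> ^ (k - i) * \<bar>\<Sum>j = 1..q. b j * u (int i + 1 - int j)\<bar>) + D"
    proof (intro exI[of _ "C * (R / (1 - \<mu>))"] conjI allI)
      show "0 \<le> C * (R / (1 - \<mu>))" using C R0 \<mu> by simp
      fix k :: nat
      have "\<bar>u (int k)\<bar> = norm (\<Sum>i\<le>k. fps_nth (inverse F) (k - i) * of_real (\<zeta> i - rest i))"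
        by (metis uk norm_of_real)
      also have "\<dots> \<le> (\<Sum>i\<le>k. norm (fps_nth (inverse F) (k - i)) * \<bar>\<zeta> i - rest i\<bar>)"
        by (rule order_trans[OF norm_sum]) (simp add: norm_mult flip: of_real_diff)
      also have "\<dots> \<le> (\<Sum>i\<le>k. C * \<mu> ^ (k - i) * (\<bar>\<zeta> i\<bar> + R))"
      proof (intro sum_mono mult_mono c)
        fix i show "\<bar>\<zeta> i - rest i\<bar> \<le> \<bar>\<zeta> i\<bar> + R" using restR[of i] by linarith
      qed (use C \<mu> in auto)
      also have "\<dots> = C * (\<Sum>i\<le>k. \<mu> ^ (k - i) * \<bar>\<zeta> i\<bar>) + C * (R * (\<Sum>i\<le>k. \<mu> ^ (k - i)))"
        by (simp add: algebra_simps sum.distrib sum_distrib_left)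
      also have "\<dots> \<le> C * (\<Sum>i\<le>k. \<mu> ^ (k - i) * \<bar>\<zeta> i\<bar>) + C * (R * (1 / (1 - \<mu>)))"
        using C R0 geo[of k] by (intro add_left_mono mult_left_mono) auto
      finally show "\<bar>u (int k)\<bar> \<le> C * (\<Sum>i\<le>k. \<mu> ^ (k - i) * \<bar>\<Sum>j = 1..q. b j * u (int i + 1 - int j)\<bar>) + C * (R / (1 - \<mu>))"
        by (simp add: \<zeta>_def)
    qed
  qed
qed

section \<open>The closed loop\<close>

text \<open>The loop along a single sample path. Its analysis is deterministic; what is random
  enters through assumptions that hold on almost every path. One of them is \<open>startup\<close>,
  which the excitation will guarantee.\<close>

locale closed_loop =
  fixes p q :: nat and a b :: "nat \<Rightarrow> real" and y u :: "int \<Rightarrow> real" and w w' :: "nat \<Rightarrow> real"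
    and \<theta>0 :: "nat \<Rightarrow> real Matrix.vec" and yref :: "nat \<Rightarrow> real" and \<epsilon> :: real
  assumes p1: "p \<ge> 1" and q1: "q \<ge> 1" and eps0: "0 < \<epsilon>"
    and arx: "\<And>k. arx_equation p q a b y u w k"
    and yref_bounded: "\<exists>C. \<forall>k. \<bar>yref k\<bar> \<le> C"
    and w'_bounded: "\<exists>C. \<forall>k. \<bar>w' k\<bar> \<le> C"
    and control: "\<And>k. k \<ge> 1 \<Longrightarrow> u (int k) = certainty_equivalence_control p q y u \<theta>0 yref k
          + w' k / regressor_energy p q y u (k - 1) powr (\<epsilon> / 2)"
    and b1_nz: "\<And>k. b1_estimate p q y u \<theta>0 k \<noteq> 0"
    and min_phase: "\<forall>z::complex. norm z \<le> 1 \<longrightarrow> (\<Sum>j = 1..q. of_real (b j) * z ^ (j - 1)) \<noteq> 0"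
    and w_average: "\<exists>R>0. (\<lambda>k. (1 / real k) * (\<Sum>i = 1..k. (w i)\<^sup>2)) \<longlonglongrightarrow> R"
    and w'_average: "\<exists>N0. \<forall>N\<ge>N0. real N / 2 \<le> (\<Sum>k = 1..N. (w' k)\<^sup>2)"
    and startup: "\<exists>n. det (gram p q y u n) \<noteq> 0"
begin

definition d :: nat where "d = p + q"
definition \<phi> :: "nat \<Rightarrow> nat \<Rightarrow> real" where "\<phi> k i = regressor p q y u k $ i"
definition \<theta> :: "nat \<Rightarrow> real" where "\<theta> i = parameter_vec p q a b $ i"
definition r :: "nat \<Rightarrow> real" where "r n = regressor_energy p q y u n"
definition f :: "nat \<Rightarrow> real" where "f k = w' k / r (k - 1) powr (\<epsilon> / 2)"
definition \<L> :: "nat \<Rightarrow> real" where "\<L> n = 1 + ln (r n)"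

sublocale lsq d \<phi> "\<lambda>k. w (Suc k)" .

lemma d0: "0 < d" "p < d" using p1 q1 by (auto simp: d_def)

lemma Gm_gram: "Gm n = gram p q y u n"
  by (simp add: Gm_def gram_def G_def \<phi>_def d_def[symmetric])

lemma dot_regressor: "v \<in> carrier_vec d \<Longrightarrow> v \<bullet> regressor p q y u k = dot d (\<lambda>i. v $ i) (\<phi> k)"
  by (simp add: scalar_prod_def dot_def \<phi>_def regressor_def d_def lessThan_atLeast0)

lemma \<phi>_y: "i < p \<Longrightarrow> \<phi> k i = y (int k - int i)"
  by (simp add: \<phi>_def regressor_def)

lemma \<phi>_u: "p \<le> i \<Longrightarrow> i < d \<Longrightarrow> \<phi> k i = u (int k - int (i - p))"
  by (simp add: \<phi>_def regressor_def d_def)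

lemma \<phi>_p: "\<phi> k p = u (int k)"
  using d0 by (simp add: \<phi>_u)

lemma r_eq: "r n = 1 + (\<Sum>k = 1..n. dot d (\<phi> k) (\<phi> k))"
proof -
  have "regressor p q y u i \<bullet> regressor p q y u i = dot d (\<phi> i) (\<phi> i)" for i
  proof -
    have "regressor p q y u i \<in> carrier_vec d" by (simp add: regressor_def d_def[symmetric])
    from dot_regressor[OF this] show ?thesis by (simp add: \<phi>_def[symmetric])
  qed
  then show ?thesis by (simp add: r_def regressor_energy_def)
qed

lemma r_ge_1: "1 \<le> r n"
  by (simp add: r_eq sum_nonneg dot_nonneg)

lemma r_mono: "m \<le> n \<Longrightarrow> r m \<le> r n"
  unfolding r_eq by (intro add_left_mono sum_mono2) (auto simp: dot_nonneg)

lemma \<L>_ge_1: "1 \<le> \<L> n"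
  using r_ge_1[of n] by (simp add: \<L>_def)

lemma \<L>_mono: "m \<le> n \<Longrightarrow> \<L> m \<le> \<L> n"
  using r_mono[of m n] r_ge_1[of m] by (simp add: \<L>_def)

lemma sum_split_d: "(\<Sum>i<d. g i) = (\<Sum>i<p. g i) + (\<Sum>j<q. g (p + j))" for g :: "nat \<Rightarrow> real"
proof -
  have "(\<Sum>i<p + n. g i) = (\<Sum>i<p. g i) + (\<Sum>j<n. g (p + j))" for n by (induction n) auto
  then show ?thesis by (simp add: d_def)
qed

lemma output_eq: "y (int k + 1) = dot d \<theta> (\<phi> k) + w (k + 1)"
proof -
  have "dot d \<theta> (\<phi> k) = (\<Sum>i<p. a (i + 1) * y (int k - int i)) + (\<Sum>j<q. b (j + 1) * u (int k - int j))"
    unfolding dot_def sum_split_d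
    by (intro arg_cong2[of _ _ _ _ "(+)"] sum.cong refl)
       (auto simp: \<theta>_def parameter_vec_def \<phi>_y \<phi>_u d_def)
  also have "(\<Sum>i<p. a (i + 1) * y (int k - int i)) = (\<Sum>i = 1..p. a i * y (int k + 1 - int i))"
    by (rule sum.reindex_bij_witness[of _ "\<lambda>j. j - 1" "\<lambda>j. j + 1"]) (auto simp: of_nat_diff algebra_simps)
  also have "(\<Sum>j<q. b (j + 1) * u (int k - int j)) = (\<Sum>j = 1..q. b j * u (int k + 1 - int j))"
    by (rule sum.reindex_bij_witness[of _ "\<lambda>j. j - 1" "\<lambda>j. j + 1"]) (auto simp: of_nat_diff algebra_simps)
  finally show ?thesis using arx[of k] by (simp add: arx_equation_def)
qed

lemma b1: "\<theta> p = b 1" "b 1 \<noteq> 0"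
proof -
  show "\<theta> p = b 1" using q1 by (simp add: \<theta>_def parameter_vec_def)
  have "(\<Sum>j = 1..q. of_real (b j) * (0::complex) ^ (j - 1)) = (\<Sum>j = 1..q. if j = 1 then of_real (b j) else 0)"
    by (intro sum.cong) auto
  then show "b 1 \<noteq> 0" using min_phase[rule_format, of 0] q1 by auto
qed

text \<open>Before \<open>n0\<close> the estimates are the start-up values, so all recursions begin
  here. It depends on the path.\<close>

definition n0 :: nat where "n0 = (LEAST n. det (Gm n) \<noteq> 0)"

lemma reg_n0: "det (Gm n0) \<noteq> 0"
  unfolding n0_def using startup unfolding Gm_gram[symmetric] by (rule LeastI_ex)

lemma singular_before_n0: "m < n0 \<Longrightarrow> det (Gm m) = 0"
  unfolding n0_def using not_less_Least by blast

lemma reg: "n0 \<le> n \<Longrightarrow> det (Gm n) \<noteq> 0"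
  using reg_mono[OF reg_n0] .

definition dev :: "nat \<Rightarrow> nat \<Rightarrow> real" where "dev n i = Qa n (S n) i"

text \<open>The normal equations: by the system equation the cross moment is the Gram matrix applied
  to \<open>\<theta>\<close> plus the noise sum \<open>S n\<close>, so the error is the inverse
  applied to \<open>S n\<close>.\<close>

lemma ls_estimate_eq:
  assumes n: "n0 \<le> n" and i: "i < d"
  shows "ls_estimate p q y u \<theta>0 (Suc n) $ i = \<theta> i + dev n i"
proof -
  have "det (gram p q y u n) \<noteq> 0" using reg[OF n] by (simp add: Gm_gram)
  moreover have gc: "gram p q y u n \<in> carrier_mat d d" by (simp add: gram_def d_def)
  ultimately have "gram p q y u n \<in> Units (ring_mat TYPE(real) d ())"
    by (intro det_non_zero_imp_unit)
  then obtain P where P: "mat_inverse (gram p q y u n) = Some P"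
    using mat_inverse(1)[OF gc, where b = "()"] by (cases "mat_inverse (gram p q y u n)") auto
  note PG = mat_inverse(2)[OF gc P]
  have est: "ls_estimate p q y u \<theta>0 (Suc n) = P *\<^sub>v cross_moment p q y u n"
    by (simp add: ls_estimate_def P)
  define x where "x = app d (\<lambda>i j. P $$ (i, j)) (\<lambda>i. cross_moment p q y u n $ i)"
  have Px: "ls_estimate p q y u \<theta>0 (Suc n) $ i = x i" if "i < d" for i
    unfolding est x_def app_def using PG that
    by (auto simp: scalar_prod_def lessThan_atLeast0 cross_moment_def d_def)
  have GP: "(\<Sum>j<d. G n i j * P $$ (j, k)) = (if i = k then 1 else 0)" if "i < d" "k < d" for i k
  proof -
    have "P \<in> carrier_mat d d" using PG by simp
    then have "(gram p q y u n * P) $$ (i, k) = (\<Sum>j<d. G n i j * P $$ (j, k))"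
      using that unfolding Gm_gram[symmetric] by (simp add: Gm_def scalar_prod_def lessThan_atLeast0)
    then show ?thesis using PG that by auto
  qed
  have Gx: "app d (G n) x i = cross_moment p q y u n $ i" if "i < d" for i
    unfolding x_def
    by (rule app_app_id[where A = "G n" and B = "\<lambda>i j. P $$ (i, j)"]) (use reg[OF n] that GP in auto)
  have cm: "cross_moment p q y u n $ i = app d (G n) \<theta> i + S n i" if "i < d" for i
  proof -
    have "cross_moment p q y u n $ i = (\<Sum>k = 1..n. \<phi> k i * y (int k + 1))"
      using that by (simp add: cross_moment_def d_def[symmetric] \<phi>_def)
    then have "cross_moment p q y u n $ i = (\<Sum>k = 1..n. \<phi> k i * (dot d \<theta> (\<phi> k) + w (k + 1)))"
      unfolding output_eq .
    then show ?thesis by (simp add: app_G S_def algebra_simps sum.distrib)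
  qed
  have "app d (G n) (\<lambda>i. x i - \<theta> i) j = S n j" if "j < d" for j
    using Gx[OF that] cm[OF that] by (simp add: app_def algebra_simps sum_subtractf)
  then have "Qa n (app d (G n) (\<lambda>i. x i - \<theta> i)) i = Qa n (S n) i"
    unfolding Qa_def app_def[of d "Q n"] by (intro sum.cong) auto
  then show ?thesis using Qa_G[OF reg[OF n] i] Px[OF i] by (simp add: dev_def)
qed

lemma ls_estimate_dim: assumes n: "n0 \<le> n" shows "ls_estimate p q y u \<theta>0 (Suc n) \<in> carrier_vec d"
proof -
  have "det (gram p q y u n) \<noteq> 0" using reg[OF n] by (simp add: Gm_gram)
  moreover have gc: "gram p q y u n \<in> carrier_mat d d" by (simp add: gram_def d_def)
  ultimately have "gram p q y u n \<in> Units (ring_mat TYPE(real) d ())"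
    by (intro det_non_zero_imp_unit)
  then obtain P where P: "mat_inverse (gram p q y u n) = Some P"
    using mat_inverse(1)[OF gc, where b = "()"] by (cases "mat_inverse (gram p q y u n)") auto
  then have "P \<in> carrier_mat d d" using mat_inverse(2)[OF gc P] by simp
  then show ?thesis by (simp add: ls_estimate_def P cross_moment_def d_def[symmetric] mult_mat_vec_carrier[of _ d d])
qed

lemma b1_estimate_eq: "n0 \<le> n \<Longrightarrow> b1_estimate p q y u \<theta>0 (Suc n) = b 1 + dev n p"
  using ls_estimate_eq[of n p] d0 by (simp add: b1_estimate_def b1)

text \<open>Multiplication by the estimate of \<open>b 1\<close>, which is nonzero, turns the
  control law back into the equation it was solved from, with the injected excitation as an
  additional term.\<close>

lemma certainty_equivalence:
  assumes n: "n0 \<le> n"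
  shows "dot d (\<lambda>i. \<theta> i + dev n i) (\<phi> (Suc n)) = yref (n + 2) + (b 1 + dev n p) * f (Suc n)"
proof -
  have "ls_estimate p q y u \<theta>0 (Suc n) \<bullet> regressor p q y u (Suc n) = dot d (\<lambda>i. \<theta> i + dev n i) (\<phi> (Suc n))"
    using dot_regressor[OF ls_estimate_dim[OF n]] ls_estimate_eq[OF n] by (auto intro: dot_cong)
  moreover have "b 1 + dev n p \<noteq> 0" using b1_nz[of "Suc n"] b1_estimate_eq[OF n] by simp
  ultimately show ?thesis
    using control[of "Suc n"] unfolding certainty_equivalence_control_def b1_estimate_eq[OF n]
    by (simp add: f_def r_def[symmetric] field_simps)
qed

text \<open>The estimated and the true prediction differ by \<open>e n\<close>, so the output misses
  the reference only by the amplified excitation, by this error and by the noise.\<close>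

lemma tracking_error:
  assumes n: "n0 \<le> n"
  shows "y (int n + 2) = yref (n + 2) + (b 1 + dev n p) * f (Suc n) - e n + w (n + 2)"
proof -
  have "dot d (\<lambda>i. \<theta> i + dev n i) (\<phi> (Suc n)) = dot d \<theta> (\<phi> (Suc n)) + e n"
    using e_eq[OF reg[OF n]] by (simp add: dot_add_left dev_def[abs_def] dot_commute[of d "\<phi> (Suc n)"])
  then show ?thesis using certainty_equivalence[OF n] output_eq[of "Suc n"] by (simp add: algebra_simps)
qed

end

lemma geometric_sum_rev_le:
  fixes x :: real
  assumes "0 < x" "x < 1"
  shows "(\<Sum>i\<le>k. x ^ (k - i)) \<le> 1 / (1 - x)"
proof -
  have "(\<Sum>i\<le>k. x ^ (k - i)) = (\<Sum>i\<le>k. x ^ i)"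
    by (rule sum.reindex_bij_witness[of _ "\<lambda>i. k - i" "\<lambda>i. k - i"]) auto
  also have "\<dots> = (1 - x ^ Suc k) / (1 - x)"
    using assms by (simp only: lessThan_Suc_atMost[symmetric] geometric_sum) (simp add: field_simps)
  also have "\<dots> \<le> 1 / (1 - x)" using assms by (intro divide_right_mono) auto
  finally show ?thesis .
qed

section \<open>A discounted energy that dominates the regressors\<close>

context closed_loop
begin

text \<open>\<open>H\<close> discounts past outputs and noises geometrically. The stable inverse of
  \<open>B\<close> recovers \<open>u k\<close> from outputs up to time \<open>k + 1\<close>, so the
  current input is bounded by \<open>H (Suc k)\<close> only, while the other components of the
  regressor are already bounded by \<open>H k\<close>. The constant \<open>K\<close> absorbs the
  initial values.\<close>

lemma energy_exists:
  obtains H :: "nat \<Rightarrow> real" and \<mu> K C where "0 < \<mu>" "\<mu> < 1" "1 \<le> K" "1 \<le> C" "\<And>k. 1 \<le> H k"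
    "\<And>k. H (Suc k) = \<mu> * H k + K + (y (int k + 1))\<^sup>2 + (w (k + 1))\<^sup>2"
    "\<And>k i. i < d \<Longrightarrow> i \<noteq> p \<Longrightarrow> (\<phi> k i)\<^sup>2 \<le> C * H k"
    "\<And>k. (u (int k))\<^sup>2 \<le> C * H (Suc k)"
proof -
  obtain \<mu> Cu where \<mu>: "0 < \<mu>" "\<mu> < 1" and Cu: "0 \<le> Cu" and
    mp: "\<And>u :: int \<Rightarrow> real. \<exists>D\<ge>0. \<forall>k::nat. \<bar>u (int k)\<bar> \<le>
        Cu * (\<Sum>i\<le>k. \<mu> ^ (k - i) * \<bar>\<Sum>j = 1..q. b j * u (int i + 1 - int j)\<bar>) + D"
    using minimum_phase_inverse[OF q1 min_phase] by blast
  obtain D where D: "0 \<le> D" "\<And>k. \<bar>u (int k)\<bar> \<le>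
        Cu * (\<Sum>i\<le>k. \<mu> ^ (k - i) * \<bar>\<Sum>j = 1..q. b j * u (int i + 1 - int j)\<bar>) + D"
    using mp[of u] by blast
  define K where "K = 1 + (\<Sum>i\<le>p + q. (y (- int i))\<^sup>2 + (u (- int i))\<^sup>2)"
  have K1: "1 \<le> K" by (simp add: K_def sum_nonneg)
  have init: "(y (- int i))\<^sup>2 \<le> K" "(u (- int i))\<^sup>2 \<le> K" if "i \<le> p + q" for i
  proof -
    have "(y (- int i))\<^sup>2 + (u (- int i))\<^sup>2 \<le> (\<Sum>i\<le>p + q. (y (- int i))\<^sup>2 + (u (- int i))\<^sup>2)"
      using that by (intro member_le_sum[of i "{..p+q}" "\<lambda>i. (y (- int i))\<^sup>2 + (u (- int i))\<^sup>2"]) auto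
    then show "(y (- int i))\<^sup>2 \<le> K" "(u (- int i))\<^sup>2 \<le> K"
      by (auto simp: K_def intro: order_trans[rotated]) (smt (verit) zero_le_power2)+
  qed
  define H where "H = rec_nat (K + (y 0)\<^sup>2 + (w 0)\<^sup>2) (\<lambda>k h. \<mu> * h + K + (y (int k + 1))\<^sup>2 + (w (k + 1))\<^sup>2)"
  have H0: "H 0 = K + (y 0)\<^sup>2 + (w 0)\<^sup>2" by (simp add: H_def)
  have HS: "H (Suc k) = \<mu> * H k + K + (y (int k + 1))\<^sup>2 + (w (k + 1))\<^sup>2" for k by (simp add: H_def)
  have HK: "K \<le> H k" for k
  proof (induction k)
    case (Suc k)
    then have "0 \<le> \<mu> * H k" using K1 \<mu> by simp
    then show ?case unfolding HS by (smt (verit) zero_le_power2)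
  qed (simp add: H0)
  have H1: "1 \<le> H k" for k using HK[of k] K1 by linarith
  have Hstep: "\<mu> * H k \<le> H (Suc k)" for k unfolding HS using K1 by (smt (verit) zero_le_power2)
  have Hpow: "\<mu> ^ j * H k \<le> H (k + j)" for j k
  proof (induction j)
    case (Suc j)
    have "\<mu> ^ Suc j * H k \<le> \<mu> * H (k + j)" using Suc \<mu> by simp
    then show ?case using Hstep[of "k + j"] by simp
  qed simp
  have Hdiv: "H i \<le> H k / \<mu> ^ n" if "i \<le> k" "k - i \<le> n" for i k n
  proof -
    have "\<mu> ^ n * H i \<le> \<mu> ^ (k - i) * H i"
      using that \<mu> H1[of i] by (intro mult_right_mono power_decreasing) auto
    then show ?thesis using Hpow[of "k - i" i] that \<mu> by (simp add: field_simps)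
  qed
  have HleD: "H k \<le> H k / \<mu> ^ n" for k n using Hdiv[of k k n] by simp
  have yH: "(y (int k))\<^sup>2 \<le> H k" "(w k)\<^sup>2 \<le> H k" for k
  proof -
    have "(y (int k))\<^sup>2 \<le> H k \<and> (w k)\<^sup>2 \<le> H k"
    proof (cases k)
      case 0 then show ?thesis using K1 by (simp add: H0)
    next
      case (Suc k')
      have "0 \<le> \<mu> * H k'" using H1[of k'] \<mu> by simp
      then show ?thesis using K1 zero_le_power2[of "y (int k' + 1)"] zero_le_power2[of "w (k' + 1)"]
        unfolding Suc HS by (simp add: add.commute)
    qed
    then show "(y (int k))\<^sup>2 \<le> H k" "(w k)\<^sup>2 \<le> H k" by auto
  qed
  have yl: "(y (int k - int l))\<^sup>2 \<le> H k / \<mu> ^ p" if "l \<le> p" for k l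
  proof (cases "l \<le> k")
    case True
    then have "(y (int k - int l))\<^sup>2 \<le> H (k - l)" using yH[of "k - l"] by (simp add: of_nat_diff)
    then show ?thesis using Hdiv[of "k - l" k p] that True by simp
  next
    case False
    then have eq: "int k - int l = - int (l - k)" by simp
    have "(y (int k - int l))\<^sup>2 \<le> K" unfolding eq by (rule init) (use that in simp)
    then show ?thesis by (rule order_trans[OF _ order_trans[OF HK HleD]])
  qed
  define A where "A = (\<Sum>i = 1..p. \<bar>a i\<bar>) + 2"
  have A0: "0 \<le> A" by (simp add: A_def sum_nonneg)
  have zeta: "\<bar>\<Sum>j = 1..q. b j * u (int i + 1 - int j)\<bar> \<le> A * sqrt (H (Suc i) / \<mu> ^ p)" for i
  proof -
    define X where "X = sqrt (H (Suc i) / \<mu> ^ p)"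
    have yX: "\<bar>y (int i + 1 - int l)\<bar> \<le> X" if "l \<le> p" for l
      using yl[OF that, of "Suc i"] unfolding X_def by (intro real_le_rsqrt) (simp add: add.commute)
    have wX: "\<bar>w (i + 1)\<bar> \<le> X"
      using yH(2)[of "Suc i"] HleD[of "Suc i" p] unfolding X_def by (intro real_le_rsqrt) simp
    have "(\<Sum>j = 1..q. b j * u (int i + 1 - int j)) = y (int i + 1) - (\<Sum>l = 1..p. a l * y (int i + 1 - int l)) - w (i + 1)"
      using arx[of i] by (simp add: arx_equation_def)
    also have "\<bar>\<dots>\<bar> \<le> X + (\<Sum>l = 1..p. \<bar>a l\<bar> * X) + X"
    proof -
      have "\<bar>\<Sum>l = 1..p. a l * y (int i + 1 - int l)\<bar> \<le> (\<Sum>l = 1..p. \<bar>a l\<bar> * X)"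
        by (rule order_trans[OF sum_abs sum_mono]) (auto simp: abs_mult intro!: mult_left_mono yX)
      then show ?thesis using wX yX[of 0] by simp
    qed
    also have "\<dots> = A * X" by (simp add: A_def algebra_simps sum_distrib_left)
    finally show ?thesis by (simp add: X_def)
  qed
  \<comment> \<open>Half of the decay pays for replacing \<open>H (Suc i)\<close> by
    \<open>H (Suc k)\<close> under the square root; the other half keeps the sum geometric.\<close>
  define \<nu> where "\<nu> = sqrt \<mu>"
  have \<nu>: "0 < \<nu>" "\<nu> < 1" "\<nu> * \<nu> = \<mu>" using \<mu> by (auto simp: \<nu>_def)
  define B where "B = Cu * (A * sqrt (1 / \<mu> ^ p) * (1 / (1 - \<nu>))) + D"
  have ub: "\<bar>u (int k)\<bar> \<le> B * sqrt (H (Suc k))" for k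
  proof -
    have tm: "\<mu> ^ (k - i) * \<bar>\<Sum>j = 1..q. b j * u (int i + 1 - int j)\<bar> \<le> \<nu> ^ (k - i) * (A * sqrt (1 / \<mu> ^ p) * sqrt (H (Suc k)))"
      if "i \<le> k" for i
    proof -
      have "sqrt (H (Suc i) / \<mu> ^ p) \<le> sqrt (H (Suc k) / \<mu> ^ (k - i) / \<mu> ^ p)"
        using Hdiv[of "Suc i" "Suc k" "k - i"] that \<mu> by (intro real_sqrt_le_mono divide_right_mono) auto
      also have "\<dots> = sqrt (1 / \<mu> ^ p) * sqrt (H (Suc k)) / \<nu> ^ (k - i)"
        by (simp add: real_sqrt_divide real_sqrt_mult \<nu>_def real_sqrt_power)
      finally have s: "sqrt (H (Suc i) / \<mu> ^ p) \<le> sqrt (1 / \<mu> ^ p) * sqrt (H (Suc k)) / \<nu> ^ (k - i)" .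
      have "\<mu> ^ (k - i) * \<bar>\<Sum>j = 1..q. b j * u (int i + 1 - int j)\<bar> \<le> \<mu> ^ (k - i) * (A * (sqrt (1 / \<mu> ^ p) * sqrt (H (Suc k)) / \<nu> ^ (k - i)))"
        using \<mu> A0 zeta[of i] mult_left_mono[OF s A0] by (intro mult_left_mono) auto
      also have "\<mu> ^ (k - i) * (A * (sqrt (1 / \<mu> ^ p) * sqrt (H (Suc k)) / \<nu> ^ (k - i)))
          = \<nu> ^ (k - i) * (A * sqrt (1 / \<mu> ^ p) * sqrt (H (Suc k)))"
      proof -
        have pow: "\<mu> ^ (k - i) = \<nu> ^ (k - i) * \<nu> ^ (k - i)" by (simp add: \<nu>(3)[symmetric] power_mult_distrib)
        show ?thesis unfolding pow using \<nu> by simp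
      qed
      finally show ?thesis .
    qed
    have "(\<Sum>i\<le>k. \<mu> ^ (k - i) * \<bar>\<Sum>j = 1..q. b j * u (int i + 1 - int j)\<bar>)
        \<le> (\<Sum>i\<le>k. \<nu> ^ (k - i)) * (A * sqrt (1 / \<mu> ^ p) * sqrt (H (Suc k)))"
      unfolding sum_distrib_right by (intro sum_mono tm) auto
    also have "\<dots> \<le> 1 / (1 - \<nu>) * (A * sqrt (1 / \<mu> ^ p) * sqrt (H (Suc k)))"
      using \<nu> \<mu> A0 H1[of "Suc k"] by (intro mult_right_mono geometric_sum_rev_le) auto
    finally have "\<bar>u (int k)\<bar> \<le> Cu * (1 / (1 - \<nu>) * (A * sqrt (1 / \<mu> ^ p) * sqrt (H (Suc k)))) + D"
      using D(2)[of k] Cu by (meson add_right_mono mult_left_mono order_trans)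
    also have "\<dots> \<le> Cu * (1 / (1 - \<nu>) * (A * sqrt (1 / \<mu> ^ p) * sqrt (H (Suc k)))) + D * sqrt (H (Suc k))"
      using mult_left_mono[OF real_sqrt_ge_one[OF H1[of "Suc k"]] D(1)] by simp
    also have "\<dots> = B * sqrt (H (Suc k))" by (simp add: B_def algebra_simps)
    finally show ?thesis .
  qed
  have B0: "0 \<le> B" using Cu A0 \<nu> \<mu> D by (simp add: B_def)
  have u2: "(u (int k))\<^sup>2 \<le> B\<^sup>2 * H (Suc k)" for k
  proof -
    have "\<bar>u (int k)\<bar>\<^sup>2 \<le> (B * sqrt (H (Suc k)))\<^sup>2" by (intro power_mono ub) auto
    then show ?thesis using H1[of "Suc k"] by (simp add: power_mult_distrib)
  qed
  define C where "C = (1 + B\<^sup>2) / \<mu> ^ (p + q)"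
  have mpq: "0 < \<mu> ^ (p + q)" "\<mu> ^ (p + q) \<le> 1" "\<mu> ^ (p + q) \<le> \<mu> ^ p" using \<mu> by (auto intro: power_le_one power_decreasing)
  have C1: "1 + B\<^sup>2 \<le> C" using mpq by (simp add: C_def pos_le_divide_eq mult_left_le del: power_add)
  have Cd: "X / \<mu> ^ (p + q) \<le> C * X" if "0 \<le> X" for X
    using that mpq by (simp add: C_def field_simps)
  show ?thesis
  proof (rule that[OF \<mu> K1 _ H1 HS])
    show "1 \<le> C" using C1 by (smt (verit) zero_le_power2)
    show "(u (int k))\<^sup>2 \<le> C * H (Suc k)" for k
    proof -
      have "B\<^sup>2 * H (Suc k) \<le> C * H (Suc k)" using C1 H1[of "Suc k"] by (intro mult_right_mono) auto
      then show ?thesis using u2[of k] by linarith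
    qed
    show "(\<phi> k i)\<^sup>2 \<le> C * H k" if i: "i < d" "i \<noteq> p" for k i
    proof (cases "i < p")
      case True
      then have "(\<phi> k i)\<^sup>2 \<le> H k / \<mu> ^ p" using yl[of i k] by (simp add: \<phi>_y)
      also have "\<dots> \<le> H k / \<mu> ^ (p + q)" using mpq H1[of k] by (intro divide_left_mono) auto
      also have "\<dots> \<le> C * H k" using Cd H1[of k] by simp
      finally show ?thesis .
    next
      case False
      define j where "j = i - p"
      have j: "1 \<le> j" "j < q" using False i by (auto simp: j_def d_def)
      have fu: "\<phi> k i = u (int k - int j)" using False i by (simp add: \<phi>_u j_def)
      show ?thesis
      proof (cases "j \<le> k")
        case True
        have "(\<phi> k i)\<^sup>2 \<le> B\<^sup>2 * H (Suc (k - j))" using u2[of "k - j"] True by (simp add: fu of_nat_diff)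
        also have "\<dots> \<le> B\<^sup>2 * (H k / \<mu> ^ (p + q))"
          using Hdiv[of "Suc (k - j)" k "p + q"] True j by (intro mult_left_mono) auto
        also have "\<dots> \<le> C * H k" using H1[of k] mpq by (simp add: C_def field_simps)
        finally show ?thesis .
      next
        case False
        then have eq: "int k - int j = - int (j - k)" by simp
        have "(\<phi> k i)\<^sup>2 \<le> K" unfolding fu eq by (rule init) (use j in simp)
        also have "\<dots> \<le> H k" by (rule HK)
        also have "\<dots> \<le> C * H k" using C1 H1[of k] by (smt (verit) mult_le_cancel_right1 zero_le_power2)
        finally show ?thesis .
      qed
    qed
  qed
qed

definition \<alpha> :: "nat \<Rightarrow> real" where "\<alpha> m = (e m)\<^sup>2 / (1 + s m)"
text \<open>\<open>lsg\<close> and \<open>lsa\<close> are the integrands of the martingale and noise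
  terms in \<open>V_sum\<close>, set to zero while the Gram matrix is singular. They are then
  defined from time 0 on, and the random time \<open>n0\<close> does not interfere with their being
  known before the noise.\<close>

definition lsg :: "nat \<Rightarrow> real" where "lsg m = (if det (Gm m) = 0 then 0 else e m / (1 + s m))"
definition lsa :: "nat \<Rightarrow> real" where "lsa m = (if det (Gm m) = 0 then 0 else s m / (1 + s m))"

lemma \<alpha>_nonneg: "n0 \<le> m \<Longrightarrow> 0 \<le> \<alpha> m"
  using s_nonneg[OF reg] by (simp add: \<alpha>_def)

lemma w_sum_bound: "\<exists>C\<ge>1. \<forall>n. (\<Sum>i\<le>n. (w i)\<^sup>2) \<le> C * (real n + 1)"
proof -
  obtain R where "(\<lambda>k. (1 / real k) * (\<Sum>i = 1..k. (w i)\<^sup>2)) \<longlonglongrightarrow> R" using w_average by blast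
  then have "Bseq (\<lambda>k. (1 / real k) * (\<Sum>i = 1..k. (w i)\<^sup>2))" by (intro convergent_imp_Bseq convergentI)
  then obtain B where B: "0 < B" "\<And>k. norm ((1 / real k) * (\<Sum>i = 1..k. (w i)\<^sup>2)) \<le> B" by (auto elim!: BseqE)
  show ?thesis
  proof (intro exI[of _ "1 + B + (w 0)\<^sup>2"] conjI allI)
    fix n
    have "(\<Sum>i = 1..n. (w i)\<^sup>2) \<le> B * real n"
    proof (cases "n = 0")
      case False
      have "(1 / real n) * (\<Sum>i = 1..n. (w i)\<^sup>2) \<le> B" using B(2)[of n] by (simp only: real_norm_def)
      then show ?thesis using False by (simp add: field_simps)
    qed simp
    moreover have "(\<Sum>i\<le>n. (w i)\<^sup>2) = (w 0)\<^sup>2 + (\<Sum>i = 1..n. (w i)\<^sup>2)"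
      by (simp add: atMost_atLeast0 sum.atLeast_Suc_atMost)
    moreover have "(w 0)\<^sup>2 \<le> (w 0)\<^sup>2 * (real n + 1)" by (simp add: algebra_simps)
    moreover have "0 \<le> real n * (w 0)\<^sup>2" by simp
    moreover have "(1 + B + (w 0)\<^sup>2) * (real n + 1) = B * real n + (w 0)\<^sup>2 + (real n * (w 0)\<^sup>2 + real n + 1 + B)"
      by (simp add: algebra_simps)
    ultimately show "(\<Sum>i\<le>n. (w i)\<^sup>2) \<le> (1 + B + (w 0)\<^sup>2) * (real n + 1)"
      using B(1) by linarith
  qed (use B in auto)
qed

lemma f_bounded: "\<exists>C\<ge>1. \<forall>k. \<bar>f k\<bar> * r (k - 1) powr (\<epsilon> / 2) \<le> C \<and> \<bar>f k\<bar> \<le> C"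
proof -
  obtain C where C: "\<And>k. \<bar>w' k\<bar> \<le> C" using w'_bounded by blast
  show ?thesis
  proof (intro exI[of _ "max 1 C"] conjI allI)
    fix k
    have p: "1 \<le> r (k - 1) powr (\<epsilon> / 2)" using r_ge_1[of "k - 1"] eps0 by (intro ge_one_powr_ge_zero) auto
    then show "\<bar>f k\<bar> * r (k - 1) powr (\<epsilon> / 2) \<le> max 1 C" using r_ge_1[of "k - 1"] C[of k] by (auto simp: f_def)
    have "\<bar>w' k\<bar> / r (k - 1) powr (\<epsilon> / 2) \<le> \<bar>w' k\<bar> / 1" using p by (intro divide_left_mono) auto
    then have "\<bar>f k\<bar> \<le> \<bar>w' k\<bar>" by (simp add: f_def)
    then show "\<bar>f k\<bar> \<le> max 1 C" using C[of k] by simp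
  qed simp
qed

end

text \<open>The martingale bounds along the path. \<open>w (k + 2)\<close> is fresh relative to the
  regressor of time \<open>Suc k\<close>. The excitation is fresh relative to outputs up to its own
  time and to strictly earlier inputs; of the current input only the part without the excitation may
  be tested against it, hence \<open>excitation_u0\<close>.\<close>

locale noisy_loop = closed_loop +
  assumes ls_cross: "\<exists>C\<ge>0. \<forall>n. \<bar>\<Sum>m<n. lsg m * w (m + 2)\<bar> \<le> C * (1 + (\<Sum>m<n. (lsg m)\<^sup>2)) powr (3/4)"
    and ls_square: "\<exists>C\<ge>0. \<forall>n. (\<Sum>m<n. lsa m * (w (m + 2))\<^sup>2) \<le> C * (1 + (\<Sum>m<n. lsa m)) powr (3/2)"
    and noise_y: "\<And>j. \<exists>C\<ge>0. \<forall>n. \<bar>\<Sum>k<n. y (int (Suc k) - int j) * w (k + 2)\<bar> \<le> C * (1 + (\<Sum>k<n. (y (int (Suc k) - int j))\<^sup>2)) powr (3/4)"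
    and noise_u: "\<And>j. \<exists>C\<ge>0. \<forall>n. \<bar>\<Sum>k<n. u (int (Suc k) - int j) * w (k + 2)\<bar> \<le> C * (1 + (\<Sum>k<n. (u (int (Suc k) - int j))\<^sup>2)) powr (3/4)"
    and excitation_y: "\<And>j. \<exists>C\<ge>0. \<forall>n. \<bar>\<Sum>k<n. y (int (Suc k) - int j) * f (Suc k)\<bar> \<le> C * (1 + (\<Sum>k<n. (y (int (Suc k) - int j))\<^sup>2)) powr (3/4)"
    and excitation_u: "\<And>j. j \<ge> 1 \<Longrightarrow> \<exists>C\<ge>0. \<forall>n. \<bar>\<Sum>k<n. u (int (Suc k) - int j) * f (Suc k)\<bar> \<le> C * (1 + (\<Sum>k<n. (u (int (Suc k) - int j))\<^sup>2)) powr (3/4)"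
    and excitation_u0: "\<exists>C\<ge>0. \<forall>n. \<bar>\<Sum>k<n. (u (int (Suc k)) - f (Suc k)) * f (Suc k)\<bar> \<le> C * (1 + (\<Sum>k<n. (u (int (Suc k)) - f (Suc k))\<^sup>2)) powr (3/4)"
begin

lemma gain_bound: "\<exists>C\<ge>0. \<forall>n. (\<Sum>m<n. lsa m) \<le> C * \<L> n"
proof (intro exI[of _ "ln (fact d) + real d + \<bar>ln \<bar>det (Gm n0)\<bar>\<bar>"] conjI allI)
  have lf: "0 \<le> ln (fact d :: real)" by simp
  then show "0 \<le> ln (fact d) + real d + \<bar>ln \<bar>det (Gm n0)\<bar>\<bar>" by simp
  fix n
  show "(\<Sum>m<n. lsa m) \<le> (ln (fact d) + real d + \<bar>ln \<bar>det (Gm n0)\<bar>\<bar>) * \<L> n"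
  proof (cases "n0 \<le> n")
    case True
    have "(\<Sum>m<n. lsa m) = (\<Sum>m = n0..<n. s m / (1 + s m))"
      by (rule sum.mono_neutral_cong_right) (auto simp: lsa_def reg not_le singular_before_n0)
    also have "\<dots> \<le> ln (fact d) + real d * ln (r n) + \<bar>ln \<bar>det (Gm n0)\<bar>\<bar>"
      using gain_sum_le_ln_det[OF reg_n0 True] ln_det_le[OF reg[OF True]] by (simp add: r_eq)
    also have "\<dots> \<le> ln (fact d) * \<L> n + real d * \<L> n + \<bar>ln \<bar>det (Gm n0)\<bar>\<bar> * \<L> n"
    proof (intro add_mono)
      show "ln (fact d) \<le> ln (fact d) * \<L> n" using lf \<L>_ge_1[of n] by (metis mult.right_neutral mult_left_mono)
      show "real d * ln (r n) \<le> real d * \<L> n" by (simp add: \<L>_def mult_left_mono)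
      show "\<bar>ln \<bar>det (Gm n0)\<bar>\<bar> \<le> \<bar>ln \<bar>det (Gm n0)\<bar>\<bar> * \<L> n" using \<L>_ge_1[of n] by (metis abs_ge_zero mult.right_neutral mult_left_mono)
    qed
    finally show ?thesis by (simp add: algebra_simps)
  next
    case False
    then have "(\<Sum>m<n. lsa m) = 0" by (intro sum.neutral) (auto simp: lsa_def singular_before_n0)
    then show ?thesis using lf \<L>_ge_1[of n] by simp
  qed
qed

text \<open>The martingale term has the order of the sum of \<open>\<alpha>\<close> to the power 3/4
  and is absorbed by half of that sum. The noise term has the order of the gain sum to the power
  3/2, and the gain sum is at most a multiple of \<open>\<L>\<close>; hence the exponent
  3/2.\<close>

lemma lyapunov_bound: "\<exists>C\<ge>1. \<forall>n\<ge>n0. V n + (\<Sum>m = n0..<n. \<alpha> m) \<le> C * \<L> n powr (3/2)"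
proof -
  obtain C1 where C1: "0 \<le> C1" "\<And>n. \<bar>\<Sum>m<n. lsg m * w (m + 2)\<bar> \<le> C1 * (1 + (\<Sum>m<n. (lsg m)\<^sup>2)) powr (3/4)"
    using ls_cross by blast
  obtain C2 where C2: "0 \<le> C2" "\<And>n. (\<Sum>m<n. lsa m * (w (m + 2))\<^sup>2) \<le> C2 * (1 + (\<Sum>m<n. lsa m)) powr (3/2)"
    using ls_square by blast
  obtain C3 where C3: "0 \<le> C3" "\<And>n. (\<Sum>m<n. lsa m) \<le> C3 * \<L> n" using gain_bound by blast
  obtain D where D: "0 \<le> D" "\<And>x. 0 \<le> x \<Longrightarrow> 2 * C1 * x powr (3/4) \<le> (1/2) * x + D"
    using powr_sublinear[of "3/4" "1/2" "2 * C1"] C1(1) by auto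
  define C where "C = 2 * (V n0 + 1/2 + D + C2 * (1 + C3) powr (3/2)) + 1"
  have V0: "0 \<le> V n0" using V_nonneg[OF reg_n0] .
  show ?thesis
  proof (intro exI[of _ C] conjI allI impI)
    show "1 \<le> C" using V0 D C2 by (simp add: C_def)
    fix n assume n: "n0 \<le> n"
    define T where "T = (\<Sum>m = n0..<n. \<alpha> m)"
    have T0: "0 \<le> T" unfolding T_def by (intro sum_nonneg) (simp add: \<alpha>_nonneg)
    have L: "1 \<le> \<L> n powr (3/2)" using \<L>_ge_1[of n] by (intro ge_one_powr_ge_zero) auto
    have e1: "(\<Sum>m = n0..<n. e m / (1 + s m) * w (Suc (Suc m))) = (\<Sum>m<n. lsg m * w (m + 2))"
      by (rule sum.mono_neutral_cong_left) (auto simp: lsg_def reg not_le singular_before_n0)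
    have e2: "(\<Sum>m = n0..<n. s m / (1 + s m) * (w (Suc (Suc m)))\<^sup>2) = (\<Sum>m<n. lsa m * (w (m + 2))\<^sup>2)"
      by (rule sum.mono_neutral_cong_left) (auto simp: lsa_def reg not_le singular_before_n0)
    \<comment> \<open>The energy of the integrand is below the dissipation, because (1 + s)^2 is at
      least 1 + s. This is what makes the absorption possible.\<close>
    have "(\<Sum>m<n. (lsg m)\<^sup>2) = (\<Sum>m = n0..<n. (lsg m)\<^sup>2)"
      by (rule sum.mono_neutral_right) (auto simp: lsg_def not_le singular_before_n0)
    also have "\<dots> \<le> T" unfolding T_def
    proof (rule sum_mono)
      fix m assume "m \<in> {n0..<n}"
      then have m: "det (Gm m) \<noteq> 0" "0 \<le> s m" using reg s_nonneg[OF reg] by auto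
      have "(e m)\<^sup>2 / (1 + s m)\<^sup>2 \<le> (e m)\<^sup>2 / (1 + s m)"
        using m by (intro divide_left_mono) (auto simp: power2_eq_square mult_le_cancel_left1 intro!: mult_pos_pos add_pos_nonneg)
      then show "(lsg m)\<^sup>2 \<le> \<alpha> m" using m by (simp add: lsg_def \<alpha>_def power_divide)
    qed
    finally have "C1 * (1 + (\<Sum>m<n. (lsg m)\<^sup>2)) powr (3/4) \<le> C1 * (1 + T) powr (3/4)"
      using C1(1) by (intro mult_left_mono powr_mono2) (auto simp: sum_nonneg add_nonneg_nonneg)
    then have b1: "2 * (\<Sum>m<n. lsg m * w (m + 2)) \<le> (1/2) * (1 + T) + D"
      using C1(2)[of n] D(2)[of "1 + T"] T0 by (simp add: abs_le_iff)
    have lsa0: "0 \<le> lsa m" for m using s_nonneg[of m] by (auto simp: lsa_def)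
    have "(1 + (\<Sum>m<n. lsa m)) powr (3/2) \<le> ((1 + C3) * \<L> n) powr (3/2)"
      using C3(2)[of n] \<L>_ge_1[of n] C3(1) by (intro powr_mono2) (auto simp: algebra_simps sum_nonneg lsa0 add_nonneg_nonneg)
    also have "\<dots> = (1 + C3) powr (3/2) * \<L> n powr (3/2)" using C3(1) \<L>_ge_1[of n] by (simp add: powr_mult)
    finally have "C2 * (1 + (\<Sum>m<n. lsa m)) powr (3/2) \<le> C2 * ((1 + C3) powr (3/2) * \<L> n powr (3/2))"
      using C2(1) by (rule mult_left_mono)
    then have b2: "(\<Sum>m<n. lsa m * (w (m + 2))\<^sup>2) \<le> C2 * (1 + C3) powr (3/2) * \<L> n powr (3/2)"
      using C2(2)[of n] by (simp add: mult.assoc)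
    have "V n + T = V n0 + 2 * (\<Sum>m<n. lsg m * w (m + 2)) + (\<Sum>m<n. lsa m * (w (m + 2))\<^sup>2)"
      using V_sum[OF reg_n0 n] unfolding T_def \<alpha>_def e1 e2 .
    then have "V n + T / 2 \<le> (V n0 + 1/2 + D) + C2 * (1 + C3) powr (3/2) * \<L> n powr (3/2)"
    proof -
      have lin: "v + t / 2 \<le> v0 + 1/2 + D + Y"
        if "v + t = v0 + 2 * x + z" "2 * x \<le> 1/2 * (1 + t) + D" "z \<le> Y" for v t v0 x z D Y :: real
        using that by (simp add: field_simps)
      show ?thesis by (rule lin[OF _ b1 b2]) fact
    qed
    also have "\<dots> \<le> (V n0 + 1/2 + D) * \<L> n powr (3/2) + C2 * (1 + C3) powr (3/2) * \<L> n powr (3/2)"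
      using L V0 D(1) by (intro add_right_mono) (simp add: mult_le_cancel_left1)
    finally have "V n + T / 2 \<le> (V n0 + 1/2 + D + C2 * (1 + C3) powr (3/2)) * \<L> n powr (3/2)" by (simp add: algebra_simps)
    moreover have "V n \<ge> 0" using V_nonneg[OF reg[OF n]] .
    ultimately have "V n + T \<le> 2 * ((V n0 + 1/2 + D + C2 * (1 + C3) powr (3/2)) * \<L> n powr (3/2))" by linarith
    then show "V n + (\<Sum>m = n0..<n. \<alpha> m) \<le> C * \<L> n powr (3/2)"
      using L by (simp add: C_def T_def algebra_simps)
  qed
qed

end

section \<open>Growth of the regressors\<close>

text \<open>With x = 1 + ln r the right side is a multiple of r to the power
  \<open>\<delta>\<close>: powers of the logarithm cost an arbitrarily small power of the
  energy.\<close>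

lemma powr_three_halves_le_exp:
  fixes \<delta> :: real assumes "0 < \<delta>"
  shows "\<exists>D\<ge>0. \<forall>x\<ge>1. x powr (3/2) \<le> exp (\<delta> * x + D)"
proof -
  obtain D where D: "0 \<le> D" "\<And>x. 0 \<le> x \<Longrightarrow> 3 * x powr (1/2) \<le> \<delta> * x + D"
    using powr_sublinear[of "1/2" \<delta> 3] assms by auto
  have "x powr (3/2) \<le> exp (\<delta> * x + D)" if "1 \<le> x" for x :: real
  proof -
    have "x powr (3/2) = exp (3/2 * ln x)" using that by (simp add: powr_def)
    also have "\<dots> \<le> exp (3 * x powr (1/2))" using ln_sublinear[of "1/2" x] that by simp
    also have "\<dots> \<le> exp (\<delta> * x + D)" using D(2)[of x] that by simp
    finally show ?thesis .
  qed
  then show ?thesis using D(1) by blast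
qed

text \<open>This will bound the total growth over the bad times: a factor polynomial in
  \<open>x\<close> for each of at most \<open>B * x powr (3/4)\<close> times. The logarithm of the
  product has order at most x^(7/8), since \<open>ln x \<le> 8 * x powr (1/8)\<close>, and is
  therefore sublinear.\<close>

lemma polylog_power_le_exp:
  fixes \<delta> A B :: real assumes "0 < \<delta>" "1 \<le> A" "0 \<le> B"
  shows "\<exists>D\<ge>0. \<forall>x\<ge>1. (A * x powr (3/2)) powr (B * x powr (3/4)) \<le> exp (\<delta> * x + D)"
proof -
  have lA: "0 \<le> ln A" using assms by simp
  obtain D where D: "0 \<le> D" "\<And>x. 0 \<le> x \<Longrightarrow> (B * (ln A + 12)) * x powr (7/8) \<le> \<delta> * x + D"
    using powr_sublinear[of "7/8" \<delta> "B * (ln A + 12)"] assms lA by auto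
  have "(A * x powr (3/2)) powr (B * x powr (3/4)) \<le> exp (\<delta> * x + D)" if x: "1 \<le> x" for x :: real
  proof -
    have x8: "1 \<le> x powr (1/8)" using x by (intro ge_one_powr_ge_zero) auto
    have "ln (A * x powr (3/2)) = ln A + 3/2 * ln x" using assms x by (simp add: ln_mult ln_powr)
    also have "\<dots> \<le> ln A * x powr (1/8) + 3/2 * (8 * x powr (1/8))"
      using ln_sublinear[of "1/8" x] x x8 lA by (intro add_mono) (auto simp: mult_le_cancel_left1)
    also have "\<dots> = (ln A + 12) * x powr (1/8)" by (simp add: algebra_simps)
    finally have "B * x powr (3/4) * ln (A * x powr (3/2)) \<le> B * x powr (3/4) * ((ln A + 12) * x powr (1/8))"
      using assms by (intro mult_left_mono) auto
    also have "\<dots> = (B * (ln A + 12)) * (x powr (3/4) * x powr (1/8))" by (simp add: algebra_simps)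
    also have "x powr (3/4) * x powr (1/8) = x powr (7/8)" by (simp add: powr_add[symmetric])
    also have "B * (ln A + 12) * x powr (7/8) \<le> \<delta> * x + D" using D(2)[of x] x by simp
    finally show ?thesis using assms x by (simp add: powr_def)
  qed
  then show ?thesis using D(1) by blast
qed

lemma log_le_powr:
  fixes \<epsilon> :: real assumes "0 < \<epsilon>"
  shows "\<exists>C\<ge>1. \<forall>r\<ge>1. (1 + ln r) powr (3/2) \<le> C * r powr \<epsilon>"
proof (intro exI[of _ "(1 + 3 / (2 * \<epsilon>)) powr (3/2)"] conjI allI impI)
  show "1 \<le> (1 + 3 / (2 * \<epsilon>)) powr (3/2)" using assms by (intro ge_one_powr_ge_zero) auto
  fix r :: real assume r: "1 \<le> r"
  define x where "x = 2 * \<epsilon> / 3"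
  have x0: "0 < x" using assms by (simp add: x_def)
  have "1 \<le> r powr x" using r x0 by (intro ge_one_powr_ge_zero) auto
  then have "1 + ln r \<le> (1 + 1 / x) * r powr x" using ln_sublinear[OF x0, of r] r by (simp add: algebra_simps)
  then have "(1 + ln r) powr (3/2) \<le> ((1 + 1 / x) * r powr x) powr (3/2)" using r by (intro powr_mono2) auto
  also have "\<dots> = (1 + 1 / x) powr (3/2) * r powr \<epsilon>" using x0 r by (simp add: powr_mult powr_powr) (simp add: x_def)
  finally show "(1 + ln r) powr (3/2) \<le> (1 + 3 / (2 * \<epsilon>)) powr (3/2) * r powr \<epsilon>" by (simp add: x_def)
qed

lemma add3_square_le: "(x + y + z)\<^sup>2 \<le> 3 * (x\<^sup>2 + y\<^sup>2 + (z::real)\<^sup>2)"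
proof -
  have "0 \<le> (x - y)\<^sup>2 + (y - z)\<^sup>2 + (x - z)\<^sup>2" by simp
  then show ?thesis by (simp add: power2_eq_square algebra_simps)
qed

lemma add2_square_le: "(x + y)\<^sup>2 \<le> 2 * (x\<^sup>2 + (y::real)\<^sup>2)"
  using add3_square_le[of x y 0] sum_squares_bound[of x y] by (simp add: power2_sum)

locale energy_loop = noisy_loop +
  fixes H :: "nat \<Rightarrow> real" and \<mu> K C0 :: real
  assumes \<mu>: "0 < \<mu>" "\<mu> < 1" and K1: "1 \<le> K" and C01: "1 \<le> C0" and H1: "\<And>k. 1 \<le> H k"
    and H_Suc: "\<And>k. H (Suc k) = \<mu> * H k + K + (y (int k + 1))\<^sup>2 + (w (k + 1))\<^sup>2"
    and \<phi>_le: "\<And>k i. i < d \<Longrightarrow> i \<noteq> p \<Longrightarrow> (\<phi> k i)\<^sup>2 \<le> C0 * H k"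
    and u_le: "\<And>k. (u (int k))\<^sup>2 \<le> C0 * H (Suc k)"
begin

lemma H_Suc_ge: "\<mu> * H k \<le> H (Suc k)"
  unfolding H_Suc using K1 zero_le_power2[of "y (int k + 1)"] zero_le_power2[of "w (k + 1)"] by linarith

lemma rest_norm_le: "(\<Sum>i\<in>{..<d} - {p}. (\<phi> k i)\<^sup>2) \<le> real d * C0 * H k"
proof -
  have "(\<Sum>i\<in>{..<d} - {p}. (\<phi> k i)\<^sup>2) \<le> (\<Sum>i\<in>{..<d} - {p}. C0 * H k)"
    by (intro sum_mono) (auto simp: \<phi>_le)
  also have "\<dots> \<le> real d * (C0 * H k)"
  proof -
    have "card ({..<d} - {p}) \<le> d" using card_mono[of "{..<d}" "{..<d} - {p}"] by simp
    then show ?thesis using H1[of k] C01 by (auto intro!: mult_right_mono)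
  qed
  finally show ?thesis by (simp add: mult.assoc)
qed

lemma dot_\<phi>_eq: "dot d (\<phi> k) (\<phi> k) = (u (int k))\<^sup>2 + (\<Sum>i\<in>{..<d} - {p}. (\<phi> k i)\<^sup>2)"
  unfolding dot_def using d0 by (subst sum.remove[of _ p]) (auto simp: \<phi>_p power2_eq_square)

definition C1 :: real where "C1 = C0 + real d * C0 / \<mu>"

lemma C1_ge_1: "1 \<le> C1"
  using C01 \<mu> by (simp add: C1_def add_increasing2)

lemma dot_\<phi>_le: "dot d (\<phi> k) (\<phi> k) \<le> C1 * H (Suc k)"
proof -
  have "real d * C0 * H k \<le> real d * C0 * (H (Suc k) / \<mu>)"
    using H_Suc_ge[of k] \<mu> C01 by (intro mult_left_mono) (auto simp: field_simps)
  then show ?thesis unfolding dot_\<phi>_eq using u_le[of k] rest_norm_le[of k] by (simp add: C1_def algebra_simps)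
qed

lemma sum_H_le: "(\<Sum>k\<le>n. H k) \<le> (H 0 + (\<Sum>k<n. K + (y (int k + 1))\<^sup>2 + (w (k + 1))\<^sup>2)) / (1 - \<mu>)"
proof -
  have "(\<Sum>k\<le>n. H k) = H 0 + (\<Sum>k<n. H (Suc k))" by (rule sum.atMost_shift)
  also have "(\<Sum>k<n. H (Suc k)) = \<mu> * (\<Sum>k<n. H k) + (\<Sum>k<n. K + (y (int k + 1))\<^sup>2 + (w (k + 1))\<^sup>2)"
    unfolding H_Suc by (simp add: sum.distrib sum_distrib_left)
  also have "\<mu> * (\<Sum>k<n. H k) \<le> \<mu> * (\<Sum>k\<le>n. H k)"
    using \<mu> H1 by (intro mult_left_mono sum_mono2) (auto intro: order_trans[of 0 1])
  finally show ?thesis using \<mu> by (simp add: field_simps)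
qed

text \<open>Summing the recursion of \<open>H\<close>, the contraction leaves outputs and noises
  only, and the noise energy is linear in time.\<close>

lemma r_le_sums: "\<exists>C\<ge>1. \<forall>N. r N \<le> C * (real N + 1 + (\<Sum>k<N. (y (int k + 2))\<^sup>2))"
proof -
  obtain Cw where Cw: "1 \<le> Cw" "\<And>n. (\<Sum>i\<le>n. (w i)\<^sup>2) \<le> Cw * (real n + 1)" using w_sum_bound by blast
  define A where "A = H 0 + 2 * K + (y 1)\<^sup>2 + 2 * Cw"
  have A: "0 \<le> A" using H1[of 0] K1 Cw by (simp add: A_def)
  have "r N \<le> (1 + C1 * (A + 1) / (1 - \<mu>)) * (real N + 1 + (\<Sum>k<N. (y (int k + 2))\<^sup>2))" for N
  proof -
    define Y where "Y = (\<Sum>k<N. (y (int k + 2))\<^sup>2)"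
    have Y0: "0 \<le> Y" by (simp add: Y_def sum_nonneg)
    have "(\<Sum>k = 1..N. dot d (\<phi> k) (\<phi> k)) \<le> C1 * (\<Sum>k = 1..N. H (Suc k))"
      unfolding sum_distrib_left by (intro sum_mono dot_\<phi>_le)
    also have "(\<Sum>k = 1..N. H (Suc k)) = sum H (Suc ` {1..N})" by (subst sum.reindex) simp_all
    also have "\<dots> \<le> (\<Sum>k\<le>Suc N. H k)"
      using H1 by (intro sum_mono2) (auto intro: order_trans[of 0 1])
    finally have a: "(\<Sum>k = 1..N. dot d (\<phi> k) (\<phi> k)) \<le> C1 * (\<Sum>k\<le>Suc N. H k)" using C1_ge_1 by simp
    have ys: "(\<Sum>k<Suc N. (y (int k + 1))\<^sup>2) = (y 1)\<^sup>2 + Y"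
      unfolding Y_def by (subst sum.lessThan_Suc_shift) (simp add: add.commute add.left_commute)
    have ws: "(\<Sum>k<Suc N. (w (k + 1))\<^sup>2) \<le> Cw * (real N + 2)"
    proof -
      have "(\<Sum>k<Suc N. (w (k + 1))\<^sup>2) = (\<Sum>i\<in>Suc ` {..<Suc N}. (w i)\<^sup>2)" by (subst sum.reindex) simp_all
      also have "\<dots> \<le> (\<Sum>i\<le>Suc N. (w i)\<^sup>2)" by (intro sum_mono2) auto
      finally show ?thesis using Cw(2)[of "Suc N"] by (simp add: algebra_simps)
    qed
    have "H 0 + (\<Sum>k<Suc N. K + (y (int k + 1))\<^sup>2 + (w (k + 1))\<^sup>2) \<le> H 0 + K * (real N + 1) + ((y 1)\<^sup>2 + Y) + Cw * (real N + 2)"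
      using ys ws by (simp add: sum.distrib algebra_simps del: sum.lessThan_Suc)
    also have "\<dots> \<le> (A + 1) * (real N + 1 + Y)"
    proof -
      have "0 \<le> H 0 * real N" "0 \<le> (y 1)\<^sup>2 * real N" "0 \<le> K * real N" "0 \<le> Cw * real N" "0 \<le> A * Y"
        using H1[of 0] K1 Cw A Y0 by auto
      moreover have "(A + 1) * (real N + 1 + Y) = A * real N + A + A * Y + real N + 1 + Y" by (simp add: algebra_simps)
      moreover have "A * real N = H 0 * real N + 2 * (K * real N) + (y 1)\<^sup>2 * real N + 2 * (Cw * real N)"
        by (simp add: A_def algebra_simps)
      moreover have "K * (real N + 1) = K * real N + K" "Cw * (real N + 2) = Cw * real N + 2 * Cw" by (simp_all add: algebra_simps)
      ultimately show ?thesis using Y0 K1 A_def by linarith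
    qed
    finally have "(\<Sum>k\<le>Suc N. H k) \<le> (A + 1) * (real N + 1 + Y) / (1 - \<mu>)"
      using sum_H_le[of "Suc N"] \<mu> by (meson divide_right_mono diff_ge_0_iff_ge less_imp_le order_trans)
    then have "C1 * (\<Sum>k\<le>Suc N. H k) \<le> C1 * ((A + 1) * (real N + 1 + Y) / (1 - \<mu>))"
      by (rule mult_left_mono) (use C1_ge_1 in simp)
    then have "r N \<le> 1 + C1 * (A + 1) / (1 - \<mu>) * (real N + 1 + Y)" unfolding r_eq using a by simp
    also have "\<dots> \<le> (1 + C1 * (A + 1) / (1 - \<mu>)) * (real N + 1 + Y)" using Y0 by (simp add: algebra_simps)
    finally show ?thesis by (simp add: Y_def)
  qed
  moreover have "1 \<le> 1 + C1 * (A + 1) / (1 - \<mu>)" using C1_ge_1 A \<mu> by simp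
  ultimately show ?thesis by blast
qed

lemma dev_bound: "\<exists>C\<ge>1. \<forall>n\<ge>n0. \<forall>i<d. (dev n i)\<^sup>2 \<le> C * \<L> n powr (3/2)"
proof -
  obtain C where C: "1 \<le> C" "\<And>n. n \<ge> n0 \<Longrightarrow> V n + (\<Sum>m = n0..<n. \<alpha> m) \<le> C * \<L> n powr (3/2)"
    using lyapunov_bound by blast
  show ?thesis
  proof (intro exI[of _ "(1 + tr n0) * C"] conjI allI impI)
    have t0: "0 \<le> tr n0" using tr_nonneg[OF reg_n0] .
    then show "1 \<le> (1 + tr n0) * C" using C(1) mult_mono[of 1 "1 + tr n0" 1 C] by simp
    fix n i assume n: "n0 \<le> n" and i: "i < d"
    have T: "0 \<le> (\<Sum>m = n0..<n. \<alpha> m)" by (intro sum_nonneg) (simp add: \<alpha>_nonneg)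
    have V: "0 \<le> V n" using V_nonneg[OF reg[OF n]] .
    have "(dev n i)\<^sup>2 \<le> Q n i i * V n" unfolding dev_def by (rule component_sq_le[OF reg[OF n] i])
    also have "\<dots> \<le> tr n0 * V n"
      using Q_diag_le_tr[OF reg[OF n] i] tr_mono[OF reg_n0 n] V by (intro mult_right_mono) auto
    also have "\<dots> \<le> (1 + tr n0) * (C * \<L> n powr (3/2))"
      using C(2)[OF n] T V t0 by (intro mult_mono) auto
    finally show "(dev n i)\<^sup>2 \<le> (1 + tr n0) * C * \<L> n powr (3/2)" by (simp add: mult.assoc)
  qed
qed

text \<open>The estimate of \<open>b 1\<close> may still grow like a power of the logarithm of
  \<open>r\<close>, but the excitation decays like a power of \<open>r\<close> itself.\<close>

lemma injected_bound: "\<exists>C\<ge>1. \<forall>n\<ge>n0. ((b 1 + dev n p) * f (Suc n))\<^sup>2 \<le> C"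
proof -
  obtain Cd where Cd: "1 \<le> Cd" "\<And>n i. n \<ge> n0 \<Longrightarrow> i < d \<Longrightarrow> (dev n i)\<^sup>2 \<le> Cd * \<L> n powr (3/2)" using dev_bound by blast
  obtain Cf where Cf: "1 \<le> Cf" "\<And>k. \<bar>f k\<bar> * r (k - 1) powr (\<epsilon> / 2) \<le> Cf" "\<And>k. \<bar>f k\<bar> \<le> Cf" using f_bounded by blast
  obtain Cl where Cl: "1 \<le> Cl" "\<And>r::real. r \<ge> 1 \<Longrightarrow> (1 + ln r) powr (3/2) \<le> Cl * r powr \<epsilon>" using log_le_powr[OF eps0] by blast
  have "((b 1 + dev n p) * f (Suc n))\<^sup>2 \<le> 2 * (b 1)\<^sup>2 * Cf\<^sup>2 + 2 * (Cd * Cl) * Cf\<^sup>2 + 1" if n: "n \<ge> n0" for n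
  proof -
    have f2: "(f (Suc n))\<^sup>2 \<le> Cf\<^sup>2" using Cf(3)[of "Suc n"] Cf(1) by (simp add: abs_le_square_iff[symmetric])
    have "(\<bar>f (Suc n)\<bar> * r n powr (\<epsilon> / 2))\<^sup>2 \<le> Cf\<^sup>2" using Cf(2)[of "Suc n"] Cf(1) r_ge_1[of n] by (intro power_mono) auto
    moreover have "(r n powr (\<epsilon> / 2))\<^sup>2 = r n powr \<epsilon>" by (simp add: power2_eq_square powr_add[symmetric])
    ultimately have f3: "(f (Suc n))\<^sup>2 * r n powr \<epsilon> \<le> Cf\<^sup>2" by (simp add: power_mult_distrib)
    have "(dev n p)\<^sup>2 \<le> Cd * (Cl * r n powr \<epsilon>)"
      using Cd(2)[OF n d0(2)] Cl(2)[OF r_ge_1[of n]] Cd(1) unfolding \<L>_def by (meson mult_left_mono order_trans zero_le_one)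
    then have "(dev n p)\<^sup>2 * (f (Suc n))\<^sup>2 \<le> Cd * (Cl * r n powr \<epsilon>) * (f (Suc n))\<^sup>2" by (intro mult_right_mono) auto
    also have "\<dots> = (Cd * Cl) * ((f (Suc n))\<^sup>2 * r n powr \<epsilon>)" by (simp add: mult_ac)
    also have "\<dots> \<le> (Cd * Cl) * Cf\<^sup>2" using f3 Cd(1) Cl(1) by (intro mult_left_mono) auto
    finally have d3: "(dev n p)\<^sup>2 * (f (Suc n))\<^sup>2 \<le> (Cd * Cl) * Cf\<^sup>2" .
    have "(b 1)\<^sup>2 * (f (Suc n))\<^sup>2 \<le> (b 1)\<^sup>2 * Cf\<^sup>2" using f2 by (intro mult_left_mono) auto
    moreover have "((b 1 + dev n p) * f (Suc n))\<^sup>2 \<le> 2 * ((b 1)\<^sup>2 * (f (Suc n))\<^sup>2 + (dev n p)\<^sup>2 * (f (Suc n))\<^sup>2)"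
      using mult_right_mono[OF add2_square_le[of "b 1" "dev n p"] zero_le_power2[of "f (Suc n)"]]
      unfolding power_mult_distrib by (simp only: mult.assoc distrib_right)
    ultimately show ?thesis using d3 by (simp add: mult.assoc)
  qed
  then show ?thesis using Cd(1) Cl(1) Cf(1) by (intro exI[of _ "2 * (b 1)\<^sup>2 * Cf\<^sup>2 + 2 * (Cd * Cl) * Cf\<^sup>2 + 1"]) auto
qed

lemma output_bound: "\<exists>C\<ge>1. \<forall>n\<ge>n0. (y (int n + 2))\<^sup>2 \<le> C * ((e n)\<^sup>2 + 1 + (w (n + 2))\<^sup>2)"
proof -
  obtain Ci where Ci: "1 \<le> Ci" "\<And>n. n \<ge> n0 \<Longrightarrow> ((b 1 + dev n p) * f (Suc n))\<^sup>2 \<le> Ci" using injected_bound by blast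
  obtain Cy where Cy: "\<And>k. \<bar>yref k\<bar> \<le> Cy" using yref_bounded by blast
  have "(y (int n + 2))\<^sup>2 \<le> (6 * (Cy\<^sup>2 + Ci) + 3) * ((e n)\<^sup>2 + 1 + (w (n + 2))\<^sup>2)" if n: "n \<ge> n0" for n
  proof -
    define A where "A = yref (n + 2) + (b 1 + dev n p) * f (Suc n)"
    have "(yref (n + 2))\<^sup>2 \<le> Cy\<^sup>2" using power_mono[OF Cy[of "n + 2"], of 2] by simp
    then have "(yref (n + 2))\<^sup>2 + ((b 1 + dev n p) * f (Suc n))\<^sup>2 \<le> Cy\<^sup>2 + Ci" using Ci(2)[OF n] by (rule add_mono)
    then have A: "A\<^sup>2 \<le> 2 * (Cy\<^sup>2 + Ci)" unfolding A_def
      by (intro order_trans[OF add2_square_le] mult_left_mono) auto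
    have "(y (int n + 2))\<^sup>2 = (A + (- e n) + w (n + 2))\<^sup>2" using tracking_error[OF n] by (simp add: A_def)
    also have "\<dots> \<le> 3 * (A\<^sup>2 + (e n)\<^sup>2 + (w (n + 2))\<^sup>2)" using add3_square_le[of A "- e n" "w (n + 2)"] by simp
    also have "\<dots> \<le> (6 * (Cy\<^sup>2 + Ci)) + 3 * ((e n)\<^sup>2 + (w (n + 2))\<^sup>2)" using A by simp
    also have "\<dots> \<le> (6 * (Cy\<^sup>2 + Ci) + 3) * ((e n)\<^sup>2 + 1 + (w (n + 2))\<^sup>2)"
    proof -
      have "0 \<le> (6 * (Cy\<^sup>2 + Ci)) * ((e n)\<^sup>2 + (w (n + 2))\<^sup>2)" using Ci(1) by simp
      then show ?thesis by (simp add: algebra_simps)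
    qed
    finally show ?thesis .
  qed
  moreover have "1 \<le> 6 * (Cy\<^sup>2 + Ci) + 3" using Ci(1) zero_le_power2[of Cy] by (simp add: algebra_simps)
  ultimately show ?thesis by blast
qed

section \<open>Good and bad times\<close>

lemma e_sq_le:
  assumes n: "n0 \<le> n"
  shows "(e n)\<^sup>2 \<le> 2 * \<alpha> n + \<alpha> n * (tr n - tr (Suc n)) * dot d (\<phi> (Suc n)) (\<phi> (Suc n))"
proof -
  have "(e n)\<^sup>2 = \<alpha> n * (1 + s n)" using s1[OF reg[OF n]] by (simp add: \<alpha>_def)
  also have "\<dots> \<le> \<alpha> n * (2 + dot d (\<phi> (Suc n)) (\<phi> (Suc n)) * (tr n - tr (Suc n)))"
    using s_le[OF reg[OF n]] \<alpha>_nonneg[OF n] by (intro mult_left_mono) auto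
  finally show ?thesis by (simp add: algebra_simps)
qed

text \<open>By \<open>e_sq_le\<close> the regressor energy feeds back into the output only through
  the product of \<open>\<alpha>\<close> and the trace decrease. Where this product is small, the
  contraction of \<open>H\<close> outweighs the feedback and the energy grows additively.\<close>

lemma good_step: "\<exists>c>0. \<exists>C\<ge>1. \<forall>n\<ge>n0. \<alpha> n * (tr n - tr (Suc n)) \<le> c \<longrightarrow>
   H (n + 2) \<le> H (n + 1) + C * (\<alpha> n + 1 + (w (n + 2))\<^sup>2)"
proof -
  obtain C2 where C2: "1 \<le> C2" "\<And>n. n \<ge> n0 \<Longrightarrow> (y (int n + 2))\<^sup>2 \<le> C2 * ((e n)\<^sup>2 + 1 + (w (n + 2))\<^sup>2)" using output_bound by blast
  \<comment> \<open>Chosen so that the feedback amounts to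
    \<open>(1 - \<mu>) / 2 * H (n + 2)\<close>, half of the margin of the contraction.\<close>
  define c where "c = (1 - \<mu>) / 2 / (C2 * C1)"
  have c0: "0 < c" using \<mu> C2(1) C1_ge_1 by (simp add: c_def)
  have "H (n + 2) \<le> H (n + 1) + (2 * (K + 1 + 2 * C2)) * (\<alpha> n + 1 + (w (n + 2))\<^sup>2)"
    if n: "n \<ge> n0" and le: "\<alpha> n * (tr n - tr (Suc n)) \<le> c" for n
  proof -
    have dn: "0 \<le> dot d (\<phi> (Suc n)) (\<phi> (Suc n))" by (rule dot_nonneg)
    have "(e n)\<^sup>2 \<le> 2 * \<alpha> n + c * dot d (\<phi> (Suc n)) (\<phi> (Suc n))"
      using e_sq_le[OF n] mult_right_mono[OF le dn] by linarith
    also have "\<dots> \<le> 2 * \<alpha> n + c * (C1 * H (n + 2))"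
      using c0 dot_\<phi>_le[of "Suc n"] by simp
    finally have "C2 * (e n)\<^sup>2 \<le> C2 * (2 * \<alpha> n) + C2 * (c * (C1 * H (n + 2)))"
      using C2(1) by (simp add: distrib_left[symmetric])
    also have "C2 * (c * (C1 * H (n + 2))) = (1 - \<mu>) / 2 * H (n + 2)" using C2(1) C1_ge_1 by (simp add: c_def)
    finally have e2: "C2 * (e n)\<^sup>2 \<le> C2 * (2 * \<alpha> n) + (1 - \<mu>) / 2 * H (n + 2)" .
    define X where "X = \<alpha> n + 1 + (w (n + 2))\<^sup>2"
    have X: "\<alpha> n \<le> X" "1 \<le> X" "(w (n + 2))\<^sup>2 \<le> X" "1 + (w (n + 2))\<^sup>2 \<le> X" using \<alpha>_nonneg[OF n] by (auto simp: X_def)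
    have "H (n + 2) = \<mu> * H (n + 1) + K + (y (int n + 2))\<^sup>2 + (w (n + 2))\<^sup>2"
      using H_Suc[of "Suc n"] by (simp add: add.commute)
    also have "(y (int n + 2))\<^sup>2 \<le> C2 * (e n)\<^sup>2 + C2 * (1 + (w (n + 2))\<^sup>2)" using C2(2)[OF n] by (simp add: algebra_simps)
    finally have "H (n + 2) \<le> \<mu> * H (n + 1) + K + (C2 * (2 * \<alpha> n) + (1 - \<mu>) / 2 * H (n + 2) + C2 * (1 + (w (n + 2))\<^sup>2)) + (w (n + 2))\<^sup>2"
      using e2 by linarith
    also have "\<dots> = \<mu> * H (n + 1) + (1 - \<mu>) / 2 * H (n + 2) + (K + 2 * C2 * \<alpha> n + C2 * (1 + (w (n + 2))\<^sup>2) + (w (n + 2))\<^sup>2)" by simp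
    also have "K + 2 * C2 * \<alpha> n + C2 * (1 + (w (n + 2))\<^sup>2) + (w (n + 2))\<^sup>2 \<le> K * X + (2 * C2) * X + X"
    proof -
      have "2 * C2 * \<alpha> n + C2 * (1 + (w (n + 2))\<^sup>2) \<le> 2 * C2 * X" using C2(1) \<alpha>_nonneg[OF n] by (simp add: X_def algebra_simps)
      moreover have "K \<le> K * X" using K1 X(2) by simp
      ultimately show ?thesis using X(3) by linarith
    qed
    also have "\<dots> = (K + 1 + 2 * C2) * X" by (simp add: algebra_simps)
    finally have main: "(1 + \<mu>) / 2 * H (n + 2) \<le> \<mu> * H (n + 1) + (K + 1 + 2 * C2) * X" by (simp add: field_simps)
    have "\<mu> * H (n + 1) \<le> (1 + \<mu>) / 2 * H (n + 1)" using \<mu> H1[of "n + 1"] by (intro mult_right_mono) auto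
    moreover have "(K + 1 + 2 * C2) * X \<le> (1 + \<mu>) / 2 * (2 * (K + 1 + 2 * C2) * X)"
      using \<mu> K1 C2(1) X(2) mult_nonneg_nonneg[of \<mu> "(K + 1 + 2 * C2) * X"] by (simp add: field_simps)
    ultimately have "(1 + \<mu>) / 2 * H (n + 2) \<le> (1 + \<mu>) / 2 * (H (n + 1) + 2 * (K + 1 + 2 * C2) * X)"
      using main by (simp add: distrib_left)
    then show ?thesis using \<mu> by (simp add: X_def)
  qed
  moreover have "1 \<le> 2 * (K + 1 + 2 * C2)" using K1 C2(1) by simp
  ultimately show ?thesis using c0 by blast
qed

text \<open>The true system equation bounds the next output at any time. The growth factor is
  proportional to a bound \<open>B\<close> for the squared input relative to the energy, which is
  why only very large inputs are dangerous.\<close>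

lemma any_step: "\<exists>C\<ge>1. \<forall>k B. 1 \<le> B \<longrightarrow> (u (int k))\<^sup>2 \<le> B * H k \<longrightarrow> H (k + 1) \<le> (C * B) * (H k + (1 + (w (k + 1))\<^sup>2))"
proof -
  define T where "T = dot d \<theta> \<theta>"
  have T0: "0 \<le> T" by (simp add: T_def dot_nonneg)
  define C where "C = \<mu> + K + 2 * T * (1 + real d * C0) + 3"
  have "H (k + 1) \<le> (C * B) * (H k + (1 + (w (k + 1))\<^sup>2))" if B: "1 \<le> B" and uB: "(u (int k))\<^sup>2 \<le> B * H k" for k B
  proof -
    have "dot d (\<phi> k) (\<phi> k) \<le> B * H k + real d * C0 * H k" unfolding dot_\<phi>_eq using uB rest_norm_le[of k] by linarith
    also have "\<dots> \<le> B * H k + B * (real d * C0 * H k)"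
      using mult_right_mono[OF B, of "real d * C0 * H k"] H1[of k] C01 by simp
    finally have ph: "dot d (\<phi> k) (\<phi> k) \<le> (1 + real d * C0) * (B * H k)" by (simp add: algebra_simps)
    have "(dot d \<theta> (\<phi> k))\<^sup>2 \<le> T * dot d (\<phi> k) (\<phi> k)" unfolding T_def by (rule dot_Cauchy_Schwarz)
    also have "\<dots> \<le> T * ((1 + real d * C0) * (B * H k))" using ph T0 by (rule mult_left_mono)
    finally have y2: "(y (int k + 1))\<^sup>2 \<le> 2 * (T * ((1 + real d * C0) * (B * H k)) + (w (k + 1))\<^sup>2)"
      unfolding output_eq by (intro order_trans[OF add2_square_le] mult_left_mono add_right_mono) auto
    define X where "X = B * (H k + (1 + (w (k + 1))\<^sup>2))"
    have BH: "H k \<le> B * H k" using B H1[of k] by simp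
    have BW: "(w (k + 1))\<^sup>2 \<le> B * (w (k + 1))\<^sup>2" using B by (simp add: mult_le_cancel_right1)
    have X: "B * H k \<le> X" "1 \<le> X" "(w (k + 1))\<^sup>2 \<le> X" "H k \<le> X"
      using B BH BW H1[of k] zero_le_power2[of "w (k + 1)"] unfolding X_def distrib_left by linarith+
    have "H (k + 1) = \<mu> * H k + K + (y (int k + 1))\<^sup>2 + (w (k + 1))\<^sup>2" using H_Suc[of k] by simp
    also have "\<dots> \<le> \<mu> * H k + K + 2 * T * (1 + real d * C0) * (B * H k) + 3 * (w (k + 1))\<^sup>2" using y2 by (simp add: algebra_simps)
    also have "\<dots> \<le> \<mu> * X + K * X + 2 * T * (1 + real d * C0) * X + 3 * X"
    proof -
      have "\<mu> * H k \<le> \<mu> * X" using \<mu> X by (intro mult_left_mono) auto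
      moreover have "K \<le> K * X" using K1 X by simp
      moreover have "2 * T * (1 + real d * C0) * (B * H k) \<le> 2 * T * (1 + real d * C0) * X"
        using X T0 C01 by (intro mult_left_mono) auto
      ultimately show ?thesis using X(3) by linarith
    qed
    also have "\<dots> = C * X" by (simp add: C_def algebra_simps)
    finally show ?thesis by (simp add: X_def mult.assoc)
  qed
  moreover have "1 \<le> C" using \<mu> K1 T0 C01 by (simp add: C_def add_increasing)
  ultimately show ?thesis by blast
qed

definition bad :: "real \<Rightarrow> nat \<Rightarrow> bool" where "bad c m \<longleftrightarrow> c < \<alpha> m * (tr m - tr (Suc m))"

text \<open>The Cauchy--Schwarz inequality, applied to \<open>\<Sum>\<alpha>\<close> and the convergent sum of the trace decrements,
  makes the number of bad times small compared with \<open>ln r\<close>, even after multiplication by \<open>ln ln r\<close>.\<close>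

lemma card_bad_le:
  assumes c: "0 < c"
  shows "\<exists>C\<ge>0. \<forall>n\<ge>n0. real (card {m\<in>{n0..<n}. bad c m}) \<le> C * \<L> n powr (3/4)"
proof -
  obtain Cv where Cv: "1 \<le> Cv" "\<And>n. n \<ge> n0 \<Longrightarrow> V n + (\<Sum>m = n0..<n. \<alpha> m) \<le> Cv * \<L> n powr (3/2)" using lyapunov_bound by blast
  have tr0: "0 \<le> tr n0" using tr_nonneg[OF reg_n0] .
  have "real (card {m\<in>{n0..<n}. bad c m}) \<le> sqrt (Cv * tr n0 / c) * \<L> n powr (3/4)" if n: "n \<ge> n0" for n
  proof -
    define \<delta> where "\<delta> m = tr m - tr (Suc m)" for m
    have \<delta>0: "0 \<le> \<delta> m" if "m \<ge> n0" for m using tr_decreasing[OF reg[OF that]] by (simp add: \<delta>_def)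
    let ?B = "{m\<in>{n0..<n}. bad c m}"
    have "real (card ?B) * sqrt c = (\<Sum>m\<in>?B. sqrt c)" by simp
    also have "\<dots> \<le> (\<Sum>m\<in>?B. sqrt (\<alpha> m) * sqrt (\<delta> m))"
      by (intro sum_mono) (auto simp: bad_def \<delta>_def real_sqrt_mult[symmetric])
    also have "\<dots> \<le> (\<Sum>m = n0..<n. sqrt (\<alpha> m) * sqrt (\<delta> m))"
      by (intro sum_mono2) (auto simp: \<alpha>_nonneg \<delta>0)
    finally have a: "real (card ?B) * sqrt c \<le> (\<Sum>m = n0..<n. sqrt (\<alpha> m) * sqrt (\<delta> m))" .
    have "(real (card ?B) * sqrt c)\<^sup>2 \<le> (\<Sum>m = n0..<n. sqrt (\<alpha> m) * sqrt (\<delta> m))\<^sup>2"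
      using a c by (intro power_mono) auto
    also have "\<dots> \<le> (\<Sum>m = n0..<n. (sqrt (\<alpha> m))\<^sup>2) * (\<Sum>m = n0..<n. (sqrt (\<delta> m))\<^sup>2)"
      by (rule Cauchy_Schwarz_ineq_sum)
    also have "\<dots> = (\<Sum>m = n0..<n. \<alpha> m) * (\<Sum>m = n0..<n. \<delta> m)"
      by (intro arg_cong2[of _ _ _ _ "(*)"] sum.cong) (auto simp: \<alpha>_nonneg \<delta>0)
    also have "\<dots> \<le> (Cv * \<L> n powr (3/2)) * tr n0"
    proof (rule mult_mono)
      show "(\<Sum>m = n0..<n. \<alpha> m) \<le> Cv * \<L> n powr (3/2)" using Cv(2)[OF n] V_nonneg[OF reg[OF n]] by linarith
      have "(\<Sum>m = n0..<n. \<delta> m) = tr n0 - tr n" using n unfolding \<delta>_def by (induction n rule: dec_induct) auto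
      then show "(\<Sum>m = n0..<n. \<delta> m) \<le> tr n0" using tr_nonneg[OF reg[OF n]] by simp
    qed (use Cv(1) in \<open>auto intro!: sum_nonneg simp: \<delta>0\<close>)
    finally have "(real (card ?B))\<^sup>2 * c \<le> Cv * \<L> n powr (3/2) * tr n0" using c by (simp add: power_mult_distrib)
    then have "(real (card ?B))\<^sup>2 \<le> Cv * tr n0 / c * \<L> n powr (3/2)" using c by (simp add: field_simps)
    also have "\<dots> = (sqrt (Cv * tr n0 / c) * \<L> n powr (3/4))\<^sup>2"
      using Cv(1) tr0 c by (simp add: power_mult_distrib) (simp add: power2_eq_square powr_add[symmetric])
    finally show ?thesis by (rule power2_le_imp_le) (use Cv(1) tr0 c in auto)
  qed
  then show ?thesis using Cv(1) tr0 c by (intro exI[of _ "sqrt (Cv * tr n0 / c)"]) auto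
qed

end

section \<open>Growth of the energy through the bad times\<close>

context energy_loop
begin

text \<open>Good times add and bad times multiply by \<open>D\<close>; since
  \<open>D \<ge> 1\<close>, what good times add may be placed inside the product.\<close>

lemma H_bound_between:
  assumes good: "\<And>m. m \<ge> n0 \<Longrightarrow> \<not> bad c m \<Longrightarrow> H (m + 2) \<le> H (m + 1) + Cg * (\<alpha> m + 1 + (w (m + 2))\<^sup>2)"
    and Cg: "1 \<le> Cg" and D: "1 \<le> D"
    and worst: "\<And>m. m \<ge> n0 \<Longrightarrow> m < N \<Longrightarrow> bad c m \<Longrightarrow> H (m + 2) \<le> D * (H (m + 1) + (1 + (w (m + 2))\<^sup>2))"
    and n: "n0 \<le> n" "n \<le> N"
  shows "H (n + 1) \<le> D ^ card {m\<in>{n0..<n}. bad c m} * (H (n0 + 1) + Cg * (\<Sum>m = n0..<n. \<alpha> m + 1 + (w (m + 2))\<^sup>2))"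
  using n
proof (induction n rule: dec_induct)
  case (step n)
  define X where "X = Cg * (\<alpha> n + 1 + (w (n + 2))\<^sup>2)"
  define Z where "Z = H (n0 + 1) + Cg * (\<Sum>m = n0..<n. \<alpha> m + 1 + (w (m + 2))\<^sup>2)"
  define k where "k = card {m\<in>{n0..<n}. bad c m}"
  have IH: "H (n + 1) \<le> D ^ k * Z" using step by (simp add: k_def Z_def)
  have Z': "H (n0 + 1) + Cg * (\<Sum>m = n0..<Suc n. \<alpha> m + 1 + (w (m + 2))\<^sup>2) = Z + X"
    using step by (simp add: Z_def X_def algebra_simps)
  have n0n: "n0 \<le> n" using step by simp
  have a0: "0 \<le> \<alpha> n" by (rule \<alpha>_nonneg[OF n0n])
  have X0: "0 \<le> X" unfolding X_def using Cg a0 by (intro mult_nonneg_nonneg) auto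
  have Dk: "1 \<le> D ^ k" using D by simp
  show ?case
  proof (cases "bad c n")
    case False
    have "{m\<in>{n0..<Suc n}. bad c m} = {m\<in>{n0..<n}. bad c m}"
      using False by (auto simp: less_Suc_eq)
    moreover have "H (n + 2) \<le> D ^ k * Z + X" using good[OF n0n False] IH by (simp add: X_def)
    moreover have "D ^ k * Z + X \<le> D ^ k * (Z + X)"
      using mult_right_mono[OF Dk X0] by (simp add: distrib_left)
    ultimately show ?thesis unfolding Z' by (simp add: k_def)
  next
    case True
    have "{m\<in>{n0..<Suc n}. bad c m} = insert n {m\<in>{n0..<n}. bad c m}"
      using True n0n by (auto simp: less_Suc_eq)
    then have card: "card {m\<in>{n0..<Suc n}. bad c m} = Suc k" by (simp add: k_def)
    have "1 + (w (n + 2))\<^sup>2 \<le> X"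
    proof -
      have "1 * (1 + (w (n + 2))\<^sup>2) \<le> Cg * (\<alpha> n + 1 + (w (n + 2))\<^sup>2)" using Cg a0 by (intro mult_mono) auto
      then show ?thesis by (simp add: X_def)
    qed
    moreover have "X \<le> D ^ k * X" using mult_right_mono[OF Dk X0] by simp
    ultimately have "H (n + 1) + (1 + (w (n + 2))\<^sup>2) \<le> D ^ k * Z + D ^ k * X" using IH by linarith
    then have "D * (H (n + 1) + (1 + (w (n + 2))\<^sup>2)) \<le> D * (D ^ k * Z + D ^ k * X)"
      using D by (intro mult_left_mono) auto
    moreover have "n < N" using step by simp
    ultimately have "H (n + 2) \<le> D * (D ^ k * Z + D ^ k * X)" using worst[OF n0n _ True] by linarith
    then show ?thesis unfolding Z' card by (simp add: algebra_simps)
  qed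
qed simp

text \<open>The inputs at bad times are measured against \<open>\<L> N\<close> of the final time,
  which is what can be verified later. The bad times then cost less than any given power of
  \<open>r N\<close>, and an inequality of the form r \<le> C N r^(3 \<delta>) results, to be solved
  for r.\<close>

lemma growth_bound:
  assumes good: "\<And>m. m \<ge> n0 \<Longrightarrow> \<not> bad c m \<Longrightarrow> H (m + 2) \<le> H (m + 1) + Cg * (\<alpha> m + 1 + (w (m + 2))\<^sup>2)"
    and c: "0 < c" and Cg: "1 \<le> Cg" and Kc: "1 \<le> Kc" and \<nu>: "0 < \<nu>"
  shows "\<exists>C\<ge>1. \<forall>N\<ge>n0. (\<forall>m\<in>{n0..<N}. bad c m \<longrightarrow> (u (int (Suc m)))\<^sup>2 \<le> Kc * \<L> N powr (3/2) * H (Suc m))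
     \<longrightarrow> r N \<le> C * (real N + 1) powr (1 + \<nu>)"
proof -
  obtain Ca where Ca: "1 \<le> Ca" "\<And>k B. 1 \<le> B \<Longrightarrow> (u (int k))\<^sup>2 \<le> B * H k \<Longrightarrow> H (k + 1) \<le> (Ca * B) * (H k + (1 + (w (k + 1))\<^sup>2))"
    using any_step by blast
  obtain Cb where Cb: "0 \<le> Cb" "\<And>n. n \<ge> n0 \<Longrightarrow> real (card {m\<in>{n0..<n}. bad c m}) \<le> Cb * \<L> n powr (3/4)"
    using card_bad_le[OF c] by blast
  obtain Cv where Cv: "1 \<le> Cv" "\<And>n. n \<ge> n0 \<Longrightarrow> V n + (\<Sum>m = n0..<n. \<alpha> m) \<le> Cv * \<L> n powr (3/2)" using lyapunov_bound by blast
  obtain Cw where Cw: "1 \<le> Cw" "\<And>n. (\<Sum>i\<le>n. (w i)\<^sup>2) \<le> Cw * (real n + 1)" using w_sum_bound by blast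
  obtain Cy where Cy: "1 \<le> Cy" "\<And>n. n \<ge> n0 \<Longrightarrow> (y (int n + 2))\<^sup>2 \<le> Cy * ((e n)\<^sup>2 + 1 + (w (n + 2))\<^sup>2)" using output_bound by blast
  obtain Cr where Cr: "1 \<le> Cr" "\<And>N. r N \<le> Cr * (real N + 1 + (\<Sum>k<N. (y (int k + 2))\<^sup>2))" using r_le_sums by blast
  \<comment> \<open>Three factors of order r^\<delta> will be lost; with this choice 1 / (1 - 3
    \<delta>) equals 1 + \<nu>.\<close>
  define \<delta> where "\<delta> = \<nu> / (3 * (1 + \<nu>))"
  have \<delta>: "0 < \<delta>" "3 * \<delta> < 1" "1 / (1 - 3 * \<delta>) = 1 + \<nu>" using \<nu> by (auto simp: \<delta>_def field_simps)
  obtain D1 where D1: "0 \<le> D1" "\<And>x. 1 \<le> x \<Longrightarrow> x powr (3/2) \<le> exp (\<delta> * x + D1)" using powr_three_halves_le_exp[OF \<delta>(1)] by blast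
  have CaK: "1 \<le> Ca * Kc" using Ca(1) Kc mult_mono[of 1 Ca 1 Kc] by simp
  obtain D2 where D2: "0 \<le> D2" "\<And>x. 1 \<le> x \<Longrightarrow> (Ca * Kc * x powr (3/2)) powr (Cb * x powr (3/4)) \<le> exp (\<delta> * x + D2)"
    using polylog_power_le_exp[OF \<delta>(1) CaK Cb(1)] by blast
  \<comment> \<open>Up to a constant this is r^\<delta>. One factor arises from the sum of
    \<open>\<alpha>\<close> inside the energy, one from the product over the bad times, and one from
    the sum of \<open>\<alpha>\<close> that multiplies the energy in the prediction errors.\<close>
  define E where "E = (\<lambda>N. exp (\<delta> * \<L> N))"
  have E1: "1 \<le> E N" for N using \<delta>(1) \<L>_ge_1[of N] by (simp add: E_def)
  have t0: "0 \<le> tr n0" using tr_nonneg[OF reg_n0] .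
  define C3 where "C3 = H (n0 + 1) + Cg * (Cv * exp D1 + 1 + 3 * Cw)"
  define C4 where "C4 = exp D2 * C3"
  define C5 where "C5 = Cv * exp D1 * (2 + C1 * C4 * tr n0)"
  define Y0 where "Y0 = (\<Sum>k<n0. (y (int k + 2))\<^sup>2)"
  define C6 where "C6 = Cr * (1 + Y0 + Cy * (C5 + 1 + 3 * Cw))"
  have C3: "1 \<le> C3" using H1[of "n0 + 1"] Cg Cv(1) Cw(1) by (simp add: C3_def add_increasing2)
  have C4: "0 \<le> C4" using C3 by (simp add: C4_def)
  have C5: "0 \<le> C5" using C4 Cv(1) C1_ge_1 t0 by (simp add: C5_def)
  have Y0: "0 \<le> Y0" by (simp add: Y0_def sum_nonneg)
  have C6: "1 \<le> C6"
  proof -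
    have "0 \<le> Cy * (C5 + 1 + 3 * Cw)" using Cy(1) C5 Cw(1) by (intro mult_nonneg_nonneg) auto
    then show ?thesis unfolding C6_def using mult_mono[of 1 Cr 1 "1 + Y0 + Cy * (C5 + 1 + 3 * Cw)"] Y0 Cr(1) by simp
  qed
  have "r N \<le> (C6 * exp (3 * \<delta>)) powr (1 + \<nu>) * (real N + 1) powr (1 + \<nu>)"
    if N: "N \<ge> n0" and P: "\<forall>m\<in>{n0..<N}. bad c m \<longrightarrow> (u (int (Suc m)))\<^sup>2 \<le> Kc * \<L> N powr (3/2) * H (Suc m)" for N
  proof -
    define B where "B = Kc * \<L> N powr (3/2)"
    have L1: "1 \<le> \<L> N powr (3/2)" using \<L>_ge_1[of N] by (intro ge_one_powr_ge_zero) auto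
    have B1: "1 \<le> B" using mult_mono[of 1 Kc 1 "\<L> N powr (3/2)"] Kc L1 by (simp add: B_def)
    have LE: "\<L> N powr (3/2) \<le> exp D1 * E N" using D1(2)[OF \<L>_ge_1[of N]] by (simp add: E_def exp_add mult.commute)
    have D: "1 \<le> Ca * B" using mult_mono[of 1 Ca 1 B] B1 Ca(1) by simp
    have wsum: "(\<Sum>m = n0..<N. (w (m + 2))\<^sup>2) \<le> 3 * Cw * (real N + 1)"
    proof -
      have "(\<Sum>m = n0..<N. (w (m + 2))\<^sup>2) = (\<Sum>i\<in>(\<lambda>m. m + 2) ` {n0..<N}. (w i)\<^sup>2)" by (subst sum.reindex) (simp_all add: inj_on_def)
      also have "\<dots> \<le> (\<Sum>i\<le>N + 2. (w i)\<^sup>2)" by (intro sum_mono2) auto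
      also have "\<dots> \<le> Cw * (real (N + 2) + 1)" by (rule Cw(2))
      also have "\<dots> \<le> Cw * (3 * (real N + 1))" using Cw(1) by (intro mult_left_mono) auto
      finally show ?thesis by (simp add: algebra_simps)
    qed
    have asum: "(\<Sum>m = n0..<n. \<alpha> m) \<le> Cv * exp D1 * E N" if n: "n0 \<le> n" "n \<le> N" for n
    proof -
      have "(\<Sum>m = n0..<n. \<alpha> m) \<le> Cv * \<L> n powr (3/2)" using Cv(2)[OF n(1)] V_nonneg[OF reg[OF n(1)]] by linarith
      also have "\<dots> \<le> Cv * \<L> N powr (3/2)"
        using Cv(1) \<L>_mono[OF n(2)] \<L>_ge_1[of n] by (intro mult_left_mono powr_mono2) auto
      also have "\<dots> \<le> Cv * (exp D1 * E N)" using LE Cv(1) by (intro mult_left_mono) auto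
      finally show ?thesis by (simp add: mult.assoc)
    qed
    have Hn: "H (n + 1) \<le> C4 * (E N)\<^sup>2 * (real N + 1)" if n: "n0 \<le> n" "n \<le> N" for n
    proof -
      have "H (n + 1) \<le> (Ca * B) ^ card {m\<in>{n0..<n}. bad c m} * (H (n0 + 1) + Cg * (\<Sum>m = n0..<n. \<alpha> m + 1 + (w (m + 2))\<^sup>2))"
      proof (rule H_bound_between[OF good Cg D _ n])
        fix m assume m: "m \<ge> n0" "m < N" "bad c m"
        then have "(u (int (Suc m)))\<^sup>2 \<le> B * H (Suc m)" using P by (simp add: B_def)
        from Ca(2)[OF B1 this] show "H (m + 2) \<le> Ca * B * (H (m + 1) + (1 + (w (m + 2))\<^sup>2))" by simp
      qed
      also have "\<dots> \<le> (exp D2 * E N) * (C3 * E N * (real N + 1))"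
      proof (rule mult_mono)
        have "(Ca * B) ^ card {m\<in>{n0..<n}. bad c m} = (Ca * B) powr real (card {m\<in>{n0..<n}. bad c m})"
          using D by (simp add: powr_realpow)
        also have "\<dots> \<le> (Ca * B) powr (Cb * \<L> N powr (3/4))"
        proof (rule powr_mono)
          have "real (card {m\<in>{n0..<n}. bad c m}) \<le> Cb * \<L> n powr (3/4)" using Cb(2)[OF n(1)] .
          also have "\<dots> \<le> Cb * \<L> N powr (3/4)" using Cb(1) \<L>_mono[OF n(2)] \<L>_ge_1[of n] by (intro mult_left_mono powr_mono2) auto
          finally show "real (card {m\<in>{n0..<n}. bad c m}) \<le> Cb * \<L> N powr (3/4)" .
        qed (use D in auto)
        also have "\<dots> \<le> exp (\<delta> * \<L> N + D2)" using D2(2)[OF \<L>_ge_1[of N]] by (simp add: B_def mult.assoc)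
        finally show "(Ca * B) ^ card {m\<in>{n0..<n}. bad c m} \<le> exp D2 * E N" by (simp add: E_def exp_add mult.commute)
        have "(\<Sum>m = n0..<n. \<alpha> m + 1 + (w (m + 2))\<^sup>2) = (\<Sum>m = n0..<n. \<alpha> m) + real (n - n0) + (\<Sum>m = n0..<n. (w (m + 2))\<^sup>2)"
          by (simp add: sum.distrib)
        also have "\<dots> \<le> Cv * exp D1 * E N + real N + 3 * Cw * (real N + 1)"
        proof -
          have "(\<Sum>m = n0..<n. (w (m + 2))\<^sup>2) \<le> (\<Sum>m = n0..<N. (w (m + 2))\<^sup>2)" using n by (intro sum_mono2) auto
          then show ?thesis using asum[OF n] wsum n by linarith
        qed
        also have "\<dots> \<le> (Cv * exp D1 + 1 + 3 * Cw) * (E N * (real N + 1))"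
        proof -
          define F where "F = E N * (real N + 1)"
          have F: "E N \<le> F" "real N + 1 \<le> F"
            using E1[of N] mult_mono[of 1 "E N" "real N + 1" "real N + 1"] mult_mono[of "E N" "E N" 1 "real N + 1"] by (auto simp: F_def)
          have "Cv * exp D1 * E N \<le> Cv * exp D1 * F" "3 * Cw * (real N + 1) \<le> 3 * Cw * F"
            using F Cv(1) Cw(1) by (auto intro!: mult_left_mono)
          then show ?thesis using F unfolding F_def[symmetric] by (simp add: distrib_right)
        qed
        finally have "Cg * (\<Sum>m = n0..<n. \<alpha> m + 1 + (w (m + 2))\<^sup>2) \<le> Cg * ((Cv * exp D1 + 1 + 3 * Cw) * (E N * (real N + 1)))"
          using Cg by (intro mult_left_mono) auto
        moreover have "H (n0 + 1) \<le> H (n0 + 1) * (E N * (real N + 1))"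
        proof -
          have "1 \<le> E N * (real N + 1)" using mult_mono[of 1 "E N" 1 "real N + 1"] E1[of N] by simp
          then show ?thesis using H1[of "n0 + 1"] by simp
        qed
        ultimately show "H (n0 + 1) + Cg * (\<Sum>m = n0..<n. \<alpha> m + 1 + (w (m + 2))\<^sup>2) \<le> C3 * E N * (real N + 1)"
          by (simp add: C3_def algebra_simps)
      next
        have "0 \<le> (\<Sum>m = n0..<n. \<alpha> m + 1 + (w (m + 2))\<^sup>2)" by (intro sum_nonneg) (simp add: \<alpha>_nonneg)
        then have "0 \<le> Cg * (\<Sum>m = n0..<n. \<alpha> m + 1 + (w (m + 2))\<^sup>2)" using Cg by simp
        then show "0 \<le> H (n0 + 1) + Cg * (\<Sum>m = n0..<n. \<alpha> m + 1 + (w (m + 2))\<^sup>2)" using H1[of "n0 + 1"] by linarith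
      qed (use E1[of N] in auto)
      also have "\<dots> = C4 * (E N)\<^sup>2 * (real N + 1)" by (simp add: C4_def power2_eq_square)
      finally show ?thesis .
    qed
    have EN1: "1 \<le> (E N)\<^sup>2 * (real N + 1)" using mult_mono[of 1 "(E N)\<^sup>2" 1 "real N + 1"] E1[of N] by simp
    have e2: "(e m)\<^sup>2 \<le> \<alpha> m * ((2 + C1 * C4 * tr n0) * ((E N)\<^sup>2 * (real N + 1)))" if m: "m \<in> {n0..<N}" for m
    proof -
      have mn: "n0 \<le> m" "n0 \<le> Suc m" "Suc m \<le> N" using m by auto
      have dt: "0 \<le> tr m - tr (Suc m)" "tr m - tr (Suc m) \<le> tr n0"
        using tr_decreasing[OF reg[OF mn(1)]] tr_mono[OF reg_n0 mn(1)] tr_nonneg[OF reg[OF mn(2)]] by auto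
      have "(tr m - tr (Suc m)) * dot d (\<phi> (Suc m)) (\<phi> (Suc m)) \<le> tr n0 * (C1 * H (Suc (Suc m)))"
        using dt dot_\<phi>_le[of "Suc m"] by (intro mult_mono) (auto simp: dot_nonneg)
      also have "\<dots> \<le> tr n0 * (C1 * (C4 * (E N)\<^sup>2 * (real N + 1)))"
        using Hn[OF mn(2,3)] t0 C1_ge_1 by (intro mult_left_mono) auto
      finally have "2 + (tr m - tr (Suc m)) * dot d (\<phi> (Suc m)) (\<phi> (Suc m)) \<le> 2 * ((E N)\<^sup>2 * (real N + 1)) + tr n0 * (C1 * (C4 * (E N)\<^sup>2 * (real N + 1)))"
        using EN1 by linarith
      also have "\<dots> = (2 + C1 * C4 * tr n0) * ((E N)\<^sup>2 * (real N + 1))" by (simp add: algebra_simps)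
      finally have "\<alpha> m * (2 + (tr m - tr (Suc m)) * dot d (\<phi> (Suc m)) (\<phi> (Suc m))) \<le> \<alpha> m * ((2 + C1 * C4 * tr n0) * ((E N)\<^sup>2 * (real N + 1)))"
        using \<alpha>_nonneg[OF mn(1)] by (rule mult_left_mono)
      then show ?thesis using e_sq_le[OF mn(1)] by (simp add: algebra_simps)
    qed
    have "(\<Sum>m = n0..<N. (e m)\<^sup>2) \<le> (\<Sum>m = n0..<N. \<alpha> m) * ((2 + C1 * C4 * tr n0) * ((E N)\<^sup>2 * (real N + 1)))"
      unfolding sum_distrib_right by (intro sum_mono e2)
    also have "\<dots> \<le> (Cv * exp D1 * E N) * ((2 + C1 * C4 * tr n0) * ((E N)\<^sup>2 * (real N + 1)))"
      using asum[OF N order_refl] C1_ge_1 C4 t0 by (intro mult_right_mono) auto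
    also have "\<dots> = C5 * ((E N) ^ 3 * (real N + 1))" by (simp add: C5_def power2_eq_square power3_eq_cube)
    finally have esum: "(\<Sum>m = n0..<N. (e m)\<^sup>2) \<le> C5 * ((E N) ^ 3 * (real N + 1))" .
    define F where "F = (E N) ^ 3 * (real N + 1)"
    have "1 \<le> (E N) ^ 3" using E1[of N] by (rule one_le_power)
    then have F1: "real N + 1 \<le> F" unfolding F_def using mult_right_mono[of 1 "(E N) ^ 3" "real N + 1"] by simp
    then have F: "real N + 1 \<le> F" "1 \<le> F" by linarith+
    have "(\<Sum>k<N. (y (int k + 2))\<^sup>2) = Y0 + (\<Sum>m = n0..<N. (y (int m + 2))\<^sup>2)"
      using N unfolding Y0_def by (simp add: lessThan_atLeast0 sum.atLeastLessThan_concat)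
    also have "(\<Sum>m = n0..<N. (y (int m + 2))\<^sup>2) \<le> (\<Sum>m = n0..<N. Cy * ((e m)\<^sup>2 + 1 + (w (m + 2))\<^sup>2))"
      by (intro sum_mono Cy(2)) auto
    also have "\<dots> = Cy * ((\<Sum>m = n0..<N. (e m)\<^sup>2) + real (N - n0) + (\<Sum>m = n0..<N. (w (m + 2))\<^sup>2))"
      by (simp add: sum_distrib_left[symmetric] sum.distrib)
    also have "\<dots> \<le> Cy * (C5 * F + F + 3 * Cw * F)"
    proof -
      have "3 * Cw * (real N + 1) \<le> 3 * Cw * F" using F Cw(1) by (intro mult_left_mono) auto
      then show ?thesis using esum wsum F Cy(1) unfolding F_def[symmetric] by (intro mult_left_mono add_mono) auto
    qed
    finally have "real N + 1 + (\<Sum>k<N. (y (int k + 2))\<^sup>2) \<le> F + Y0 * F + Cy * (C5 * F + F + 3 * Cw * F)"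
      using F mult_left_mono[OF F(2) Y0] by linarith
    also have "\<dots> = (1 + Y0 + Cy * (C5 + 1 + 3 * Cw)) * F" by (simp add: algebra_simps)
    finally have "Cr * (real N + 1 + (\<Sum>k<N. (y (int k + 2))\<^sup>2)) \<le> Cr * ((1 + Y0 + Cy * (C5 + 1 + 3 * Cw)) * F)"
      using Cr(1) by (intro mult_left_mono) auto
    then have "r N \<le> C6 * F" using Cr(2)[of N] by (simp add: C6_def mult.assoc)
    also have "\<dots> = C6 * exp (3 * \<delta>) * r N powr (3 * \<delta>) * (real N + 1)"
    proof -
      have "(E N) ^ 3 = exp (3 * \<delta> * \<L> N)" by (simp add: E_def exp_of_nat_mult[symmetric] mult.assoc)
      also have "\<dots> = exp (3 * \<delta>) * r N powr (3 * \<delta>)" using r_ge_1[of N]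
        by (simp add: \<L>_def powr_def exp_add[symmetric] algebra_simps)
      finally show ?thesis by (simp add: F_def)
    qed
    finally have "r N / r N powr (3 * \<delta>) \<le> C6 * exp (3 * \<delta>) * (real N + 1)"
      using r_ge_1[of N] by (simp add: field_simps)
    moreover have "r N / r N powr (3 * \<delta>) = r N powr (1 - 3 * \<delta>)" using r_ge_1[of N] by (simp add: powr_diff)
    ultimately have "(r N powr (1 - 3 * \<delta>)) powr (1 + \<nu>) \<le> (C6 * exp (3 * \<delta>) * (real N + 1)) powr (1 + \<nu>)"
      using \<nu> by (intro powr_mono2) auto
    moreover have "(r N powr (1 - 3 * \<delta>)) powr (1 + \<nu>) = r N"
      unfolding \<delta>(3)[symmetric] using \<delta>(2) r_ge_1[of N] by (simp add: powr_powr)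
    ultimately show ?thesis using C6 by (simp add: powr_mult)
  qed
  moreover have "1 \<le> (C6 * exp (3 * \<delta>)) powr (1 + \<nu>)"
    using \<nu> \<delta>(1) C6 mult_mono[of 1 C6 1 "exp (3 * \<delta>)"] by (intro ge_one_powr_ge_zero) auto
  ultimately show ?thesis by blast
qed

text \<open>An input of this size requires a poor estimate of \<open>b\<^sub>1\<close>.\<close>

lemma large_input_dev: "\<exists>\<Phi>\<ge>1. \<forall>m\<ge>n0. \<Phi> * \<L> m powr (3/2) * H (Suc m) < (u (int (Suc m)))\<^sup>2 \<longrightarrow> \<bar>b 1\<bar> / 2 \<le> \<bar>dev m p\<bar>"
proof -
  obtain Cd where Cd: "1 \<le> Cd" "\<And>n i. n \<ge> n0 \<Longrightarrow> i < d \<Longrightarrow> (dev n i)\<^sup>2 \<le> Cd * \<L> n powr (3/2)" using dev_bound by blast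
  obtain Cf where Cf: "1 \<le> Cf" "\<And>k. \<bar>f k\<bar> \<le> Cf" using f_bounded by blast
  obtain Cy where Cy: "\<And>k. \<bar>yref k\<bar> \<le> Cy" using yref_bounded by blast
  define A where "A = (\<Sum>i<d. (\<theta> i)\<^sup>2)"
  have A: "0 \<le> A" by (simp add: A_def sum_nonneg)
  define B where "B = 2 * (A + real d * Cd) * (real d * C0)"
  have B: "0 \<le> B" using A Cd(1) C01 by (simp add: B_def)
  define \<Phi> where "\<Phi> = 2 * (2 * (Cy\<^sup>2 + B) * 4 / (b 1)\<^sup>2 + Cf\<^sup>2) + 1"
  have b0: "0 < (b 1)\<^sup>2" using b1 by simp
  \<comment> \<open>The contrapositive: when the estimate of \<open>b 1\<close> stays away from
    zero, the certainty equivalence equation can be solved for the input, whose square is then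
    governed by the other components, of order \<open>H (Suc m)\<close>, and by the squared
    estimates, of order \<open>\<L> m powr (3/2)\<close>.\<close>
  have "(u (int (Suc m)))\<^sup>2 \<le> \<Phi> * \<L> m powr (3/2) * H (Suc m)" if m: "m \<ge> n0" and small: "\<bar>dev m p\<bar> < \<bar>b 1\<bar> / 2" for m
  proof -
    define U where "U = u (int (Suc m)) - f (Suc m)"
    define R where "R = (\<Sum>i\<in>{..<d} - {p}. (\<theta> i + dev m i) * \<phi> (Suc m) i)"
    define LH where "LH = \<L> m powr (3/2) * H (Suc m)"
    have L1: "1 \<le> \<L> m powr (3/2)" using \<L>_ge_1[of m] by (intro ge_one_powr_ge_zero) auto
    have LH: "1 \<le> LH" using mult_mono[of 1 "\<L> m powr (3/2)" 1 "H (Suc m)"] L1 H1[of "Suc m"] by (simp add: LH_def)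
    have "dot d (\<lambda>i. \<theta> i + dev m i) (\<phi> (Suc m)) = (b 1 + dev m p) * u (int (Suc m)) + R"
      unfolding dot_def R_def using d0 by (subst sum.remove[of _ p]) (auto simp: \<phi>_p b1)
    then have eq: "(b 1 + dev m p) * U = yref (m + 2) - R"
      using certainty_equivalence[OF m] by (simp add: U_def algebra_simps)
    have "R\<^sup>2 \<le> (\<Sum>i\<in>{..<d} - {p}. (\<theta> i + dev m i)\<^sup>2) * (\<Sum>i\<in>{..<d} - {p}. (\<phi> (Suc m) i)\<^sup>2)"
      unfolding R_def by (rule Cauchy_Schwarz_ineq_sum)
    also have "\<dots> \<le> (2 * (A + real d * Cd) * \<L> m powr (3/2)) * (real d * C0 * H (Suc m))"
    proof (rule mult_mono)
      have "(\<Sum>i\<in>{..<d} - {p}. (\<theta> i + dev m i)\<^sup>2) \<le> (\<Sum>i<d. (\<theta> i + dev m i)\<^sup>2)" by (intro sum_mono2) auto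
      also have "\<dots> \<le> (\<Sum>i<d. 2 * ((\<theta> i)\<^sup>2 + Cd * \<L> m powr (3/2)))"
        by (intro sum_mono order_trans[OF add2_square_le] mult_left_mono add_left_mono Cd(2)[OF m]) auto
      also have "\<dots> = 2 * (A + real d * (Cd * \<L> m powr (3/2)))" by (simp add: A_def sum_distrib_left[symmetric] sum.distrib)
      also have "\<dots> \<le> 2 * (A * \<L> m powr (3/2) + real d * (Cd * \<L> m powr (3/2)))" using A L1 mult_left_mono[OF L1 A] by simp
      finally show "(\<Sum>i\<in>{..<d} - {p}. (\<theta> i + dev m i)\<^sup>2) \<le> 2 * (A + real d * Cd) * \<L> m powr (3/2)" by (simp add: algebra_simps)
    qed (use rest_norm_le A Cd(1) in \<open>auto intro: sum_nonneg\<close>)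
    also have "\<dots> = B * LH" by (simp add: B_def LH_def)
    finally have R2: "R\<^sup>2 \<le> B * LH" .
    have "(yref (m + 2))\<^sup>2 \<le> Cy\<^sup>2" using power_mono[OF Cy[of "m + 2"], of 2] by simp
    also have "\<dots> \<le> Cy\<^sup>2 * LH" using LH by (simp add: mult_le_cancel_left1)
    finally have "(yref (m + 2))\<^sup>2 + (- R)\<^sup>2 \<le> (Cy\<^sup>2 + B) * LH" using R2 by (simp add: distrib_right)
    then have "2 * ((yref (m + 2))\<^sup>2 + (- R)\<^sup>2) \<le> 2 * ((Cy\<^sup>2 + B) * LH)" by simp
    then have "((b 1 + dev m p) * U)\<^sup>2 \<le> 2 * ((Cy\<^sup>2 + B) * LH)"
      using add2_square_le[of "yref (m + 2)" "- R"] unfolding eq by simp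
    moreover have "(\<bar>b 1\<bar> / 2)\<^sup>2 \<le> \<bar>b 1 + dev m p\<bar>\<^sup>2" using small by (intro power_mono; linarith)
    then have "(b 1)\<^sup>2 / 4 * U\<^sup>2 \<le> ((b 1 + dev m p) * U)\<^sup>2"
      unfolding power_mult_distrib by (intro mult_right_mono) (auto simp: power_divide)
    ultimately have "(b 1)\<^sup>2 / 4 * U\<^sup>2 \<le> 2 * ((Cy\<^sup>2 + B) * LH)" by linarith
    then have U2: "U\<^sup>2 \<le> 2 * (Cy\<^sup>2 + B) * 4 / (b 1)\<^sup>2 * LH" using b0 by (simp add: field_simps)
    have "(f (Suc m))\<^sup>2 \<le> Cf\<^sup>2" using Cf(2)[of "Suc m"] Cf(1) by (simp add: abs_le_square_iff[symmetric])
    also have "\<dots> \<le> Cf\<^sup>2 * LH" using LH by (simp add: mult_le_cancel_left1)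
    finally have "U\<^sup>2 + (f (Suc m))\<^sup>2 \<le> (2 * (Cy\<^sup>2 + B) * 4 / (b 1)\<^sup>2 + Cf\<^sup>2) * LH" using U2 by (simp add: distrib_right)
    then have "2 * (U\<^sup>2 + (f (Suc m))\<^sup>2) \<le> 2 * ((2 * (Cy\<^sup>2 + B) * 4 / (b 1)\<^sup>2 + Cf\<^sup>2) * LH)" by simp
    moreover have "(u (int (Suc m)))\<^sup>2 \<le> 2 * (U\<^sup>2 + (f (Suc m))\<^sup>2)" using add2_square_le[of U "f (Suc m)"] by (simp add: U_def)
    moreover have "2 * (Z * LH) \<le> (2 * Z + 1) * LH" for Z using LH by (simp add: algebra_simps)
    then have "2 * ((2 * (Cy\<^sup>2 + B) * 4 / (b 1)\<^sup>2 + Cf\<^sup>2) * LH) \<le> \<Phi> * LH" unfolding \<Phi>_def .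
    ultimately show ?thesis by (simp add: LH_def mult.assoc)
  qed
  moreover have "1 \<le> \<Phi>" using B b0 by (simp add: \<Phi>_def)
  ultimately show ?thesis by (meson not_le)
qed

text \<open>The squared error in \<open>b 1\<close> is at most \<open>Q m p p * V m\<close>, and
  \<open>V m\<close> is at most a power of the logarithm. So a bad estimate means that little
  information on \<open>b 1\<close> has been collected.\<close>

lemma Q_large_of_dev: "\<exists>c>0. \<forall>m\<ge>n0. \<bar>b 1\<bar> / 2 \<le> \<bar>dev m p\<bar> \<longrightarrow> c \<le> Q m p p * \<L> m powr (3/2)"
proof -
  obtain Cv where Cv: "1 \<le> Cv" "\<And>n. n \<ge> n0 \<Longrightarrow> V n + (\<Sum>m = n0..<n. \<alpha> m) \<le> Cv * \<L> n powr (3/2)" using lyapunov_bound by blast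
  have "(b 1)\<^sup>2 / (4 * Cv) \<le> Q m p p * \<L> m powr (3/2)" if m: "m \<ge> n0" and dv: "\<bar>b 1\<bar> / 2 \<le> \<bar>dev m p\<bar>" for m
  proof -
    have "0 \<le> (\<Sum>m = n0..<m. \<alpha> m)" by (intro sum_nonneg) (simp add: \<alpha>_nonneg)
    then have Vm: "V m \<le> Cv * \<L> m powr (3/2)" using Cv(2)[OF m] by linarith
    have Qp: "0 \<le> Q m p p" using Q_diag[OF reg[OF m] d0(2)] Qa_nonneg[OF reg[OF m]] by simp
    have "(\<bar>b 1\<bar> / 2)\<^sup>2 \<le> \<bar>dev m p\<bar>\<^sup>2" using dv by (intro power_mono) auto
    also have "\<dots> \<le> Q m p p * V m" unfolding dev_def power2_abs by (rule component_sq_le[OF reg[OF m] d0(2)])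
    also have "\<dots> \<le> Q m p p * (Cv * \<L> m powr (3/2))" using Vm Qp by (rule mult_left_mono)
    finally show ?thesis using Cv(1) by (simp add: power_divide field_simps)
  qed
  moreover have "0 < (b 1)\<^sup>2 / (4 * Cv)" using b1 Cv(1) by simp
  ultimately show ?thesis by blast
qed

text \<open>The unit vector of the input, scaled by the input, is the regressor minus its other
  components. In the updated metric the former has square at most 1 and the latter at most a
  multiple of \<open>H\<close>, so a large input leaves a small diagonal entry. The two are combined
  by the parallelogram identity.\<close>

lemma Q_after_input: "\<exists>C\<ge>1. \<forall>m\<ge>n0. Q (Suc m) p p * (u (int (Suc m)))\<^sup>2 \<le> C * H (Suc m)"
proof -
  have t0: "0 \<le> tr n0" using tr_nonneg[OF reg_n0] .
  define C where "C = 2 + 2 * (tr n0 * (real d * C0))"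
  have "Q (Suc m) p p * (u (int (Suc m)))\<^sup>2 \<le> C * H (Suc m)" if m: "m \<ge> n0" for m
  proof -
    have m1: "Suc m \<ge> n0" using m by simp
    note rg = reg[OF m1]
    define x where "x i = (if i = p then 0 else \<phi> (Suc m) i)" for i
    define U where "U = u (int (Suc m))"
    let ?q = "\<lambda>v. dot d v (Qa (Suc m) v)"
    have dec: "unitv p i * U = \<phi> (Suc m) i - x i" for i by (simp add: unitv_def x_def \<phi>_p U_def)
    have lin: "Qa (Suc m) (\<lambda>i. unitv p i * U) = (\<lambda>i. Qa (Suc m) (unitv p) i * U)"
      by (simp add: Qa_def app_def fun_eq_iff sum_distrib_right sum_distrib_left mult_ac)
    have "?q (\<lambda>i. unitv p i * U) = U\<^sup>2 * ?q (unitv p)"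
      unfolding lin dot_scale_left dot_scale_right by (simp add: power2_eq_square)
    then have 1: "?q (\<lambda>i. \<phi> (Suc m) i - x i) = Q (Suc m) p p * U\<^sup>2" using Q_diag[OF rg d0(2)] by (simp add: dec)
    have linm: "Qa (Suc m) (\<lambda>i. a i - b i) = (\<lambda>i. Qa (Suc m) a i - Qa (Suc m) b i)"
      "Qa (Suc m) (\<lambda>i. a i + b i) = (\<lambda>i. Qa (Suc m) a i + Qa (Suc m) b i)" for a b
      by (simp_all add: Qa_def app_def fun_eq_iff algebra_simps sum_subtractf sum.distrib)
    have "?q (\<lambda>i. \<phi> (Suc m) i - x i) + ?q (\<lambda>i. \<phi> (Suc m) i + x i) = 2 * ?q (\<phi> (Suc m)) + 2 * ?q x"
      unfolding linm dot_add_left dot_add_right dot_diff_left dot_diff_right by simp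
    then have 2: "?q (\<lambda>i. \<phi> (Suc m) i - x i) \<le> 2 * ?q (\<phi> (Suc m)) + 2 * ?q x" using Qa_nonneg[OF rg, of "\<lambda>i. \<phi> (Suc m) i + x i"] by linarith
    have 3: "?q (\<phi> (Suc m)) \<le> H (Suc m)" using updated_form[OF reg[OF m]] H1[of "Suc m"] by linarith
    have "dot d x x = (\<Sum>i\<in>{..<d} - {p}. (\<phi> (Suc m) i)\<^sup>2)"
      unfolding dot_def using d0 by (subst sum.remove[of _ p]) (auto simp: x_def power2_eq_square intro!: sum.cong)
    then have "dot d x x \<le> real d * C0 * H (Suc m)" using rest_norm_le[of "Suc m"] by simp
    then have "?q x \<le> tr n0 * (real d * C0 * H (Suc m))"
      using Q_form_le[OF rg, of x] tr_mono[OF reg_n0 m1] t0 dot_nonneg[of d x] mult_mono by (meson order_trans)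
    then show ?thesis using 1 2 3 by (simp add: C_def U_def algebra_simps)
  qed
  moreover have "1 \<le> C" using t0 C01 by (simp add: C_def)
  ultimately show ?thesis by blast
qed

end

section \<open>Excitation of the regressors\<close>

lemma uniform_constant:
  fixes A B :: "nat \<Rightarrow> nat \<Rightarrow> real"
  assumes "\<And>j. j < J \<Longrightarrow> \<exists>C\<ge>0. \<forall>n. A j n \<le> C * B j n" and B: "\<And>j n. 0 \<le> B j n"
  shows "\<exists>C\<ge>0. \<forall>j<J. \<forall>n. A j n \<le> C * B j n"
  using assms(1)
proof (induction J)
  case (Suc J)
  obtain C where C: "0 \<le> C" "\<And>j n. j < J \<Longrightarrow> A j n \<le> C * B j n" using Suc by (auto simp: less_Suc_eq)
  obtain C' where C': "0 \<le> C'" "\<And>n. A J n \<le> C' * B J n" using Suc.prems[of J] by auto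
  have "A j n \<le> (C + C') * B j n" if "j < Suc J" for j n
  proof (cases "j = J")
    case True
    then show ?thesis using C'(2)[of n] mult_nonneg_nonneg[OF C(1) B[of J n]] by (simp add: distrib_right)
  next
    case False
    then show ?thesis using C(2)[of j n] that mult_nonneg_nonneg[OF C'(1) B[of j n]] by (simp add: distrib_right)
  qed
  then show ?case using C(1) C'(1) by (intro exI[of _ "C + C'"]) auto
qed auto

lemma abs_sum_window_le:
  fixes g :: "nat \<Rightarrow> real"
  assumes "\<And>n'. n' \<le> n \<Longrightarrow> \<bar>\<Sum>k<n'. g k\<bar> \<le> B" "l \<le> n"
  shows "\<bar>\<Sum>k = l..<n. g k\<bar> \<le> 2 * B"
proof -
  have "(\<Sum>k<n. g k) = (\<Sum>k<l. g k) + (\<Sum>k = l..<n. g k)"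
    using assms(2) by (simp add: lessThan_atLeast0 sum.atLeastLessThan_concat)
  then show ?thesis using assms(1)[of n] assms(1)[of l] assms(2) by linarith
qed

text \<open>One step of the peeling argument: the component \<open>h + v\<close> has a fresh part \<open>h\<close> of energy at
  least \<open>F\<close> that is nearly orthogonal to everything older, so a small total forces a small
  coefficient, after which the component can be removed.\<close>

lemma peel_step:
  fixes h v \<rho> :: "nat \<Rightarrow> real"
  assumes F: "0 < F" "F \<le> (\<Sum>k\<in>I. (h k)\<^sup>2)" and Z: "\<bar>\<Sum>k\<in>I. h k * (\<beta> * v k + \<rho> k)\<bar> \<le> Z"
    and X: "(\<Sum>k\<in>I. (h k + v k)\<^sup>2) \<le> X" and E: "2 * Z\<^sup>2 / F \<le> E"
    and T: "T = (\<Sum>k\<in>I. (\<beta> * (h k + v k) + \<rho> k)\<^sup>2)"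
  shows "\<beta>\<^sup>2 \<le> 2 / F * (T + E)" and "(\<Sum>k\<in>I. (\<rho> k)\<^sup>2) + E \<le> (3 + 4 * X / F) * (T + E)"
proof -
  have E0: "0 \<le> E" using E F by (smt (verit) divide_nonneg_pos zero_le_power2 mult_nonneg_nonneg)
  have T0: "0 \<le> T" unfolding T by (intro sum_nonneg) auto
  have Z0: "0 \<le> Z" using Z by linarith
  have "T = (\<Sum>k\<in>I. \<beta>\<^sup>2 * (h k)\<^sup>2 + 2 * \<beta> * (h k * (\<beta> * v k + \<rho> k)) + (\<beta> * v k + \<rho> k)\<^sup>2)"
    unfolding T by (intro sum.cong refl) (simp add: power2_eq_square algebra_simps)
  also have "\<dots> = \<beta>\<^sup>2 * (\<Sum>k\<in>I. (h k)\<^sup>2) + 2 * \<beta> * (\<Sum>k\<in>I. h k * (\<beta> * v k + \<rho> k)) + (\<Sum>k\<in>I. (\<beta> * v k + \<rho> k)\<^sup>2)"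
    by (simp only: sum.distrib sum_distrib_left)
  finally have eq: "T = \<beta>\<^sup>2 * (\<Sum>k\<in>I. (h k)\<^sup>2) + 2 * \<beta> * (\<Sum>k\<in>I. h k * (\<beta> * v k + \<rho> k)) + (\<Sum>k\<in>I. (\<beta> * v k + \<rho> k)\<^sup>2)" .
  have a: "\<beta>\<^sup>2 * F \<le> \<beta>\<^sup>2 * (\<Sum>k\<in>I. (h k)\<^sup>2)" using F by (intro mult_left_mono) auto
  have "\<bar>2 * \<beta> * (\<Sum>k\<in>I. h k * (\<beta> * v k + \<rho> k))\<bar> \<le> 2 * \<bar>\<beta>\<bar> * Z"
    unfolding abs_mult using Z by (intro mult_mono) auto
  then have b: "- (2 * \<bar>\<beta>\<bar> * Z) \<le> 2 * \<beta> * (\<Sum>k\<in>I. h k * (\<beta> * v k + \<rho> k))" by linarith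
  have c: "0 \<le> (\<Sum>k\<in>I. (\<beta> * v k + \<rho> k)\<^sup>2)" by (intro sum_nonneg) auto
  \<comment> \<open>A weighted square completion: half of \<open>\<beta>\<^sup>2 * F\<close> absorbs
    the cross term, and what is left over is the definition of the admissible error
    \<open>E\<close>.\<close>
  have d: "2 * \<bar>\<beta>\<bar> * Z \<le> \<beta>\<^sup>2 * F / 2 + 2 * Z\<^sup>2 / F"
  proof -
    have "0 \<le> (\<bar>\<beta>\<bar> * F - 2 * Z)\<^sup>2" by simp
    also have "\<dots> = (\<beta>\<^sup>2 * F / 2 + 2 * Z\<^sup>2 / F - 2 * \<bar>\<beta>\<bar> * Z) * (2 * F)"
      using F(1) by (simp add: power2_diff power_mult_distrib field_simps) (simp add: power2_eq_square)
    finally show ?thesis using F(1) by (simp add: zero_le_mult_iff)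
  qed
  have "\<beta>\<^sup>2 * F \<le> 2 * T + 2 * E" using eq a b c d E by linarith
  then show b2: "\<beta>\<^sup>2 \<le> 2 / F * (T + E)" using F(1) by (simp add: field_simps)
  have "(\<Sum>k\<in>I. (\<rho> k)\<^sup>2) \<le> (\<Sum>k\<in>I. 2 * (\<beta> * (h k + v k) + \<rho> k)\<^sup>2 + 2 * \<beta>\<^sup>2 * (h k + v k)\<^sup>2)"
  proof (rule sum_mono)
    fix k
    have "0 \<le> (2 * \<beta> * (h k + v k) + \<rho> k)\<^sup>2" by simp
    then show "(\<rho> k)\<^sup>2 \<le> 2 * (\<beta> * (h k + v k) + \<rho> k)\<^sup>2 + 2 * \<beta>\<^sup>2 * (h k + v k)\<^sup>2"
      by (simp add: power2_eq_square algebra_simps)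
  qed
  also have "\<dots> = 2 * T + 2 * \<beta>\<^sup>2 * (\<Sum>k\<in>I. (h k + v k)\<^sup>2)" by (simp only: T sum.distrib sum_distrib_left)
  also have "2 * \<beta>\<^sup>2 * (\<Sum>k\<in>I. (h k + v k)\<^sup>2) \<le> 2 * (2 / F * (T + E)) * X"
    using b2 X T0 E0 F(1) by (intro mult_mono) (auto intro!: sum_nonneg mult_nonneg_nonneg)
  also have "2 * (2 / F * (T + E)) * X = 4 * X / F * (T + E)" by simp
  finally show "(\<Sum>k\<in>I. (\<rho> k)\<^sup>2) + E \<le> (3 + 4 * X / F) * (T + E)" using T0 E0 by (simp add: distrib_right)
qed

context noisy_loop
begin

lemma w_sum_lower: "\<exists>c>0. \<exists>N0. \<forall>N\<ge>N0. c * real N \<le> (\<Sum>i = 1..N. (w i)\<^sup>2)"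
proof -
  obtain R where R: "0 < R" "(\<lambda>k. (1 / real k) * (\<Sum>i = 1..k. (w i)\<^sup>2)) \<longlonglongrightarrow> R" using w_average by blast
  have "eventually (\<lambda>k. R / 2 < (1 / real k) * (\<Sum>i = 1..k. (w i)\<^sup>2)) sequentially"
    using order_tendstoD(1)[OF R(2), of "R / 2"] R(1) by simp
  then obtain N0 where N0: "\<And>k. k \<ge> N0 \<Longrightarrow> R / 2 < (1 / real k) * (\<Sum>i = 1..k. (w i)\<^sup>2)"
    by (auto simp: eventually_sequentially)
  have "R / 2 * real N \<le> (\<Sum>i = 1..N. (w i)\<^sup>2)" if "N \<ge> max 1 N0" for N
    using N0[of N] that by (simp add: field_simps)
  then show ?thesis using R(1) by (intro exI[of _ "R / 2"] conjI exI[of _ "max 1 N0"]) auto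
qed

lemma regressor_sums_le:
  assumes "n \<le> N"
  shows "j < p \<Longrightarrow> (\<Sum>k<n. (y (int (Suc k) - int j))\<^sup>2) \<le> r N"
    and "j < q \<Longrightarrow> (\<Sum>k<n. (u (int (Suc k) - int j))\<^sup>2) \<le> r N"
proof -
  have *: "(\<Sum>k<n. (\<phi> (Suc k) i)\<^sup>2) \<le> r N" if i: "i < d" for i
  proof -
    have "(\<Sum>k<n. (\<phi> (Suc k) i)\<^sup>2) \<le> (\<Sum>k<n. dot d (\<phi> (Suc k)) (\<phi> (Suc k)))"
      by (intro sum_mono component_sq_le_dot i)
    also have "\<dots> = (\<Sum>k\<in>Suc ` {..<n}. dot d (\<phi> k) (\<phi> k))" by (subst sum.reindex) simp_all
    also have "\<dots> \<le> (\<Sum>k = 1..N. dot d (\<phi> k) (\<phi> k))" using assms by (intro sum_mono2) (auto simp: dot_nonneg)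
    finally show ?thesis by (simp add: r_eq)
  qed
  show "j < p \<Longrightarrow> (\<Sum>k<n. (y (int (Suc k) - int j))\<^sup>2) \<le> r N" using *[of j] by (simp add: \<phi>_y d_def)
  show "j < q \<Longrightarrow> (\<Sum>k<n. (u (int (Suc k) - int j))\<^sup>2) \<le> r N" using *[of "p + j"] by (simp add: \<phi>_u d_def)
qed

text \<open>One \<open>X\<close> dominates the energies of all integrands. The multiple 2 of
  \<open>r N\<close> and the term linear in \<open>N\<close> come from the input without its
  excitation, whose square is at most twice that of the input plus a constant.\<close>

lemma cross_bounds:
  "\<exists>C\<ge>1. \<forall>N X n. 1 + 2 * r N + C * real N \<le> X \<longrightarrow> n \<le> N \<longrightarrow>
     (\<forall>j<p. \<bar>\<Sum>k<n. y (int (Suc k) - int j) * w (k + 2)\<bar> \<le> C * X powr (3/4)) \<and>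
     (\<forall>j<q. \<bar>\<Sum>k<n. u (int (Suc k) - int j) * w (k + 2)\<bar> \<le> C * X powr (3/4)) \<and>
     (\<forall>j<p. \<bar>\<Sum>k<n. y (int (Suc k) - int j) * f (Suc k)\<bar> \<le> C * X powr (3/4)) \<and>
     (\<forall>j<q. j \<ge> 1 \<longrightarrow> \<bar>\<Sum>k<n. u (int (Suc k) - int j) * f (Suc k)\<bar> \<le> C * X powr (3/4)) \<and>
     \<bar>\<Sum>k<n. (u (int (Suc k)) - f (Suc k)) * f (Suc k)\<bar> \<le> C * X powr (3/4)"
proof -
  let ?y = "\<lambda>j k. y (int (Suc k) - int j)" and ?u = "\<lambda>j k. u (int (Suc k) - int j)"
  obtain Cf where Cf: "1 \<le> Cf" "\<And>k. \<bar>f k\<bar> \<le> Cf" using f_bounded by blast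
  obtain A1 where A1: "0 \<le> A1" "\<And>j n. j < p \<Longrightarrow> \<bar>\<Sum>k<n. ?y j k * w (k + 2)\<bar> \<le> A1 * (1 + (\<Sum>k<n. (?y j k)\<^sup>2)) powr (3/4)"
    using uniform_constant[of p "\<lambda>j n. \<bar>\<Sum>k<n. ?y j k * w (k + 2)\<bar>" "\<lambda>j n. (1 + (\<Sum>k<n. (?y j k)\<^sup>2)) powr (3/4)"] noise_y by auto
  obtain A2 where A2: "0 \<le> A2" "\<And>j n. j < q \<Longrightarrow> \<bar>\<Sum>k<n. ?u j k * w (k + 2)\<bar> \<le> A2 * (1 + (\<Sum>k<n. (?u j k)\<^sup>2)) powr (3/4)"
    using uniform_constant[of q "\<lambda>j n. \<bar>\<Sum>k<n. ?u j k * w (k + 2)\<bar>" "\<lambda>j n. (1 + (\<Sum>k<n. (?u j k)\<^sup>2)) powr (3/4)"] noise_u by auto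
  obtain A3 where A3: "0 \<le> A3" "\<And>j n. j < p \<Longrightarrow> \<bar>\<Sum>k<n. ?y j k * f (Suc k)\<bar> \<le> A3 * (1 + (\<Sum>k<n. (?y j k)\<^sup>2)) powr (3/4)"
    using uniform_constant[of p "\<lambda>j n. \<bar>\<Sum>k<n. ?y j k * f (Suc k)\<bar>" "\<lambda>j n. (1 + (\<Sum>k<n. (?y j k)\<^sup>2)) powr (3/4)"] excitation_y by auto
  have "\<exists>C\<ge>0. \<forall>j<q. \<forall>n. (if j \<ge> 1 then \<bar>\<Sum>k<n. ?u j k * f (Suc k)\<bar> else 0) \<le> C * (1 + (\<Sum>k<n. (?u j k)\<^sup>2)) powr (3/4)"
  proof (rule uniform_constant)
    show "\<exists>C\<ge>0. \<forall>n. (if j \<ge> 1 then \<bar>\<Sum>k<n. ?u j k * f (Suc k)\<bar> else 0) \<le> C * (1 + (\<Sum>k<n. (?u j k)\<^sup>2)) powr (3/4)" for j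
      using excitation_u[of j] by (cases "j \<ge> 1") auto
  qed simp
  then obtain A4 where A4: "0 \<le> A4" and A4': "\<And>j n. j < q \<Longrightarrow> (if j \<ge> 1 then \<bar>\<Sum>k<n. ?u j k * f (Suc k)\<bar> else 0) \<le> A4 * (1 + (\<Sum>k<n. (?u j k)\<^sup>2)) powr (3/4)"
    by blast
  have A4q: "\<bar>\<Sum>k<n. ?u j k * f (Suc k)\<bar> \<le> A4 * (1 + (\<Sum>k<n. (?u j k)\<^sup>2)) powr (3/4)" if "j < q" "j \<ge> 1" for j n
    using A4'[OF that(1), of n] that(2) by simp
  obtain A5 where A5: "0 \<le> A5" "\<And>n. \<bar>\<Sum>k<n. (u (int (Suc k)) - f (Suc k)) * f (Suc k)\<bar> \<le> A5 * (1 + (\<Sum>k<n. (u (int (Suc k)) - f (Suc k))\<^sup>2)) powr (3/4)"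
    using excitation_u0 by auto
  define C where "C = 1 + A1 + A2 + A3 + A4 + A5 + 2 * Cf\<^sup>2"
  have C: "A1 \<le> C" "A2 \<le> C" "A3 \<le> C" "A4 \<le> C" "A5 \<le> C" "2 * Cf\<^sup>2 \<le> C" "1 \<le> C"
    using A1(1) A2(1) A3(1) A4 A5(1) zero_le_power2[of Cf] by (auto simp: C_def)
  show ?thesis
  proof (rule exI[of _ C], intro conjI allI impI)
    fix N X n assume X: "1 + 2 * r N + C * real N \<le> X" and n: "n \<le> N"
    have rX: "1 + r N \<le> X" using X r_ge_1[of N] C mult_nonneg_nonneg[of C "real N"] by linarith
    have bd: "A \<le> C * X powr (3/4)" if "A \<le> A' * (1 + s) powr (3/4)" "A' \<le> C" "0 \<le> A'" "0 \<le> s" "1 + s \<le> X" for A A' s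
    proof -
      have "A' * (1 + s) powr (3/4) \<le> C * X powr (3/4)" using that C by (intro mult_mono powr_mono2) auto
      then show ?thesis using that by linarith
    qed
    note rs = regressor_sums_le[OF n]
    show "\<bar>\<Sum>k<n. ?y j k * w (k + 2)\<bar> \<le> C * X powr (3/4)" if "j < p" for j
      by (rule bd[OF A1(2)[OF that] C(1) A1(1)]) (use rs(1)[OF that] rX in \<open>auto intro: sum_nonneg\<close>)
    show "\<bar>\<Sum>k<n. ?u j k * w (k + 2)\<bar> \<le> C * X powr (3/4)" if "j < q" for j
      by (rule bd[OF A2(2)[OF that] C(2) A2(1)]) (use rs(2)[OF that] rX in \<open>auto intro: sum_nonneg\<close>)
    show "\<bar>\<Sum>k<n. ?y j k * f (Suc k)\<bar> \<le> C * X powr (3/4)" if "j < p" for j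
      by (rule bd[OF A3(2)[OF that] C(3) A3(1)]) (use rs(1)[OF that] rX in \<open>auto intro: sum_nonneg\<close>)
    show "\<bar>\<Sum>k<n. ?u j k * f (Suc k)\<bar> \<le> C * X powr (3/4)" if "j < q" "j \<ge> 1" for j
      by (rule bd[OF A4q[OF that] C(4) A4]) (use rs(2)[OF that(1)] rX in \<open>auto intro: sum_nonneg\<close>)
    show "\<bar>\<Sum>k<n. (u (int (Suc k)) - f (Suc k)) * f (Suc k)\<bar> \<le> C * X powr (3/4)"
    proof (rule bd[OF A5(2) C(5) A5(1)])
      have "(\<Sum>k<n. (u (int (Suc k)) - f (Suc k))\<^sup>2) \<le> (\<Sum>k<n. 2 * (u (int (Suc k)))\<^sup>2 + 2 * Cf\<^sup>2)"
      proof (rule sum_mono)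
        fix k
        have "(f (Suc k))\<^sup>2 \<le> Cf\<^sup>2" using Cf(2)[of "Suc k"] Cf(1) by (simp add: abs_le_square_iff[symmetric])
        moreover have "0 \<le> (u (int (Suc k)) + f (Suc k))\<^sup>2" by simp
        ultimately show "(u (int (Suc k)) - f (Suc k))\<^sup>2 \<le> 2 * (u (int (Suc k)))\<^sup>2 + 2 * Cf\<^sup>2"
          unfolding power2_diff power2_sum by linarith
      qed
      also have "\<dots> = 2 * (\<Sum>k<n. (u (int (Suc k)))\<^sup>2) + 2 * Cf\<^sup>2 * real n" by (simp add: sum.distrib sum_distrib_left)
      also have "\<dots> \<le> 2 * r N + C * real N"
        using rs(2)[of 0] q1 mult_mono[OF C(6), of "real n" "real N"] n C by auto
      finally show "1 + (\<Sum>k<n. (u (int (Suc k)) - f (Suc k))\<^sup>2) \<le> X" using X by linarith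
    qed (auto intro: sum_nonneg)
  qed (rule C(7))
qed

text \<open>At each lag first the input and then the output is peeled off, at the cost of a factor
  \<open>\<kappa>u\<close> and \<open>\<kappa>w\<close> respectively. Every squared coefficient of a
  unit vector is thereby bounded by a multiple of the initial total, which cannot be small since the
  squares add up to 1. The quantities are introduced by equations so that their orders can be
  inserted later.\<close>

lemma excitation_raw:
  defines "m \<equiv> max p q"
  shows "\<exists>C\<ge>1. \<exists>c>0. \<exists>N1. \<forall>N\<ge>N1. \<forall>X Fu Fw Z E \<kappa>u \<kappa>w x. 1 + 2 * r N + C * real N \<le> X \<longrightarrow> dot d x x = 1 \<longrightarrow>
     Fu = real N / 4 / X powr \<epsilon> \<longrightarrow> Fw = c * real N \<longrightarrow> Z = C * X powr (3/4) \<longrightarrow> E = 2 * Z\<^sup>2 / Fu + 2 * Z\<^sup>2 / Fw \<longrightarrow>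
     \<kappa>u = 3 + 4 * X / Fu \<longrightarrow> \<kappa>w = 3 + 4 * X / Fw \<longrightarrow>
     2 * X / (real d * (\<kappa>w ^ m * \<kappa>u ^ q)) \<le> (\<Sum>k = 1..N. (dot d x (\<phi> k))\<^sup>2) + E"
proof -
  obtain Cx where Cx: "1 \<le> Cx" and cross: "\<forall>N X n. 1 + 2 * r N + Cx * real N \<le> X \<longrightarrow> n \<le> N \<longrightarrow>
     (\<forall>j<p. \<bar>\<Sum>k<n. y (int (Suc k) - int j) * w (k + 2)\<bar> \<le> Cx * X powr (3/4)) \<and>
     (\<forall>j<q. \<bar>\<Sum>k<n. u (int (Suc k) - int j) * w (k + 2)\<bar> \<le> Cx * X powr (3/4)) \<and>
     (\<forall>j<p. \<bar>\<Sum>k<n. y (int (Suc k) - int j) * f (Suc k)\<bar> \<le> Cx * X powr (3/4)) \<and>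
     (\<forall>j<q. j \<ge> 1 \<longrightarrow> \<bar>\<Sum>k<n. u (int (Suc k) - int j) * f (Suc k)\<bar> \<le> Cx * X powr (3/4)) \<and>
     \<bar>\<Sum>k<n. (u (int (Suc k)) - f (Suc k)) * f (Suc k)\<bar> \<le> Cx * X powr (3/4)"
    using cross_bounds by blast
  obtain cw Nw where cw: "0 < cw" "\<And>N. N \<ge> Nw \<Longrightarrow> cw * real N \<le> (\<Sum>i = 1..N. (w i)\<^sup>2)" using w_sum_lower by blast
  obtain Nv where Nv: "\<And>N. N \<ge> Nv \<Longrightarrow> real N / 2 \<le> (\<Sum>k = 1..N. (w' k)\<^sup>2)" using w'_average by blast
  define \<Theta> where "\<Theta> = (\<Sum>l<d. \<bar>\<theta> l\<bar>)"
  have \<Theta>: "0 \<le> \<Theta>" by (simp add: \<Theta>_def sum_nonneg)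
  \<comment> \<open>A lagged window is a difference of two partial sums, hence the factor 2.
    \<open>\<Theta>\<close> accounts for the regressor inside an output, \<open>real d\<close> for
    the older components, and 2 for those of the current lag.\<close>
  define D where "D = (\<Theta> + real d + 2) * (2 * Cx)"
  have DC: "Cx \<le> D" using \<Theta> Cx mult_right_mono[of 1 "\<Theta> + real d + 1" "2 * Cx"] by (simp add: D_def)
  have D1: "1 \<le> D" using DC Cx by simp
  define Kw where "Kw = (\<Sum>i = 1..m. (w i)\<^sup>2)"
  define Kv where "Kv = (\<Sum>i = 1..m. (w' i)\<^sup>2)"
  \<comment> \<open>From here on windows that start after \<open>m\<close> and are shifted by up to
    \<open>m\<close> retain half of the guaranteed energy of excitation and noise.\<close>
  obtain Nk where Nk: "real m / 2 + Kv \<le> real Nk / 4" "cw * real m + Kw \<le> cw / 2 * real Nk"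
  proof -
    obtain k1 :: nat where k1: "(real m / 2 + Kv) * 4 \<le> real k1" using real_arch_simple by blast
    obtain k2 :: nat where k2: "(cw * real m + Kw) / (cw / 2) \<le> real k2" using real_arch_simple by blast
    show ?thesis
    proof (rule that[of "max k1 k2"])
      show "real m / 2 + Kv \<le> real (max k1 k2) / 4" using k1 by simp
      have "(cw * real m + Kw) / (cw / 2) \<le> real (max k1 k2)" using k2 by simp
      then show "cw * real m + Kw \<le> cw / 2 * real (max k1 k2)" using cw(1) by (simp add: divide_le_eq mult.commute)
    qed
  qed
  define N1 where "N1 = Suc (Nw + Nv + Nk + m)"
  have win: "(\<Sum>k = Suc m..N. g (k - j)) = (\<Sum>k = m - j..<N - j. g (Suc k))" if "j \<le> m" "m \<le> N" for g :: "nat \<Rightarrow> real" and N j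
    by (rule sum.reindex_bij_witness[of _ "\<lambda>k. Suc k + j" "\<lambda>k. k - j - 1"]) (use that in \<open>auto simp: Suc_diff_Suc\<close>)
  have win2: "(\<Sum>k = Suc m..N. g (k - j)) = (\<Sum>k = m - j - 1..<N - j - 1. g (k + 2))" if "j < m" "m \<le> N" for g :: "nat \<Rightarrow> real" and N j
    by (rule sum.reindex_bij_witness[of _ "\<lambda>k. k + 2 + j" "\<lambda>k. k - j - 2"]) (use that in \<open>auto simp: Suc_diff_Suc\<close>)
  have low: "L - Kg \<le> (\<Sum>k = Suc m..N. g (k - j))"
    if j: "j \<le> m" "m \<le> N" and g: "\<And>i. 0 \<le> g i" and L: "L \<le> (\<Sum>i = 1..N - j. g i)" and Kg: "(\<Sum>i = 1..m. g i) = Kg" for g :: "nat \<Rightarrow> real" and N j L Kg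
  proof -
    have "(\<Sum>i = 1..N - j. g i) = (\<Sum>k<N - j. g (Suc k))" by (rule sum.reindex_bij_witness[of _ Suc "\<lambda>k. k - 1"]) auto
    also have "\<dots> = (\<Sum>k<m - j. g (Suc k)) + (\<Sum>k = m - j..<N - j. g (Suc k))"
      using j by (simp add: lessThan_atLeast0 sum.atLeastLessThan_concat)
    also have "(\<Sum>k<m - j. g (Suc k)) \<le> (\<Sum>k<m. g (Suc k))" using g by (intro sum_mono2) auto
    also have "(\<Sum>k<m. g (Suc k)) = (\<Sum>i = 1..m. g i)" by (rule sum.reindex_bij_witness[of _ "\<lambda>k. k - 1" Suc]) auto
    finally show ?thesis using L Kg unfolding win[OF j] by linarith
  qed
  have main: "2 * X / (real d * (\<kappa>w ^ m * \<kappa>u ^ q)) \<le> (\<Sum>k = 1..N. (dot d x (\<phi> k))\<^sup>2) + E"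
    if N: "N \<ge> N1" and X: "1 + 2 * r N + D * real N \<le> X" and unit: "dot d x x = 1"
      and Fu: "Fu = real N / 4 / X powr \<epsilon>" and Fw: "Fw = cw / 2 * real N" and Z: "Z = D * X powr (3/4)"
      and E: "E = 2 * Z\<^sup>2 / Fu + 2 * Z\<^sup>2 / Fw" and \<kappa>u: "\<kappa>u = 3 + 4 * X / Fu" and \<kappa>w: "\<kappa>w = 3 + 4 * X / Fw"
    for N X Fu Fw Z E \<kappa>u \<kappa>w x
  proof -
    define XC where "XC = Cx * X powr (3/4)"
    have Nm: "m \<le> N" "0 < N" "N \<ge> Nk" "N - m \<ge> Nw" "N - m \<ge> Nv" using N by (auto simp: N1_def)
    have XN: "1 + 2 * r N + Cx * real N \<le> X" using X mult_right_mono[OF DC, of "real N"] by simp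
    have X0: "0 < X" "r N \<le> X" using XN r_ge_1[of N] Cx mult_nonneg_nonneg[of Cx "real N"] by linarith+
    have Fu0: "0 < Fu" using Nm X0 by (simp add: Fu)
    have Fw0: "0 < Fw" using Nm cw by (simp add: Fw)
    have XC0: "0 \<le> XC" using Cx by (simp add: XC_def)
    have Z0: "0 \<le> Z" using D1 by (simp add: Z)
    have ZXC: "Z = (\<Theta> + real d + 2) * (2 * XC)" by (simp add: Z D_def XC_def)
    have E2: "2 * Z\<^sup>2 / Fu \<le> E" "2 * Z\<^sup>2 / Fw \<le> E" using Fu0 Fw0 by (auto simp: E)
    have E0: "0 \<le> E" using Fu0 Fw0 by (simp add: E)
    have \<kappa>1: "1 \<le> \<kappa>u" "1 \<le> \<kappa>w" "2 / Fu \<le> \<kappa>u / (2 * X)" "2 / Fw \<le> \<kappa>w / (2 * X)"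
      using Fu0 Fw0 X0 by (auto simp: \<kappa>u \<kappa>w add_divide_distrib)
    define \<alpha>' where "\<alpha>' i = (if i < p then x i else 0)" for i
    define \<beta>' where "\<beta>' i = (if i < q then x (p + i) else 0)" for i
    have x1: "\<bar>x i\<bar> \<le> 1" if "i < d" for i
      using component_sq_le_dot[OF that, of x] unit by (simp add: abs_square_le_1)
    have ab1: "\<bar>\<alpha>' i\<bar> \<le> 1" "\<bar>\<beta>' i\<bar> \<le> 1" for i using x1[of i] x1[of "p + i"] by (auto simp: \<alpha>'_def \<beta>'_def d_def)
    \<comment> \<open>What remains of the linear combination once all lags below \<open>j\<close>
      have been removed.\<close>
    define sr where "sr j k = (\<Sum>i = j..<m. \<alpha>' i * y (int k - int i) + \<beta>' i * u (int k - int i))" for j k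
    define T where "T j = (\<Sum>k = Suc m..N. (sr j k)\<^sup>2)" for j
    have sr_step: "sr j k = \<beta>' j * u (int k - int j) + (\<alpha>' j * y (int k - int j) + sr (Suc j) k)" if "j < m" for j k
      using that by (simp add: sr_def sum.atLeast_Suc_lessThan)
    have T0: "T 0 \<le> (\<Sum>k = 1..N. (dot d x (\<phi> k))\<^sup>2)"
    proof -
      have "sr 0 k = dot d x (\<phi> k)" for k
      proof -
        have "dot d x (\<phi> k) = (\<Sum>i<p. x i * y (int k - int i)) + (\<Sum>i<q. x (p + i) * u (int k - int i))"
          unfolding dot_def sum_split_d by (intro arg_cong2[of _ _ _ _ "(+)"] sum.cong refl) (auto simp: \<phi>_y \<phi>_u d_def)
        also have "(\<Sum>i<p. x i * y (int k - int i)) = (\<Sum>i = 0..<m. \<alpha>' i * y (int k - int i))"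
          by (rule sum.mono_neutral_cong_left) (auto simp: \<alpha>'_def m_def)
        also have "(\<Sum>i<q. x (p + i) * u (int k - int i)) = (\<Sum>i = 0..<m. \<beta>' i * u (int k - int i))"
          by (rule sum.mono_neutral_cong_left) (auto simp: \<beta>'_def m_def)
        finally show ?thesis by (simp add: sr_def sum.distrib)
      qed
      then show ?thesis unfolding T_def by (simp only:) (intro sum_mono2, auto)
    qed
    have crYW: "\<bar>\<Sum>k<n. y (int (Suc k) - int j) * w (k + 2)\<bar> \<le> XC" if "n \<le> N" "j < p" for n j
      using cross XN that unfolding XC_def by blast
    have crUW: "\<bar>\<Sum>k<n. u (int (Suc k) - int j) * w (k + 2)\<bar> \<le> XC" if "n \<le> N" "j < q" for n j
      using cross XN that unfolding XC_def by blast
    have crYF: "\<bar>\<Sum>k<n. y (int (Suc k) - int j) * f (Suc k)\<bar> \<le> XC" if "n \<le> N" "j < p" for n j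
      using cross XN that unfolding XC_def by blast
    have crUF: "\<bar>\<Sum>k<n. u (int (Suc k) - int j) * f (Suc k)\<bar> \<le> XC" if "n \<le> N" "j < q" "j \<ge> 1" for n j
      using cross XN that unfolding XC_def by blast
    have crU0: "\<bar>\<Sum>k<n. (u (int (Suc k)) - f (Suc k)) * f (Suc k)\<bar> \<le> XC" if "n \<le> N" for n
      using cross XN that unfolding XC_def by blast
    have yf: "\<bar>\<Sum>k = Suc m..N. f (k - j) * y (int k - int i)\<bar> \<le> 2 * XC" if "j \<le> i" "i < p" "j < m" for i j
    proof -
      have "(\<Sum>k = Suc m..N. f (k - j) * y (int k - int i)) = (\<Sum>k = Suc m..N. (\<lambda>k'. y (int k' - int (i - j)) * f k') (k - j))"
        using that by (intro sum.cong) (auto simp: of_nat_diff algebra_simps)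
      also have "\<dots> = (\<Sum>k = m - j..<N - j. y (int (Suc k) - int (i - j)) * f (Suc k))" using that Nm by (subst win) auto
      also have "\<bar>\<dots>\<bar> \<le> 2 * XC"
        by (rule abs_sum_window_le, rule crYF) (use that Nm in auto)
      finally show ?thesis .
    qed
    have uf: "\<bar>\<Sum>k = Suc m..N. f (k - j) * u (int k - int i)\<bar> \<le> 2 * XC" if "j < i" "i < q" "j < m" for i j
    proof -
      have "(\<Sum>k = Suc m..N. f (k - j) * u (int k - int i)) = (\<Sum>k = Suc m..N. (\<lambda>k'. u (int k' - int (i - j)) * f k') (k - j))"
        using that by (intro sum.cong) (auto simp: of_nat_diff algebra_simps)
      also have "\<dots> = (\<Sum>k = m - j..<N - j. u (int (Suc k) - int (i - j)) * f (Suc k))" using that Nm by (subst win) auto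
      also have "\<bar>\<dots>\<bar> \<le> 2 * XC"
        by (rule abs_sum_window_le, rule crUF) (use that Nm in auto)
      finally show ?thesis .
    qed
    have u0f: "\<bar>\<Sum>k = Suc m..N. f (k - j) * (u (int k - int j) - f (k - j))\<bar> \<le> 2 * XC" if "j < m" for j
    proof -
      have "(\<Sum>k = Suc m..N. f (k - j) * (u (int k - int j) - f (k - j))) = (\<Sum>k = Suc m..N. (\<lambda>k'. (u (int k') - f k') * f k') (k - j))"
        using that by (intro sum.cong) (auto simp: of_nat_diff algebra_simps)
      also have "\<dots> = (\<Sum>k = m - j..<N - j. (u (int (Suc k)) - f (Suc k)) * f (Suc k))" using that Nm by (subst win) auto
      also have "\<bar>\<dots>\<bar> \<le> 2 * XC"
        by (rule abs_sum_window_le, rule crU0) (use that Nm in auto)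
      finally show ?thesis .
    qed
    have yw: "\<bar>\<Sum>k = Suc m..N. w (k - j) * y (int k - int i)\<bar> \<le> 2 * XC" if "j < i" "i \<le> j + p" "j < m" for i j
    proof -
      have "(\<Sum>k = Suc m..N. w (k - j) * y (int k - int i)) = (\<Sum>k = Suc m..N. (\<lambda>k'. y (int k' - int (i - j)) * w k') (k - j))"
        using that by (intro sum.cong) (auto simp: of_nat_diff algebra_simps)
      also have "\<dots> = (\<Sum>k = m - j - 1..<N - j - 1. y (int (k + 2) - int (i - j)) * w (k + 2))" using that Nm by (subst win2) auto
      also have "\<dots> = (\<Sum>k = m - j - 1..<N - j - 1. y (int (Suc k) - int (i - j - 1)) * w (k + 2))"
        using that by (intro sum.cong) (auto simp: of_nat_diff algebra_simps)
      also have "\<bar>\<dots>\<bar> \<le> 2 * XC"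
        by (rule abs_sum_window_le, rule crYW) (use that Nm in auto)
      finally show ?thesis .
    qed
    have uw: "\<bar>\<Sum>k = Suc m..N. w (k - j) * u (int k - int i)\<bar> \<le> 2 * XC" if "j < i" "i \<le> j + q" "j < m" for i j
    proof -
      have "(\<Sum>k = Suc m..N. w (k - j) * u (int k - int i)) = (\<Sum>k = Suc m..N. (\<lambda>k'. u (int k' - int (i - j)) * w k') (k - j))"
        using that by (intro sum.cong) (auto simp: of_nat_diff algebra_simps)
      also have "\<dots> = (\<Sum>k = m - j - 1..<N - j - 1. u (int (k + 2) - int (i - j)) * w (k + 2))" using that Nm by (subst win2) auto
      also have "\<dots> = (\<Sum>k = m - j - 1..<N - j - 1. u (int (Suc k) - int (i - j - 1)) * w (k + 2))"
        using that by (intro sum.cong) (auto simp: of_nat_diff algebra_simps)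
      also have "\<bar>\<dots>\<bar> \<le> 2 * XC"
        by (rule abs_sum_window_le, rule crUW) (use that Nm in auto)
      finally show ?thesis .
    qed
    have lag: "(\<Sum>k = Suc m..N. (g (int k - int j))\<^sup>2) \<le> (\<Sum>k<N. (g (int (Suc k) - int 0))\<^sup>2)" if "j < m" for g :: "int \<Rightarrow> real" and j
    proof -
      have "(\<Sum>k = Suc m..N. (g (int k - int j))\<^sup>2) = (\<Sum>k = Suc m..N. (\<lambda>k'. (g (int k'))\<^sup>2) (k - j))"
        using that by (intro sum.cong) (auto simp: of_nat_diff)
      also have "\<dots> = (\<Sum>k = m - j..<N - j. (g (int (Suc k)))\<^sup>2)" using that Nm by (subst win) auto
      also have "\<dots> \<le> (\<Sum>k<N. (g (int (Suc k)))\<^sup>2)" by (intro sum_mono2) auto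
      finally show ?thesis by simp
    qed
    \<comment> \<open>All components from lag \<open>j'\<close> on are tested against the fresh part
      \<open>h\<close> one by one; the coefficients of a unit vector are at most 1.\<close>
    have old: "\<bar>\<Sum>k = Suc m..N. h k * (\<Sum>i = j'..<m. \<alpha>' i * y (int k - int i) + \<beta>' i * u (int k - int i))\<bar> \<le> real d * (2 * XC)"
      if hy: "\<And>i. j' \<le> i \<Longrightarrow> i < p \<Longrightarrow> \<bar>\<Sum>k = Suc m..N. h k * y (int k - int i)\<bar> \<le> 2 * XC"
        and hu: "\<And>i. j' \<le> i \<Longrightarrow> i < q \<Longrightarrow> \<bar>\<Sum>k = Suc m..N. h k * u (int k - int i)\<bar> \<le> 2 * XC" for h :: "nat \<Rightarrow> real" and j'
    proof -
      have eq: "(\<Sum>k = Suc m..N. h k * (\<Sum>i = j'..<m. \<alpha>' i * y (int k - int i) + \<beta>' i * u (int k - int i)))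
          = (\<Sum>i = j'..<m. \<alpha>' i * (\<Sum>k = Suc m..N. h k * y (int k - int i))) + (\<Sum>i = j'..<m. \<beta>' i * (\<Sum>k = Suc m..N. h k * u (int k - int i)))"
        unfolding sum_distrib_left by (subst sum.swap) (simp only: sum.distrib[symmetric] distrib_left mult_ac)
      have "\<bar>\<Sum>i = j'..<m. \<alpha>' i * (\<Sum>k = Suc m..N. h k * y (int k - int i))\<bar> \<le> (\<Sum>i<p. 2 * XC)"
      proof -
        have "\<bar>\<Sum>i = j'..<m. \<alpha>' i * (\<Sum>k = Suc m..N. h k * y (int k - int i))\<bar>
            \<le> (\<Sum>i = j'..<m. \<bar>\<alpha>' i * (\<Sum>k = Suc m..N. h k * y (int k - int i))\<bar>)" by (rule sum_abs)
        also have "\<dots> \<le> (\<Sum>i = j'..<m. if i < p then 2 * XC else 0)"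
        proof (rule sum_mono)
          fix i assume i: "i \<in> {j'..<m}"
          show "\<bar>\<alpha>' i * (\<Sum>k = Suc m..N. h k * y (int k - int i))\<bar> \<le> (if i < p then 2 * XC else 0)"
            using hy[of i] ab1(1)[of i] i XC0 mult_mono[of "\<bar>\<alpha>' i\<bar>" 1 "\<bar>\<Sum>k = Suc m..N. h k * y (int k - int i)\<bar>" "2 * XC"]
            by (auto simp: abs_mult) (simp add: \<alpha>'_def)
        qed
        also have "\<dots> = (\<Sum>i\<in>{i\<in>{j'..<m}. i < p}. 2 * XC)" by (rule sum.inter_filter[symmetric]) simp
        also have "\<dots> \<le> (\<Sum>i<p. 2 * XC)" by (intro sum_mono2) (use XC0 in auto)
        finally show ?thesis .
      qed
      moreover have "\<bar>\<Sum>i = j'..<m. \<beta>' i * (\<Sum>k = Suc m..N. h k * u (int k - int i))\<bar> \<le> (\<Sum>i<q. 2 * XC)"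
      proof -
        have "\<bar>\<Sum>i = j'..<m. \<beta>' i * (\<Sum>k = Suc m..N. h k * u (int k - int i))\<bar>
            \<le> (\<Sum>i = j'..<m. \<bar>\<beta>' i * (\<Sum>k = Suc m..N. h k * u (int k - int i))\<bar>)" by (rule sum_abs)
        also have "\<dots> \<le> (\<Sum>i = j'..<m. if i < q then 2 * XC else 0)"
        proof (rule sum_mono)
          fix i assume i: "i \<in> {j'..<m}"
          show "\<bar>\<beta>' i * (\<Sum>k = Suc m..N. h k * u (int k - int i))\<bar> \<le> (if i < q then 2 * XC else 0)"
            using hu[of i] ab1(2)[of i] i XC0 mult_mono[of "\<bar>\<beta>' i\<bar>" 1 "\<bar>\<Sum>k = Suc m..N. h k * u (int k - int i)\<bar>" "2 * XC"]
            by (auto simp: abs_mult) (simp add: \<beta>'_def)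
        qed
        also have "\<dots> = (\<Sum>i\<in>{i\<in>{j'..<m}. i < q}. 2 * XC)" by (rule sum.inter_filter[symmetric]) simp
        also have "\<dots> \<le> (\<Sum>i<q. 2 * XC)" by (intro sum_mono2) (use XC0 in auto)
        finally show ?thesis .
      qed
      ultimately show ?thesis unfolding eq by (simp add: d_def algebra_simps)
    qed
    have u_step: "(\<beta>' j)\<^sup>2 \<le> 2 / Fu * (T j + E)"
      "(\<Sum>k = Suc m..N. (\<alpha>' j * y (int k - int j) + sr (Suc j) k)\<^sup>2) + E \<le> \<kappa>u * (T j + E)" if j: "j < q" for j
    proof -
      have jm: "j < m" using j by (simp add: m_def)
      let ?\<rho> = "\<lambda>k. \<alpha>' j * y (int k - int j) + sr (Suc j) k"
      \<comment> \<open>The fresh part of the input is its excitation; the rest is the certainty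
        equivalence control.\<close>
      let ?v = "\<lambda>k. u (int k - int j) - f (k - j)"
      have F: "Fu \<le> (\<Sum>k = Suc m..N. (f (k - j))\<^sup>2)"
      proof -
        have wf: "(w' (k - j))\<^sup>2 / X powr \<epsilon> \<le> (f (k - j))\<^sup>2" if k: "k \<in> {Suc m..N}" for k
        proof -
          have "k - j - 1 \<le> N" using k by auto
          then have "r (k - j - 1) \<le> X" by (rule order_trans[OF r_mono X0(2)])
          then have "r (k - j - 1) powr \<epsilon> \<le> X powr \<epsilon>"
            using r_ge_1[of "k - j - 1"] eps0 by (intro powr_mono2) auto
          moreover have "(f (k - j))\<^sup>2 = (w' (k - j))\<^sup>2 / r (k - j - 1) powr \<epsilon>"
            by (simp add: f_def power_divide) (simp add: power2_eq_square powr_add[symmetric])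
          moreover have "0 < r (k - j - 1) powr \<epsilon>" using r_ge_1[of "k - j - 1"] by simp
          ultimately show ?thesis using X0(1) by (simp only:) (intro divide_left_mono mult_pos_pos, auto)
        qed
        have "real (N - j) / 2 - Kv \<le> (\<Sum>k = Suc m..N. (w' (k - j))\<^sup>2)"
          by (rule low) (use jm Nm Nv[of "N - j"] in \<open>auto simp: Kv_def\<close>)
        moreover have "real N / 4 \<le> real (N - j) / 2 - Kv"
        proof -
          have "real (N - j) / 2 = real N / 2 - real j / 2" using jm Nm by (simp add: of_nat_diff diff_divide_distrib)
          moreover have "real Nk \<le> real N" "real j \<le> real m" using Nm jm by auto
          ultimately show ?thesis using Nk(1) by linarith
        qed
        ultimately have "real N / 4 / X powr \<epsilon> \<le> (\<Sum>k = Suc m..N. (w' (k - j))\<^sup>2) / X powr \<epsilon>"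
          by (intro divide_right_mono) auto
        also have "\<dots> \<le> (\<Sum>k = Suc m..N. (f (k - j))\<^sup>2)" unfolding sum_divide_distrib by (intro sum_mono wf)
        finally show ?thesis by (simp add: Fu)
      qed
      have Zb: "\<bar>\<Sum>k = Suc m..N. f (k - j) * (\<beta>' j * ?v k + ?\<rho> k)\<bar> \<le> Z"
      proof -
        have "(\<Sum>k = Suc m..N. f (k - j) * (\<beta>' j * ?v k + ?\<rho> k))
          = \<beta>' j * (\<Sum>k = Suc m..N. f (k - j) * ?v k) + (\<alpha>' j * (\<Sum>k = Suc m..N. f (k - j) * y (int k - int j)) + (\<Sum>k = Suc m..N. f (k - j) * sr (Suc j) k))"
          by (simp only: sum_distrib_left sum.distrib[symmetric] distrib_left mult_ac add_ac)
        moreover have "\<bar>\<Sum>k = Suc m..N. f (k - j) * sr (Suc j) k\<bar> \<le> real d * (2 * XC) - (if j < p then 2 * XC else 0) + (if j < p then 2 * XC else 0)"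
          using old[of "Suc j" "\<lambda>k. f (k - j)"] yf[of j] uf[of j] jm unfolding sr_def by auto
        moreover have "\<bar>\<beta>' j * (\<Sum>k = Suc m..N. f (k - j) * ?v k)\<bar> \<le> 1 * (2 * XC)"
          unfolding abs_mult using ab1 u0f[OF jm] by (intro mult_mono) auto
        moreover have "\<bar>\<alpha>' j * (\<Sum>k = Suc m..N. f (k - j) * y (int k - int j))\<bar> \<le> 1 * (2 * XC)"
        proof (cases "j < p")
          case True then show ?thesis unfolding abs_mult using ab1 yf[OF order_refl True jm] by (intro mult_mono) auto
        next
          case False then show ?thesis using XC0 by (simp add: \<alpha>'_def)
        qed
        ultimately have "\<bar>\<Sum>k = Suc m..N. f (k - j) * (\<beta>' j * ?v k + ?\<rho> k)\<bar> \<le> real d * (2 * XC) + 1 * (2 * XC) + 1 * (2 * XC)" by linarith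
        also have "\<dots> \<le> Z" using \<Theta> XC0 mult_right_mono[of "real d + 2" "\<Theta> + real d + 2" "2 * XC"] by (simp add: ZXC algebra_simps)
        finally show ?thesis .
      qed
      have Xb: "(\<Sum>k = Suc m..N. (f (k - j) + ?v k)\<^sup>2) \<le> X"
        using lag[OF jm, of u] regressor_sums_le(2)[of N N 0] q1 X0 by simp
      have Tb: "T j = (\<Sum>k = Suc m..N. (\<beta>' j * (f (k - j) + ?v k) + ?\<rho> k)\<^sup>2)"
        unfolding T_def sr_step[OF jm] by simp
      show "(\<beta>' j)\<^sup>2 \<le> 2 / Fu * (T j + E)"
        "(\<Sum>k = Suc m..N. (?\<rho> k)\<^sup>2) + E \<le> \<kappa>u * (T j + E)"
        unfolding \<kappa>u
        using peel_step[where h = "\<lambda>k. f (k - j)" and v = ?v and \<rho> = ?\<rho>, OF Fu0 F Zb Xb E2(1) Tb] by auto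
    qed
    define T' where "T' j = (\<Sum>k = Suc m..N. (\<alpha>' j * y (int k - int j) + sr (Suc j) k)\<^sup>2)" for j
    have y_step: "(\<alpha>' j)\<^sup>2 \<le> 2 / Fw * (T' j + E)" "T (Suc j) + E \<le> \<kappa>w * (T' j + E)" if j: "j < p" for j
    proof -
      have jm: "j < m" using j by (simp add: m_def)
      \<comment> \<open>The fresh part of the output is its noise; the rest is the true prediction
        from the regressor one step earlier.\<close>
      let ?v = "\<lambda>k. dot d \<theta> (\<phi> (k - j - 1))"
      have yv: "w (k - j) + ?v k = y (int k - int j)" if k: "k \<in> {Suc m..N}" for k
      proof -
        have "int (k - j - 1) + 1 = int k - int j" "k - j - 1 + 1 = k - j" using k jm by (auto simp: of_nat_diff)
        then show ?thesis using output_eq[of "k - j - 1"] by simp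
      qed
      have F: "Fw \<le> (\<Sum>k = Suc m..N. (w (k - j))\<^sup>2)"
      proof -
        have "cw * real (N - j) - Kw \<le> (\<Sum>k = Suc m..N. (w (k - j))\<^sup>2)"
          by (rule low) (use jm Nm cw(2)[of "N - j"] in \<open>auto simp: Kw_def\<close>)
        moreover have "cw * (real N - real m) \<le> cw * real (N - j)" using cw(1) jm Nm by (intro mult_left_mono) auto
        moreover have "cw / 2 * real Nk \<le> cw / 2 * real N" using cw(1) Nm by (intro mult_left_mono) auto
        ultimately show ?thesis using Nk(2) unfolding Fw right_diff_distrib by linarith
      qed
      have hv: "\<bar>\<Sum>k = Suc m..N. w (k - j) * ?v k\<bar> \<le> \<Theta> * (2 * XC)"
      proof -
        have "(\<Sum>k = Suc m..N. w (k - j) * ?v k) = (\<Sum>l<d. \<theta> l * (\<Sum>k = Suc m..N. w (k - j) * \<phi> (k - j - 1) l))"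
          unfolding dot_def sum_distrib_left by (subst sum.swap) (simp add: mult_ac)
        also have "\<bar>\<dots>\<bar> \<le> (\<Sum>l<d. \<bar>\<theta> l\<bar> * (2 * XC))"
        proof (rule order_trans[OF sum_abs], rule sum_mono)
          fix l assume l: "l \<in> {..<d}"
          have "\<bar>\<Sum>k = Suc m..N. w (k - j) * \<phi> (k - j - 1) l\<bar> \<le> 2 * XC"
          proof (cases "l < p")
            case True
            have "(\<Sum>k = Suc m..N. w (k - j) * \<phi> (k - j - 1) l) = (\<Sum>k = Suc m..N. w (k - j) * y (int k - int (j + 1 + l)))"
              using True jm by (intro sum.cong) (auto simp: \<phi>_y of_nat_diff algebra_simps)
            also have "\<bar>\<dots>\<bar> \<le> 2 * XC" by (rule yw) (use True jm in auto)
            finally show ?thesis .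
          next
            case False
            have "(\<Sum>k = Suc m..N. w (k - j) * \<phi> (k - j - 1) l) = (\<Sum>k = Suc m..N. w (k - j) * u (int k - int (j + 1 + (l - p))))"
              using False l jm by (intro sum.cong) (auto simp: \<phi>_u of_nat_diff algebra_simps)
            also have "\<bar>\<dots>\<bar> \<le> 2 * XC" by (rule uw) (use False l jm in \<open>auto simp: d_def\<close>)
            finally show ?thesis .
          qed
          then show "\<bar>\<theta> l * (\<Sum>k = Suc m..N. w (k - j) * \<phi> (k - j - 1) l)\<bar> \<le> \<bar>\<theta> l\<bar> * (2 * XC)"
            unfolding abs_mult by (intro mult_left_mono) auto
        qed
        finally show ?thesis by (simp add: \<Theta>_def sum_distrib_right)
      qed
      have Zb: "\<bar>\<Sum>k = Suc m..N. w (k - j) * (\<alpha>' j * ?v k + sr (Suc j) k)\<bar> \<le> Z"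
      proof -
        have "(\<Sum>k = Suc m..N. w (k - j) * (\<alpha>' j * ?v k + sr (Suc j) k))
          = \<alpha>' j * (\<Sum>k = Suc m..N. w (k - j) * ?v k) + (\<Sum>k = Suc m..N. w (k - j) * sr (Suc j) k)"
          by (simp only: sum_distrib_left sum.distrib[symmetric] distrib_left mult_ac add_ac)
        moreover have "\<bar>\<Sum>k = Suc m..N. w (k - j) * sr (Suc j) k\<bar> \<le> real d * (2 * XC)"
          unfolding sr_def by (rule old) (rule yw uw, use jm in auto)+
        moreover have "\<bar>\<alpha>' j * (\<Sum>k = Suc m..N. w (k - j) * ?v k)\<bar> \<le> 1 * (\<Theta> * (2 * XC))"
          unfolding abs_mult using ab1 hv by (intro mult_mono) auto
        ultimately have "\<bar>\<Sum>k = Suc m..N. w (k - j) * (\<alpha>' j * ?v k + sr (Suc j) k)\<bar> \<le> real d * (2 * XC) + 1 * (\<Theta> * (2 * XC))" by linarith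
        also have "\<dots> \<le> Z" using XC0 by (simp add: ZXC algebra_simps)
        finally show ?thesis .
      qed
      have Xb: "(\<Sum>k = Suc m..N. (w (k - j) + ?v k)\<^sup>2) \<le> X"
      proof -
        have "(\<Sum>k = Suc m..N. (w (k - j) + ?v k)\<^sup>2) = (\<Sum>k = Suc m..N. (y (int k - int j))\<^sup>2)"
          by (intro sum.cong) (use yv in auto)
        then show ?thesis using lag[OF jm, of y] regressor_sums_le(1)[of N N 0] p1 X0 by simp
      qed
      have Tb: "T' j = (\<Sum>k = Suc m..N. (\<alpha>' j * (w (k - j) + ?v k) + sr (Suc j) k)\<^sup>2)"
        unfolding T'_def by (intro sum.cong) (use yv in auto)
      show "(\<alpha>' j)\<^sup>2 \<le> 2 / Fw * (T' j + E)" "T (Suc j) + E \<le> \<kappa>w * (T' j + E)"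
        unfolding \<kappa>w T_def
        using peel_step[where h = "\<lambda>k. w (k - j)" and v = ?v and \<rho> = "sr (Suc j)", OF Fw0 F Zb Xb E2(2) Tb] by auto
    qed
    define W0 where "W0 = T 0 + E"
    have Tn: "0 \<le> T j" "0 \<le> T' j" for j by (auto simp: T_def T'_def intro: sum_nonneg)
    have W00: "0 \<le> W0" using Tn(1)[of 0] E0 by (simp add: W0_def)
    \<comment> \<open>The state between the two removals at lag \<open>j\<close>. For
      \<open>j \<ge> q\<close> no input is left to remove, so the power of \<open>\<kappa>u\<close>
      stops at \<open>q\<close>.\<close>
    have Y: "T' j + E \<le> \<kappa>w ^ j * \<kappa>u ^ min (Suc j) q * W0" if W: "T j + E \<le> \<kappa>w ^ j * \<kappa>u ^ min j q * W0" and jm: "j < m" for j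
    proof (cases "j < q")
      case True
      have "T' j + E \<le> \<kappa>u * (T j + E)" using u_step(2)[OF True] by (simp add: T'_def)
      also have "\<dots> \<le> \<kappa>u * (\<kappa>w ^ j * \<kappa>u ^ min j q * W0)" using W \<kappa>1 by (intro mult_left_mono) auto
      also have "\<dots> = \<kappa>w ^ j * \<kappa>u ^ min (Suc j) q * W0" using True by (simp add: min_def)
      finally show ?thesis .
    next
      case False
      then have "T j = T' j" unfolding T_def T'_def using sr_step[OF jm] by (simp add: \<beta>'_def)
      moreover have "min (Suc j) q = q" "min j q = q" using False by auto
      ultimately show ?thesis using W by simp
    qed
    have W: "T j + E \<le> \<kappa>w ^ j * \<kappa>u ^ min j q * W0" if "j \<le> m" for j
      using that
    proof (induction j)
      case (Suc j)
      then have jm: "j < m" and IH: "T' j + E \<le> \<kappa>w ^ j * \<kappa>u ^ min (Suc j) q * W0" using Y by auto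
      have "T (Suc j) + E \<le> \<kappa>w * (T' j + E)"
      proof (cases "j < p")
        case True then show ?thesis by (rule y_step(2))
      next
        case False
        then have "T (Suc j) = T' j" unfolding T_def T'_def by (simp add: \<alpha>'_def)
        then show ?thesis using mult_right_mono[OF \<kappa>1(2), of "T' j + E"] Tn(2)[of j] E0 by simp
      qed
      also have "\<dots> \<le> \<kappa>w * (\<kappa>w ^ j * \<kappa>u ^ min (Suc j) q * W0)" using IH \<kappa>1 by (intro mult_left_mono) auto
      finally show ?case by (simp add: mult_ac)
    qed (simp add: W0_def)
    define M where "M = \<kappa>w ^ m * \<kappa>u ^ q"
    have M1: "1 \<le> M" using mult_mono[of 1 "\<kappa>w ^ m" 1 "\<kappa>u ^ q"] \<kappa>1 by (simp add: M_def one_le_power)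
    have Mle: "\<kappa>w ^ i * \<kappa>u ^ l * W0 \<le> M * W0" if "i \<le> m" "l \<le> q" for i l
      unfolding M_def using that \<kappa>1 W00 by (intro mult_right_mono mult_mono power_increasing) auto
    have bq: "(\<beta>' j)\<^sup>2 \<le> M * W0 / (2 * X)" if j: "j < q" for j
    proof -
      have jm: "j < m" using j by (simp add: m_def)
      have "(\<beta>' j)\<^sup>2 \<le> \<kappa>u / (2 * X) * (T j + E)"
        using u_step(1)[OF j] mult_right_mono[OF \<kappa>1(3), of "T j + E"] Tn(1)[of j] E0 by linarith
      also have "\<dots> \<le> \<kappa>u / (2 * X) * (\<kappa>w ^ j * \<kappa>u ^ j * W0)"
        using W[of j] jm j \<kappa>1 X0 by (intro mult_left_mono) (auto simp: min_def split: if_splits)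
      also have "\<dots> = \<kappa>w ^ j * \<kappa>u ^ Suc j * W0 / (2 * X)" by simp
      also have "\<dots> \<le> M * W0 / (2 * X)" using Mle[of j "Suc j"] jm j X0 by (intro divide_right_mono) auto
      finally show ?thesis .
    qed
    have aq: "(\<alpha>' j)\<^sup>2 \<le> M * W0 / (2 * X)" if j: "j < p" for j
    proof -
      have jm: "j < m" using j by (simp add: m_def)
      have "(\<alpha>' j)\<^sup>2 \<le> \<kappa>w / (2 * X) * (T' j + E)"
        using y_step(1)[OF j] mult_right_mono[OF \<kappa>1(4), of "T' j + E"] Tn(2)[of j] E0 by linarith
      also have "\<dots> \<le> \<kappa>w / (2 * X) * (\<kappa>w ^ j * \<kappa>u ^ min (Suc j) q * W0)"
        using Y[OF W jm] jm \<kappa>1 X0 by (intro mult_left_mono) auto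
      also have "\<dots> = \<kappa>w ^ Suc j * \<kappa>u ^ min (Suc j) q * W0 / (2 * X)" by simp
      also have "\<dots> \<le> M * W0 / (2 * X)" using Mle[of "Suc j" "min (Suc j) q"] jm X0 by (intro divide_right_mono) auto
      finally show ?thesis .
    qed
    \<comment> \<open>All squared coefficients have the same bound, proportional to
      \<open>W0\<close>; the unit norm turns it into a lower bound for \<open>W0\<close>.\<close>
    have "1 = (\<Sum>i<p. (\<alpha>' i)\<^sup>2) + (\<Sum>i<q. (\<beta>' i)\<^sup>2)"
      using unit unfolding dot_def sum_split_d by (simp add: \<alpha>'_def \<beta>'_def power2_eq_square)
    also have "\<dots> \<le> (\<Sum>i<p. M * W0 / (2 * X)) + (\<Sum>i<q. M * W0 / (2 * X))"
      using aq bq by (intro add_mono sum_mono) auto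
    also have "\<dots> = real d * M * W0 / (2 * X)" by (simp add: d_def algebra_simps add_divide_distrib)
    finally have "2 * X / (real d * M) \<le> W0" using X0 M1 d0 by (simp add: field_simps)
    then show ?thesis using T0 by (simp add: W0_def M_def)
  qed
  show ?thesis
    by (rule exI[of _ D], rule conjI[OF D1], rule exI[of _ "cw / 2"], rule conjI, use cw(1) in simp,
        rule exI[of _ N1]) (use main in blast)
qed


text \<open>With \<open>X\<close> of order N^(1 + \<nu>), an input step costs about N^\<epsilon> and
  an output step N^\<nu>, so the lower bound has order N^(1 - q \<epsilon>) up to multiples of
  \<nu>. As \<open>p \<ge> 1\<close>, the exponent \<eta> exceeds q \<epsilon> by at least
  \<epsilon>, and \<nu> is so small that all these multiples fit into the gap.\<close>

lemma excitation:
  fixes \<eta> \<nu> A :: real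
  assumes \<eta>: "\<eta> = \<epsilon> * real (max p q + p)" "\<eta> < 1/4" and \<nu>: "\<nu> = \<epsilon> / (8 * real d)" and A: "1 \<le> A"
  shows "\<exists>c>0. \<exists>N0. \<forall>N\<ge>N0. r N \<le> A * (real N + 1) powr (1 + \<nu>) \<longrightarrow>
     (\<forall>x. c * real N powr (1 - \<eta>) * dot d x x \<le> (\<Sum>k = 1..N. (dot d x (\<phi> k))\<^sup>2))"
proof -
  define m where "m = max p q"
  obtain C c N1 where C: "1 \<le> C" and c: "0 < c" and raw: "\<forall>N\<ge>N1. \<forall>X Fu Fw Z E \<kappa>u \<kappa>w x. 1 + 2 * r N + C * real N \<le> X \<longrightarrow> dot d x x = 1 \<longrightarrow>
     Fu = real N / 4 / X powr \<epsilon> \<longrightarrow> Fw = c * real N \<longrightarrow> Z = C * X powr (3/4) \<longrightarrow> E = 2 * Z\<^sup>2 / Fu + 2 * Z\<^sup>2 / Fw \<longrightarrow>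
     \<kappa>u = 3 + 4 * X / Fu \<longrightarrow> \<kappa>w = 3 + 4 * X / Fw \<longrightarrow>
     2 * X / (real d * (\<kappa>w ^ m * \<kappa>u ^ q)) \<le> (\<Sum>k = 1..N. (dot d x (\<phi> k))\<^sup>2) + E"
    using excitation_raw unfolding m_def by blast
  have d2: "2 \<le> real d" using p1 q1 by (simp add: d_def)
  have mp2: "2 \<le> real (m + p)" using p1 q1 by (simp add: m_def)
  have \<eta>': "\<eta> = \<epsilon> * real (m + p)" using \<eta>(1) by (simp add: m_def)
  have eps8: "\<epsilon> < 1/8" using mult_left_mono[OF mp2, of \<epsilon>] eps0 \<eta>(2) unfolding \<eta>' by linarith
  have \<nu>0: "0 < \<nu>" using eps0 d2 by (simp add: \<nu>)
  have \<nu>d: "8 * (real d * \<nu>) = \<epsilon>" using d2 by (simp add: \<nu>)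
  have \<nu>1: "\<nu> \<le> 1/128" using \<nu>d mult_right_mono[OF d2, of \<nu>] \<nu>0 eps8 by linarith
  define B where "B = 1 + 8 * A + C"
  have B1: "1 \<le> B" using A C by (simp add: B_def)
  define a where "a = \<nu> + \<epsilon> * (1 + \<nu>)"
  define Bu where "Bu = 3 + 16 * B powr (1 + \<epsilon>)"
  define Bw where "Bw = 3 + 4 * B / c"
  define B4 where "B4 = 2 * B / (real d * (Bw ^ m * Bu ^ q))"
  define B5 where "B5 = 2 * C\<^sup>2 * B powr (3/2) * (4 * B powr \<epsilon> + 1 / c)"
  \<comment> \<open>The order of the error \<open>E\<close>: Z^2 has the order X^(3/2) and is
    divided by \<open>Fu\<close>. That it stays below 1 - \<eta> is a consequence of \<eta> < 1/4,
    which also forces \<epsilon> < 1/8.\<close>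
  define e5 where "e5 = (3/2 + \<epsilon>) * (1 + \<nu>) - 1"
  have Bu3: "3 \<le> Bu" "3 \<le> Bw" using B1 c by (auto simp: Bu_def Bw_def)
  have B40: "0 < B4" using B1 Bu3 d2 by (simp add: B4_def)
  have B50: "0 \<le> B5" using c by (simp add: B5_def)
  have gap: "0 < 1 - \<eta> - e5"
  proof -
    have "(3/2 + \<epsilon>) * (1 + \<nu>) \<le> (3/2 + 1/8) * (1 + 1/128)" using eps8 \<nu>1 \<nu>0 eps0 by (intro mult_mono) auto
    then show ?thesis using \<eta>(2) by (simp add: e5_def)
  qed
  have ex4: "1 - \<eta> \<le> 1 + \<nu> - (real m * \<nu> + real q * a)"
  proof -
    have md: "real m \<le> real d" "real q \<le> real d" by (auto simp: m_def d_def)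
    have "real q * (\<epsilon> * \<nu>) \<le> real q * (1 * \<nu>)" using eps8 \<nu>0 eps0 by (intro mult_left_mono mult_right_mono) auto
    also have "\<dots> \<le> real d * \<nu>" using md \<nu>0 by (simp add: mult_right_mono)
    finally have 1: "real q * (\<epsilon> * \<nu>) \<le> real d * \<nu>" .
    have 2: "real m * \<nu> \<le> real d * \<nu>" "real q * \<nu> \<le> real d * \<nu>" using md \<nu>0 by (auto intro: mult_right_mono)
    have "real (q + 1) \<le> real (m + p)" using p1 by (simp add: m_def)
    then have "\<epsilon> * (real q + 1) \<le> \<eta>" unfolding \<eta>' using eps0 by (intro mult_left_mono) auto
    then have 3: "\<epsilon> * real q + \<epsilon> \<le> \<eta>" by (simp add: algebra_simps)
    have "real q * a = real q * \<nu> + \<epsilon> * real q + real q * (\<epsilon> * \<nu>)" by (simp add: a_def algebra_simps)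
    then show ?thesis using 1 2 3 \<nu>d \<nu>0 eps0 by linarith
  qed
  obtain N2 :: nat where N2: "(2 * B5 / B4) powr (1 / (1 - \<eta> - e5)) \<le> real N2" using real_arch_simple by blast
  have unit: "B4 / 2 * real N powr (1 - \<eta>) \<le> (\<Sum>k = 1..N. (dot d x (\<phi> k))\<^sup>2)"
    if N: "N \<ge> Suc (N1 + N2)" and rN: "r N \<le> A * (real N + 1) powr (1 + \<nu>)" and x: "dot d x x = 1" for N x
  proof -
    define n where "n = real N"
    have n1: "1 \<le> n" "N \<ge> N1" "real N2 \<le> n" using N by (auto simp: n_def)
    define X where "X = B * n powr (1 + \<nu>)"
    define Fu where "Fu = n / 4 / X powr \<epsilon>"
    define Fw where "Fw = c * n"
    define Z where "Z = C * X powr (3/4)"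
    define E where "E = 2 * Z\<^sup>2 / Fu + 2 * Z\<^sup>2 / Fw"
    define \<kappa>u where "\<kappa>u = 3 + 4 * X / Fu"
    define \<kappa>w where "\<kappa>w = 3 + 4 * X / Fw"
    have npos: "1 \<le> n powr t" if "0 \<le> t" for t using n1 that by (intro ge_one_powr_ge_zero) auto
    have X0: "0 < X" using B1 n1 by (simp add: X_def)
    have nn: "n \<le> n powr (1 + \<nu>)" using n1 \<nu>0 powr_mono[of 1 "1 + \<nu>" n] by simp
    have XN: "1 + 2 * r N + C * real N \<le> X"
    proof -
      have "(n + 1) powr (1 + \<nu>) \<le> (2 * n) powr (1 + \<nu>)" using n1 \<nu>0 by (intro powr_mono2) auto
      also have "\<dots> = 2 powr (1 + \<nu>) * n powr (1 + \<nu>)" using n1 by (simp add: powr_mult)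
      also have "\<dots> \<le> 4 * n powr (1 + \<nu>)"
        using powr_mono[of "1 + \<nu>" 2 "2::real"] \<nu>1 by (intro mult_right_mono) auto
      finally have "A * (n + 1) powr (1 + \<nu>) \<le> A * (4 * n powr (1 + \<nu>))" using A by (intro mult_left_mono) auto
      then have "2 * r N \<le> 8 * A * n powr (1 + \<nu>)" using rN by (simp add: n_def)
      moreover have "C * n \<le> C * n powr (1 + \<nu>)" using nn C by (intro mult_left_mono) auto
      moreover have "1 \<le> n powr (1 + \<nu>)" using npos \<nu>0 by simp
      ultimately show ?thesis unfolding X_def B_def n_def[symmetric] distrib_right by linarith
    qed
    have Xe: "X powr \<epsilon> = B powr \<epsilon> * n powr (\<epsilon> * (1 + \<nu>))" using B1 n1 by (simp add: X_def powr_mult powr_powr mult.commute)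
    have iFu: "1 / Fu = 4 * B powr \<epsilon> * n powr (\<epsilon> * (1 + \<nu>) - 1)" using n1 by (simp add: Fu_def Xe powr_diff)
    have iFw: "1 / Fw = 1 / c * n powr (-1)" using n1 by (simp add: Fw_def powr_minus field_simps)
    have "4 * X / Fu = 4 * X * (1 / Fu)" by simp
    also have "\<dots> = 16 * (B * B powr \<epsilon>) * (n powr (1 + \<nu>) * n powr (\<epsilon> * (1 + \<nu>) - 1))" unfolding iFu X_def by (simp add: mult_ac)
    also have "B * B powr \<epsilon> = B powr (1 + \<epsilon>)" using B1 by (simp add: powr_add)
    also have "n powr (1 + \<nu>) * n powr (\<epsilon> * (1 + \<nu>) - 1) = n powr a" by (simp add: powr_add[symmetric] a_def)
    finally have ku: "\<kappa>u \<le> Bu * n powr a" using npos[of a] \<nu>0 eps0 by (simp add: \<kappa>u_def Bu_def a_def distrib_right)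
    have "4 * X / Fw = 4 * X * (1 / Fw)" by simp
    also have "\<dots> = 4 * B / c * (n powr (1 + \<nu>) * n powr (-1))" unfolding iFw X_def by simp
    also have "n powr (1 + \<nu>) * n powr (-1) = n powr \<nu>" unfolding powr_add[symmetric] by simp
    finally have kw: "\<kappa>w \<le> Bw * n powr \<nu>" using npos[of \<nu>] \<nu>0 by (simp add: \<kappa>w_def Bw_def distrib_right)
    have k0: "0 < \<kappa>u" "0 < \<kappa>w" using X0 n1 c by (auto simp: \<kappa>u_def \<kappa>w_def Fu_def Fw_def intro!: add_pos_nonneg)
    have "\<kappa>w ^ m * \<kappa>u ^ q \<le> (Bw * n powr \<nu>) ^ m * (Bu * n powr a) ^ q"
      using ku kw k0 by (intro mult_mono power_mono) auto
    also have "\<dots> = Bw ^ m * Bu ^ q * n powr (real m * \<nu> + real q * a)"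
      using n1 by (simp add: power_mult_distrib powr_add powr_power mult.commute mult.left_commute)
    finally have M: "\<kappa>w ^ m * \<kappa>u ^ q \<le> Bw ^ m * Bu ^ q * n powr (real m * \<nu> + real q * a)" .
    have "B4 * n powr (1 - \<eta>) \<le> B4 * n powr (1 + \<nu> - (real m * \<nu> + real q * a))"
      using B40 n1 ex4 by (intro mult_left_mono powr_mono) auto
    also have "\<dots> = 2 * X / (real d * (Bw ^ m * Bu ^ q * n powr (real m * \<nu> + real q * a)))"
      by (simp add: B4_def X_def powr_diff)
    also have "\<dots> \<le> 2 * X / (real d * (\<kappa>w ^ m * \<kappa>u ^ q))"
      using M d2 X0 k0 Bu3 n1 by (intro divide_left_mono mult_left_mono mult_pos_pos zero_less_power) auto
    also have "\<dots> \<le> (\<Sum>k = 1..N. (dot d x (\<phi> k))\<^sup>2) + E"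
      using raw n1(2) XN x by (simp add: Fu_def Fw_def Z_def E_def \<kappa>u_def \<kappa>w_def n_def)
    finally have main: "B4 * n powr (1 - \<eta>) \<le> (\<Sum>k = 1..N. (dot d x (\<phi> k))\<^sup>2) + E" .
    have Z2: "Z\<^sup>2 = C\<^sup>2 * (B powr (3/2) * n powr (3/2 * (1 + \<nu>)))"
    proof -
      have "(X powr (3/4))\<^sup>2 = X powr (3/2)" by (simp add: power2_eq_square powr_add[symmetric])
      then show ?thesis using B1 n1 by (simp add: Z_def power_mult_distrib X_def powr_mult powr_powr mult.commute)
    qed
    have "E = 2 * Z\<^sup>2 * (1 / Fu) + 2 * Z\<^sup>2 * (1 / Fw)" by (simp add: E_def)
    also have "\<dots> \<le> B5 * n powr e5"
    proof -
      have "n powr (-1) \<le> n powr (\<epsilon> * (1 + \<nu>) - 1)" using n1 eps0 \<nu>0 by (intro powr_mono) auto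
      then have "1 / c * n powr (-1) \<le> 1 / c * n powr (\<epsilon> * (1 + \<nu>) - 1)" using c by (intro mult_left_mono) auto
      then have "1 / Fu + 1 / Fw \<le> (4 * B powr \<epsilon> + 1 / c) * n powr (\<epsilon> * (1 + \<nu>) - 1)"
        unfolding iFu iFw by (simp add: distrib_right)
      then have "2 * Z\<^sup>2 * (1 / Fu + 1 / Fw) \<le> 2 * Z\<^sup>2 * ((4 * B powr \<epsilon> + 1 / c) * n powr (\<epsilon> * (1 + \<nu>) - 1))"
        by (intro mult_left_mono) auto
      also have "\<dots> = B5 * (n powr (3/2 * (1 + \<nu>)) * n powr (\<epsilon> * (1 + \<nu>) - 1))" unfolding Z2 B5_def by (simp add: mult_ac)
      also have "n powr (3/2 * (1 + \<nu>)) * n powr (\<epsilon> * (1 + \<nu>) - 1) = n powr e5"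
        unfolding powr_add[symmetric] e5_def by (rule arg_cong[of _ _ "\<lambda>t. n powr t"]) (simp add: algebra_simps)
      finally show ?thesis by (simp add: distrib_left)
    qed
    also have "\<dots> \<le> B4 / 2 * n powr (1 - \<eta>)"
    proof -
      have "2 * B5 / B4 = ((2 * B5 / B4) powr (1 / (1 - \<eta> - e5))) powr (1 - \<eta> - e5)" if "B5 \<noteq> 0"
        using gap B40 B50 that by (simp add: powr_powr)
      also have "\<dots> \<le> n powr (1 - \<eta> - e5)" using N2 n1 gap by (intro powr_mono2) auto
      finally have "2 * B5 / B4 \<le> n powr (1 - \<eta> - e5)" if "B5 \<noteq> 0" using that .
      then have "B5 \<le> B4 / 2 * n powr (1 - \<eta> - e5)" using B40 by (cases "B5 = 0") (auto simp: field_simps)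
      then have "B5 * n powr e5 \<le> B4 / 2 * n powr (1 - \<eta> - e5) * n powr e5" by (rule mult_right_mono) simp
      also have "\<dots> = B4 / 2 * n powr (1 - \<eta>)" by (simp add: mult.assoc powr_add[symmetric])
      finally show ?thesis .
    qed
    finally show ?thesis using main by (simp add: n_def)
  qed
  have "B4 / 2 * real N powr (1 - \<eta>) * dot d x x \<le> (\<Sum>k = 1..N. (dot d x (\<phi> k))\<^sup>2)"
    if N: "N \<ge> Suc (N1 + N2)" and rN: "r N \<le> A * (real N + 1) powr (1 + \<nu>)" for N x
  proof (cases "dot d x x = 0")
    case False
    then have pos: "0 < dot d x x" using dot_nonneg[of d x] by simp
    define s where "s = 1 / sqrt (dot d x x)"
    have ss: "s * s * dot d x x = 1" using pos by (simp add: s_def)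
    have "dot d (\<lambda>i. x i * s) (\<lambda>i. x i * s) = 1" unfolding dot_scale_left dot_scale_right using ss by simp
    from unit[OF N rN this] have "B4 / 2 * real N powr (1 - \<eta>) \<le> (\<Sum>k = 1..N. (s * dot d x (\<phi> k))\<^sup>2)" unfolding dot_scale_left .
    also have "\<dots> = s * s * (\<Sum>k = 1..N. (dot d x (\<phi> k))\<^sup>2)" by (simp add: power_mult_distrib sum_distrib_left power2_eq_square mult_ac)
    finally have "B4 / 2 * real N powr (1 - \<eta>) * dot d x x \<le> s * s * (\<Sum>k = 1..N. (dot d x (\<phi> k))\<^sup>2) * dot d x x"
      using pos by (intro mult_right_mono) auto
    also have "\<dots> = (s * s * dot d x x) * (\<Sum>k = 1..N. (dot d x (\<phi> k))\<^sup>2)" by (simp add: mult_ac)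
    finally show ?thesis using ss by simp
  qed (simp add: sum_nonneg)
  then show ?thesis using B40 by (intro exI[of _ "B4 / 2"]) auto
qed

end

section \<open>Very large inputs occur only finitely often\<close>

context energy_loop
begin

lemma dev_sq_le_of_excitation:
  assumes n: "n0 \<le> N" and i: "i < d" and ex: "\<And>x. c * dot d x x \<le> (\<Sum>k = 1..N. (dot d x (\<phi> k))\<^sup>2)"
    and c: "0 \<le> c"
  shows "c * (dev N i)\<^sup>2 \<le> V N"
proof -
  have "c * (dev N i)\<^sup>2 \<le> c * dot d (dev N) (dev N)"
    using c component_sq_le_dot[OF i] by (intro mult_left_mono)
  also have "\<dots> \<le> (\<Sum>k = 1..N. (dot d (dev N) (\<phi> k))\<^sup>2)" by (rule ex)
  also have "\<dots> = V N" unfolding V_eq[OF reg[OF n]] dot_G dev_def[abs_def] by (simp add: power2_eq_square)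
  finally show ?thesis .
qed

lemma lyapunov_le_powr:
  assumes "1 \<le> A" "0 \<le> \<nu>" "\<nu> \<le> 1" "0 < \<kappa>"
  shows "\<exists>C\<ge>1. \<forall>N\<ge>n0. r N \<le> A * (real N + 1) powr (1 + \<nu>) \<longrightarrow> V N \<le> C * (real N + 1) powr \<kappa>"
proof -
  obtain Cv where Cv: "1 \<le> Cv" "\<And>n. n \<ge> n0 \<Longrightarrow> V n + (\<Sum>m = n0..<n. \<alpha> m) \<le> Cv * \<L> n powr (3/2)" using lyapunov_bound by blast
  obtain Cl where Cl: "1 \<le> Cl" "\<And>r::real. r \<ge> 1 \<Longrightarrow> (1 + ln r) powr (3/2) \<le> Cl * r powr (\<kappa> / 2)"
    using log_le_powr[of "\<kappa> / 2"] assms by auto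
  have "V N \<le> Cv * (Cl * A powr (\<kappa> / 2)) * (real N + 1) powr \<kappa>" if N: "N \<ge> n0" and rN: "r N \<le> A * (real N + 1) powr (1 + \<nu>)" for N
  proof -
    have "0 \<le> (\<Sum>m = n0..<N. \<alpha> m)" by (intro sum_nonneg) (simp add: \<alpha>_nonneg)
    then have "V N \<le> Cv * \<L> N powr (3/2)" using Cv(2)[OF N] by linarith
    also have "\<dots> \<le> Cv * (Cl * r N powr (\<kappa> / 2))" using Cl(2)[OF r_ge_1[of N]] Cv(1) unfolding \<L>_def by (intro mult_left_mono) auto
    also have "r N powr (\<kappa> / 2) \<le> A powr (\<kappa> / 2) * (real N + 1) powr \<kappa>"
    proof -
      have "r N powr (\<kappa> / 2) \<le> (A * (real N + 1) powr (1 + \<nu>)) powr (\<kappa> / 2)"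
        using rN r_ge_1[of N] assms by (intro powr_mono2) auto
      also have "\<dots> = A powr (\<kappa> / 2) * (real N + 1) powr ((1 + \<nu>) * (\<kappa> / 2))" using assms by (simp add: powr_mult powr_powr)
      also have "\<dots> \<le> A powr (\<kappa> / 2) * (real N + 1) powr \<kappa>"
        using assms mult_right_mono[of "1 + \<nu>" 2 "\<kappa> / 2"] by (intro mult_left_mono powr_mono) auto
      finally show ?thesis .
    qed
    then have "Cv * (Cl * r N powr (\<kappa> / 2)) \<le> Cv * (Cl * (A powr (\<kappa> / 2) * (real N + 1) powr \<kappa>))"
      using Cv(1) Cl(1) by (intro mult_left_mono) auto
    finally show ?thesis by (simp add: mult.assoc)
  qed
  moreover have "1 \<le> Cv * (Cl * A powr (\<kappa> / 2))"
  proof -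
    have "1 \<le> A powr (\<kappa> / 2)" using assms by (intro ge_one_powr_ge_zero) auto
    then have "1 * 1 \<le> Cl * A powr (\<kappa> / 2)" using Cl(1) by (intro mult_mono) auto
    then have "1 * 1 \<le> Cv * (Cl * A powr (\<kappa> / 2))" using Cv(1) by (intro mult_mono) auto
    then show ?thesis by simp
  qed
  ultimately show ?thesis by blast
qed

text \<open>A giant input at time \<open>m + 1\<close> is followed by another one only after \<open>ln r\<close> has caught up with its
  size. Just before each giant the energy is therefore almost linear, so that \<open>b\<^sub>1\<close> is well
  estimated there; but a giant needs a bad estimate of \<open>b\<^sub>1\<close>. Hence there are finitely many.\<close>

lemma energy_growth:
  assumes \<eta>: "\<eta> = \<epsilon> * real (max p q + p)" "\<eta> < 1/4" and \<nu>: "\<nu> = \<epsilon> / (8 * real d)"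
  shows "\<exists>A\<ge>1. \<forall>N\<ge>n0. r N \<le> A * (real N + 1) powr (1 + \<nu>)"
proof -
  have d2: "2 \<le> real d" using p1 q1 by (simp add: d_def)
  have \<nu>0: "0 < \<nu>" using eps0 d2 by (simp add: \<nu>)
  have "\<epsilon> * 1 \<le> \<eta>" unfolding \<eta> using eps0 p1 by (intro mult_left_mono) auto
  then have e1: "\<epsilon> < 1" using \<eta> by simp
  have \<nu>1: "\<nu> \<le> 1" using e1 d2 eps0 by (simp add: \<nu> divide_le_eq)
  obtain c Cg where c: "0 < c" and Cg: "1 \<le> Cg" and good0: "\<And>n. n \<ge> n0 \<Longrightarrow> \<alpha> n * (tr n - tr (Suc n)) \<le> c \<Longrightarrow>
     H (n + 2) \<le> H (n + 1) + Cg * (\<alpha> n + 1 + (w (n + 2))\<^sup>2)" using good_step by blast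
  have good: "H (m + 2) \<le> H (m + 1) + Cg * (\<alpha> m + 1 + (w (m + 2))\<^sup>2)" if "m \<ge> n0" "\<not> bad c m" for m
    using good0[OF that(1)] that(2) by (simp add: bad_def not_less)
  obtain \<Phi> where \<Phi>: "1 \<le> \<Phi>" "\<And>m. m \<ge> n0 \<Longrightarrow> \<Phi> * \<L> m powr (3/2) * H (Suc m) < (u (int (Suc m)))\<^sup>2 \<Longrightarrow> \<bar>b 1\<bar> / 2 \<le> \<bar>dev m p\<bar>"
    using large_input_dev by blast
  obtain cq where cq: "0 < cq" "\<And>m. m \<ge> n0 \<Longrightarrow> \<bar>b 1\<bar> / 2 \<le> \<bar>dev m p\<bar> \<Longrightarrow> cq \<le> Q m p p * \<L> m powr (3/2)"
    using Q_large_of_dev by blast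
  obtain Ca where Ca: "1 \<le> Ca" "\<And>m. m \<ge> n0 \<Longrightarrow> Q (Suc m) p p * (u (int (Suc m)))\<^sup>2 \<le> Ca * H (Suc m)"
    using Q_after_input by blast
  \<comment> \<open>The inputs that \<open>growth_bound\<close> cannot accommodate directly; by
    \<open>large_input_dev\<close> they come with a bad estimate of \<open>b 1\<close>.\<close>
  define giant where "giant m \<longleftrightarrow> m \<ge> n0 \<and> \<Phi> * \<L> m powr (3/2) * H (Suc m) < (u (int (Suc m)))\<^sup>2" for m
  have gd: "\<bar>b 1\<bar> / 2 \<le> \<bar>dev m p\<bar>" if "giant m" for m using \<Phi>(2) that by (auto simp: giant_def)
  define Kc where "Kc = \<Phi> + Ca / cq"
  have Kc: "1 \<le> Kc" "\<Phi> \<le> Kc" "Ca / cq \<le> Kc" using \<Phi>(1) Ca(1) cq(1) by (auto simp: Kc_def add_increasing2)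
  have LHmono: "K1 * \<L> m powr (3/2) * H (Suc m) \<le> K2 * \<L> N powr (3/2) * H (Suc m)" if "0 \<le> K1" "K1 \<le> K2" "m \<le> N" for K1 K2 m N
    using that \<L>_mono[OF that(3)] \<L>_ge_1[of m] H1[of "Suc m"] by (intro mult_right_mono mult_mono powr_mono2) auto
  obtain A where A: "1 \<le> A" "\<And>N. N \<ge> n0 \<Longrightarrow> (\<forall>m\<in>{n0..<N}. bad c m \<longrightarrow> (u (int (Suc m)))\<^sup>2 \<le> Kc * \<L> N powr (3/2) * H (Suc m))
     \<Longrightarrow> r N \<le> A * (real N + 1) powr (1 + \<nu>)"
    using growth_bound[OF good c Cg Kc(1) \<nu>0] by blast
  \<comment> \<open>A giant at \<open>N\<close> means that \<open>Q N p p\<close> is still at least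
    of order \<open>1 / \<L> N powr (3/2)\<close>. As this entry never increases, an earlier giant
    cannot have reduced it further, which limits its size in terms of \<open>\<L> N\<close>, so
    \<open>growth_bound\<close> applies up to \<open>N\<close>.\<close>
  have rg: "r N \<le> A * (real N + 1) powr (1 + \<nu>)" if N: "giant N" for N
  proof (rule A(2))
    show "N \<ge> n0" using N by (simp add: giant_def)
    have gN: "cq \<le> Q N p p * \<L> N powr (3/2)" using cq(2) gd[OF N] N by (simp add: giant_def)
    show "\<forall>m\<in>{n0..<N}. bad c m \<longrightarrow> (u (int (Suc m)))\<^sup>2 \<le> Kc * \<L> N powr (3/2) * H (Suc m)"
    proof (intro ballI impI)
      fix m assume m: "m \<in> {n0..<N}"
      show "(u (int (Suc m)))\<^sup>2 \<le> Kc * \<L> N powr (3/2) * H (Suc m)"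
      proof (cases "giant m")
        case False
        then have "(u (int (Suc m)))\<^sup>2 \<le> \<Phi> * \<L> m powr (3/2) * H (Suc m)" using m by (simp add: giant_def)
        also have "\<dots> \<le> Kc * \<L> N powr (3/2) * H (Suc m)" using m \<Phi>(1) Kc by (intro LHmono) auto
        finally show ?thesis .
      next
        case True
        have "Q N p p \<le> Q (Suc m) p p" by (rule Q_diag_mono) (use m reg d0 in auto)
        then have "cq \<le> Q (Suc m) p p * \<L> N powr (3/2)" using gN by (meson mult_right_mono order_trans powr_ge_zero)
        then have "cq * (u (int (Suc m)))\<^sup>2 \<le> Q (Suc m) p p * \<L> N powr (3/2) * (u (int (Suc m)))\<^sup>2" by (rule mult_right_mono) simp
        also have "\<dots> = (Q (Suc m) p p * (u (int (Suc m)))\<^sup>2) * \<L> N powr (3/2)" by simp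
        also have "\<dots> \<le> (Ca * H (Suc m)) * \<L> N powr (3/2)" using Ca(2)[of m] m by (intro mult_right_mono) auto
        finally have "(u (int (Suc m)))\<^sup>2 \<le> (Ca / cq) * \<L> N powr (3/2) * H (Suc m)" using cq(1) by (simp add: field_simps)
        also have "\<dots> \<le> Kc * \<L> N powr (3/2) * H (Suc m)"
          using Kc(3) H1[of "Suc m"] by (intro mult_right_mono) auto
        finally show ?thesis .
      qed
    qed
  qed
  obtain c0 N0 where c0: "0 < c0" "\<And>N x. N \<ge> N0 \<Longrightarrow> r N \<le> A * (real N + 1) powr (1 + \<nu>) \<Longrightarrow>
     c0 * real N powr (1 - \<eta>) * dot d x x \<le> (\<Sum>k = 1..N. (dot d x (\<phi> k))\<^sup>2)"
    using excitation[OF \<eta> \<nu> A(1)] by blast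
  obtain Cl where Cl: "1 \<le> Cl" "\<And>N. N \<ge> n0 \<Longrightarrow> r N \<le> A * (real N + 1) powr (1 + \<nu>) \<Longrightarrow> V N \<le> Cl * (real N + 1) powr (1/2)"
    using lyapunov_le_powr[OF A(1) less_imp_le[OF \<nu>0] \<nu>1, of "1/2"] by auto
  define c1 where "c1 = c0 * ((b 1)\<^sup>2 / 4)"
  have c1: "0 < c1" using c0 b1 by (simp add: c1_def)
  have "eventually (\<lambda>N::nat. Cl * (real N + 1) powr (1/2) < c1 * real N powr (3/4)) at_top"
    using c1 Cl(1) by real_asymp
  then obtain N1 where N1: "\<And>N. N \<ge> N1 \<Longrightarrow> Cl * (real N + 1) powr (1/2) < c1 * real N powr (3/4)"
    by (auto simp: eventually_at_top_linorder)
  \<comment> \<open>At a giant the growth bound holds, hence also the excitation bound. The squared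
    error in \<open>b 1\<close>, bounded below, times the eigenvalue bound has at least the order
    N^(3/4) and yet lies below \<open>V N\<close>, of order at most N^(1/2).\<close>
  have few: "N < Suc (max N0 N1)" if N: "giant N" for N
  proof (rule ccontr)
    assume "\<not> N < Suc (max N0 N1)"
    then have Nb: "N \<ge> N0" "N \<ge> N1" "1 \<le> real N" by auto
    have Nn: "N \<ge> n0" using N by (simp add: giant_def)
    have "c1 * real N powr (3/4) \<le> c1 * real N powr (1 - \<eta>)" using c1 \<eta>(2) Nb by (intro mult_left_mono powr_mono) auto
    also have "\<dots> = c0 * real N powr (1 - \<eta>) * (\<bar>b 1\<bar> / 2)\<^sup>2" by (simp add: c1_def power_divide)
    also have "\<dots> \<le> c0 * real N powr (1 - \<eta>) * \<bar>dev N p\<bar>\<^sup>2"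
      using c0(1) gd[OF N] by (intro mult_left_mono power_mono) auto
    also have "\<dots> \<le> V N" unfolding power2_abs
      by (rule dev_sq_le_of_excitation[OF Nn d0(2) c0(2)[OF Nb(1) rg[OF N]]]) (use c0(1) in auto)
    also have "\<dots> \<le> Cl * (real N + 1) powr (1/2)" by (rule Cl(2)[OF Nn rg[OF N]])
    finally show False using N1[OF Nb(2)] by linarith
  qed
  \<comment> \<open>No giant occurs at or after \<open>M\<close>; the finitely many before it are
    absorbed into a constant.\<close>
  define M where "M = Suc (max N0 N1)"
  define Kd where "Kd = \<Phi> + (\<Sum>m<M. (u (int (Suc m)))\<^sup>2)"
  have Kd: "1 \<le> Kd" "\<Phi> \<le> Kd" using \<Phi>(1) by (auto simp: Kd_def add_increasing2 sum_nonneg)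
  obtain A' where A': "1 \<le> A'" "\<And>N. N \<ge> n0 \<Longrightarrow> (\<forall>m\<in>{n0..<N}. bad c m \<longrightarrow> (u (int (Suc m)))\<^sup>2 \<le> Kd * \<L> N powr (3/2) * H (Suc m))
     \<Longrightarrow> r N \<le> A' * (real N + 1) powr (1 + \<nu>)"
    using growth_bound[OF good c Cg Kd(1) \<nu>0] by blast
  have "r N \<le> A' * (real N + 1) powr (1 + \<nu>)" if N: "N \<ge> n0" for N
  proof (rule A'(2)[OF N], intro ballI impI)
    fix m assume m: "m \<in> {n0..<N}"
    show "(u (int (Suc m)))\<^sup>2 \<le> Kd * \<L> N powr (3/2) * H (Suc m)"
    proof (cases "giant m")
      case False
      then have "(u (int (Suc m)))\<^sup>2 \<le> \<Phi> * \<L> m powr (3/2) * H (Suc m)" using m by (simp add: giant_def)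
      also have "\<dots> \<le> Kd * \<L> N powr (3/2) * H (Suc m)" using m \<Phi>(1) Kd by (intro LHmono) auto
      finally show ?thesis .
    next
      case True
      then have "(u (int (Suc m)))\<^sup>2 \<le> (\<Sum>m<M. (u (int (Suc m)))\<^sup>2)"
        using few by (intro member_le_sum[of m "{..<M}" "\<lambda>m. (u (int (Suc m)))\<^sup>2"]) (auto simp: M_def)
      then have "(u (int (Suc m)))\<^sup>2 \<le> Kd" using \<Phi>(1) by (simp add: Kd_def)
      moreover have "1 \<le> \<L> N powr (3/2)" using \<L>_ge_1[of N] by (intro ge_one_powr_ge_zero) auto
      then have "1 * 1 \<le> \<L> N powr (3/2) * H (Suc m)" using H1[of "Suc m"] by (intro mult_mono) auto
      then have "Kd * 1 \<le> Kd * (\<L> N powr (3/2) * H (Suc m))" using Kd by (intro mult_left_mono) auto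
      ultimately show ?thesis by (simp add: mult.assoc)
    qed
  qed
  then show ?thesis using A'(1) by blast
qed

end

context noisy_loop
begin

text \<open>The three rates on which the sparse estimate rests. The exponent \<open>\<kappa>\<close>
  is at choice because \<open>V\<close> grows only like a power of the logarithm of
  \<open>r\<close>.\<close>

lemma asymptotic_rates:
  assumes \<eta>: "\<eta> = \<epsilon> * real (max p q + p)" "\<eta> < 1/4" and \<kappa>: "0 < \<kappa>"
  shows "\<exists>A\<ge>1. \<exists>c>0. \<exists>N0. \<forall>N\<ge>N0. N \<ge> n0 \<and> r N \<le> A * (real N + 1) powr (1 + \<epsilon> / 8) \<and>
      V N \<le> A * (real N + 1) powr \<kappa> \<and>
      (\<forall>x. c * real N powr (1 - \<eta>) * dot d x x \<le> (\<Sum>k = 1..N. (dot d x (\<phi> k))\<^sup>2))"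
proof -
  obtain H \<mu> K C where "0 < \<mu>" "\<mu> < 1" "1 \<le> K" "1 \<le> C" "\<And>k. 1 \<le> H k"
    "\<And>k. H (Suc k) = \<mu> * H k + K + (y (int k + 1))\<^sup>2 + (w (k + 1))\<^sup>2"
    "\<And>k i. i < d \<Longrightarrow> i \<noteq> p \<Longrightarrow> (\<phi> k i)\<^sup>2 \<le> C * H k" "\<And>k. (u (int k))\<^sup>2 \<le> C * H (Suc k)"
    by (rule energy_exists) (rule that)
  then interpret energy_loop p q a b y u w w' \<theta>0 yref \<epsilon> H \<mu> K C by unfold_locales
  define \<nu> where "\<nu> = \<epsilon> / (8 * real d)"
  have d1: "1 \<le> real d" using d0 by simp
  have \<nu>8: "0 < \<nu>" "\<nu> \<le> \<epsilon> / 8" using eps0 d1 by (auto simp: \<nu>_def field_simps)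
  have "\<epsilon> * 1 \<le> \<eta>" unfolding \<eta> using eps0 p1 by (intro mult_left_mono) auto
  then have \<nu>1: "\<nu> \<le> 1" using \<eta>(2) \<nu>8 by linarith
  obtain A where A: "1 \<le> A" "\<And>N. N \<ge> n0 \<Longrightarrow> r N \<le> A * (real N + 1) powr (1 + \<nu>)"
    using energy_growth[OF \<eta> \<nu>_def] by blast
  obtain C' where C': "1 \<le> C'" "\<And>N. N \<ge> n0 \<Longrightarrow> V N \<le> C' * (real N + 1) powr \<kappa>"
    using lyapunov_le_powr[OF A(1) less_imp_le[OF \<nu>8(1)] \<nu>1 \<kappa>] A(2) by blast
  obtain c0 N0 where c0: "0 < c0" "\<And>N x. N \<ge> N0 \<Longrightarrow> r N \<le> A * (real N + 1) powr (1 + \<nu>) \<Longrightarrow>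
     c0 * real N powr (1 - \<eta>) * dot d x x \<le> (\<Sum>k = 1..N. (dot d x (\<phi> k))\<^sup>2)"
    using excitation[OF \<eta> \<nu>_def A(1)] by blast
  show ?thesis
  proof (rule exI[of _ "A + C'"], rule conjI, use A(1) C'(1) in simp, rule exI[of _ c0], rule conjI, rule c0(1),
      rule exI[of _ "max n0 N0"], intro allI impI conjI)
    fix N x assume N: "max n0 N0 \<le> N"
    have "r N \<le> A * (real N + 1) powr (1 + \<nu>)" using A(2) N by simp
    also have "\<dots> \<le> (A + C') * (real N + 1) powr (1 + \<epsilon> / 8)"
      using A(1) C'(1) \<nu>8 by (intro mult_mono powr_mono) auto
    finally show "r N \<le> (A + C') * (real N + 1) powr (1 + \<epsilon> / 8)" .
    have "V N \<le> C' * (real N + 1) powr \<kappa>" using C'(2) N by simp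
    also have "\<dots> \<le> (A + C') * (real N + 1) powr \<kappa>" using A(1) by (intro mult_right_mono) auto
    finally show "V N \<le> (A + C') * (real N + 1) powr \<kappa>" .
    show "c0 * real N powr (1 - \<eta>) * dot d x x \<le> (\<Sum>k = 1..N. (dot d x (\<phi> k))\<^sup>2)" using c0(2) A(2) N by simp
  qed simp
qed

end

section \<open>The sparse estimate\<close>

text \<open>Tychonoff's theorem. Coordinates beyond the dimension will be confined to a single
  point.\<close>

lemma compact_box:
  fixes S :: "nat \<Rightarrow> real set"
  assumes "\<And>i. compact (S i)"
  shows "compact (PiE UNIV S)"
proof -
  have "compactin (product_topology (\<lambda>i. euclidean) UNIV) (PiE UNIV S)"
    unfolding compactin_PiE using assms by simp
  then show ?thesis by (simp add: euclidean_product_topology)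
qed

text \<open>The sparse estimate is a chosen minimizer, so existence has to be ensured before
  anything is known about it. Excitation makes the criterion coercive: points not worse than 0 lie,
  up to irrelevant coordinates, in a box that is compact in the product topology.\<close>

lemma penalized_least_squares_minimum:
  fixes \<phi> :: "nat \<Rightarrow> nat \<Rightarrow> real" and Y :: "nat \<Rightarrow> real" and \<omega> :: "nat \<Rightarrow> real"
  assumes \<mu>: "0 < \<mu>" "\<And>x. \<mu> * dot d x x \<le> (\<Sum>k = 1..N. (dot d x (\<phi> k))\<^sup>2)"
    and \<omega>: "\<And>l. 0 \<le> \<omega> l"
  defines "J \<equiv> \<lambda>x. (\<Sum>k = 1..N. (Y k - dot d x (\<phi> k))\<^sup>2) + (\<Sum>l<d. \<omega> l * \<bar>x l\<bar>)"
  shows "\<exists>x. \<forall>z. J x \<le> J z"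
proof -
  have J0: "0 \<le> (\<Sum>l<d. \<omega> l * \<bar>x l\<bar>)" for x using \<omega> by (intro sum_nonneg mult_nonneg_nonneg) auto
  define J1 where "J1 = J (\<lambda>_. 0)"
  have J1: "J1 = (\<Sum>k = 1..N. (Y k)\<^sup>2)" by (simp add: J1_def J_def dot_def)
  have J1nn: "0 \<le> J1" by (simp add: J1 sum_nonneg)
  \<comment> \<open>If \<open>J z \<le> J1\<close>, the squares of \<open>dot d z (\<phi> k)\<close>
    sum to at most \<open>4 * J1\<close>; hence this radius.\<close>
  define R where "R = sqrt (4 * J1 / \<mu>)"
  define box where "box = PiE UNIV (\<lambda>i. if i < d then {-R..R} else {0})"
  have R0: "0 \<le> R" using J1nn \<mu> by (simp add: R_def)
  have "compact box" unfolding box_def by (rule compact_box) auto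
  moreover have box0: "(\<lambda>_. 0) \<in> box" using R0 by (auto simp: box_def)
  moreover have "continuous_on box J"
  proof -
    have "continuous_on UNIV J" unfolding J_def dot_def
      by (intro continuous_intros continuous_on_product_coordinates)
    then show ?thesis by (rule continuous_on_subset) simp
  qed
  ultimately obtain x where x: "x \<in> box" "\<And>z. z \<in> box \<Longrightarrow> J x \<le> J z"
    using continuous_attains_inf[of box J] by blast
  have "J x \<le> J z" for z
  proof (cases "J z \<le> J1")
    case False
    then show ?thesis using x(2)[OF box0] by (simp add: J1_def)
  next
    case True
    define z' where "z' i = (if i < d then z i else 0)" for i
    have dz: "dot d z' v = dot d z v" for v by (rule dot_cong) (auto simp: z'_def)
    have Jz: "J z' = J z" unfolding J_def dz by (simp add: z'_def)
    have "z' \<in> box"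
    proof -
      have "(\<Sum>k = 1..N. (dot d z (\<phi> k))\<^sup>2) \<le> (\<Sum>k = 1..N. 2 * ((Y k)\<^sup>2 + (dot d z (\<phi> k) - Y k)\<^sup>2))"
      proof (rule sum_mono)
        fix k
        show "(dot d z (\<phi> k))\<^sup>2 \<le> 2 * ((Y k)\<^sup>2 + (dot d z (\<phi> k) - Y k)\<^sup>2)"
          using add2_square_le[of "Y k" "dot d z (\<phi> k) - Y k"] by simp
      qed
      also have "\<dots> = 2 * (J1 + (\<Sum>k = 1..N. (Y k - dot d z (\<phi> k))\<^sup>2))"
        by (simp only: J1 sum_distrib_left[symmetric] sum.distrib power2_commute)
      also have "\<dots> \<le> 2 * (J1 + J1)"
        using True J0[of z] by (intro mult_left_mono add_left_mono) (auto simp: J_def)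
      finally have "\<mu> * dot d z z \<le> 4 * J1" using \<mu>(2)[of z] by simp
      then have zz: "dot d z z \<le> 4 * J1 / \<mu>" using \<mu>(1) by (simp add: field_simps)
      have "\<bar>z i\<bar> \<le> R" if i: "i < d" for i
      proof -
        have "(z i)\<^sup>2 \<le> 4 * J1 / \<mu>" using component_sq_le_dot[OF i, of z] zz by linarith
        then show ?thesis unfolding R_def by (metis real_sqrt_le_iff real_sqrt_abs)
      qed
      then have "- R \<le> z i \<and> z i \<le> R" if "i < d" for i using that by (simp add: abs_le_iff minus_le_iff)
      then show ?thesis by (auto simp: box_def z'_def)
    qed
    then show ?thesis using x(2)[of z'] Jz by simp
  qed
  then show ?thesis by blast
qed

text \<open>Needed since the extrema of an empty spectrum would be meaningless. A complex eigenvalue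
  exists, the Hermitian form shows that it is real, and the real or the imaginary part of its
  eigenvector is a real eigenvector.\<close>

lemma real_symmetric_eigenvalue_exists:
  fixes A :: "real Matrix.mat"
  assumes A: "A \<in> carrier_mat d d" and d: "0 < d"
    and sym: "\<And>i j. i < d \<Longrightarrow> j < d \<Longrightarrow> A $$ (i, j) = A $$ (j, i)"
  shows "spectrum A \<noteq> {}"
proof -
  define Ac where "Ac = Matrix.mat d d (\<lambda>(i, j). complex_of_real (A $$ (i, j)))"
  have Ac: "Ac \<in> carrier_mat d d" by (simp add: Ac_def)
  obtain z where "z \<in> spectrum Ac" using spectrum_non_empty[OF Ac d] by auto
  then obtain v where v: "v \<in> carrier_vec d" "v \<noteq> 0\<^sub>v d" "Ac *\<^sub>v v = z \<cdot>\<^sub>v v"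
    using Ac by (auto simp: spectrum_def eigenvalue_def eigenvector_def)
  have comp: "(\<Sum>j<d. of_real (A $$ (i, j)) * v $ j) = z * v $ i" if "i < d" for i
  proof -
    have "(Ac *\<^sub>v v) $ i = (\<Sum>j<d. of_real (A $$ (i, j)) * v $ j)"
      using that v(1) by (simp add: Ac_def scalar_prod_def lessThan_atLeast0)
    then show ?thesis using v that by simp
  qed
  have ex: "\<exists>i<d. v $ i \<noteq> 0"
  proof (rule ccontr)
    assume "\<not> ?thesis"
    then have "v = 0\<^sub>v d" using v(1) by (intro eq_vecI) auto
    then show False using v(2) by simp
  qed
  define n2 where "n2 = (\<Sum>i<d. (cmod (v $ i))\<^sup>2)"
  have n2: "0 < n2"
  proof -
    obtain i where "i < d" "v $ i \<noteq> 0" using ex by blast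
    then show ?thesis unfolding n2_def by (intro sum_pos2[of _ i]) auto
  qed
  define qf where "qf = (\<Sum>i<d. \<Sum>j<d. cnj (v $ i) * of_real (A $$ (i, j)) * v $ j)"
  have "qf = (\<Sum>i<d. cnj (v $ i) * (\<Sum>j<d. of_real (A $$ (i, j)) * v $ j))"
    by (simp add: qf_def sum_distrib_left mult.assoc)
  also have "\<dots> = (\<Sum>i<d. z * of_real ((cmod (v $ i))\<^sup>2))"
  proof (intro sum.cong refl)
    fix i assume "i \<in> {..<d}"
    then have "cnj (v $ i) * (\<Sum>j<d. of_real (A $$ (i, j)) * v $ j) = cnj (v $ i) * (z * v $ i)" using comp[of i] by simp
    then show "cnj (v $ i) * (\<Sum>j<d. of_real (A $$ (i, j)) * v $ j) = z * of_real ((cmod (v $ i))\<^sup>2)"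
      unfolding complex_norm_square by (simp add: mult_ac)
  qed
  also have "\<dots> = z * of_real n2" by (simp add: n2_def sum_distrib_left)
  finally have q1: "qf = z * of_real n2" .
  have "cnj qf = (\<Sum>i<d. \<Sum>j<d. cnj (v $ j) * of_real (A $$ (j, i)) * v $ i)"
    unfolding qf_def cnj_sum by (intro sum.cong refl) (use sym in \<open>simp add: mult_ac\<close>)
  also have "\<dots> = qf" unfolding qf_def by (rule sum.swap)
  finally have "cnj z * of_real n2 = z * of_real n2" using q1 by (metis complex_cnj_complex_of_real complex_cnj_mult)
  then have "cnj z = z" using n2 by simp
  then have zr: "z = of_real (Re z)" by (simp add: complex_eq_iff)
  have comp': "(\<Sum>j<d. A $$ (i, j) * Re (v $ j)) = Re z * Re (v $ i)" "(\<Sum>j<d. A $$ (i, j) * Im (v $ j)) = Re z * Im (v $ i)" if "i < d" for i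
  proof -
    have c: "(\<Sum>j<d. of_real (A $$ (i, j)) * v $ j) = of_real (Re z) * v $ i" using comp[OF that] zr by simp
    show "(\<Sum>j<d. A $$ (i, j) * Re (v $ j)) = Re z * Re (v $ i)" using arg_cong[OF c, of Re] by simp
    show "(\<Sum>j<d. A $$ (i, j) * Im (v $ j)) = Re z * Im (v $ i)" using arg_cong[OF c, of Im] by simp
  qed
  have eig: "Re z \<in> spectrum A" if x: "\<And>i. i < d \<Longrightarrow> (\<Sum>j<d. A $$ (i, j) * x j) = Re z * x i" "i0 < d" "x i0 \<noteq> 0" for x i0
  proof -
    have "A *\<^sub>v Matrix.vec d x = Re z \<cdot>\<^sub>v Matrix.vec d x"
      using A x(1) by (intro eq_vecI) (auto simp: scalar_prod_def lessThan_atLeast0)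
    moreover have "Matrix.vec d x \<noteq> 0\<^sub>v d" using x(2,3) by (metis index_vec index_zero_vec(1))
    ultimately have "eigenvector A (Matrix.vec d x) (Re z)" using A by (simp add: eigenvector_def)
    then show ?thesis by (auto simp: spectrum_def eigenvalue_def)
  qed
  obtain i where i: "i < d" "v $ i \<noteq> 0" using ex by blast
  show ?thesis
  proof (cases "Re (v $ i) = 0")
    case False then show ?thesis using eig[of "\<lambda>j. Re (v $ j)" i] comp'(1) i by auto
  next
    case True
    then have "Im (v $ i) \<noteq> 0" using i by (simp add: complex_eq_iff)
    then show ?thesis using eig[of "\<lambda>j. Im (v $ j)" i] comp'(2) i by auto
  qed
qed

context closed_loop
begin

text \<open>Rayleigh quotients: on unit vectors the form of the Gram matrix lies between
  \<open>\<mu>\<close> and its trace, and the trace is below \<open>r N\<close>.\<close>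

lemma gram_spectrum:
  assumes \<mu>: "\<And>x. \<mu> * dot d x x \<le> (\<Sum>k = 1..N. (dot d x (\<phi> k))\<^sup>2)"
  shows "\<mu> \<le> lambda_min p q y u N" "lambda_max p q y u N \<le> r N" "lambda_min p q y u N \<le> lambda_max p q y u N"
proof -
  let ?S = "spectrum (gram p q y u N)"
  have gc: "gram p q y u N \<in> carrier_mat d d" by (simp add: gram_def d_def)
  have fin: "finite ?S" using card_finite_spectrum[OF gc] by simp
  have ne: "?S \<noteq> {}"
    by (rule real_symmetric_eigenvalue_exists[OF gc d0(1)])
       (simp add: Gm_gram[symmetric] Gm_def G_def mult.commute)
  have bd: "\<mu> \<le> ev \<and> ev \<le> r N" if ev: "ev \<in> ?S" for ev
  proof -
    obtain v where v: "v \<in> carrier_vec d" "v \<noteq> 0\<^sub>v d" "gram p q y u N *\<^sub>v v = ev \<cdot>\<^sub>v v"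
      using ev gc unfolding spectrum_def eigenvalue_def eigenvector_def by auto
    define x where "x i = v $ i" for i
    have Gx: "app d (G N) x i = ev * x i" if "i < d" for i
    proof -
      have "(Gm N *\<^sub>v v) $ i = app d (G N) x i" using that v(1)
        by (simp add: Gm_def app_def x_def scalar_prod_def lessThan_atLeast0)
      then show ?thesis using v that by (simp add: Gm_gram x_def)
    qed
    have "dot d x (app d (G N) x) = dot d x (\<lambda>i. x i * ev)" by (rule dot_cong) (auto simp: Gx)
    then have eq: "(\<Sum>k = 1..N. (dot d x (\<phi> k))\<^sup>2) = ev * dot d x x"
      unfolding dot_G dot_scale_right by (simp add: power2_eq_square)
    have "\<exists>i<d. x i \<noteq> 0"
    proof (rule ccontr)
      assume "\<not> ?thesis"
      then have "v = 0\<^sub>v d" using v(1) by (intro eq_vecI) (auto simp: x_def)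
      then show False using v(2) by simp
    qed
    then obtain i where "i < d" "x i \<noteq> 0" by blast
    then have pos: "0 < dot d x x" using component_sq_le_dot[of i d x] by (smt (verit) zero_less_power2)
    have "\<mu> * dot d x x \<le> ev * dot d x x" using \<mu>[of x] eq by simp
    moreover have "ev * dot d x x \<le> r N * dot d x x"
    proof -
      have "(\<Sum>k = 1..N. (dot d x (\<phi> k))\<^sup>2) \<le> (\<Sum>k = 1..N. dot d x x * dot d (\<phi> k) (\<phi> k))"
        by (intro sum_mono dot_Cauchy_Schwarz)
      also have "\<dots> \<le> r N * dot d x x" using pos by (simp add: r_eq sum_distrib_left[symmetric] algebra_simps)
      finally show ?thesis using eq by simp
    qed
    ultimately show ?thesis using pos by (simp add: mult_le_cancel_right)
  qed
  show "\<mu> \<le> lambda_min p q y u N" unfolding lambda_min_def using fin ne bd by simp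
  show "lambda_max p q y u N \<le> r N" unfolding lambda_max_def using fin ne bd by simp
  show "lambda_min p q y u N \<le> lambda_max p q y u N" unfolding lambda_min_def lambda_max_def
    using fin ne Max_ge Min_le by (metis Max_in)
qed

lemma sparse_estimate_minimal:
  fixes lam :: "nat \<Rightarrow> real"
  assumes \<mu>: "0 < \<mu>" "\<And>x. \<mu> * dot d x x \<le> (\<Sum>k = 1..N. (dot d x (\<phi> k))\<^sup>2)" and lam: "0 \<le> lam N"
  defines "\<omega> \<equiv> \<lambda>l. lam N / \<bar>modified_estimate p q y u \<theta>0 N $ l\<bar>"
  defines "J \<equiv> \<lambda>x. (\<Sum>k = 1..N. (y (int k + 1) - dot d x (\<phi> k))\<^sup>2) + (\<Sum>l<d. \<omega> l * \<bar>x l\<bar>)"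
  shows "J (\<lambda>i. sparse_estimate p q y u \<theta>0 lam N $ i) \<le> J x'"
proof -
  have crit: "sparse_criterion p q y u \<theta>0 lam N v = J (\<lambda>i. v $ i)" if "v \<in> carrier_vec d" for v
    using dot_regressor[OF that] by (simp add: sparse_criterion_def J_def \<omega>_def d_def[symmetric] sum_distrib_left mult_ac)
  have Jvec: "J (\<lambda>i. Matrix.vec d v' $ i) = J v'" for v'
  proof -
    have "dot d (\<lambda>i. Matrix.vec d v' $ i) v = dot d v' v" for v by (rule dot_cong) auto
    then show ?thesis by (simp add: J_def)
  qed
  obtain x where x: "\<And>v. J x \<le> J v"
    using penalized_least_squares_minimum[OF \<mu>, of \<omega> "\<lambda>k. y (int k + 1)"] lam unfolding J_def \<omega>_def by auto
  have "is_arg_min (sparse_criterion p q y u \<theta>0 lam N) (\<lambda>v. v \<in> carrier_vec d) (Matrix.vec d x)"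
    unfolding is_arg_min_def using x crit Jvec by (auto simp: not_less)
  then have "is_arg_min (sparse_criterion p q y u \<theta>0 lam N) (\<lambda>v. v \<in> carrier_vec d) (sparse_estimate p q y u \<theta>0 lam N)"
    unfolding sparse_estimate_def arg_min_on_def arg_min_def d_def[symmetric] by (rule someI)
  then have "sparse_estimate p q y u \<theta>0 lam N \<in> carrier_vec d"
     "\<And>v. v \<in> carrier_vec d \<Longrightarrow> sparse_criterion p q y u \<theta>0 lam N (sparse_estimate p q y u \<theta>0 lam N) \<le> sparse_criterion p q y u \<theta>0 lam N v"
    unfolding is_arg_min_def by (auto simp: not_less)
  then show ?thesis using crit[of "sparse_estimate p q y u \<theta>0 lam N"] crit[of "Matrix.vec d x'"] Jvec[of x'] by (metis vec_carrier)
qed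

end

lemma eventually_powr_dominates:
  fixes a b c D :: real
  assumes "a < b" "0 < c"
  shows "eventually (\<lambda>N::nat. D * real N powr a < c * real N powr b) sequentially"
proof -
  have "0 < b - a" using assms by simp
  then have "filterlim (\<lambda>N::nat. real N powr (b - a)) at_top sequentially" by real_asymp
  then have "eventually (\<lambda>N::nat. D / c < real N powr (b - a)) sequentially"
    by (rule filterlim_at_top_dense[THEN iffD1, rule_format])
  then show ?thesis using eventually_gt_at_top[of 0]
  proof eventually_elim
    case (elim N)
    then have "D < c * real N powr (b - a)" using assms by (simp add: divide_less_eq mult.commute)
    then have "D * real N powr a < c * real N powr (b - a) * real N powr a" using elim by (intro mult_strict_right_mono) auto
    then show ?case by (simp add: mult.assoc powr_add[symmetric])
  qed
qed

text \<open>The shift points away from zero, so it cannot cancel the estimate; the weights of the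
  penalty therefore have denominators of at least \<open>s\<close>.\<close>

lemma abs_sgn1_shift: "0 \<le> s \<Longrightarrow> \<bar>t + sgn1 t * s\<bar> = \<bar>t\<bar> + s"
  by (auto simp: sgn1_def)

section \<open>Comparison of the sparse minimizer with the true parameter and with
  truncations\<close>

context noisy_loop
begin

text \<open>The normal equations convert noise into estimation error: tested against any direction,
  the noise acts like the Gram form with \<open>dev N\<close>, whose own square is
  \<open>V N\<close>. The bounds on the sparse estimate thus inherit the noise only through
  \<open>V N\<close>.\<close>

lemma noise_form:
  assumes N: "n0 \<le> N"
  shows "(\<Sum>k = 1..N. w (Suc k) * dot d v (\<phi> k)) = (\<Sum>k = 1..N. dot d v (\<phi> k) * dot d (dev N) (\<phi> k))"
proof -
  have "(\<Sum>k = 1..N. w (Suc k) * dot d v (\<phi> k)) = dot d v (S N)"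
    unfolding dot_def S_def sum_distrib_left by (subst sum.swap) (simp add: mult_ac)
  also have "\<dots> = dot d v (app d (G N) (Qa N (S N)))" by (rule dot_cong) (simp_all add: G_Qa[OF reg[OF N]])
  also have "\<dots> = (\<Sum>k = 1..N. dot d v (\<phi> k) * dot d (dev N) (\<phi> k))" unfolding dot_G dev_def[abs_def] ..
  finally show ?thesis .
qed

lemma V_dev: "n0 \<le> N \<Longrightarrow> V N = (\<Sum>k = 1..N. (dot d (dev N) (\<phi> k))\<^sup>2)"
  using V_eq[OF reg] by (simp add: dot_G dev_def[abs_def] power2_eq_square)

text \<open>A fixed time \<open>N\<close> with its rates as parameters: \<open>\<mu>\<close> bounds
  the smallest eigenvalue from below, \<open>Y\<close> will bound the error energy,
  \<open>\<rho>\<close> bounds \<open>r N\<close>. The assumption \<open>big\<close> keeps the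
  weights of nonzero coordinates of order \<open>L\<close>.\<close>

context
  fixes N :: nat and \<mu> L \<rho> Y :: real and lam :: "nat \<Rightarrow> real" and bt e' \<omega> :: "nat \<Rightarrow> real"
  assumes N: "n0 \<le> N" and \<mu>0: "0 < \<mu>" and ex: "\<And>x. \<mu> * dot d x x \<le> (\<Sum>k = 1..N. (dot d x (\<phi> k))\<^sup>2)"
    and L: "lam N = L" "0 \<le> L" and V: "4 * V N + 4 * real d * L \<le> Y" and \<rho>: "r N \<le> \<rho>"
    and big: "\<And>l. l < d \<Longrightarrow> \<theta> l \<noteq> 0 \<Longrightarrow> \<bar>\<theta> l\<bar> / 2 \<le> \<bar>modified_estimate p q y u \<theta>0 N $ l\<bar>"
  defines "bt \<equiv> \<lambda>i. sparse_estimate p q y u \<theta>0 lam N $ i"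
    and "e' \<equiv> \<lambda>i. bt i - \<theta> i"
    and "\<omega> \<equiv> \<lambda>l. L / \<bar>modified_estimate p q y u \<theta>0 N $ l\<bar>"
begin

lemma criterion_minimal:
  "(\<Sum>k = 1..N. (y (int k + 1) - dot d bt (\<phi> k))\<^sup>2) + (\<Sum>l<d. \<omega> l * \<bar>bt l\<bar>)
   \<le> (\<Sum>k = 1..N. (y (int k + 1) - dot d v (\<phi> k))\<^sup>2) + (\<Sum>l<d. \<omega> l * \<bar>v l\<bar>)"
  unfolding bt_def \<omega>_def L(1)[symmetric] by (rule sparse_estimate_minimal[OF \<mu>0 ex]) (use L in auto)

lemma omega_nonneg: "0 \<le> \<omega> l"
  using L by (simp add: \<omega>_def)

lemma residual: "y (int k + 1) - dot d bt (\<phi> k) = w (Suc k) - dot d e' (\<phi> k)"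
  unfolding output_eq e'_def dot_diff_left by simp

text \<open>Comparison with the true parameter. The noise term costs half of the error energy plus
  \<open>2 * V N\<close>; the penalty of the true parameter is at most \<open>2 * L\<close> per
  coordinate.\<close>

lemma sparse_error_le: "(\<Sum>k = 1..N. (dot d e' (\<phi> k))\<^sup>2) \<le> Y"
proof -
  define x2 where "x2 = (\<Sum>k = 1..N. (dot d e' (\<phi> k))\<^sup>2)"
  define W2 where "W2 = (\<Sum>k = 1..N. (w (Suc k))\<^sup>2)"
  have 1: "(\<Sum>k = 1..N. (y (int k + 1) - dot d bt (\<phi> k))\<^sup>2) = W2 - 2 * (\<Sum>k = 1..N. w (Suc k) * dot d e' (\<phi> k)) + x2"
    unfolding residual W2_def x2_def by (simp add: power2_diff sum.distrib sum_subtractf sum_distrib_left mult.assoc)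
  have 2: "(\<Sum>k = 1..N. (y (int k + 1) - dot d \<theta> (\<phi> k))\<^sup>2) = W2"
    unfolding output_eq W2_def by simp
  have 3: "2 * (\<Sum>k = 1..N. w (Suc k) * dot d e' (\<phi> k)) \<le> x2 / 2 + 2 * V N"
  proof -
    have "2 * (\<Sum>k = 1..N. w (Suc k) * dot d e' (\<phi> k)) = (\<Sum>k = 1..N. 2 * (dot d e' (\<phi> k) * dot d (dev N) (\<phi> k)))"
      unfolding noise_form[OF N] sum_distrib_left ..
    also have "\<dots> \<le> (\<Sum>k = 1..N. (dot d e' (\<phi> k))\<^sup>2 / 2 + 2 * (dot d (dev N) (\<phi> k))\<^sup>2)"
    proof (rule sum_mono)
      fix k
      have "0 \<le> (dot d e' (\<phi> k) - 2 * dot d (dev N) (\<phi> k))\<^sup>2" by simp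
      then show "2 * (dot d e' (\<phi> k) * dot d (dev N) (\<phi> k)) \<le> (dot d e' (\<phi> k))\<^sup>2 / 2 + 2 * (dot d (dev N) (\<phi> k))\<^sup>2"
        by (simp add: power2_eq_square algebra_simps)
    qed
    also have "\<dots> = x2 / 2 + 2 * V N" unfolding V_dev[OF N] x2_def
      by (simp add: sum.distrib sum_distrib_left sum_divide_distrib)
    finally show ?thesis .
  qed
  have 4: "(\<Sum>l<d. \<omega> l * \<bar>\<theta> l\<bar>) \<le> (\<Sum>l<d. 2 * L)"
  proof (rule sum_mono)
    fix l assume l: "l \<in> {..<d}"
    show "\<omega> l * \<bar>\<theta> l\<bar> \<le> 2 * L"
    proof (cases "\<theta> l = 0")
      case False
      then have b: "\<bar>\<theta> l\<bar> / 2 \<le> \<bar>modified_estimate p q y u \<theta>0 N $ l\<bar>" "0 < \<bar>\<theta> l\<bar>" using big l by auto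
      then have "0 < \<bar>modified_estimate p q y u \<theta>0 N $ l\<bar>" by linarith
      moreover have "L * \<bar>\<theta> l\<bar> \<le> L * (2 * \<bar>modified_estimate p q y u \<theta>0 N $ l\<bar>)" using b L by (intro mult_left_mono) auto
      ultimately show ?thesis by (simp add: \<omega>_def divide_le_eq)
    qed (use L in simp)
  qed
  have 5: "0 \<le> (\<Sum>l<d. \<omega> l * \<bar>bt l\<bar>)" by (intro sum_nonneg mult_nonneg_nonneg omega_nonneg) auto
  have "W2 - 2 * (\<Sum>k = 1..N. w (Suc k) * dot d e' (\<phi> k)) + x2 + (\<Sum>l<d. \<omega> l * \<bar>bt l\<bar>) \<le> W2 + (\<Sum>l<d. \<omega> l * \<bar>\<theta> l\<bar>)"
    using criterion_minimal[of \<theta>] unfolding 1 2 .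
  then have "x2 / 2 \<le> 2 * V N + 2 * (real d * L)" using 3 4 5 by simp
  then show ?thesis using V by (simp add: x2_def)
qed

lemma sparse_component_error: "l < d \<Longrightarrow> \<mu> * (bt l - \<theta> l)\<^sup>2 \<le> Y"
proof -
  assume "l < d"
  then have "(bt l - \<theta> l)\<^sup>2 \<le> dot d e' e'" using component_sq_le_dot[of l d e'] by (simp add: e'_def)
  then have "\<mu> * (bt l - \<theta> l)\<^sup>2 \<le> \<mu> * dot d e' e'" using \<mu>0 by (intro mult_left_mono) auto
  also have "\<dots> \<le> Y" using ex[of e'] sparse_error_le by linarith
  finally show ?thesis .
qed

text \<open>Setting the coordinate \<open>B\<close> to zero saves its penalty and costs a linear and
  a quadratic term in \<open>B\<close>. The linear coefficient is bounded by Cauchy-Schwarz, one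
  factor of the quadratic term by \<open>sparse_component_error\<close>; dividing by the modulus of
  \<open>B\<close> bounds the weight.\<close>

lemma sparse_false_positive:
  assumes l: "l < d" "\<theta> l = 0" "bt l \<noteq> 0"
  shows "\<omega> l \<le> 4 * sqrt (Y * \<rho>) + \<rho> * sqrt (Y / \<mu>)"
proof -
  define g where "g k = \<phi> k l" for k
  define v where "v i = (if i = l then 0 else bt i)" for i
  define B where "B = bt l"
  have dv: "dot d v (\<phi> k) = dot d bt (\<phi> k) - B * g k" for k
  proof -
    have "dot d bt (\<phi> k) = dot d (\<lambda>i. v i + unitv l i * B) (\<phi> k)"
      by (rule dot_cong) (auto simp: v_def unitv_def B_def)
    then show ?thesis using l(1) by (simp add: dot_add_left dot_scale_left dot_unitv_left g_def)
  qed
  define rs where "rs k = y (int k + 1) - dot d bt (\<phi> k)" for k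
  have 1: "(\<Sum>k = 1..N. (y (int k + 1) - dot d v (\<phi> k))\<^sup>2) = (\<Sum>k = 1..N. (rs k)\<^sup>2) + 2 * B * (\<Sum>k = 1..N. rs k * g k) + B\<^sup>2 * (\<Sum>k = 1..N. (g k)\<^sup>2)"
  proof -
    have "(y (int k + 1) - dot d v (\<phi> k))\<^sup>2 = (rs k)\<^sup>2 + 2 * B * (rs k * g k) + B\<^sup>2 * (g k)\<^sup>2" for k
      unfolding dv rs_def by (simp add: power2_eq_square algebra_simps)
    then show ?thesis by (simp add: sum.distrib sum_distrib_left)
  qed
  have 2: "(\<Sum>i<d. \<omega> i * \<bar>bt i\<bar>) = (\<Sum>i<d. \<omega> i * \<bar>v i\<bar>) + \<omega> l * \<bar>B\<bar>"
    using l(1) by (simp add: sum.remove[of "{..<d}" l] v_def B_def)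
  have le1: "\<omega> l * \<bar>B\<bar> \<le> 2 * B * (\<Sum>k = 1..N. rs k * g k) + B\<^sup>2 * (\<Sum>k = 1..N. (g k)\<^sup>2)"
    using criterion_minimal[of v] unfolding 1 2 rs_def[symmetric] by linarith
  have gg: "(\<Sum>k = 1..N. (g k)\<^sup>2) \<le> \<rho>"
  proof -
    have "(\<Sum>k = 1..N. (g k)\<^sup>2) \<le> (\<Sum>k = 1..N. dot d (\<phi> k) (\<phi> k))"
      unfolding g_def by (intro sum_mono component_sq_le_dot l)
    then show ?thesis using \<rho> by (simp add: r_eq)
  qed
  have V0: "0 \<le> V N" using V_nonneg[OF reg[OF N]] .
  have dL: "0 \<le> real d * L" using L by simp
  have VY: "4 * V N \<le> Y" using V dL by simp
  then have Y0: "0 \<le> Y" using V0 by simp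
  have \<rho>0: "0 \<le> \<rho>" using \<rho> r_ge_1[of N] by linarith
  have "(\<Sum>k = 1..N. rs k * g k) = (\<Sum>k = 1..N. w (Suc k) * dot d (unitv l) (\<phi> k)) - (\<Sum>k = 1..N. dot d e' (\<phi> k) * g k)"
    using l(1) unfolding rs_def residual by (simp add: dot_unitv_left g_def left_diff_distrib sum_subtractf)
  also have "\<dots> = (\<Sum>k = 1..N. (dot d (dev N) (\<phi> k) - dot d e' (\<phi> k)) * g k)"
    using l(1) unfolding noise_form[OF N] by (simp add: dot_unitv_left g_def left_diff_distrib right_diff_distrib sum_subtractf mult.commute)
  finally have "(\<Sum>k = 1..N. rs k * g k)\<^sup>2 \<le> (\<Sum>k = 1..N. (dot d (dev N) (\<phi> k) - dot d e' (\<phi> k))\<^sup>2) * (\<Sum>k = 1..N. (g k)\<^sup>2)"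
    using Cauchy_Schwarz_ineq_sum[of "\<lambda>k. dot d (dev N) (\<phi> k) - dot d e' (\<phi> k)" g "{1..N}"] by simp
  also have "\<dots> \<le> (4 * Y) * \<rho>"
  proof (rule mult_mono)
    have "(\<Sum>k = 1..N. (dot d (dev N) (\<phi> k) - dot d e' (\<phi> k))\<^sup>2) \<le> (\<Sum>k = 1..N. 2 * ((dot d (dev N) (\<phi> k))\<^sup>2 + (dot d e' (\<phi> k))\<^sup>2))"
    proof (rule sum_mono)
      fix k
      show "(dot d (dev N) (\<phi> k) - dot d e' (\<phi> k))\<^sup>2 \<le> 2 * ((dot d (dev N) (\<phi> k))\<^sup>2 + (dot d e' (\<phi> k))\<^sup>2)"
        using add2_square_le[of "dot d (dev N) (\<phi> k)" "- dot d e' (\<phi> k)"] by simp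
    qed
    also have "\<dots> = 2 * (V N + (\<Sum>k = 1..N. (dot d e' (\<phi> k))\<^sup>2))" by (simp add: V_dev[OF N] sum_distrib_left sum.distrib)
    also have "\<dots> \<le> 2 * (Y + Y)" using VY V0 sparse_error_le by (intro mult_left_mono add_mono) auto
    finally show "(\<Sum>k = 1..N. (dot d (dev N) (\<phi> k) - dot d e' (\<phi> k))\<^sup>2) \<le> 4 * Y" by simp
  qed (use gg Y0 in \<open>auto intro: sum_nonneg\<close>)
  finally have "\<bar>\<Sum>k = 1..N. rs k * g k\<bar> \<le> sqrt (4 * Y * \<rho>)" by (metis real_sqrt_le_iff real_sqrt_abs)
  also have "\<dots> = 2 * sqrt (Y * \<rho>)" by (simp add: real_sqrt_mult)
  finally have c: "\<bar>\<Sum>k = 1..N. rs k * g k\<bar> \<le> 2 * sqrt (Y * \<rho>)" .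
  have "\<mu> * B\<^sup>2 \<le> Y" using sparse_component_error[OF l(1)] l(2) by (simp add: B_def)
  then have "B\<^sup>2 \<le> Y / \<mu>" using \<mu>0 by (simp add: field_simps)
  then have B: "\<bar>B\<bar> \<le> sqrt (Y / \<mu>)" by (metis real_sqrt_le_iff real_sqrt_abs)
  have "\<omega> l * \<bar>B\<bar> \<le> (4 * sqrt (Y * \<rho>) + \<rho> * sqrt (Y / \<mu>)) * \<bar>B\<bar>"
  proof -
    have "2 * B * (\<Sum>k = 1..N. rs k * g k) \<le> \<bar>2 * B * (\<Sum>k = 1..N. rs k * g k)\<bar>" by simp
    also have "\<dots> \<le> 2 * \<bar>B\<bar> * (2 * sqrt (Y * \<rho>))" unfolding abs_mult using c by (intro mult_mono) auto
    finally have "2 * B * (\<Sum>k = 1..N. rs k * g k) \<le> 4 * sqrt (Y * \<rho>) * \<bar>B\<bar>" by simp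
    moreover have "B\<^sup>2 * (\<Sum>k = 1..N. (g k)\<^sup>2) \<le> (\<bar>B\<bar> * sqrt (Y / \<mu>)) * \<rho>"
    proof (rule mult_mono)
      show "B\<^sup>2 \<le> \<bar>B\<bar> * sqrt (Y / \<mu>)" using mult_left_mono[OF B, of "\<bar>B\<bar>"] by (simp add: power2_eq_square)
    qed (use gg Y0 \<mu>0 in \<open>auto intro: sum_nonneg\<close>)
    moreover have "(4 * sqrt (Y * \<rho>) + \<rho> * sqrt (Y / \<mu>)) * \<bar>B\<bar> = 4 * sqrt (Y * \<rho>) * \<bar>B\<bar> + (\<bar>B\<bar> * sqrt (Y / \<mu>)) * \<rho>"
      by (simp add: algebra_simps)
    ultimately show ?thesis using le1 by linarith
  qed
  then show ?thesis using l(3) by (simp add: B_def mult_le_cancel_right)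
qed

end

lemma path_consistency:
  fixes lam :: "nat \<Rightarrow> real"
  assumes \<eta>: "\<eta> = \<epsilon> * real (max p q + p)" "\<eta> < 1/4" and lam: "\<And>N. lam N = real N powr (1 - 3 / 2 * \<eta>)"
  shows "\<exists>N0. \<forall>N\<ge>N0. \<forall>l<d. sparse_estimate p q y u \<theta>0 lam N $ l = 0 \<longleftrightarrow> \<theta> l = 0"
proof -
  \<comment> \<open>A small exponent that has to cover the logarithms in \<open>V N\<close> and in
    the modified estimate.\<close>
  define \<kappa> :: real where "\<kappa> = 1/64"
  have \<kappa>0: "0 < \<kappa>" by (simp add: \<kappa>_def)
  obtain A c N0 where A: "1 \<le> A" and c: "0 < c" and rates: "\<forall>N\<ge>N0. N \<ge> n0 \<and> r N \<le> A * (real N + 1) powr (1 + \<epsilon> / 8) \<and>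
      V N \<le> A * (real N + 1) powr \<kappa> \<and>
      (\<forall>x. c * real N powr (1 - \<eta>) * dot d x x \<le> (\<Sum>k = 1..N. (dot d x (\<phi> k))\<^sup>2))"
    using asymptotic_rates[OF \<eta> \<kappa>0] by blast
  have "2 \<le> real (max p q + p)" using p1 by simp
  then have "\<epsilon> * 2 \<le> \<eta>" unfolding \<eta>(1) using eps0 by (intro mult_left_mono) auto
  then have e2: "\<epsilon> \<le> \<eta> / 2" "\<epsilon> < 1" "0 < \<eta>" using \<eta>(2) eps0 by auto
  define Bn where "Bn = 4 * A"
  define D1 where "D1 = 4 * Bn + 4 * real d"
  \<comment> \<open>From \<open>ln x \<le> 128 * x powr (1/128)\<close>, applied to the bound of
    \<open>r N\<close>.\<close>
  define Dl where "Dl = 128 * Bn powr (1/128)"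
  define D2 where "D2 = sqrt (Bn / c) + sqrt (Dl / c)"
  define D3 where "D3 = D2 * (4 * sqrt (D1 * Bn) + Bn * sqrt (D1 / c))"
  \<comment> \<open>The sum of two exponents: (\<kappa> - (1 - \<eta>)) / 2 for the modified
    estimate of a vanishing coordinate and 1 + \<epsilon> / 8 - \<eta> / 4 for the bound in
    \<open>sparse_false_positive\<close>. For \<eta> < 1/4 it stays below the exponent of
    \<open>lam N\<close>.\<close>
  define e3 where "e3 = 1/2 + \<kappa> / 2 + \<eta> / 4 + \<epsilon> / 8"
  have B1: "1 \<le> Bn" using A by (simp add: Bn_def)
  have D10: "1 \<le> D1" using B1 by (simp add: D1_def)
  obtain \<tau> where \<tau>: "0 < \<tau>" "\<And>l. l < d \<Longrightarrow> \<theta> l \<noteq> 0 \<Longrightarrow> \<tau> \<le> (\<theta> l)\<^sup>2"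
  proof
    let ?M = "Min (insert 1 ((\<lambda>l. (\<theta> l)\<^sup>2) ` {l. l < d \<and> \<theta> l \<noteq> 0}))"
    show "0 < ?M" by (subst Min_gr_iff) auto
    show "?M \<le> (\<theta> l)\<^sup>2" if "l < d" "\<theta> l \<noteq> 0" for l using that by (intro Min_le) auto
  qed
  have "e3 < 1 - 3/2 * \<eta>" using \<eta>(2) e2 by (simp add: e3_def \<kappa>_def)
  \<comment> \<open>The four comparisons: a vanishing coordinate cannot remain nonzero, a nonzero
    one cannot be lost, the least squares error is at most half of a nonzero coordinate, and the
    smallest eigenvalue exceeds 1, so that the logarithm is positive.\<close>
  from eventually_powr_dominates[OF this, of 1 D3]
  have ev1: "eventually (\<lambda>N. D3 * real N powr e3 < real N powr (1 - 3/2 * \<eta>)) sequentially" by simp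
  have ev2: "eventually (\<lambda>N. D1 * real N powr (1 - 3/2 * \<eta>) < c * \<tau> * real N powr (1 - \<eta>)) sequentially"
    by (rule eventually_powr_dominates) (use e2 c \<tau> in auto)
  have ev3: "eventually (\<lambda>N. Bn * real N powr \<kappa> < c * \<tau> / 4 * real N powr (1 - \<eta>)) sequentially"
    by (rule eventually_powr_dominates) (use \<eta>(2) c \<tau> in \<open>auto simp: \<kappa>_def\<close>)
  have ev4: "eventually (\<lambda>N. 1 * real N powr 0 < c * real N powr (1 - \<eta>)) sequentially"
    by (rule eventually_powr_dominates) (use \<eta>(2) c in auto)
  have "eventually (\<lambda>N. \<forall>l<d. sparse_estimate p q y u \<theta>0 lam N $ l = 0 \<longleftrightarrow> \<theta> l = 0) sequentially"
    using ev1 ev2 ev3 ev4 eventually_ge_at_top[of N0] eventually_ge_at_top[of 1]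
  proof eventually_elim
    case (elim N)
    define n where "n = real N"
    have n1: "1 \<le> n" using elim by (simp add: n_def)
    have Nn0: "n0 \<le> N" and rN: "r N \<le> A * (n + 1) powr (1 + \<epsilon> / 8)" and VN: "V N \<le> A * (n + 1) powr \<kappa>"
      and ex: "\<And>x. c * n powr (1 - \<eta>) * dot d x x \<le> (\<Sum>k = 1..N. (dot d x (\<phi> k))\<^sup>2)"
      using rates elim(5) unfolding n_def by blast+
    have two: "(n + 1) powr t \<le> 4 * n powr t" if "0 \<le> t" "t \<le> 2" for t
    proof -
      have "(n + 1) powr t \<le> (2 * n) powr t" using n1 that by (intro powr_mono2) auto
      also have "\<dots> = 2 powr t * n powr t" using n1 by (simp add: powr_mult)
      also have "\<dots> \<le> 4 * n powr t" using powr_mono[of t 2 "2::real"] that by (intro mult_right_mono) auto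
      finally show ?thesis .
    qed
    define \<mu> where "\<mu> = c * n powr (1 - \<eta>)"
    define L where "L = n powr (1 - 3/2 * \<eta>)"
    define \<rho> where "\<rho> = Bn * n powr (1 + \<epsilon> / 8)"
    define VB where "VB = Bn * n powr \<kappa>"
    define Y where "Y = D1 * L"
    have \<mu>1: "1 < \<mu>" using elim(4) n1 by (simp add: \<mu>_def n_def)
    have L0: "0 \<le> L" by (simp add: L_def)
    have r\<rho>: "r N \<le> \<rho>"
    proof -
      have "A * (n + 1) powr (1 + \<epsilon> / 8) \<le> A * (4 * n powr (1 + \<epsilon> / 8))"
        using A e2 eps0 by (intro mult_left_mono two) auto
      then show ?thesis using rN by (simp add: \<rho>_def Bn_def)
    qed
    have VVB: "V N \<le> VB"
    proof -
      have "A * (n + 1) powr \<kappa> \<le> A * (4 * n powr \<kappa>)"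
        using A by (intro mult_left_mono two) (auto simp: \<kappa>_def)
      then show ?thesis using VN by (simp add: VB_def Bn_def)
    qed
    have VL: "VB \<le> Bn * L" unfolding VB_def L_def
      using B1 n1 \<eta>(2) by (intro mult_left_mono powr_mono) (auto simp: \<kappa>_def)
    have VY: "4 * V N + 4 * real d * L \<le> Y" using VVB VL by (simp add: Y_def D1_def distrib_right)
    have spec: "\<mu> \<le> lambda_min p q y u N" "lambda_max p q y u N \<le> r N" "lambda_min p q y u N \<le> lambda_max p q y u N"
      using gram_spectrum[of \<mu> N] ex unfolding \<mu>_def by blast+
    define s where "s = sqrt (ln (lambda_max p q y u N) / lambda_min p q y u N)"
    have s0: "0 < s" using spec \<mu>1 by (simp add: s_def)
    have lnr: "ln \<rho> \<le> Dl * n powr \<kappa>"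
    proof -
      have "ln \<rho> \<le> \<rho> powr (1/128) / (1/128)" by (rule ln_sublinear) (use B1 n1 in \<open>auto simp: \<rho>_def\<close>)
      also have "\<dots> = Dl * n powr ((1 + \<epsilon> / 8) * (1/128))" using B1 n1 by (simp add: \<rho>_def Dl_def powr_mult powr_powr)
      also have "\<dots> \<le> Dl * n powr \<kappa>" using n1 e2 by (intro mult_left_mono powr_mono) (auto simp: \<kappa>_def Dl_def)
      finally show ?thesis .
    qed
    have sle: "s \<le> sqrt (Dl * n powr \<kappa> / \<mu>)"
    proof -
      have "ln (lambda_max p q y u N) \<le> ln \<rho>" using spec \<mu>1 r\<rho> by (intro ln_mono) auto
      then have "ln (lambda_max p q y u N) \<le> Dl * n powr \<kappa>" using lnr by linarith
      moreover have "0 \<le> ln (lambda_max p q y u N)" using spec \<mu>1 by simp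
      moreover have "0 \<le> Dl * n powr \<kappa>" by (simp add: Dl_def)
      ultimately have "ln (lambda_max p q y u N) / lambda_min p q y u N \<le> Dl * n powr \<kappa> / \<mu>"
        using spec \<mu>1 by (intro frac_le) auto
      then show ?thesis unfolding s_def by (rule real_sqrt_le_mono)
    qed
    have mod: "\<bar>modified_estimate p q y u \<theta>0 N $ l\<bar> = \<bar>\<theta> l + dev N l\<bar> + s" if "l < d" for l
      using that abs_sgn1_shift[OF less_imp_le[OF s0], of "\<theta> l + dev N l"] ls_estimate_eq[OF Nn0 that]
      by (simp add: modified_estimate_def d_def[symmetric] s_def[symmetric])
    have devl: "(dev N l)\<^sup>2 \<le> VB / \<mu>" if "l < d" for l
    proof -
      have "\<mu> * (dev N l)\<^sup>2 \<le> \<mu> * dot d (dev N) (dev N)" using \<mu>1 component_sq_le_dot[OF that] by (intro mult_left_mono) auto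
      also have "\<dots> \<le> V N" using ex[of "dev N"] V_dev[OF Nn0] by (simp add: \<mu>_def)
      finally show ?thesis using VVB \<mu>1 by (simp add: pos_le_divide_eq mult.commute)
    qed
    have big: "\<bar>\<theta> l\<bar> / 2 \<le> \<bar>modified_estimate p q y u \<theta>0 N $ l\<bar>" if l: "l < d" "\<theta> l \<noteq> 0" for l
    proof -
      have "VB \<le> \<tau> / 4 * \<mu>" using elim(3) by (simp add: VB_def \<mu>_def n_def mult_ac)
      then have "VB / \<mu> \<le> \<tau> / 4" using \<mu>1 by (simp add: divide_le_eq)
      then have "(dev N l)\<^sup>2 \<le> (\<theta> l)\<^sup>2 / 4" using devl[OF l(1)] \<tau>(2)[OF l] by linarith
      then have "(dev N l)\<^sup>2 \<le> (\<bar>\<theta> l\<bar> / 2)\<^sup>2" by (simp add: power_divide)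
      then have "\<bar>dev N l\<bar> \<le> \<bar>\<theta> l\<bar> / 2" by (metis abs_le_square_iff abs_divide abs_idempotent abs_numeral)
      then show ?thesis unfolding mod[OF l(1)] using s0 by linarith
    qed
    have lamN: "lam N = L" by (simp add: lam L_def n_def)
    have \<mu>0: "0 < \<mu>" using \<mu>1 by simp
    note facts = Nn0 \<mu>0 ex[folded \<mu>_def] lamN L0 VY r\<rho> big
    show ?case
    proof (intro allI impI iffI)
      fix l assume l: "l < d" and z: "sparse_estimate p q y u \<theta>0 lam N $ l = 0"
      show "\<theta> l = 0"
      proof (rule ccontr)
        assume nz: "\<theta> l \<noteq> 0"
        have "\<mu> * (sparse_estimate p q y u \<theta>0 lam N $ l - \<theta> l)\<^sup>2 \<le> Y"
          by (rule sparse_component_error[where N = N and lam = lam and L = L and \<rho> = \<rho>]) (fact facts l)+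
        then have "\<mu> * (\<theta> l)\<^sup>2 \<le> Y" using z by simp
        moreover have "\<mu> * \<tau> \<le> \<mu> * (\<theta> l)\<^sup>2" using \<mu>1 \<tau>(2)[OF l nz] by (intro mult_left_mono) auto
        ultimately show False using elim(2) by (simp add: Y_def L_def \<mu>_def n_def mult_ac)
      qed
    next
      fix l assume l: "l < d" and z: "\<theta> l = 0"
      show "sparse_estimate p q y u \<theta>0 lam N $ l = 0"
      proof (rule ccontr)
        assume nz: "sparse_estimate p q y u \<theta>0 lam N $ l \<noteq> 0"
        have om: "L / \<bar>modified_estimate p q y u \<theta>0 N $ l\<bar> \<le> 4 * sqrt (Y * \<rho>) + \<rho> * sqrt (Y / \<mu>)"
          by (rule sparse_false_positive[where N = N and lam = lam and L = L and \<rho> = \<rho>]) (fact facts l z nz)+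
        define h where "h = \<bar>modified_estimate p q y u \<theta>0 N $ l\<bar>"
        have h: "h = \<bar>dev N l\<bar> + s" using mod[OF l] z by (simp add: h_def)
        have h0: "0 < h" using h s0 by simp
        have sq: "sqrt (n powr t) = n powr (t / 2)" for t using n1 by (simp add: powr_half_sqrt[symmetric] powr_powr)
        have "\<bar>dev N l\<bar> \<le> sqrt (VB / \<mu>)" using devl[OF l] by (metis real_sqrt_le_iff real_sqrt_abs)
        also have "VB / \<mu> = Bn / c * n powr (\<kappa> - (1 - \<eta>))" by (simp add: VB_def \<mu>_def powr_diff)
        finally have h1: "\<bar>dev N l\<bar> \<le> sqrt (Bn / c) * n powr ((\<kappa> - (1 - \<eta>)) / 2)" by (simp only: real_sqrt_mult sq)
        have "Dl * n powr \<kappa> / \<mu> = Dl / c * n powr (\<kappa> - (1 - \<eta>))" by (simp add: \<mu>_def powr_diff)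
        then have h2: "s \<le> sqrt (Dl / c) * n powr ((\<kappa> - (1 - \<eta>)) / 2)" using sle by (simp only: real_sqrt_mult sq)
        have hh: "h \<le> D2 * n powr ((\<kappa> - (1 - \<eta>)) / 2)" using h h1 h2 by (simp add: D2_def distrib_right)
        have "Y * \<rho> = D1 * Bn * n powr (1 - 3/2 * \<eta> + (1 + \<epsilon> / 8))"
          unfolding Y_def L_def \<rho>_def powr_add[of n "1 - 3/2 * \<eta>" "1 + \<epsilon> / 8"] by (simp only: mult_ac)
        then have y1: "sqrt (Y * \<rho>) = sqrt (D1 * Bn) * n powr ((1 - 3/2 * \<eta> + (1 + \<epsilon> / 8)) / 2)" by (simp only: real_sqrt_mult sq)
        have "Y / \<mu> = D1 / c * n powr (1 - 3/2 * \<eta> - (1 - \<eta>))"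
          unfolding Y_def L_def \<mu>_def powr_diff[of n "1 - 3/2 * \<eta>" "1 - \<eta>"] by (simp only: times_divide_times_eq)
        then have y2: "sqrt (Y / \<mu>) = sqrt (D1 / c) * n powr ((1 - 3/2 * \<eta> - (1 - \<eta>)) / 2)" by (simp only: real_sqrt_mult sq)
        define e4 where "e4 = 1 + \<epsilon> / 8 - \<eta> / 4"
        have "4 * sqrt (Y * \<rho>) \<le> 4 * (sqrt (D1 * Bn) * n powr e4)"
          unfolding y1 using n1 e2 eps0 B1 D10 by (intro mult_left_mono powr_mono) (auto simp: e4_def)
        moreover have "\<rho> * sqrt (Y / \<mu>) = Bn * sqrt (D1 / c) * n powr e4"
        proof -
          have "\<rho> * sqrt (Y / \<mu>) = Bn * sqrt (D1 / c) * (n powr (1 + \<epsilon> / 8) * n powr ((1 - 3/2 * \<eta> - (1 - \<eta>)) / 2))"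
            unfolding y2 \<rho>_def by simp
          also have "n powr (1 + \<epsilon> / 8) * n powr ((1 - 3/2 * \<eta> - (1 - \<eta>)) / 2) = n powr e4"
            unfolding powr_add[symmetric] by (rule arg_cong[of _ _ "\<lambda>t. n powr t"]) (simp add: e4_def field_simps)
          finally show ?thesis .
        qed
        ultimately have om2: "L / h \<le> (4 * sqrt (D1 * Bn) + Bn * sqrt (D1 / c)) * n powr e4"
          using om unfolding h_def by (simp add: distrib_right)
        have "L \<le> h * ((4 * sqrt (D1 * Bn) + Bn * sqrt (D1 / c)) * n powr e4)"
          using om2 h0 by (simp add: divide_le_eq mult.commute)
        also have "\<dots> \<le> (D2 * n powr ((\<kappa> - (1 - \<eta>)) / 2)) * ((4 * sqrt (D1 * Bn) + Bn * sqrt (D1 / c)) * n powr e4)"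
          using hh B1 D10 c by (intro mult_right_mono) auto
        also have "\<dots> = D3 * (n powr ((\<kappa> - (1 - \<eta>)) / 2) * n powr e4)" by (simp add: D3_def)
        also have "n powr ((\<kappa> - (1 - \<eta>)) / 2) * n powr e4 = n powr e3"
          unfolding powr_add[symmetric] by (rule arg_cong[of _ _ "\<lambda>t. n powr t"]) (simp add: e3_def e4_def field_simps)
        finally show False using elim(1) by (simp add: L_def n_def)
      qed
    qed
  qed
  then show ?thesis by (simp add: eventually_sequentially)
qed

end

section \<open>Regularity of the Gram matrix\<close>

text \<open>Recursive projection onto the orthogonal complement of the data, with the interpolating linear
  predictor. Each update lowers the trace of the projection by one, so there are at most \<open>d\<close> of
  them; from the last one on, exact linear relations are predicted exactly.\<close>

primrec proj :: "nat \<Rightarrow> (nat \<Rightarrow> nat \<Rightarrow> real) \<Rightarrow> nat \<Rightarrow> nat \<Rightarrow> nat \<Rightarrow> real" where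
  "proj d \<psi> 0 = (\<lambda>i j. if i = j then 1 else 0)"
| "proj d \<psi> (Suc k) = (\<lambda>i j. proj d \<psi> k i j
     - app d (proj d \<psi> k) (\<psi> (Suc k)) i * app d (proj d \<psi> k) (\<psi> (Suc k)) j
       / dot d (\<psi> (Suc k)) (app d (proj d \<psi> k) (\<psi> (Suc k))))"

primrec predictor :: "nat \<Rightarrow> (nat \<Rightarrow> nat \<Rightarrow> real) \<Rightarrow> (nat \<Rightarrow> real) \<Rightarrow> nat \<Rightarrow> nat \<Rightarrow> real" where
  "predictor d \<psi> x 0 = (\<lambda>i. 0)"
| "predictor d \<psi> x (Suc k) = (\<lambda>i. predictor d \<psi> x k i
     + app d (proj d \<psi> k) (\<psi> (Suc k)) i * (x (Suc k) - dot d (predictor d \<psi> x k) (\<psi> (Suc k)))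
       / dot d (\<psi> (Suc k)) (app d (proj d \<psi> k) (\<psi> (Suc k))))"

context
  fixes d :: nat and \<psi> :: "nat \<Rightarrow> nat \<Rightarrow> real"
begin

private abbreviation "P \<equiv> proj d \<psi>"
private definition "pdir k = app d (P k) (\<psi> (Suc k))"
private definition "pgain k = dot d (\<psi> (Suc k)) (pdir k)"

lemma proj_Suc_app: "app d (P (Suc k)) v i = app d (P k) v i - pdir k i * dot d (pdir k) v / pgain k"
proof -
  have "app d (P (Suc k)) v i = (\<Sum>j<d. P k i j * v j - pdir k i / pgain k * (pdir k j * v j))"
    unfolding app_def[of d "P (Suc k)"] by (simp add: pdir_def[symmetric] pgain_def[symmetric] algebra_simps)
  also have "\<dots> = app d (P k) v i - pdir k i / pgain k * dot d (pdir k) v"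
    by (simp only: sum_subtractf sum_distrib_left[symmetric] app_def dot_def)
  finally show ?thesis by simp
qed

lemma proj_0_app: "i < d \<Longrightarrow> app d (P 0) v i = v i"
  by (simp add: app_def if_distrib[of "\<lambda>x. x * _"] cong: if_cong)

lemma proj_sym: "P k i j = P k j i"
  by (induction k arbitrary: i j) (auto simp: mult.commute)

lemma dot_proj: "dot d (app d (P k) v) x = dot d v (app d (P k) x)"
proof -
  have "dot d (app d (P k) v) x = (\<Sum>i<d. \<Sum>j<d. P k i j * v j * x i)"
    by (simp add: dot_def app_def sum_distrib_right)
  also have "\<dots> = (\<Sum>j<d. \<Sum>i<d. v j * (P k j i * x i))"
    by (subst sum.swap) (simp add: proj_sym[of k] mult_ac)
  finally show ?thesis by (simp add: dot_def app_def sum_distrib_left)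
qed

text \<open>The direction removed in a step is fixed by the previous projection and has the gain as
  its squared length, so the removal is itself an orthogonal projection. If the gain vanishes,
  division by zero removes nothing.\<close>

lemma proj_idem: "i < d \<Longrightarrow> app d (P k) (app d (P k) v) i = app d (P k) v i"
proof (induction k arbitrary: v i)
  case 0
  then show ?case by (simp only: proj_0_app)
next
  case (Suc k)
  have Ph: "app d (P k) (pdir k) i = pdir k i" if "i < d" for i unfolding pdir_def by (rule Suc.IH[OF that])
  have hh: "dot d (pdir k) (pdir k) = pgain k"
  proof -
    have "dot d (pdir k) (pdir k) = dot d (\<psi> (Suc k)) (app d (P k) (pdir k))" by (simp add: pdir_def dot_proj)
    also have "\<dots> = pgain k" unfolding pgain_def by (rule dot_cong) (auto simp: Ph)
    finally show ?thesis .
  qed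
  define c where "c = dot d (pdir k) v / pgain k"
  have Pv: "app d (P (Suc k)) v = (\<lambda>i. app d (P k) v i - pdir k i * c)"
    by (rule ext) (simp only: proj_Suc_app c_def times_divide_eq_right)
  have hPv: "dot d (pdir k) (app d (P k) v) = dot d (pdir k) v"
    unfolding dot_proj[symmetric] by (rule dot_cong) (auto simp: Ph)
  have PPv: "app d (P k) (\<lambda>i. app d (P k) v i - pdir k i * c) i = app d (P k) v i - pdir k i * c"
  proof -
    have "app d (P k) (\<lambda>i. app d (P k) v i - pdir k i * c) i = app d (P k) (app d (P k) v) i - app d (P k) (pdir k) i * c"
      by (simp add: app_def[of d "P k" "\<lambda>i. _ i - _ i"] app_def[of d "P k" "app d (P k) v"] app_def[of d "P k" "pdir k"]
          right_diff_distrib sum_subtractf sum_distrib_right mult.assoc)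
    then show ?thesis using Suc.IH[OF Suc.prems] Ph[OF Suc.prems] by simp
  qed
  have "app d (P (Suc k)) (app d (P (Suc k)) v) i = app d (P k) v i - pdir k i * c - pdir k i * (dot d (pdir k) v - c * pgain k) / pgain k"
    unfolding proj_Suc_app[of k "app d (P (Suc k)) v"] unfolding Pv PPv dot_diff_right dot_scale_right hPv hh ..
  also have "pdir k i * (dot d (pdir k) v - c * pgain k) / pgain k = 0" by (simp add: c_def)
  finally show ?case unfolding Pv by simp
qed

lemma pgain_eq: "pgain k = dot d (pdir k) (pdir k)"
proof -
  have "dot d (pdir k) (pdir k) = dot d (\<psi> (Suc k)) (app d (P k) (pdir k))" by (simp add: pdir_def dot_proj)
  also have "\<dots> = pgain k" unfolding pgain_def by (rule dot_cong) (auto simp: pdir_def proj_idem)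
  finally show ?thesis by simp
qed

text \<open>A vanishing gain means that the new vector is already spanned by the data; the void
  update is then the right one.\<close>

lemma pdir_zero: "pgain k = 0 \<Longrightarrow> i < d \<Longrightarrow> pdir k i = 0"
  using component_sq_le_dot[of i d "pdir k"] by (simp add: pgain_eq)

lemma proj_annihilates: "1 \<le> j \<Longrightarrow> j \<le> k \<Longrightarrow> i < d \<Longrightarrow> app d (P k) (\<psi> j) i = 0"
proof (induction k arbitrary: i)
  case (Suc k)
  show ?case
  proof (cases "j = Suc k")
    case True
    have "app d (P (Suc k)) (\<psi> j) i = pdir k i - pdir k i * pgain k / pgain k"
      unfolding proj_Suc_app True pgain_def by (simp add: pdir_def[symmetric] dot_commute)
    then show ?thesis using pdir_zero[of k i] Suc.prems(3) by (cases "pgain k = 0") auto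
  next
    case False
    then have z: "app d (P k) (\<psi> j) i = 0" if "i < d" for i using Suc that by auto
    have "dot d (pdir k) (\<psi> j) = dot d (\<psi> (Suc k)) (app d (P k) (\<psi> j))" by (simp add: pdir_def dot_proj)
    also have "\<dots> = 0" by (simp add: dot_def z)
    finally show ?thesis unfolding proj_Suc_app using z Suc.prems(3) by simp
  qed
qed simp

lemma proj_fixes_null:
  "(\<And>j. 1 \<le> j \<Longrightarrow> j \<le> k \<Longrightarrow> dot d v (\<psi> j) = 0) \<Longrightarrow> i < d \<Longrightarrow> app d (P k) v i = v i"
proof (induction k arbitrary: i)
  case (Suc k)
  then have IH: "app d (P k) v i = v i" if "i < d" for i using that by simp
  have "dot d (pdir k) v = dot d (\<psi> (Suc k)) (app d (P k) v)" by (simp add: pdir_def dot_proj)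
  also have "\<dots> = dot d (\<psi> (Suc k)) v" by (rule dot_cong) (auto simp: IH)
  also have "\<dots> = 0" using Suc.prems(1)[of "Suc k"] by (simp add: dot_commute)
  finally show ?case unfolding proj_Suc_app using IH Suc.prems(2) by simp
qed (simp only: proj_0_app)

lemma proj_eventually_fixed: "\<exists>K. \<forall>k\<ge>K. pgain k = 0"
proof (rule ccontr)
  define T where "T k = (\<Sum>i<d. P k i i)" for k
  have P_diag: "P k i i = dot d (app d (P k) (unitv i)) (app d (P k) (unitv i))" if "i < d" for k i
  proof -
    have "dot d (app d (P k) (unitv i)) (app d (P k) (unitv i)) = dot d (unitv i) (app d (P k) (app d (P k) (unitv i)))" by (rule dot_proj)
    also have "\<dots> = app d (P k) (unitv i) i" using that by (simp add: dot_unitv_left proj_idem)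
    also have "\<dots> = P k i i" using that by (simp add: app_def unitv_def if_distrib[of "\<lambda>x. _ * x"] cong: if_cong)
    finally show ?thesis by simp
  qed
  have T0: "0 \<le> T k" for k unfolding T_def by (intro sum_nonneg) (simp add: P_diag dot_nonneg)
  have T_Suc: "T (Suc k) = T k - (if pgain k = 0 then 0 else 1)" for k
  proof -
    have "T (Suc k) = T k - (\<Sum>i<d. pdir k i * pdir k i / pgain k)"
      by (simp add: T_def pdir_def[symmetric] pgain_def[symmetric] sum_subtractf)
    then have "T (Suc k) = T k - dot d (pdir k) (pdir k) / pgain k"
      by (simp only: dot_def sum_divide_distrib)
    then show ?thesis by (simp add: pgain_eq)
  qed
  have T_mono: "T (k + n) \<le> T k" for k n by (induction n) (auto simp: T_Suc)
  assume "\<not> (\<exists>K. \<forall>k\<ge>K. pgain k = 0)"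
  then have inf: "\<exists>k\<ge>K. pgain k \<noteq> 0" for K by auto
  have "\<exists>k. T k \<le> real d - real n" for n
  proof (induction n)
    case 0
    have "T 0 = real d" by (simp add: T_def)
    then show ?case by (intro exI[of _ 0]) simp
  next
    case (Suc n)
    then obtain k where k: "T k \<le> real d - real n" by blast
    obtain k' where k': "k' \<ge> k" "pgain k' \<noteq> 0" using inf by blast
    have "T k' \<le> T k" using T_mono[of k "k' - k"] k' by simp
    then have "T (Suc k') \<le> real d - real (Suc n)" using k k'(2) by (simp add: T_Suc)
    then show ?case by blast
  qed
  then obtain k where "T k \<le> real d - real (Suc d)" by blast
  then show False using T0[of k] by simp
qed

text \<open>Invariant: \<open>c\<close> minus the predictor is the projection of \<open>c\<close>.
  The predictor thus learns \<open>c\<close> up to its component orthogonal to the data, although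
  \<open>c\<close> does not occur in its definition. Once the projection is stationary, new vectors
  are orthogonal to that component.\<close>

lemma predictor_eventually_exact:
  assumes x: "\<And>k. 1 \<le> k \<Longrightarrow> x k = dot d c (\<psi> k)"
  shows "\<exists>K. \<forall>k\<ge>K. x (Suc k) = dot d (predictor d \<psi> x k) (\<psi> (Suc k))"
proof -
  have inv: "c i - predictor d \<psi> x k i = app d (P k) c i" if "i < d" for k i
    using that
  proof (induction k arbitrary: i)
    case (Suc k)
    have "x (Suc k) - dot d (predictor d \<psi> x k) (\<psi> (Suc k)) = dot d (\<lambda>i. c i - predictor d \<psi> x k i) (\<psi> (Suc k))"
      using x[of "Suc k"] by (simp add: dot_diff_left)
    also have "\<dots> = dot d (app d (P k) c) (\<psi> (Suc k))" by (rule dot_cong) (auto simp: Suc.IH)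
    also have "\<dots> = dot d (pdir k) c" unfolding pdir_def dot_proj by (rule dot_commute[THEN trans]) (simp add: dot_proj)
    finally have "predictor d \<psi> x (Suc k) i = predictor d \<psi> x k i + pdir k i * dot d (pdir k) c / pgain k"
      by (simp add: pdir_def[symmetric] pgain_def[symmetric])
    then show ?case unfolding proj_Suc_app using Suc.IH[OF Suc.prems] by simp
  qed (simp add: proj_0_app del: proj.simps)
  obtain K where K: "\<And>k. k \<ge> K \<Longrightarrow> pgain k = 0" using proj_eventually_fixed by blast
  have "x (Suc k) = dot d (predictor d \<psi> x k) (\<psi> (Suc k))" if "k \<ge> K" for k
  proof -
    have "x (Suc k) - dot d (predictor d \<psi> x k) (\<psi> (Suc k)) = dot d (\<lambda>i. c i - predictor d \<psi> x k i) (\<psi> (Suc k))"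
      using x[of "Suc k"] by (simp add: dot_diff_left)
    also have "\<dots> = dot d (app d (P k) c) (\<psi> (Suc k))" by (rule dot_cong) (auto simp: inv)
    also have "\<dots> = dot d c (pdir k)" unfolding pdir_def dot_proj ..
    also have "\<dots> = 0" using pdir_zero[OF K[OF that]] by (simp add: dot_def)
    finally show ?thesis by simp
  qed
  then show ?thesis by blast
qed

text \<open>Singularity gives a null vector at each single time. One that is null up to the last
  update is fixed by the final projection; this annihilates all later vectors as well, so the same
  vector is null forever.\<close>

lemma null_vector_of_singular:
  assumes sing: "\<And>n. det (lsq.Gm d \<psi> n) = 0"
  shows "\<exists>v. (\<exists>i<d. v i \<noteq> 0) \<and> (\<forall>k\<ge>1. dot d v (\<psi> k) = 0)"
proof -
  interpret lsq d \<psi> "\<lambda>_. 0" .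
  obtain K where K: "\<And>k. k \<ge> K \<Longrightarrow> pgain k = 0" using proj_eventually_fixed by blast
  have Pc: "app d (P (K + n)) v i = app d (P K) v i" if "i < d" for n v i
  proof (induction n)
    case (Suc n)
    have "app d (P (Suc (K + n))) v i = app d (P (K + n)) v i" unfolding proj_Suc_app using K[of "K + n"] by simp
    then show ?case using Suc by (simp del: proj.simps)
  qed simp
  have ann: "app d (P K) (\<psi> k) i = 0" if "1 \<le> k" "i < d" for k i
    using proj_annihilates[of k "K + k" i] Pc[of i k "\<psi> k"] that by simp
  obtain v where v: "v \<in> carrier_vec d" "v \<noteq> 0\<^sub>v d" "Gm K *\<^sub>v v = 0\<^sub>v d"
    using det_0_iff_vec_prod_zero_field[OF Gm_carrier, of K] sing[of K] by auto
  define x where "x i = v $ i" for i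
  have "app d (G K) x i = 0" if "i < d" for i
  proof -
    have "(Gm K *\<^sub>v v) $ i = app d (G K) x i" using that v(1)
      by (simp add: Gm_def app_def x_def scalar_prod_def lessThan_atLeast0)
    then show ?thesis using v that by simp
  qed
  then have "dot d x (app d (G K) x) = 0" by (simp add: dot_def)
  then have "(\<Sum>k = 1..K. (dot d x (\<psi> k))\<^sup>2) = 0" unfolding dot_G by (simp add: power2_eq_square)
  then have x0: "dot d x (\<psi> k) = 0" if "1 \<le> k" "k \<le> K" for k
    using that by (subst (asm) sum_nonneg_eq_0_iff) auto
  have Px: "app d (P K) x i = x i" if "i < d" for i by (rule proj_fixes_null[OF x0 that])
  have "\<exists>i<d. x i \<noteq> 0"
  proof (rule ccontr)
    assume "\<not> ?thesis"
    then have "v = 0\<^sub>v d" using v(1) by (intro eq_vecI) (auto simp: x_def)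
    then show False using v(2) by simp
  qed
  moreover have "dot d x (\<psi> k) = 0" if "1 \<le> k" for k
  proof -
    have "dot d x (\<psi> k) = dot d (app d (P K) x) (\<psi> k)" by (rule dot_cong) (auto simp: Px)
    also have "\<dots> = 0" unfolding dot_proj unfolding dot_def by (rule sum.neutral) (use ann that in auto)
    finally show ?thesis .
  qed
  ultimately show ?thesis by blast
qed

end

text \<open>Shifting a linear relation in time until its newest coefficient is nonzero.\<close>

lemma leading_linear_relation:
  fixes y u :: "int \<Rightarrow> real" and p q :: nat
  defines "\<phi> \<equiv> \<lambda>k i. regressor p q y u k $ i"
  assumes v: "i0 < p + q" "v i0 \<noteq> 0" "\<And>k. k \<ge> 1 \<Longrightarrow> dot (p + q) v (\<phi> k) = 0" and p: "p \<ge> 1" and q: "q \<ge> 1"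
  shows "(\<exists>c. c p = 0 \<and> (\<forall>k\<ge>1. u (int k) = dot (p + q) c (\<phi> k))) \<or>
         (\<exists>c. c p = 0 \<and> c 0 = 0 \<and> (\<forall>k\<ge>1. y (int k) = dot (p + q) c (\<phi> k)))"
proof -
  define \<alpha> where "\<alpha> i = (if i < p then v i else 0)" for i
  define \<beta> where "\<beta> i = (if i < q then v (p + i) else 0)" for i
  define m where "m = p + q"
  have split: "dot (p + q) x (\<phi> k) = (\<Sum>i<p. x i * y (int k - int i)) + (\<Sum>i<q. x (p + i) * u (int k - int i))" for x k
  proof -
    have "(\<Sum>i<p + n. g i) = (\<Sum>i<p. g i) + (\<Sum>j<n. g (p + j))" for n and g :: "nat \<Rightarrow> real" by (induction n) auto
    then show ?thesis by (simp add: dot_def \<phi>_def regressor_def)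
  qed
  have ext: "(\<Sum>i<p. x i * g i) = (\<Sum>i<m. (if i < p then x i else 0) * g i)" "(\<Sum>i<q. x (p + i) * g i) = (\<Sum>i<m. (if i < q then x (p + i) else 0) * g i)"
    for x g :: "nat \<Rightarrow> real"
    by (rule sum.mono_neutral_cong_left, auto simp: m_def)+
  have rel: "(\<Sum>i<m. \<alpha> i * y (int k - int i) + \<beta> i * u (int k - int i)) = 0" if "k \<ge> 1" for k
    using v(3)[OF that] unfolding split ext(1) ext(2)[of v] by (simp add: sum.distrib \<alpha>_def \<beta>_def)
  define j where "j = (LEAST j. \<alpha> j \<noteq> 0 \<or> \<beta> j \<noteq> 0)"
  have "\<exists>j. \<alpha> j \<noteq> 0 \<or> \<beta> j \<noteq> 0"
  proof (cases "i0 < p")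
    case True then show ?thesis using v by (intro exI[of _ i0]) (simp add: \<alpha>_def)
  next
    case False then show ?thesis using v by (intro exI[of _ "i0 - p"]) (simp add: \<beta>_def)
  qed
  then have j: "\<alpha> j \<noteq> 0 \<or> \<beta> j \<noteq> 0" unfolding j_def by (rule LeastI_ex)
  have small: "\<alpha> i = 0" "\<beta> i = 0" if "i < j" for i using not_less_Least[OF that[unfolded j_def]] by auto
  have jm: "j < m" using j p q by (auto simp: \<alpha>_def \<beta>_def m_def split: if_splits)
  have big: "\<alpha> i = 0" "\<beta> i = 0" if "m \<le> i" for i using that by (auto simp: \<alpha>_def \<beta>_def m_def)
  \<comment> \<open>Coefficients below \<open>j\<close> vanish, so the relation at time
    \<open>k + j\<close> involves no time after \<open>k\<close> and becomes a relation at time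
    \<open>k\<close>.\<close>
  have shifted: "(\<Sum>i<m. \<alpha> (i + j) * y (int k - int i) + \<beta> (i + j) * u (int k - int i)) = 0" if k: "k \<ge> 1" for k
  proof -
    have "(\<Sum>i<m. \<alpha> (i + j) * y (int k - int i) + \<beta> (i + j) * u (int k - int i))
        = (\<Sum>i<m - j. \<alpha> (i + j) * y (int k - int i) + \<beta> (i + j) * u (int k - int i))"
      by (rule sum.mono_neutral_right) (use big in auto)
    also have "\<dots> = (\<Sum>i = j..<m. \<alpha> i * y (int (k + j) - int i) + \<beta> i * u (int (k + j) - int i))"
      by (rule sum.reindex_bij_witness[of _ "\<lambda>i. i - j" "\<lambda>i. i + j"]) auto
    also have "\<dots> = (\<Sum>i<m. \<alpha> i * y (int (k + j) - int i) + \<beta> i * u (int (k + j) - int i))"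
      by (rule sum.mono_neutral_left) (use small in auto)
    also have "\<dots> = 0" using k by (intro rel) simp
    finally show ?thesis .
  qed
  define x where "x i = (if i < p then \<alpha> (i + j) else \<beta> (i - p + j))" for i
  have xrel: "dot (p + q) x (\<phi> k) = 0" if "k \<ge> 1" for k
  proof -
    have e1: "(if i < p then x i else 0) = \<alpha> (i + j)" for i by (auto simp: x_def \<alpha>_def)
    have e2: "(if i < q then x (p + i) else 0) = \<beta> (i + j)" for i by (auto simp: x_def \<beta>_def)
    show ?thesis unfolding split ext(1) ext(2)[of x] e1 e2 using shifted[OF that] by (simp add: sum.distrib)
  qed
  have xp: "x p = \<beta> j" and x0: "x 0 = \<alpha> j" using p by (auto simp: x_def)
  have \<phi>0: "\<phi> k p = u (int k)" "\<phi> k 0 = y (int k)" for k using p q by (auto simp: \<phi>_def regressor_def)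
  have solve: "\<phi> k i = dot (p + q) (\<lambda>l. if l = i then 0 else - x l / x i) (\<phi> k)" if "x i \<noteq> 0" "i < p + q" "k \<ge> 1" for i k
  proof -
    have "dot (p + q) x (\<phi> k) = x i * \<phi> k i + (\<Sum>l\<in>{..<p + q} - {i}. x l * \<phi> k l)"
      unfolding dot_def using that by (subst sum.remove[of _ i]) auto
    then have "\<phi> k i = - (\<Sum>l\<in>{..<p + q} - {i}. x l * \<phi> k l) / x i" using xrel[OF that(3)] that(1) by (simp add: field_simps)
    also have "\<dots> = (\<Sum>l\<in>{..<p + q} - {i}. - x l / x i * \<phi> k l)" by (simp add: sum_divide_distrib sum_negf)
    also have "\<dots> = dot (p + q) (\<lambda>l. if l = i then 0 else - x l / x i) (\<phi> k)"
      unfolding dot_def by (rule sum.mono_neutral_cong_left) auto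
    finally show ?thesis .
  qed
  show ?thesis
  \<comment> \<open>The current input counts as newer than the current output: only if its
    coefficient vanishes is the relation solved for the output, which then involves neither.\<close>
  proof (cases "\<beta> j = 0")
    case False
    then show ?thesis using solve[of p] q xp \<phi>0
      by (intro disjI1 exI[of _ "\<lambda>l. if l = p then 0 else - x l / x p"]) auto
  next
    case True
    then have "x 0 \<noteq> 0" "x p = 0" using j xp x0 by auto
    then show ?thesis using solve[of 0] p \<phi>0
      by (intro disjI2 exI[of _ "\<lambda>l. if l = 0 then 0 else - x l / x 0"]) auto
  qed
qed

section \<open>Measurability\<close>

lemma borel_measurable_det:
  fixes A :: "'a \<Rightarrow> real Matrix.mat"
  assumes A: "\<And>\<omega>. A \<omega> \<in> carrier_mat n n"
    and meas: "\<And>i j. i < n \<Longrightarrow> j < n \<Longrightarrow> (\<lambda>\<omega>. A \<omega> $$ (i, j)) \<in> borel_measurable F"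
  shows "(\<lambda>\<omega>. det (A \<omega>)) \<in> borel_measurable F"
  unfolding det_def'[OF A]
proof (intro borel_measurable_sum borel_measurable_times borel_measurable_const borel_measurable_prod)
  fix p i assume "p \<in> {p. p permutes {0..<n}}" "i \<in> {0..<n}"
  then show "(\<lambda>\<omega>. A \<omega> $$ (i, p i)) \<in> borel_measurable F"
    using permutes_in_image[of p "{0..<n}" i] by (intro meas) auto
qed

lemma borel_measurable_adj_mat:
  fixes A :: "'a \<Rightarrow> real Matrix.mat"
  assumes A: "\<And>\<omega>. A \<omega> \<in> carrier_mat n n"
    and meas: "\<And>i j. i < n \<Longrightarrow> j < n \<Longrightarrow> (\<lambda>\<omega>. A \<omega> $$ (i, j)) \<in> borel_measurable F"
    and ij: "i < n" "j < n"
  shows "(\<lambda>\<omega>. adj_mat (A \<omega>) $$ (i, j)) \<in> borel_measurable F"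
proof -
  have dims: "dim_row (A \<omega>) = n" "dim_col (A \<omega>) = n" for \<omega> using A[of \<omega>] by auto
  have "(\<lambda>\<omega>. det (mat_delete (A \<omega>) j i)) \<in> borel_measurable F"
  proof (rule borel_measurable_det)
    show "mat_delete (A \<omega>) j i \<in> carrier_mat (n - 1) (n - 1)" for \<omega> using dims by (simp add: mat_delete_def)
    fix k l assume "k < n - 1" "l < n - 1"
    then show "(\<lambda>\<omega>. mat_delete (A \<omega>) j i $$ (k, l)) \<in> borel_measurable F"
      using ij by (cases "k < j"; cases "l < i") (auto simp: mat_delete_def dims intro!: meas)
  qed
  then show ?thesis using ij by (simp add: adj_mat_def cofactor_def dims)
qed

lemma borel_measurable_app:
  assumes "\<And>i j. i < d \<Longrightarrow> j < d \<Longrightarrow> (\<lambda>\<omega>. A \<omega> i j) \<in> borel_measurable F"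
    "\<And>j. j < d \<Longrightarrow> (\<lambda>\<omega>. x \<omega> j) \<in> borel_measurable F" "i < d"
  shows "(\<lambda>\<omega>. app d (A \<omega>) (x \<omega>) i) \<in> borel_measurable F"
  unfolding app_def using assms by (intro borel_measurable_sum borel_measurable_times) auto

lemma borel_measurable_dot:
  assumes "\<And>j. j < d \<Longrightarrow> (\<lambda>\<omega>. x \<omega> j) \<in> borel_measurable F" "\<And>j. j < d \<Longrightarrow> (\<lambda>\<omega>. z \<omega> j) \<in> borel_measurable F"
  shows "(\<lambda>\<omega>. dot d (x \<omega>) (z \<omega>)) \<in> borel_measurable F"
  unfolding dot_def using assms by (intro borel_measurable_sum borel_measurable_times) auto

context
  fixes d n :: nat and \<phi> :: "'a \<Rightarrow> nat \<Rightarrow> nat \<Rightarrow> real" and W :: "'a \<Rightarrow> nat \<Rightarrow> real" and F :: "'a measure"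
  assumes \<phi>: "\<And>k i. 1 \<le> k \<Longrightarrow> k \<le> n \<Longrightarrow> i < d \<Longrightarrow> (\<lambda>\<omega>. \<phi> \<omega> k i) \<in> borel_measurable F"
begin

lemma borel_measurable_gram_entry: "i < d \<Longrightarrow> j < d \<Longrightarrow> (\<lambda>\<omega>. lsq.Gm d (\<phi> \<omega>) n $$ (i, j)) \<in> borel_measurable F"
  by (simp add: lsq.Gm_def lsq.G_def) (intro borel_measurable_sum borel_measurable_times, auto intro!: \<phi>)

lemma borel_measurable_det_gram: "(\<lambda>\<omega>. det (lsq.Gm d (\<phi> \<omega>) n)) \<in> borel_measurable F"
  by (rule borel_measurable_det[of _ d]) (auto intro: borel_measurable_gram_entry lsq.Gm_carrier)

lemma borel_measurable_Q: "i < d \<Longrightarrow> j < d \<Longrightarrow> (\<lambda>\<omega>. lsq.Q d (\<phi> \<omega>) n i j) \<in> borel_measurable F"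
  unfolding lsq.Q_def
  by (intro borel_measurable_divide borel_measurable_det_gram borel_measurable_adj_mat[of _ d])
     (auto intro: borel_measurable_gram_entry lsq.Gm_carrier)

lemma borel_measurable_Qa:
  "(\<And>j. j < d \<Longrightarrow> (\<lambda>\<omega>. x \<omega> j) \<in> borel_measurable F) \<Longrightarrow> i < d \<Longrightarrow> (\<lambda>\<omega>. lsq.Qa d (\<phi> \<omega>) n (x \<omega>) i) \<in> borel_measurable F"
  unfolding lsq.Qa_def by (rule borel_measurable_app) (auto intro: borel_measurable_Q)

context
  assumes next_\<phi>: "\<And>i. i < d \<Longrightarrow> (\<lambda>\<omega>. \<phi> \<omega> (Suc n) i) \<in> borel_measurable F"
begin

lemma borel_measurable_ls_s: "(\<lambda>\<omega>. lsq.s d (\<phi> \<omega>) n) \<in> borel_measurable F"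
  unfolding lsq.s_def lsq.z_def by (intro borel_measurable_dot borel_measurable_Qa next_\<phi>)

lemma borel_measurable_ls_e:
  assumes "\<And>k. 1 \<le> k \<Longrightarrow> k \<le> n \<Longrightarrow> (\<lambda>\<omega>. W \<omega> k) \<in> borel_measurable F"
  shows "(\<lambda>\<omega>. lsq.e d (\<phi> \<omega>) (W \<omega>) n) \<in> borel_measurable F"
  unfolding lsq.e_def lsq.z_def lsq.S_def
  by (intro borel_measurable_dot borel_measurable_Qa next_\<phi> borel_measurable_sum borel_measurable_times)
     (auto intro!: \<phi> assms)

end
end

lemma borel_measurable_proj:
  assumes "\<And>k i. 1 \<le> k \<Longrightarrow> k \<le> n \<Longrightarrow> i < d \<Longrightarrow> (\<lambda>\<omega>. \<psi> \<omega> k i) \<in> borel_measurable F" "i < d" "j < d"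
  shows "(\<lambda>\<omega>. proj d (\<psi> \<omega>) n i j) \<in> borel_measurable F"
  using assms
proof (induction n arbitrary: i j)
  case (Suc n)
  then have IH: "(\<lambda>\<omega>. proj d (\<psi> \<omega>) n i j) \<in> borel_measurable F" if "i < d" "j < d" for i j using that by simp
  show ?case using Suc.prems
    by (simp only: proj.simps)
       (intro borel_measurable_diff borel_measurable_divide borel_measurable_times borel_measurable_dot borel_measurable_app IH, auto)
qed simp

lemma borel_measurable_predictor:
  assumes "\<And>k i. 1 \<le> k \<Longrightarrow> k \<le> n \<Longrightarrow> i < d \<Longrightarrow> (\<lambda>\<omega>. \<psi> \<omega> k i) \<in> borel_measurable F"
    "\<And>k. 1 \<le> k \<Longrightarrow> k \<le> n \<Longrightarrow> (\<lambda>\<omega>. x \<omega> k) \<in> borel_measurable F" "i < d"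
  shows "(\<lambda>\<omega>. predictor d (\<psi> \<omega>) (x \<omega>) n i) \<in> borel_measurable F"
  using assms
proof (induction n arbitrary: i)
  case (Suc n)
  then have IH: "(\<lambda>\<omega>. predictor d (\<psi> \<omega>) (x \<omega>) n i) \<in> borel_measurable F" if "i < d" for i using that by simp
  have P: "(\<lambda>\<omega>. proj d (\<psi> \<omega>) n i j) \<in> borel_measurable F" if "i < d" "j < d" for i j
    using that Suc.prems by (intro borel_measurable_proj) auto
  show ?case using Suc.prems
    by (simp only: predictor.simps)
       (intro borel_measurable_add borel_measurable_diff borel_measurable_divide borel_measurable_times borel_measurable_dot borel_measurable_app IH P, auto)
qed simp

text \<open>Replaces the case distinction on the algorithmic inverse by a test of the determinant
  and the adjugate, both polynomial in the data, so that the estimate is measurable.\<close>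

lemma ls_estimate_formula:
  fixes y u \<theta>0 k p q
  defines "\<phi> \<equiv> \<lambda>k i. regressor p q y u k $ i"
  assumes i: "i < p + q"
  shows "ls_estimate p q y u \<theta>0 k $ i = (if det (lsq.Gm (p + q) \<phi> (k - 1)) = 0 then \<theta>0 k $ i
     else lsq.Qa (p + q) \<phi> (k - 1) (\<lambda>j. cross_moment p q y u (k - 1) $ j) i)"
proof -
  interpret lsq "p + q" \<phi> "\<lambda>_. 0" .
  have gm: "gram p q y u (k - 1) = Gm (k - 1)" by (rule eq_matI) (simp_all add: gram_def Gm_def G_def, simp add: \<phi>_def)
  show ?thesis
  proof (cases "mat_inverse (Gm (k - 1))")
    case None
    then have "Gm (k - 1) \<notin> Units (ring_mat TYPE(real) (p + q) ())" by (rule mat_inverse(1)[OF Gm_carrier])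
    then have "det (Gm (k - 1)) = 0" using det_non_zero_imp_unit[OF Gm_carrier, of "k - 1" "()"] by (rule contrapos_np)
    then show ?thesis using None unfolding ls_estimate_def gm by simp
  next
    case (Some P)
    note PG = mat_inverse(2)[OF Gm_carrier Some]
    have Pc: "P \<in> carrier_mat (p + q) (p + q)" using PG by simp
    have "det (Gm (k - 1)) * det P = 1" using PG det_mult[OF Gm_carrier Pc, of "k - 1"] by simp
    then have reg: "det (Gm (k - 1)) \<noteq> 0" by auto
    define x where "x j = cross_moment p q y u (k - 1) $ j" for j
    have Pi: "(\<Sum>j<p + q. P $$ (i, j) * G (k - 1) j l) = (if i = l then 1 else 0)" if "i < p + q" "l < p + q" for i l
    proof -
      have "(P * Gm (k - 1)) $$ (i, l) = (\<Sum>j<p + q. P $$ (i, j) * G (k - 1) j l)"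
        using that Pc by (simp add: Gm_def scalar_prod_def lessThan_atLeast0)
      then show ?thesis using PG that by simp
    qed
    have "ls_estimate p q y u \<theta>0 k $ i = app (p + q) (\<lambda>i j. P $$ (i, j)) x i"
      using Pc i Some unfolding ls_estimate_def gm by (simp add: app_def x_def scalar_prod_def lessThan_atLeast0 cross_moment_def)
    also have "\<dots> = app (p + q) (\<lambda>i j. P $$ (i, j)) (app (p + q) (G (k - 1)) (Qa (k - 1) x)) i"
      unfolding app_def[of "p + q" "\<lambda>i j. P $$ (i, j)"] using G_Qa[OF reg] by (intro sum.cong) auto
    also have "\<dots> = Qa (k - 1) x i"
      by (rule app_app_id[where A = "\<lambda>i j. P $$ (i, j)" and B = "G (k - 1)"]) (use reg i Pi in auto)
    finally show ?thesis using reg by (simp add: x_def[abs_def])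
  qed
qed

lemma space_generated_by [simp]: "space (generated_by M X) = space M"
  unfolding generated_by_def by (rule space_measure_of) auto

lemma sets_generated_by:
  "sets (generated_by M X) = sigma_sets (space M) {f -` A \<inter> space M | f A. f \<in> X \<and> A \<in> sets borel}"
  unfolding generated_by_def by (rule sets_measure_of) auto

lemma measurable_generated_by: "f \<in> X \<Longrightarrow> f \<in> borel_measurable (generated_by M X)"
  by (rule measurableI) (auto simp: sets_generated_by intro!: sigma_sets.Basic)

lemma sets_generated_by_subset:
  assumes "space N = space M" "\<And>f. f \<in> X \<Longrightarrow> f \<in> borel_measurable N"
  shows "sets (generated_by M X) \<subseteq> sets N"
  unfolding sets_generated_by assms(1)[symmetric]
  using measurable_sets[OF assms(2)] by (intro sets.sigma_sets_subset) auto

lemma generated_by_mono: "X \<subseteq> Y \<Longrightarrow> sets (generated_by M X) \<subseteq> sets (generated_by M Y)"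
  by (rule sets_generated_by_subset) (auto intro: measurable_generated_by)

lemma observations_mono: "j \<le> k \<Longrightarrow> observations y u j \<subseteq> observations y u k"
  unfolding observations_def by (intro Un_mono Collect_mono) (auto intro: le_trans less_le_trans)

lemma subalgebra_generated_by: "(\<And>f. f \<in> X \<Longrightarrow> f \<in> borel_measurable M) \<Longrightarrow> subalgebra M (generated_by M X)"
  by (simp add: subalgebra_def sets_generated_by_subset)

section \<open>Conditional expectations and independence\<close>

context prob_space
begin

lemma sigma_finite_subalgebraI: "subalgebra M F \<Longrightarrow> sigma_finite_subalgebra M F"
proof -
  assume "subalgebra M F"
  then interpret finite_measure_subalgebra M F by unfold_locales
  show ?thesis by (rule sigma_finite_subalgebra_axioms)
qed

text \<open>By independence \<open>v\<close> integrates to zero over every set of \<open>F\<close>,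
  which characterizes the conditional expectation.\<close>

lemma real_cond_exp_independent:
  fixes v :: "'a \<Rightarrow> real"
  assumes F: "subalgebra M F" and v: "integrable M v" "v \<in> borel_measurable N" "expectation v = 0"
    and N: "space N = space M" and indep: "indep_set (sets N) (sets F)"
  shows "AE \<omega> in M. real_cond_exp M F v \<omega> = 0"
proof -
  interpret sigma_finite_subalgebra M F by (rule sigma_finite_subalgebraI[OF F])
  have spF: "space F = space M" and FM: "sets F \<subseteq> sets M" using F by (auto simp: subalgebra_def)
  show ?thesis
  proof (rule real_cond_exp_charact)
    fix A assume A: "A \<in> sets F"
    have iA: "(indicator A :: 'a \<Rightarrow> real) \<in> borel_measurable F" using A by simp
    have "indep_var borel v borel (indicator A)"
      unfolding indep_var_eq
    proof (intro conjI)
      show "random_variable borel v" using v(1) by auto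
      show "random_variable borel (indicator A :: 'a \<Rightarrow> real)" using A FM by auto
      show "indep_set (sigma_sets (space M) {v -` B \<inter> space M |B. B \<in> sets borel})
          (sigma_sets (space M) {indicator A -` B \<inter> space M |B. B \<in> sets (borel :: real measure)})"
      proof -
        have 1: "sigma_sets (space M) {v -` B \<inter> space M |B. B \<in> sets borel} \<subseteq> sets N"
          using measurable_sets[OF v(2)] unfolding N[symmetric] by (intro sets.sigma_sets_subset) auto
        have 2: "sigma_sets (space M) {indicator A -` B \<inter> space M |B. B \<in> sets (borel :: real measure)} \<subseteq> sets F"
          using measurable_sets[OF iA] unfolding spF[symmetric] by (intro sets.sigma_sets_subset) auto
        show ?thesis using indep 1 2 unfolding indep_sets2_eq by (meson subset_trans subsetD)
      qed
    qed
    moreover have "integrable M (indicator A :: 'a \<Rightarrow> real)" using A FM by (auto simp: emeasure_finite less_top[symmetric])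
    ultimately have "expectation (\<lambda>\<omega>. v \<omega> * indicator A \<omega>) = expectation v * expectation (indicator A)"
      using v(1) by (intro indep_var_lebesgue_integral)
    then show "(LINT x:A|M. v x) = (LINT x:A|M. 0)"
      unfolding set_lebesgue_integral_def by (simp add: v(3) mult.commute)
  qed (use v in auto)
qed

lemma nn_cond_exp_le_const:
  assumes F: "subalgebra M F" and f: "f \<in> borel_measurable M" "AE \<omega> in M. f \<omega> \<le> c"
  shows "AE \<omega> in M. nn_cond_exp M F f \<omega> \<le> c"
proof -
  interpret sigma_finite_subalgebra M F by (rule sigma_finite_subalgebraI[OF F])
  have "AE \<omega> in M. nn_cond_exp M F f \<omega> \<le> nn_cond_exp M F (\<lambda>_. c) \<omega>"
    by (rule nn_cond_exp_mono) (use f in auto)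
  moreover have "AE \<omega> in M. c = nn_cond_exp M F (\<lambda>_. c) \<omega>" by (rule nn_cond_exp_F_meas) auto
  ultimately show ?thesis by eventually_elim simp
qed

lemma mds_independentI:
  fixes v :: "nat \<Rightarrow> 'a \<Rightarrow> real" and N :: "nat \<Rightarrow> 'a measure"
  assumes F: "\<And>k. subalgebra M (F k)" "\<And>j k. j \<le> k \<Longrightarrow> sets (F j) \<subseteq> sets (F k)"
    and v: "\<And>k. v k \<in> borel_measurable (F (Suc k))" "\<And>k. v k \<in> borel_measurable (N k)"
      "\<And>k. expectation (v k) = 0" "\<And>k. AE \<omega> in M. \<bar>v k \<omega>\<bar> \<le> c"
    and N: "\<And>k. space (N k) = space M" "\<And>k. indep_set (sets (N k)) (sets (F k))"
  shows "mds M F v"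
proof unfold_locales
  have vM: "v k \<in> borel_measurable M" for k by (rule measurable_from_subalg[OF F(1) v(1)])
  show int: "integrable M (v k)" for k
    by (rule integrable_const_bound[where B = c]) (use v(4) vM in auto)
  show "AE \<omega> in M. real_cond_exp M (F k) (v k) \<omega> = 0" for k
    by (rule real_cond_exp_independent[OF F(1) int v(2,3) N])
  have "AE \<omega> in M. nn_cond_exp M (F k) (\<lambda>\<omega>. ennreal ((v k \<omega>)\<^sup>2)) \<omega> \<le> ennreal (c\<^sup>2)" for k
  proof (rule nn_cond_exp_le_const[OF F(1)])
    show "AE \<omega> in M. ennreal ((v k \<omega>)\<^sup>2) \<le> ennreal (c\<^sup>2)"
      using v(4)[of k]
    proof eventually_elim
      case (elim \<omega>)
      then have "\<bar>v k \<omega>\<bar>^2 \<le> c^2" by (intro power_mono) auto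
      then show ?case by (simp add: ennreal_leI)
    qed
  qed (use vM in measurable)
  then have "AE \<omega> in M. \<forall>k. nn_cond_exp M (F k) (\<lambda>\<omega>. ennreal ((v k \<omega>)\<^sup>2)) \<omega> \<le> ennreal (c\<^sup>2)"
    by (simp add: AE_all_countable)
  then show "AE \<omega> in M. (SUP k. nn_cond_exp M (F k) (\<lambda>\<omega>. ennreal ((v k \<omega>)\<^sup>2)) \<omega>) < \<infinity>"
  proof eventually_elim
    case (elim \<omega>)
    then have "(SUP k. nn_cond_exp M (F k) (\<lambda>\<omega>. ennreal ((v k \<omega>)\<^sup>2)) \<omega>) \<le> ennreal (c\<^sup>2)" by (intro SUP_least) auto
    then show ?case by (simp add: order_le_less_trans)
  qed
qed (use F v in auto)

text \<open>The square is at most 1 plus the power \<open>\<gamma>\<close> of the modulus, and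
  conditional expectation is monotone.\<close>

lemma square_cond_exp_bounded:
  fixes v :: "nat \<Rightarrow> 'a \<Rightarrow> real"
  assumes F: "\<And>k. subalgebra M (F k)" and v: "\<And>k. v k \<in> borel_measurable M" and \<gamma>: "\<gamma> > 2"
    and mom: "AE \<omega> in M. (SUP k. nn_cond_exp M (F k) (\<lambda>\<omega>. ennreal (\<bar>v k \<omega>\<bar> powr \<gamma>)) \<omega>) < \<infinity>"
  shows "AE \<omega> in M. (SUP k. nn_cond_exp M (F k) (\<lambda>\<omega>. ennreal ((v k \<omega>)\<^sup>2)) \<omega>) < \<infinity>"
proof -
  have le: "x\<^sup>2 \<le> 1 + \<bar>x\<bar> powr \<gamma>" for x :: real
  proof (cases "\<bar>x\<bar> \<le> 1")
    case True
    then have "\<bar>x\<bar>^2 \<le> 1^2" by (intro power_mono) auto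
    then have "x\<^sup>2 \<le> 1" by simp
    then show ?thesis using powr_ge_zero[of "\<bar>x\<bar>" \<gamma>] by linarith
  next
    case False
    then have "\<bar>x\<bar> powr 2 \<le> \<bar>x\<bar> powr \<gamma>" using \<gamma> by (intro powr_mono) auto
    moreover have "\<bar>x\<bar> powr 2 = x\<^sup>2" using False by (simp add: powr_numeral)
    ultimately show ?thesis by linarith
  qed
  have "AE \<omega> in M. nn_cond_exp M (F k) (\<lambda>\<omega>. ennreal ((v k \<omega>)\<^sup>2)) \<omega>
      \<le> 1 + nn_cond_exp M (F k) (\<lambda>\<omega>. ennreal (\<bar>v k \<omega>\<bar> powr \<gamma>)) \<omega>" for k
  proof -
    interpret sigma_finite_subalgebra M "F k" by (rule sigma_finite_subalgebraI[OF F])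
    have [measurable]: "v k \<in> borel_measurable M" by (rule v)
    have "ennreal ((v k \<omega>)\<^sup>2) \<le> 1 + ennreal (\<bar>v k \<omega>\<bar> powr \<gamma>)" for \<omega>
      using ennreal_leI[OF le[of "v k \<omega>"]] by simp
    then have "AE \<omega> in M. nn_cond_exp M (F k) (\<lambda>\<omega>. ennreal ((v k \<omega>)\<^sup>2)) \<omega>
       \<le> nn_cond_exp M (F k) (\<lambda>\<omega>. 1 + ennreal (\<bar>v k \<omega>\<bar> powr \<gamma>)) \<omega>"
      by (intro nn_cond_exp_mono) auto
    moreover have "AE \<omega> in M. nn_cond_exp M (F k) (\<lambda>_. 1) \<omega> + nn_cond_exp M (F k) (\<lambda>\<omega>. ennreal (\<bar>v k \<omega>\<bar> powr \<gamma>)) \<omega>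
        = nn_cond_exp M (F k) (\<lambda>\<omega>. 1 + ennreal (\<bar>v k \<omega>\<bar> powr \<gamma>)) \<omega>"
      by (rule nn_cond_exp_sum) auto
    moreover have "AE \<omega> in M. 1 = nn_cond_exp M (F k) (\<lambda>_. 1) \<omega>" by (rule nn_cond_exp_F_meas) auto
    ultimately show ?thesis by eventually_elim simp
  qed
  then have "AE \<omega> in M. \<forall>k. nn_cond_exp M (F k) (\<lambda>\<omega>. ennreal ((v k \<omega>)\<^sup>2)) \<omega>
      \<le> 1 + nn_cond_exp M (F k) (\<lambda>\<omega>. ennreal (\<bar>v k \<omega>\<bar> powr \<gamma>)) \<omega>"
    by (simp add: AE_all_countable)
  with mom show ?thesis
  proof eventually_elim
    case (elim \<omega>)
    have "(SUP k. nn_cond_exp M (F k) (\<lambda>\<omega>. ennreal ((v k \<omega>)\<^sup>2)) \<omega>)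
       \<le> 1 + (SUP k. nn_cond_exp M (F k) (\<lambda>\<omega>. ennreal (\<bar>v k \<omega>\<bar> powr \<gamma>)) \<omega>)"
    proof (rule SUP_least)
      fix k
      have "nn_cond_exp M (F k) (\<lambda>\<omega>. ennreal (\<bar>v k \<omega>\<bar> powr \<gamma>)) \<omega> \<le> (SUP k. nn_cond_exp M (F k) (\<lambda>\<omega>. ennreal (\<bar>v k \<omega>\<bar> powr \<gamma>)) \<omega>)"
        by (rule SUP_upper) simp
      then show "nn_cond_exp M (F k) (\<lambda>\<omega>. ennreal ((v k \<omega>)\<^sup>2)) \<omega>
         \<le> 1 + (SUP k. nn_cond_exp M (F k) (\<lambda>\<omega>. ennreal (\<bar>v k \<omega>\<bar> powr \<gamma>)) \<omega>)"
        using elim(2) by (meson add_left_mono order_trans)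
    qed
    also have "\<dots> < \<infinity>" using elim(1) by simp
    finally show ?case .
  qed
qed

end

section \<open>Measurability of the estimates and of the control\<close>

context
  fixes Y U :: "'a \<Rightarrow> int \<Rightarrow> real" and \<theta>0 :: "'a \<Rightarrow> nat \<Rightarrow> real Matrix.vec" and p q k :: nat and F :: "'a measure"
  assumes Y: "\<And>i. i \<le> int k \<Longrightarrow> (\<lambda>\<omega>. Y \<omega> i) \<in> borel_measurable F"
    and U: "\<And>i. i \<le> int k \<Longrightarrow> (\<lambda>\<omega>. U \<omega> i) \<in> borel_measurable F"
begin

lemma borel_measurable_regressor:
  "j \<le> k \<Longrightarrow> i < p + q \<Longrightarrow> (\<lambda>\<omega>. regressor p q (Y \<omega>) (U \<omega>) j $ i) \<in> borel_measurable F"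
  by (cases "i < p") (auto simp: regressor_def intro!: Y U)

lemma borel_measurable_regressor_energy:
  assumes "n \<le> k"
  shows "(\<lambda>\<omega>. regressor_energy p q (Y \<omega>) (U \<omega>) n) \<in> borel_measurable F"
proof -
  have "regressor p q (Y \<omega>) (U \<omega>) j \<bullet> regressor p q (Y \<omega>) (U \<omega>) j
      = (\<Sum>i<p + q. regressor p q (Y \<omega>) (U \<omega>) j $ i * regressor p q (Y \<omega>) (U \<omega>) j $ i)" for \<omega> j
    by (simp add: scalar_prod_def regressor_def lessThan_atLeast0)
  then show ?thesis unfolding regressor_energy_def
    using assms by (auto intro!: borel_measurable_add borel_measurable_sum borel_measurable_times borel_measurable_regressor)
qed

lemma borel_measurable_cross_moment:
  "n < k \<Longrightarrow> i < p + q \<Longrightarrow> (\<lambda>\<omega>. cross_moment p q (Y \<omega>) (U \<omega>) n $ i) \<in> borel_measurable F"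
  by (simp add: cross_moment_def) (auto intro!: borel_measurable_sum borel_measurable_times borel_measurable_regressor Y)

lemma borel_measurable_ls_estimate:
  assumes k: "1 \<le> k" and \<theta>0: "\<And>i. i < p + q \<Longrightarrow> (\<lambda>\<omega>. \<theta>0 \<omega> k $ i) \<in> borel_measurable F" and i: "i < p + q"
  shows "(\<lambda>\<omega>. ls_estimate p q (Y \<omega>) (U \<omega>) (\<theta>0 \<omega>) k $ i) \<in> borel_measurable F"
proof -
  have D: "(\<lambda>\<omega>. det (lsq.Gm (p + q) (\<lambda>k i. regressor p q (Y \<omega>) (U \<omega>) k $ i) (k - 1))) \<in> borel_measurable F"
    by (rule borel_measurable_det_gram) (auto intro: borel_measurable_regressor)
  have "{\<omega> \<in> space F. det (lsq.Gm (p + q) (\<lambda>k i. regressor p q (Y \<omega>) (U \<omega>) k $ i) (k - 1)) = 0} \<in> sets F"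
    using D by measurable
  then show ?thesis
    unfolding ls_estimate_formula[OF i] using k i
    by (intro measurable_If \<theta>0 borel_measurable_Qa) (auto intro: borel_measurable_regressor borel_measurable_cross_moment)
qed

lemma borel_measurable_control:
  assumes k: "1 \<le> k" and q: "1 \<le> q" and \<theta>0: "\<And>i. i < p + q \<Longrightarrow> (\<lambda>\<omega>. \<theta>0 \<omega> k $ i) \<in> borel_measurable F"
  shows "(\<lambda>\<omega>. certainty_equivalence_control p q (Y \<omega>) (U \<omega>) (\<theta>0 \<omega>) yref k) \<in> borel_measurable F"
proof -
  have "ls_estimate p q (Y \<omega>) (U \<omega>) (\<theta>0 \<omega>) k \<bullet> regressor p q (Y \<omega>) (U \<omega>) k
      = (\<Sum>i<p + q. ls_estimate p q (Y \<omega>) (U \<omega>) (\<theta>0 \<omega>) k $ i * regressor p q (Y \<omega>) (U \<omega>) k $ i)" for \<omega>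
    by (simp add: scalar_prod_def regressor_def lessThan_atLeast0)
  then show ?thesis unfolding certainty_equivalence_control_def b1_estimate_def
    using k q by (auto intro!: borel_measurable_divide borel_measurable_add borel_measurable_times borel_measurable_diff borel_measurable_sum
        borel_measurable_regressor U borel_measurable_ls_estimate \<theta>0)
qed

end

lemma regressor_upd_eq: "j < k \<Longrightarrow> regressor p q y (u(int k := x)) j = regressor p q y u j"
  by (rule eq_vecI) (auto simp: regressor_def)

text \<open>The control law determines the current input from the past: the terms in the current input cancel.\<close>

lemma certainty_equivalence_control_upd:
  assumes k: "1 \<le> k" and q: "1 \<le> q"
  shows "certainty_equivalence_control p q y (u(int k := x)) \<theta>0 yref k = certainty_equivalence_control p q y u \<theta>0 yref k"
proof -
  have gram: "gram p q y (u(int k := x)) (k - 1) = gram p q y u (k - 1)"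
    using k unfolding gram_def by (intro cong_mat refl) (auto simp: regressor_upd_eq intro!: sum.cong)
  have cross: "cross_moment p q y (u(int k := x)) (k - 1) = cross_moment p q y u (k - 1)"
    using k unfolding cross_moment_def by (intro eq_vecI) (auto simp: regressor_upd_eq intro!: sum.cong)
  define c where "c = ls_estimate p q y u \<theta>0 k"
  have c: "ls_estimate p q y (u(int k := x)) \<theta>0 k = c"
    unfolding c_def ls_estimate_def gram cross ..
  have sp: "c \<bullet> regressor p q y v k = (\<Sum>i<p + q. c $ i * regressor p q y v k $ i)" for v
    by (simp add: scalar_prod_def regressor_def lessThan_atLeast0)
  have reg: "regressor p q y (u(int k := x)) k $ i = regressor p q y u k $ i + (if i = p then x - u (int k) else 0)"
    if "i < p + q" for i using that by (auto simp: regressor_def)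
  have "c \<bullet> regressor p q y (u(int k := x)) k
      = (\<Sum>i<p + q. c $ i * regressor p q y u k $ i + (if i = p then c $ p * (x - u (int k)) else 0))"
    unfolding sp by (rule sum.cong) (auto simp: reg distrib_left)
  also have "\<dots> = c \<bullet> regressor p q y u k + c $ p * (x - u (int k))"
    unfolding sp sum.distrib using q by simp
  finally have "c $ p * x - c \<bullet> regressor p q y (u(int k := x)) k = c $ p * u (int k) - c \<bullet> regressor p q y u k"
    by (simp add: algebra_simps)
  then show ?thesis
    unfolding certainty_equivalence_control_def b1_estimate_def c c_def[symmetric] by simp
qed

text \<open>Components whose coefficients vanish are masked by zeros. The prediction of the input
  then avoids the current input, and that of the output avoids the current input and output, so that
  each is known before the fresh excitation or noise enters.\<close>

lemma singular_start_predictable: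
  fixes y u :: "int \<Rightarrow> real" and p q :: nat
  defines "\<phi> \<equiv> \<lambda>k i. regressor p q y u k $ i"
  assumes p: "p \<ge> 1" and q: "q \<ge> 1" and sing: "\<And>n. det (gram p q y u n) = 0"
  shows "(\<exists>K. \<forall>k\<ge>K. u (int (Suc k)) = dot (p + q)
            (predictor (p + q) (\<lambda>k i. if i = p then 0 else \<phi> k i) (\<lambda>k. u (int k)) k) (\<lambda>i. if i = p then 0 else \<phi> (Suc k) i)) \<or>
         (\<exists>K. \<forall>k\<ge>K. y (int (Suc k)) = dot (p + q)
            (predictor (p + q) (\<lambda>k i. if i = p \<or> i = 0 then 0 else \<phi> k i) (\<lambda>k. y (int k)) k) (\<lambda>i. if i = p \<or> i = 0 then 0 else \<phi> (Suc k) i))"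
proof -
  interpret lsq "p + q" \<phi> "\<lambda>_. 0" .
  have gm: "gram p q y u n = Gm n" for n by (rule eq_matI) (simp_all add: gram_def Gm_def G_def, simp add: \<phi>_def)
  have "det (lsq.Gm (p + q) \<phi> n) = 0" for n using sing[of n] by (simp add: gm)
  then obtain v i0 where v: "i0 < p + q" "v i0 \<noteq> 0" "\<And>k. k \<ge> 1 \<Longrightarrow> dot (p + q) v (\<phi> k) = 0"
    using null_vector_of_singular by metis
  have drop: "dot (p + q) c (\<phi> k) = dot (p + q) c (\<lambda>i. if P i then 0 else \<phi> k i)" if "\<And>i. P i \<Longrightarrow> c i = 0" for c P k
    using that by (auto simp: dot_def intro!: sum.cong)
  have v3: "\<forall>k\<ge>1. dot (p + q) v (\<lambda>i. regressor p q y u k $ i) = 0" using v(3) by (simp add: \<phi>_def)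
  have "(\<exists>c. c p = 0 \<and> (\<forall>k\<ge>1. u (int k) = dot (p + q) c (\<lambda>i. regressor p q y u k $ i))) \<or>
         (\<exists>c. c p = 0 \<and> c 0 = 0 \<and> (\<forall>k\<ge>1. y (int k) = dot (p + q) c (\<lambda>i. regressor p q y u k $ i)))"
    by (rule leading_linear_relation[of i0 p q v y u, OF v(1,2) _ p q]) (use v3 in blast)
  then show ?thesis
  proof (elim disjE exE conjE)
    fix c assume c: "c p = 0" "\<forall>k\<ge>1. u (int k) = dot (p + q) c (\<lambda>i. regressor p q y u k $ i)"
    have "u (int k) = dot (p + q) c (\<lambda>i. if i = p then 0 else \<phi> k i)" if "k \<ge> 1" for k
      using c that drop[of "\<lambda>i. i = p" c k] by (simp add: \<phi>_def)
    from predictor_eventually_exact[of "\<lambda>k. u (int k)", OF this] show ?thesis by blast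
  next
    fix c assume c: "c p = 0" "c 0 = 0" "\<forall>k\<ge>1. y (int k) = dot (p + q) c (\<lambda>i. regressor p q y u k $ i)"
    have "y (int k) = dot (p + q) c (\<lambda>i. if i = p \<or> i = 0 then 0 else \<phi> k i)" if "k \<ge> 1" for k
      using c that drop[of "\<lambda>i. i = p \<or> i = 0" c k] by (auto simp: \<phi>_def)
    from predictor_eventually_exact[of "\<lambda>k. y (int k)", OF this] show ?thesis by blast
  qed
qed

section \<open>The closed loop process\<close>

locale closed_loop_process = prob_space M for M :: "'a measure" +
  fixes p q :: nat and a b :: "nat \<Rightarrow> real" and y u :: "'a \<Rightarrow> int \<Rightarrow> real" and w w' :: "'a \<Rightarrow> nat \<Rightarrow> real"
    and \<theta>0 :: "'a \<Rightarrow> nat \<Rightarrow> real Matrix.vec" and yref :: "nat \<Rightarrow> real" and \<epsilon> R \<gamma> :: real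
  assumes p1: "p \<ge> 1" and q1: "q \<ge> 1" and eps0: "0 < \<epsilon>"
    and processes: "arx_processes M y u w w'"
    and system: "AE \<omega> in M. \<forall>k. arx_equation p q a b (y \<omega>) (u \<omega>) (w \<omega>) k"
    and reference: "bounded (range yref)"
    and normalized: "iid_bounded_normalized M w'"
    and exogenous: "exogenous M y u w w'"
    and startup_values: "startup_values M p q y u \<theta>0"
    and control_law: "AE \<omega> in M. \<forall>k\<ge>1.
        u \<omega> (int k) = certainty_equivalence_control p q (y \<omega>) (u \<omega>) (\<theta>0 \<omega>) yref k
          + w' \<omega> k / regressor_energy p q (y \<omega>) (u \<omega>) (k - 1) powr (\<epsilon> / 2)"
    and noise_mds: "martingale_difference M (filtration_at M y u w w') w"
    and \<gamma>: "\<gamma> > 2" and noise_moments: "bounded_conditional_moments M (filtration_at M y u w w') w \<gamma>"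
    and R: "R > 0" and noise_average: "AE \<omega> in M. (\<lambda>k. (1 / real k) * (\<Sum>i = 1..k. (w \<omega> i)\<^sup>2)) \<longlonglongrightarrow> R"
    and min_phase: "\<forall>z::complex. norm z \<le> 1 \<longrightarrow> (\<Sum>j = 1..q. of_real (b j) * z ^ (j - 1)) \<noteq> 0"
    and b1_nz: "AE \<omega> in M. \<forall>k. b1_estimate p q (y \<omega>) (u \<omega>) (\<theta>0 \<omega>) k \<noteq> 0"
begin

abbreviation "F \<equiv> filtration_at M y u w w'"

text \<open>The information just before the excitation of time \<open>k\<close> is injected: it
  contains \<open>w k\<close> and \<open>y k\<close>, and \<open>F k\<close> adds exactly
  \<open>w' k\<close>.\<close>

definition H :: "nat \<Rightarrow> 'a measure" where
  "H k = generated_by M (observations y u k \<union> {\<lambda>\<omega>. w \<omega> i | i. i \<le> k} \<union> {\<lambda>\<omega>. w' \<omega> i | i. i < k})"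

text \<open>The input is given by the control law only almost surely, hence is not measurable with respect to
  the filtration at the current time; \<open>u_mod\<close> is a version that is.\<close>

definition u_ce :: "nat \<Rightarrow> 'a \<Rightarrow> real" where
  "u_ce k \<omega> = certainty_equivalence_control p q (y \<omega>) ((u \<omega>)(int k := 0)) (\<theta>0 \<omega>) yref k"

definition r :: "nat \<Rightarrow> 'a \<Rightarrow> real" where "r k \<omega> = regressor_energy p q (y \<omega>) (u \<omega>) k"

definition u_mod :: "nat \<Rightarrow> 'a \<Rightarrow> int \<Rightarrow> real" where
  "u_mod k \<omega> = (u \<omega>)(int k := u_ce k \<omega> + w' \<omega> k / r (k - 1) \<omega> powr (\<epsilon> / 2))"

lemma space_H [simp]: "space (H k) = space M" by (simp add: H_def)
lemma space_F [simp]: "space (F k) = space M" by (simp add: filtration_at_def)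

lemma y_measurable: "(\<lambda>\<omega>. y \<omega> i) \<in> borel_measurable M" and u_measurable: "(\<lambda>\<omega>. u \<omega> i) \<in> borel_measurable M"
  and w_measurable: "(\<lambda>\<omega>. w \<omega> k) \<in> borel_measurable M" and w'_measurable: "(\<lambda>\<omega>. w' \<omega> k) \<in> borel_measurable M"
  using processes by (auto simp: arx_processes_def)

lemma subalgebra_F: "subalgebra M (F k)" and subalgebra_H: "subalgebra M (H k)"
  unfolding filtration_at_def H_def
  by (rule subalgebra_generated_by, auto simp: observations_def intro: y_measurable u_measurable w_measurable w'_measurable)+

lemma F_generator: "f \<in> observations y u k \<union> {\<lambda>\<omega>. w \<omega> i | i. i \<le> k} \<union> {\<lambda>\<omega>. w' \<omega> i | i. i \<le> k} \<Longrightarrow> f \<in> borel_measurable (F k)"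
  unfolding filtration_at_def by (rule measurable_generated_by)

lemma H_generator: "f \<in> observations y u k \<union> {\<lambda>\<omega>. w \<omega> i | i. i \<le> k} \<union> {\<lambda>\<omega>. w' \<omega> i | i. i < k} \<Longrightarrow> f \<in> borel_measurable (H k)"
  unfolding H_def by (rule measurable_generated_by)

lemma F_mono: "j \<le> k \<Longrightarrow> sets (F j) \<subseteq> sets (F k)"
  unfolding filtration_at_def by (intro generated_by_mono Un_mono observations_mono) (auto intro: le_trans)

lemma H_mono: "j \<le> k \<Longrightarrow> sets (H j) \<subseteq> sets (H k)"
  unfolding H_def by (intro generated_by_mono Un_mono observations_mono) (auto intro: le_trans less_le_trans)

lemma H_F: "sets (H k) \<subseteq> sets (F k)"
  unfolding H_def filtration_at_def by (intro generated_by_mono Un_mono) auto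

lemma H_to_F: "f \<in> borel_measurable (H k) \<Longrightarrow> f \<in> borel_measurable (F k)"
  by (rule borel_measurable_subalgebra[OF H_F]) simp_all

lemma H_y: "i \<le> int k \<Longrightarrow> (\<lambda>\<omega>. y \<omega> i) \<in> borel_measurable (H k)"
proof (cases "i < 0")
  case True
  then obtain c d where "\<forall>\<omega>\<in>space M. y \<omega> i = c \<and> u \<omega> i = d" using processes unfolding arx_processes_def by blast
  then show ?thesis by (subst measurable_cong[where g = "\<lambda>_. c"]) auto
next
  case False
  moreover assume "i \<le> int k"
  ultimately show ?thesis by (intro H_generator) (auto simp: observations_def intro!: exI[of _ "nat i"])
qed

lemma H_u: "i < int k \<Longrightarrow> (\<lambda>\<omega>. u \<omega> i) \<in> borel_measurable (H k)"
proof (cases "i < 0")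
  case True
  then obtain c d where "\<forall>\<omega>\<in>space M. y \<omega> i = c \<and> u \<omega> i = d" using processes unfolding arx_processes_def by blast
  then show ?thesis by (subst measurable_cong[where g = "\<lambda>_. d"]) auto
next
  case False
  moreover assume "i < int k"
  ultimately show ?thesis by (intro H_generator) (auto simp: observations_def intro!: exI[of _ "nat i"])
qed

lemma H_\<theta>0: "i < p + q \<Longrightarrow> (\<lambda>\<omega>. \<theta>0 \<omega> k $ i) \<in> borel_measurable (H k)"
proof -
  assume i: "i < p + q"
  have "sets (generated_by M (observations y u k)) \<subseteq> sets (H k)"
    unfolding H_def by (intro generated_by_mono) auto
  moreover have "(\<lambda>\<omega>. \<theta>0 \<omega> k $ i) \<in> borel_measurable (generated_by M (observations y u k))"
    using startup_values i unfolding startup_values_def by blast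
  ultimately show ?thesis using borel_measurable_subalgebra[of "generated_by M (observations y u k)" "H k"] by simp
qed

lemma H_u_ce: "1 \<le> k \<Longrightarrow> u_ce k \<in> borel_measurable (H k)"
  unfolding u_ce_def[abs_def]
proof (rule borel_measurable_control)
  fix i assume "i \<le> int k"
  then show "(\<lambda>\<omega>. ((u \<omega>)(int k := 0)) i) \<in> borel_measurable (H k)" by (cases "i = int k") (auto intro: H_u)
qed (use q1 in \<open>auto intro: H_y H_\<theta>0\<close>)

lemma H_r: "n < k \<Longrightarrow> r n \<in> borel_measurable (H k)"
  unfolding r_def[abs_def] by (rule borel_measurable_regressor_energy[where k = n]) (auto intro: H_y H_u)

lemma r_ge_1: "1 \<le> r n \<omega>"
  unfolding r_def regressor_energy_def by (simp add: sum_nonneg scalar_prod_def)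

lemma F_u_mod: "1 \<le> k \<Longrightarrow> i \<le> int k \<Longrightarrow> (\<lambda>\<omega>. u_mod k \<omega> i) \<in> borel_measurable (F k)"
proof (cases "i = int k")
  case True
  assume k: "1 \<le> k"
  have "(\<lambda>\<omega>. u_ce k \<omega> + w' \<omega> k / r (k - 1) \<omega> powr (\<epsilon> / 2)) \<in> borel_measurable (F k)"
    using k by (intro borel_measurable_add borel_measurable_divide powr_real_measurable H_to_F[OF H_u_ce] H_to_F[OF H_r]) (auto intro: F_generator)
  then show ?thesis using True by (simp add: u_mod_def)
next
  case False
  moreover assume "i \<le> int k"
  ultimately have "i < int k" "i \<noteq> int k" by auto
  then show ?thesis by (simp add: u_mod_def H_to_F H_u)
qed

lemma F_y: "i \<le> int k \<Longrightarrow> (\<lambda>\<omega>. y \<omega> i) \<in> borel_measurable (F k)"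
  by (rule H_to_F[OF H_y])

lemma F_w: "i \<le> k \<Longrightarrow> (\<lambda>\<omega>. w \<omega> i) \<in> borel_measurable (F k)"
  by (rule F_generator) auto

lemma control_explicit: "AE \<omega> in M. \<forall>k\<ge>1. u \<omega> (int k) = u_ce k \<omega> + w' \<omega> k / r (k - 1) \<omega> powr (\<epsilon> / 2)"
  using control_law
proof eventually_elim
  case (elim \<omega>)
  then show ?case using certainty_equivalence_control_upd[OF _ q1] by (simp add: u_ce_def r_def)
qed

lemma u_mod_eq: "AE \<omega> in M. \<forall>k\<ge>1. u_mod k \<omega> = u \<omega>"
  using control_explicit by eventually_elim (auto simp: u_mod_def)

section \<open>The pathwise bounds hold almost surely\<close>

lemma noise: "mds M (\<lambda>m. F (Suc m)) (\<lambda>m \<omega>. w \<omega> (m + 2))"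
proof (intro mds.intro mds_axioms.intro)
  show "prob_space M" by (rule prob_space_axioms)
  show "(\<lambda>\<omega>. w \<omega> (k + 2)) \<in> borel_measurable (F (Suc (Suc k)))" for k by (auto intro!: F_generator)
  show "integrable M (\<lambda>\<omega>. w \<omega> (k + 2))" for k using noise_mds by (simp add: martingale_difference_def)
  show "AE \<omega> in M. real_cond_exp M (F (Suc k)) (\<lambda>\<omega>. w \<omega> (k + 2)) \<omega> = 0" for k
  proof -
    have "AE \<omega> in M. real_cond_exp M (F (Suc k)) (\<lambda>\<omega>. w \<omega> (Suc k + 1)) \<omega> = 0"
      using noise_mds unfolding martingale_difference_def by simp
    then show ?thesis by simp
  qed
  have "AE \<omega> in M. (SUP k. nn_cond_exp M (F (Suc k)) (\<lambda>\<omega>. ennreal (\<bar>w \<omega> (k + 2)\<bar> powr \<gamma>)) \<omega>) < \<infinity>"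
    using noise_moments unfolding bounded_conditional_moments_def
  proof eventually_elim
    case (elim \<omega>)
    have "(SUP k. nn_cond_exp M (F (Suc k)) (\<lambda>\<omega>. ennreal (\<bar>w \<omega> (k + 2)\<bar> powr \<gamma>)) \<omega>)
        \<le> (SUP k\<in>{1..}. nn_cond_exp M (F k) (\<lambda>\<omega>. ennreal (\<bar>w \<omega> (k + 1)\<bar> powr \<gamma>)) \<omega>)"
      by (rule SUP_least) (rule SUP_upper2[where i = "Suc _"], auto)
    then show ?case using elim by (rule order_le_less_trans)
  qed
  then show "AE \<omega> in M. (SUP k. nn_cond_exp M (F (Suc k)) (\<lambda>\<omega>. ennreal ((w \<omega> (k + 2))\<^sup>2)) \<omega>) < \<infinity>"
    by (rule square_cond_exp_bounded[OF subalgebra_F w_measurable \<gamma>])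
qed (auto intro: subalgebra_F F_mono[THEN subsetD])

text \<open>Used for the excitation itself and for its centred square; boundedness and independence
  of the past carry over to functions of \<open>w'\<close>.\<close>

lemma excitation_mds:
  fixes h :: "real \<Rightarrow> real"
  assumes h: "h \<in> borel_measurable borel" "\<And>k. expectation (\<lambda>\<omega>. h (w' \<omega> k)) = 0" "\<And>k. AE \<omega> in M. \<bar>h (w' \<omega> k)\<bar> \<le> c"
  shows "mds M (\<lambda>m. H (Suc m)) (\<lambda>m \<omega>. h (w' \<omega> (Suc m)))"
proof (rule mds_independentI[where N = "\<lambda>m. generated_by M {\<lambda>\<omega>. w' \<omega> (Suc m)}" and c = c])
  fix k
  have "(\<lambda>\<omega>. w' \<omega> (Suc k)) \<in> borel_measurable (H (Suc (Suc k)))" by (rule H_generator) auto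
  then show "(\<lambda>\<omega>. h (w' \<omega> (Suc k))) \<in> borel_measurable (H (Suc (Suc k)))" using h(1) by (rule measurable_compose)
  have "(\<lambda>\<omega>. w' \<omega> (Suc k)) \<in> borel_measurable (generated_by M {\<lambda>\<omega>. w' \<omega> (Suc k)})" by (rule measurable_generated_by) simp
  then show "(\<lambda>\<omega>. h (w' \<omega> (Suc k))) \<in> borel_measurable (generated_by M {\<lambda>\<omega>. w' \<omega> (Suc k)})" using h(1) by (rule measurable_compose)
  show "indep_set (sets (generated_by M {\<lambda>\<omega>. w' \<omega> (Suc k)})) (sets (H (Suc k)))"
    using exogenous unfolding exogenous_def H_def by simp
qed (use h in \<open>auto intro: subalgebra_H H_mono[THEN subsetD]\<close>)

lemma w'_bounded_AE: "\<exists>c. AE \<omega> in M. \<forall>k. \<bar>w' \<omega> k\<bar> \<le> c"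
  using normalized unfolding iid_bounded_normalized_def by (auto simp: AE_all_countable)

lemma excitation: "mds M (\<lambda>m. H (Suc m)) (\<lambda>m \<omega>. w' \<omega> (Suc m))"
proof -
  obtain c where "\<And>k. AE \<omega> in M. \<bar>w' \<omega> k\<bar> \<le> c" using normalized unfolding iid_bounded_normalized_def by blast
  then show ?thesis using normalized unfolding iid_bounded_normalized_def
    by (intro excitation_mds[where h = "\<lambda>x. x" and c = c]) auto
qed

lemma excitation_square: "mds M (\<lambda>m. H (Suc m)) (\<lambda>m \<omega>. (w' \<omega> (Suc m))\<^sup>2 - 1)"
proof -
  obtain c where c: "\<And>k. AE \<omega> in M. \<bar>w' \<omega> k\<bar> \<le> c" using normalized unfolding iid_bounded_normalized_def by blast
  have bd: "AE \<omega> in M. (w' \<omega> k)\<^sup>2 \<le> c\<^sup>2" for k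
    using c[of k]
  proof eventually_elim
    case (elim \<omega>)
    then have "\<bar>w' \<omega> k\<bar>^2 \<le> c^2" by (intro power_mono) auto
    then show ?case by simp
  qed
  have int: "integrable M (\<lambda>\<omega>. (w' \<omega> k)\<^sup>2)" for k
    by (rule integrable_const_bound[where B = "c\<^sup>2"]) (use bd[of k] w'_measurable[of k] in auto)
  show ?thesis
  proof (rule excitation_mds[where h = "\<lambda>x. x\<^sup>2 - 1" and c = "c\<^sup>2 + 1"])
    fix k
    show "expectation (\<lambda>\<omega>. (w' \<omega> k)\<^sup>2 - 1) = 0"
      using int[of k] normalized unfolding iid_bounded_normalized_def by (simp add: prob_space)
    show "AE \<omega> in M. \<bar>(w' \<omega> k)\<^sup>2 - 1\<bar> \<le> c\<^sup>2 + 1"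
      using bd[of k] by eventually_elim (smt (verit) zero_le_power2)
  qed simp
qed

definition reg :: "(int \<Rightarrow> real) \<Rightarrow> (int \<Rightarrow> real) \<Rightarrow> nat \<Rightarrow> nat \<Rightarrow> real" where
  "reg Y U k i = regressor p q Y U k $ i"

lemma F_reg: "1 \<le> k \<Longrightarrow> j \<le> k \<Longrightarrow> i < p + q \<Longrightarrow> (\<lambda>\<omega>. reg (y \<omega>) (u_mod k \<omega>) j i) \<in> borel_measurable (F k)"
  unfolding reg_def by (rule borel_measurable_regressor[where k = k]) (auto intro: F_y F_u_mod)

text \<open>A function of paths rather than of \<open>\<omega>\<close>: the measurable version
  \<open>u_mod\<close> can be inserted in order to apply the transform bounds, and then be replaced
  by \<open>u\<close> almost surely.\<close>

definition lsg :: "(int \<Rightarrow> real) \<Rightarrow> (int \<Rightarrow> real) \<Rightarrow> (nat \<Rightarrow> real) \<Rightarrow> nat \<Rightarrow> real" where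
  "lsg Y U W m = (if det (lsq.Gm (p + q) (reg Y U) m) = 0 then 0
     else lsq.e (p + q) (reg Y U) (\<lambda>k. W (Suc k)) m / (1 + lsq.s (p + q) (reg Y U) m))"

definition lsa :: "(int \<Rightarrow> real) \<Rightarrow> (int \<Rightarrow> real) \<Rightarrow> nat \<Rightarrow> real" where
  "lsa Y U m = (if det (lsq.Gm (p + q) (reg Y U) m) = 0 then 0
     else lsq.s (p + q) (reg Y U) m / (1 + lsq.s (p + q) (reg Y U) m))"

lemma F_det: "{\<omega> \<in> space (F (Suc m)). det (lsq.Gm (p + q) (reg (y \<omega>) (u_mod (Suc m) \<omega>)) m) = 0} \<in> sets (F (Suc m))"
proof -
  have "(\<lambda>\<omega>. det (lsq.Gm (p + q) (reg (y \<omega>) (u_mod (Suc m) \<omega>)) m)) \<in> borel_measurable (F (Suc m))"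
    by (rule borel_measurable_det_gram) (auto intro: F_reg)
  then show ?thesis by measurable
qed

lemma F_s: "(\<lambda>\<omega>. lsq.s (p + q) (reg (y \<omega>) (u_mod (Suc m) \<omega>)) m) \<in> borel_measurable (F (Suc m))"
  by (rule borel_measurable_ls_s) (auto intro: F_reg)

lemma F_lsg: "(\<lambda>\<omega>. lsg (y \<omega>) (u_mod (Suc m) \<omega>) (w \<omega>) m) \<in> borel_measurable (F (Suc m))"
proof -
  have "(\<lambda>\<omega>. lsq.e (p + q) (reg (y \<omega>) (u_mod (Suc m) \<omega>)) (\<lambda>k. w \<omega> (Suc k)) m) \<in> borel_measurable (F (Suc m))"
    by (rule borel_measurable_ls_e) (auto intro: F_reg F_w)
  then show ?thesis unfolding lsg_def
    by (intro measurable_If F_det borel_measurable_divide borel_measurable_add F_s) auto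
qed

lemma F_lsa: "(\<lambda>\<omega>. lsa (y \<omega>) (u_mod (Suc m) \<omega>) m) \<in> borel_measurable (F (Suc m))"
  unfolding lsa_def by (intro measurable_If F_det borel_measurable_divide borel_measurable_add F_s) auto

lemma lsa_nonneg: "0 \<le> lsa Y U m"
  using lsq.s_nonneg[of "p + q" "reg Y U" m] by (simp add: lsa_def)

lemma ls_cross_AE: "AE \<omega> in M. \<exists>C\<ge>0. \<forall>n. \<bar>\<Sum>m<n. lsg (y \<omega>) (u \<omega>) (w \<omega>) m * w \<omega> (m + 2)\<bar>
    \<le> C * (1 + (\<Sum>m<n. (lsg (y \<omega>) (u \<omega>) (w \<omega>) m)\<^sup>2)) powr (3/4)"
  using mds.transform_bound[OF noise F_lsg] u_mod_eq by eventually_elim simp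

lemma ls_square_AE: "AE \<omega> in M. \<exists>C\<ge>0. \<forall>n. (\<Sum>m<n. lsa (y \<omega>) (u \<omega>) m * (w \<omega> (m + 2))\<^sup>2)
    \<le> C * (1 + (\<Sum>m<n. lsa (y \<omega>) (u \<omega>) m)) powr (3/2)"
  using mds.square_bound[OF noise F_lsa lsa_nonneg] u_mod_eq by eventually_elim simp

lemma noise_y_AE: "AE \<omega> in M. \<forall>j. \<exists>C\<ge>0. \<forall>n. \<bar>\<Sum>k<n. y \<omega> (int (Suc k) - int j) * w \<omega> (k + 2)\<bar>
    \<le> C * (1 + (\<Sum>k<n. (y \<omega> (int (Suc k) - int j))\<^sup>2)) powr (3/4)"
  unfolding AE_all_countable by (intro allI mds.transform_bound[OF noise] F_y) auto

lemma noise_u_AE: "AE \<omega> in M. \<forall>j. \<exists>C\<ge>0. \<forall>n. \<bar>\<Sum>k<n. u \<omega> (int (Suc k) - int j) * w \<omega> (k + 2)\<bar>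
    \<le> C * (1 + (\<Sum>k<n. (u \<omega> (int (Suc k) - int j))\<^sup>2)) powr (3/4)"
  unfolding AE_all_countable
proof
  fix j
  have "AE \<omega> in M. \<exists>C\<ge>0. \<forall>n. \<bar>\<Sum>k<n. u_mod (Suc k) \<omega> (int (Suc k) - int j) * w \<omega> (k + 2)\<bar>
    \<le> C * (1 + (\<Sum>k<n. (u_mod (Suc k) \<omega> (int (Suc k) - int j))\<^sup>2)) powr (3/4)"
    by (intro mds.transform_bound[OF noise] F_u_mod) auto
  with u_mod_eq show "AE \<omega> in M. \<exists>C\<ge>0. \<forall>n. \<bar>\<Sum>k<n. u \<omega> (int (Suc k) - int j) * w \<omega> (k + 2)\<bar>
    \<le> C * (1 + (\<Sum>k<n. (u \<omega> (int (Suc k) - int j))\<^sup>2)) powr (3/4)"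
    by eventually_elim simp
qed

text \<open>The damping by \<open>r\<close> is known before the excitation and at most 1, so it is
  moved into the integrand and then dropped from its energy.\<close>

lemma excitation_AE:
  assumes g: "\<And>k. g k \<in> borel_measurable (H (Suc k))"
  shows "AE \<omega> in M. \<exists>C\<ge>0. \<forall>n. \<bar>\<Sum>k<n. g k \<omega> * (w' \<omega> (Suc k) / r k \<omega> powr (\<epsilon> / 2))\<bar> \<le> C * (1 + (\<Sum>k<n. (g k \<omega>)\<^sup>2)) powr (3/4)"
proof -
  have "(\<lambda>\<omega>. g k \<omega> / r k \<omega> powr (\<epsilon> / 2)) \<in> borel_measurable (H (Suc k))" for k
    by (intro borel_measurable_divide powr_real_measurable g H_r) auto
  from mds.transform_bound[OF excitation this] show ?thesis
  proof eventually_elim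
    case (elim \<omega>)
    then obtain C where C: "0 \<le> C" "\<And>n. \<bar>\<Sum>k<n. g k \<omega> / r k \<omega> powr (\<epsilon> / 2) * w' \<omega> (Suc k)\<bar>
        \<le> C * (1 + (\<Sum>k<n. (g k \<omega> / r k \<omega> powr (\<epsilon> / 2))\<^sup>2)) powr (3/4)" by blast
    have "(g k \<omega> / r k \<omega> powr (\<epsilon> / 2))\<^sup>2 \<le> (g k \<omega>)\<^sup>2" for k
    proof -
      have "1 \<le> r k \<omega> powr (\<epsilon> / 2)" using r_ge_1[of k \<omega>] eps0 by (simp add: ge_one_powr_ge_zero)
      then have "\<bar>g k \<omega>\<bar> / r k \<omega> powr (\<epsilon> / 2) \<le> \<bar>g k \<omega>\<bar> / 1" by (intro divide_left_mono) auto
      then have "(\<bar>g k \<omega>\<bar> / r k \<omega> powr (\<epsilon> / 2))\<^sup>2 \<le> \<bar>g k \<omega>\<bar>\<^sup>2" by (intro power_mono) auto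
      then show ?thesis by (simp add: power_divide)
    qed
    then have "C * (1 + (\<Sum>k<n. (g k \<omega> / r k \<omega> powr (\<epsilon> / 2))\<^sup>2)) powr (3/4) \<le> C * (1 + (\<Sum>k<n. (g k \<omega>)\<^sup>2)) powr (3/4)" for n
      by (intro mult_left_mono[OF _ C(1)] powr_mono2 add_left_mono sum_mono) (auto simp: sum_nonneg)
    then have "\<bar>\<Sum>k<n. g k \<omega> * (w' \<omega> (Suc k) / r k \<omega> powr (\<epsilon> / 2))\<bar> \<le> C * (1 + (\<Sum>k<n. (g k \<omega>)\<^sup>2)) powr (3/4)" for n
      using order_trans[OF C(2)] by simp
    then show ?case using C(1) by blast
  qed
qed

lemma excitation_y_AE: "AE \<omega> in M. \<forall>j. \<exists>C\<ge>0. \<forall>n. \<bar>\<Sum>k<n. y \<omega> (int (Suc k) - int j) * (w' \<omega> (Suc k) / r k \<omega> powr (\<epsilon> / 2))\<bar>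
    \<le> C * (1 + (\<Sum>k<n. (y \<omega> (int (Suc k) - int j))\<^sup>2)) powr (3/4)"
  unfolding AE_all_countable by (intro allI excitation_AE H_y) auto

lemma excitation_u_AE: "AE \<omega> in M. \<forall>j. 1 \<le> j \<longrightarrow> (\<exists>C\<ge>0. \<forall>n. \<bar>\<Sum>k<n. u \<omega> (int (Suc k) - int j) * (w' \<omega> (Suc k) / r k \<omega> powr (\<epsilon> / 2))\<bar>
    \<le> C * (1 + (\<Sum>k<n. (u \<omega> (int (Suc k) - int j))\<^sup>2)) powr (3/4))"
  unfolding AE_all_countable by (intro allI AE_impI excitation_AE H_u) auto

lemma excitation_u0_AE: "AE \<omega> in M. \<exists>C\<ge>0. \<forall>n.
    \<bar>\<Sum>k<n. (u \<omega> (int (Suc k)) - w' \<omega> (Suc k) / r k \<omega> powr (\<epsilon> / 2)) * (w' \<omega> (Suc k) / r k \<omega> powr (\<epsilon> / 2))\<bar>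
    \<le> C * (1 + (\<Sum>k<n. (u \<omega> (int (Suc k)) - w' \<omega> (Suc k) / r k \<omega> powr (\<epsilon> / 2))\<^sup>2)) powr (3/4)"
proof -
  have "AE \<omega> in M. \<exists>C\<ge>0. \<forall>n. \<bar>\<Sum>k<n. u_ce (Suc k) \<omega> * (w' \<omega> (Suc k) / r k \<omega> powr (\<epsilon> / 2))\<bar> \<le> C * (1 + (\<Sum>k<n. (u_ce (Suc k) \<omega>)\<^sup>2)) powr (3/4)"
    by (rule excitation_AE[OF H_u_ce]) simp
  with control_explicit show ?thesis
  proof eventually_elim
    case (elim \<omega>)
    have "u \<omega> (int (Suc k)) - w' \<omega> (Suc k) / r k \<omega> powr (\<epsilon> / 2) = u_ce (Suc k) \<omega>" for k
      using elim(1)[rule_format, of "Suc k"] by simp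
    then show ?case using elim(2) by presburger
  qed
qed

text \<open>The transform of the centred squares with integrand 1 has order N^(3/4), so the energy
  of the excitation differs from \<open>N\<close> by less than half of it eventually.\<close>

lemma excitation_average_AE: "AE \<omega> in M. \<exists>N0. \<forall>N\<ge>N0. real N / 2 \<le> (\<Sum>k = 1..N. (w' \<omega> k)\<^sup>2)"
proof -
  have "AE \<omega> in M. \<exists>C\<ge>0. \<forall>n. \<bar>\<Sum>k<n. 1 * ((w' \<omega> (Suc k))\<^sup>2 - 1)\<bar> \<le> C * (1 + (\<Sum>k<n. 1\<^sup>2)) powr (3/4)"
    by (rule mds.transform_bound[OF excitation_square]) simp
  then show ?thesis
  proof eventually_elim
    case (elim \<omega>)
    then obtain C where C: "0 \<le> C" "\<And>n. \<bar>\<Sum>k<n. (w' \<omega> (Suc k))\<^sup>2 - 1\<bar> \<le> C * (1 + real n) powr (3/4)" by auto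
    obtain D where D: "\<And>x. 0 \<le> x \<Longrightarrow> C * x powr (3/4) \<le> 1/4 * x + D" using powr_sublinear[of "3/4" "1/4" C] C(1) by auto
    show ?case
    proof (intro exI allI impI)
      fix N assume N: "nat \<lceil>4 * (1/4 + D)\<rceil> \<le> N"
      then have "4 * (1/4 + D) \<le> real N" by linarith
      then have N': "1 + 4 * D \<le> real N" by simp
      have "(\<Sum>k<N. (w' \<omega> (Suc k))\<^sup>2 - 1) = (\<Sum>k<N. (w' \<omega> (Suc k))\<^sup>2) - real N" by (simp add: sum_subtractf)
      also have "(\<Sum>k<N. (w' \<omega> (Suc k))\<^sup>2) = (\<Sum>k = 1..N. (w' \<omega> k)\<^sup>2)"
        by (rule sum.reindex_bij_witness[of _ "\<lambda>k. k - 1" Suc]) auto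
      finally have "\<bar>(\<Sum>k = 1..N. (w' \<omega> k)\<^sup>2) - real N\<bar> \<le> 1/4 * (1 + real N) + D"
        using C(2)[of N] D[of "1 + real N"] by simp
      then have "\<bar>(\<Sum>k = 1..N. (w' \<omega> k)\<^sup>2) - real N\<bar> \<le> 1/4 + real N / 4 + D" by (simp add: add_divide_distrib)
      then show "real N / 2 \<le> (\<Sum>k = 1..N. (w' \<omega> k)\<^sup>2)" using N' by linarith
    qed
  qed
qed

section \<open>The Gram matrix cannot stay singular\<close>

definition u_pred :: "'a \<Rightarrow> nat \<Rightarrow> real" where
  "u_pred \<omega> k = dot (p + q) (predictor (p + q) (\<lambda>k i. if i = p then 0 else reg (y \<omega>) (u \<omega>) k i) (\<lambda>k. u \<omega> (int k)) k)
      (\<lambda>i. if i = p then 0 else reg (y \<omega>) (u \<omega>) (Suc k) i)"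

definition y_pred :: "(int \<Rightarrow> real) \<Rightarrow> (int \<Rightarrow> real) \<Rightarrow> nat \<Rightarrow> real" where
  "y_pred Y U k = dot (p + q) (predictor (p + q) (\<lambda>k i. if i = p \<or> i = 0 then 0 else reg Y U k i) (\<lambda>k. Y (int k)) k)
      (\<lambda>i. if i = p \<or> i = 0 then 0 else reg Y U (Suc k) i)"

lemma H_reg_off: "i < p + q \<Longrightarrow> j \<le> k \<Longrightarrow> (\<lambda>\<omega>. if i = p then 0 else reg (y \<omega>) (u \<omega>) j i) \<in> borel_measurable (H k)"
proof (cases "i = p")
  case False
  moreover assume "i < p + q" "j \<le> k"
  ultimately have "(\<lambda>\<omega>. reg (y \<omega>) (u \<omega>) j i) \<in> borel_measurable (H k)"
    by (cases "i < p") (auto simp: reg_def regressor_def intro!: H_y H_u)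
  then show ?thesis using False by simp
qed simp

lemma F_reg_off: "i < p + q \<Longrightarrow> 1 \<le> k \<Longrightarrow> j \<le> Suc k \<Longrightarrow>
    (\<lambda>\<omega>. if i = p \<or> i = 0 then 0 else reg (y \<omega>) (u_mod k \<omega>) j i) \<in> borel_measurable (F k)"
proof (cases "i = p \<or> i = 0")
  case False
  moreover assume "i < p + q" "1 \<le> k" "j \<le> Suc k"
  ultimately have "(\<lambda>\<omega>. reg (y \<omega>) (u_mod k \<omega>) j i) \<in> borel_measurable (F k)"
    by (cases "i < p") (auto simp: reg_def regressor_def intro!: F_y F_u_mod)
  then show ?thesis using False by simp
qed simp

lemma H_u_pred: "(\<lambda>\<omega>. u_pred \<omega> k) \<in> borel_measurable (H (Suc k))"
  unfolding u_pred_def by (intro borel_measurable_dot borel_measurable_predictor H_reg_off H_u) auto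

lemma F_y_pred: "1 \<le> k \<Longrightarrow> (\<lambda>\<omega>. y_pred (y \<omega>) (u_mod k \<omega>) k) \<in> borel_measurable (F k)"
  unfolding y_pred_def by (intro borel_measurable_dot borel_measurable_predictor F_reg_off F_y) auto

text \<open>If the input were eventually predicted exactly, the control law would express the
  excitation by earlier data; if the output were, the system equation would express the noise by
  earlier data. Both have unbounded energy, so \<open>not_predictable\<close> excludes either
  case.\<close>

lemma startup_AE: "AE \<omega> in M. \<exists>n. det (gram p q (y \<omega>) (u \<omega>) n) \<noteq> 0"
proof -
  have "AE \<omega> in M. (\<forall>B. \<exists>n. B < (\<Sum>k<n. (w' \<omega> (Suc k))\<^sup>2)) \<longrightarrow>
      \<not> (\<exists>K. \<forall>k\<ge>K. w' \<omega> (Suc k) = (u_pred \<omega> k - u_ce (Suc k) \<omega>) * r k \<omega> powr (\<epsilon> / 2))"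
    by (intro mds.not_predictable[OF excitation] borel_measurable_times borel_measurable_diff powr_real_measurable
        H_u_pred H_u_ce H_r) auto
  moreover have "AE \<omega> in M. (\<forall>B. \<exists>n. B < (\<Sum>k<n. (w \<omega> (k + 2))\<^sup>2)) \<longrightarrow>
      \<not> (\<exists>K. \<forall>k\<ge>K. w \<omega> (k + 2) = y_pred (y \<omega>) (u_mod (Suc k) \<omega>) (Suc k) -
        ((\<Sum>i = 1..p. a i * y \<omega> (int (Suc k) + 1 - int i)) + (\<Sum>j = 1..q. b j * u_mod (Suc k) \<omega> (int (Suc k) + 1 - int j))))"
    by (intro mds.not_predictable[OF noise] borel_measurable_diff borel_measurable_add borel_measurable_sum borel_measurable_times
        F_y_pred F_y F_u_mod) auto
  ultimately show ?thesis
    using excitation_average_AE noise_average control_explicit u_mod_eq system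
  proof eventually_elim
    case (elim \<omega>)
    have w'_unb: "\<exists>n. B < (\<Sum>k<n. (w' \<omega> (Suc k))\<^sup>2)" for B
    proof -
      obtain N0 where N0: "\<And>N. N0 \<le> N \<Longrightarrow> real N / 2 \<le> (\<Sum>k = 1..N. (w' \<omega> k)\<^sup>2)" using elim(3) by blast
      define N where "N = max N0 (nat \<lceil>2 * B\<rceil> + 1)"
      have "2 * B < real N" unfolding N_def by linarith
      then have "B < (\<Sum>k = 1..N. (w' \<omega> k)\<^sup>2)" using N0[of N] by (simp add: N_def)
      also have "\<dots> = (\<Sum>k<N. (w' \<omega> (Suc k))\<^sup>2)"
        by (rule sum.reindex_bij_witness[of _ Suc "\<lambda>k. k - 1"]) auto
      finally show ?thesis by blast
    qed
    have w_unb: "\<exists>n. B < (\<Sum>k<n. (w \<omega> (k + 2))\<^sup>2)" for B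
    proof -
      have "eventually (\<lambda>k. R / 2 < (1 / real k) * (\<Sum>i = 1..k. (w \<omega> i)\<^sup>2)) sequentially"
        using elim(4) R by (intro order_tendstoD(1)) auto
      then obtain N0 where N0: "\<And>N. N0 \<le> N \<Longrightarrow> R / 2 < (1 / real N) * (\<Sum>i = 1..N. (w \<omega> i)\<^sup>2)"
        unfolding eventually_sequentially by blast
      define D where "D = B + (w \<omega> 1)\<^sup>2"
      define N where "N = max N0 (nat \<lceil>D / (R / 2)\<rceil> + 1)"
      have N: "D / (R / 2) \<le> real N" "0 < real N" "N0 \<le> N" unfolding N_def by linarith+
      have "D \<le> R / 2 * real N" using N(1) R by (simp add: field_simps)
      also have "\<dots> < (\<Sum>i = 1..N. (w \<omega> i)\<^sup>2)" using N0[OF N(3)] N(2) by (simp add: field_simps)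
      also have "\<dots> = (\<Sum>k<N. (w \<omega> (Suc k))\<^sup>2)"
        by (rule sum.reindex_bij_witness[of _ Suc "\<lambda>k. k - 1"]) auto
      also have "\<dots> \<le> (\<Sum>k<Suc N. (w \<omega> (Suc k))\<^sup>2)" by simp
      also have "\<dots> = (w \<omega> 1)\<^sup>2 + (\<Sum>k<N. (w \<omega> (k + 2))\<^sup>2)" by (subst sum.lessThan_Suc_shift) simp
      finally show ?thesis unfolding D_def by auto
    qed
    have um: "u_mod (Suc k) \<omega> = u \<omega>" for k using elim(6) by simp
    have no_u: "\<not> (\<exists>K. \<forall>k\<ge>K. u \<omega> (int (Suc k)) = u_pred \<omega> k)"
    proof
      assume "\<exists>K. \<forall>k\<ge>K. u \<omega> (int (Suc k)) = u_pred \<omega> k"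
      then obtain K where K: "\<And>k. K \<le> k \<Longrightarrow> u \<omega> (int (Suc k)) = u_pred \<omega> k" by blast
      have "w' \<omega> (Suc k) = (u_pred \<omega> k - u_ce (Suc k) \<omega>) * r k \<omega> powr (\<epsilon> / 2)" if "K \<le> k" for k
      proof -
        have "u_pred \<omega> k = u_ce (Suc k) \<omega> + w' \<omega> (Suc k) / r k \<omega> powr (\<epsilon> / 2)"
          using elim(5)[rule_format, of "Suc k"] K[OF that] by simp
        moreover have "r k \<omega> powr (\<epsilon> / 2) \<noteq> 0" using r_ge_1[of k \<omega>] by simp
        ultimately show ?thesis by simp
      qed
      then have "\<exists>K. \<forall>k\<ge>K. w' \<omega> (Suc k) = (u_pred \<omega> k - u_ce (Suc k) \<omega>) * r k \<omega> powr (\<epsilon> / 2)"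
        by (intro exI[of _ K] allI impI)
      with elim(1)[THEN mp, OF allI[OF w'_unb]] show False by (rule notE)
    qed
    have no_y: "\<not> (\<exists>K. \<forall>k\<ge>K. y \<omega> (int (Suc k)) = y_pred (y \<omega>) (u \<omega>) k)"
    proof
      assume "\<exists>K. \<forall>k\<ge>K. y \<omega> (int (Suc k)) = y_pred (y \<omega>) (u \<omega>) k"
      then obtain K where K: "\<And>k. K \<le> k \<Longrightarrow> y \<omega> (int (Suc k)) = y_pred (y \<omega>) (u \<omega>) k" by blast
      have "w \<omega> (k + 2) = y_pred (y \<omega>) (u_mod (Suc k) \<omega>) (Suc k) -
        ((\<Sum>i = 1..p. a i * y \<omega> (int (Suc k) + 1 - int i)) + (\<Sum>j = 1..q. b j * u_mod (Suc k) \<omega> (int (Suc k) + 1 - int j)))"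
        if "K \<le> k" for k
      proof -
        have "y \<omega> (int (Suc k) + 1) = y_pred (y \<omega>) (u \<omega>) (Suc k)" using K[of "Suc k"] that by (simp add: add.commute)
        moreover have "y \<omega> (int (Suc k) + 1) = (\<Sum>i = 1..p. a i * y \<omega> (int (Suc k) + 1 - int i))
             + (\<Sum>j = 1..q. b j * u \<omega> (int (Suc k) + 1 - int j)) + w \<omega> (Suc k + 1)"
          using elim(7)[rule_format, of "Suc k"] unfolding arx_equation_def .
        moreover have "Suc k + 1 = k + 2" by simp
        ultimately show ?thesis unfolding um by simp
      qed
      then have "\<exists>K. \<forall>k\<ge>K. w \<omega> (k + 2) = y_pred (y \<omega>) (u_mod (Suc k) \<omega>) (Suc k) -
        ((\<Sum>i = 1..p. a i * y \<omega> (int (Suc k) + 1 - int i)) + (\<Sum>j = 1..q. b j * u_mod (Suc k) \<omega> (int (Suc k) + 1 - int j)))"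
        by (intro exI[of _ K] allI impI)
      with elim(2)[THEN mp, OF allI[OF w_unb]] show False by (rule notE)
    qed
    show ?case
    proof (rule ccontr)
      assume "\<not> (\<exists>n. det (gram p q (y \<omega>) (u \<omega>) n) \<noteq> 0)"
      then have "\<And>n. det (gram p q (y \<omega>) (u \<omega>) n) = 0" by blast
      from singular_start_predictable[OF p1 q1 this]
      have "(\<exists>K. \<forall>k\<ge>K. u \<omega> (int (Suc k)) = u_pred \<omega> k) \<or> (\<exists>K. \<forall>k\<ge>K. y \<omega> (int (Suc k)) = y_pred (y \<omega>) (u \<omega>) k)"
        unfolding u_pred_def y_pred_def reg_def .
      then show False using no_u no_y by blast
    qed
  qed
qed

lemma noisy_loop_AE: "AE \<omega> in M. noisy_loop p q a b (y \<omega>) (u \<omega>) (w \<omega>) (w' \<omega>) (\<theta>0 \<omega>) yref \<epsilon>"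
proof -
  obtain c where "AE \<omega> in M. \<forall>k. \<bar>w' \<omega> k\<bar> \<le> c" using w'_bounded_AE by blast
  then have "AE \<omega> in M. closed_loop p q a b (y \<omega>) (u \<omega>) (w \<omega>) (w' \<omega>) (\<theta>0 \<omega>) yref \<epsilon>"
    using system control_law b1_nz noise_average excitation_average_AE startup_AE
  proof eventually_elim
    case (elim \<omega>)
    have "\<exists>C. \<forall>k. \<bar>yref k\<bar> \<le> C" using reference by (auto simp: bounded_iff)
    then show ?case using elim p1 q1 eps0 min_phase R by unfold_locales blast+
  qed
  then show ?thesis
    using ls_cross_AE ls_square_AE noise_y_AE noise_u_AE excitation_y_AE excitation_u_AE excitation_u0_AE
  proof eventually_elim
    case (elim \<omega>)
    interpret path: closed_loop p q a b "y \<omega>" "u \<omega>" "w \<omega>" "w' \<omega>" "\<theta>0 \<omega>" yref \<epsilon> by (rule elim(1))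
    have \<phi>: "path.\<phi> = reg (y \<omega>) (u \<omega>)" by (intro ext) (simp add: path.\<phi>_def reg_def)
    have g: "path.lsg m = lsg (y \<omega>) (u \<omega>) (w \<omega>) m" for m unfolding path.lsg_def lsg_def \<phi> path.d_def ..
    have a: "path.lsa m = lsa (y \<omega>) (u \<omega>) m" for m unfolding path.lsa_def lsa_def \<phi> path.d_def ..
    have f: "path.f (Suc k) = w' \<omega> (Suc k) / r k \<omega> powr (\<epsilon> / 2)" for k by (simp add: path.f_def path.r_def r_def)
    show ?case
      by (intro noisy_loop.intro noisy_loop_axioms.intro, rule elim(1), unfold g a f)
         (use elim(2-) in blast)+
  qed
qed

end


theorem proposition4:
  fixes M :: "'a measure"
    and p q t :: nat
    and a b :: "nat \<Rightarrow> real"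
    and y u :: "'a \<Rightarrow> int \<Rightarrow> real"
    and w w' :: "'a \<Rightarrow> nat \<Rightarrow> real"
    and \<theta>0 :: "'a \<Rightarrow> nat \<Rightarrow> real Matrix.vec"
    and yref :: "nat \<Rightarrow> real"
    and \<epsilon> R :: real
    and lam :: "nat \<Rightarrow> real"
  assumes "prob_space M"
    and "p \<ge> 1" and "q \<ge> 1"
    and processes: "arx_processes M y u w w'"
    and system: "AE \<omega> in M. \<forall>k. arx_equation p q a b (y \<omega>) (u \<omega>) (w \<omega>) k"
    and reference: "bounded (range yref)"
    and excitation: "iid_bounded_normalized M w'" "exogenous M y u w w'"
    and startup: "startup_values M p q y u \<theta>0"
    and control: "AE \<omega> in M. \<forall>k\<ge>1.
        u \<omega> (int k) = certainty_equivalence_control p q (y \<omega>) (u \<omega>) (\<theta>0 \<omega>) yref k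
          + w' \<omega> k / regressor_energy p q (y \<omega>) (u \<omega>) (k - 1) powr (\<epsilon> / 2)"
    and C1_mds: "martingale_difference M (filtration_at M y u w w') w"
    and C1_moments: "\<exists>\<gamma>>2. bounded_conditional_moments M (filtration_at M y u w w') w \<gamma>"
    and C1_average: "R > 0"
        "AE \<omega> in M. (\<lambda>k. (1 / real k) * (\<Sum>i = 1..k. (w \<omega> i)\<^sup>2)) \<longlonglongrightarrow> R"
    and C2: "\<forall>z::complex. norm z \<le> 1 \<longrightarrow> (\<Sum>j = 1..q. of_real (b j) * z ^ (j - 1)) \<noteq> 0"
    and C3: "\<bar>a p\<bar> + \<bar>b q\<bar> \<noteq> 0"
    and C4: "AE \<omega> in M. \<forall>k. b1_estimate p q (y \<omega>) (u \<omega>) (\<theta>0 \<omega>) k \<noteq> 0"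
    and t: "t = max p q + p - 1"
    and eps: "\<epsilon> * real (t + 1) \<in> {0<..<1/4}"
    and lam: "\<forall>N. lam N = real N powr (1 - 3 / 2 * \<epsilon> * real (t + 1))"
  shows "\<exists>\<Omega>0 \<in> sets M. measure M \<Omega>0 = 1 \<and>
    (\<forall>\<omega>\<in>\<Omega>0. \<exists>N0. \<forall>N\<ge>N0.
       {i\<in>{..<p + q}. sparse_estimate p q (y \<omega>) (u \<omega>) (\<theta>0 \<omega>) lam N $ i = 0}
       = {i\<in>{..<p + q}. parameter_vec p q a b $ i = 0})"
proof -
  obtain \<gamma> where \<gamma>: "\<gamma> > 2" "bounded_conditional_moments M (filtration_at M y u w w') w \<gamma>"
    using C1_moments by blast
  have eps0: "0 < \<epsilon>" using eps by (simp add: zero_less_mult_iff)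
  interpret closed_loop_process M p q a b y u w w' \<theta>0 yref \<epsilon> R \<gamma>
    by (intro closed_loop_process.intro closed_loop_process_axioms.intro) (fact assms \<gamma> eps0)+
  define \<eta> where "\<eta> = \<epsilon> * real (max p q + p)"
  \<comment> \<open>The subtraction in \<open>t\<close> is truncated, so this needs
    \<open>p \<ge> 1\<close>.\<close>
  have t1: "t + 1 = max p q + p" using t \<open>p \<ge> 1\<close> by simp
  then have \<eta>: "\<eta> < 1/4" using eps by (simp add: \<eta>_def)
  have lam': "lam N = real N powr (1 - 3 / 2 * \<eta>)" for N
    using lam unfolding \<eta>_def t1 by (simp only: mult.assoc)
  have "AE \<omega> in M. \<exists>N0. \<forall>N\<ge>N0.
       {i\<in>{..<p + q}. sparse_estimate p q (y \<omega>) (u \<omega>) (\<theta>0 \<omega>) lam N $ i = 0}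
       = {i\<in>{..<p + q}. parameter_vec p q a b $ i = 0}"
    using noisy_loop_AE
  proof eventually_elim
    case (elim \<omega>)
    interpret path: noisy_loop p q a b "y \<omega>" "u \<omega>" "w \<omega>" "w' \<omega>" "\<theta>0 \<omega>" yref \<epsilon> by (rule elim)
    from path.path_consistency[OF \<eta>_def \<eta> lam'] show ?case
      unfolding path.d_def path.\<theta>_def by (elim exE, intro exI) auto
  qed
  \<comment> \<open>The exceptional set need not be measurable; the complement of a measurable null
    set that contains it serves as \<Omega>0.\<close>
  then obtain N where N: "{\<omega> \<in> space M. \<not> (\<exists>N0. \<forall>N\<ge>N0.
       {i\<in>{..<p + q}. sparse_estimate p q (y \<omega>) (u \<omega>) (\<theta>0 \<omega>) lam N $ i = 0}
       = {i\<in>{..<p + q}. parameter_vec p q a b $ i = 0})} \<subseteq> N" "emeasure M N = 0" "N \<in> sets M"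
    by (rule AE_E)
  show ?thesis
  proof (intro bexI conjI ballI)
    show "space M - N \<in> sets M" using N(3) by simp
    show "measure M (space M - N) = 1" using N(2,3) prob_compl[OF N(3)] by (simp add: measure_def)
  qed (use N(1) in blast)
qed

end
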